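(* Let $R$ be a standard graded algebra over a field $k$. Let $G\in \mathsf{D}^{\mathsf f}_{\mathsf b}(\mathsf{Gr}\,R)$ be a complex of graded $R$-modules such that $\dim H_i(G)\le 1$ for all $i>\inf G$. Then $$\operatorname{reg} G=\sup_{i\in \mathbb{Z}}\{\operatorname{reg} H_i(G)-i\}.$$
   Context: A standard graded $k$-algebra $R$ is a commutative $\mathbb{N}$-graded ring with $R_0=k$, generated over $k$ by finitely many elements of degree $1$; $\mathfrak m$ is its graded maximal ideal. Modules are graded and morphisms preserve degree. Complexes are indexed homologically (differential $G_i\to G_{i-1}$). $\mathsf{D}^{\mathsf f}_{\mathsf b}(\mathsf{Gr}\,R)$ is the full subcategory of the derived category of graded $R$-modules consisting of complexes $G$ with every $H_i(G)$ finitely generated and $H_i(G)=0$ for $|i|\gg 0$. $\inf G=\inf\{i: H_i(G)\neq 0\}$. For such a complex (modules being complexes concentrated in degree $0$), $H^i_{\mathfrak m}(G)=H_{-i}(\mathsf R\Gamma_{\mathfrak m}(G))$ is local cohomology, and $\operatorname{reg} G=\sup\{i+j: H^i_{\mathfrak m}(G)_j\neq 0\}$, with $\operatorname{reg} 0=-\infty$. The zero module has dimension $-\infty$. *)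

theory Defs
  imports "HOL-Algebra.Algebra" "HOL-Library.Extended_Real"
begin

section \<open>Graded rings and graded modules\<close>

record 'a gring = "'a ring" + rgrade :: "nat \<Rightarrow> 'a set"

text \<open>As for every HOL-Algebra module, the fields \<open>mult\<close> and \<open>one\<close> of a graded module
  carry no meaning.\<close>

record ('a, 'b) gmodule = "('a, 'b) module" + grade :: "int \<Rightarrow> 'b set"

text \<open>\<open>M\<close> is the internal direct sum of the additive subgroups \<open>D i\<close>.\<close>

definition direct_sum_decomp :: "('b, 'z) ring_scheme \<Rightarrow> ('i \<Rightarrow> 'b set) \<Rightarrow> bool" where
  "direct_sum_decomp M D \<longleftrightarrow>
     (\<forall>i. additive_subgroup (D i) M) \<and>
     (\<forall>x\<in>carrier M. \<exists>!c. (\<forall>i. c i \<in> D i) \<and> finite {i. c i \<noteq> \<zero>\<^bsub>M\<^esub>} \<and>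
        x = (\<Oplus>\<^bsub>M\<^esub>i\<in>{i. c i \<noteq> \<zero>\<^bsub>M\<^esub>}. c i))"

definition graded_cring :: "'r gring \<Rightarrow> bool" where
  "graded_cring R \<longleftrightarrow> cring R \<and> direct_sum_decomp R (rgrade R) \<and> \<one>\<^bsub>R\<^esub> \<in> rgrade R 0 \<and>
     (\<forall>a b. \<forall>r\<in>rgrade R a. \<forall>s\<in>rgrade R b. r \<otimes>\<^bsub>R\<^esub> s \<in> rgrade R (a + b))"

text \<open>The ground field \<open>k\<close> is the degree \<open>0\<close> part of the ring.\<close>

definition standard_graded_algebra :: "'r gring \<Rightarrow> bool" where
  "standard_graded_algebra R \<longleftrightarrow> graded_cring R \<and> subfield (rgrade R 0) R \<and>
     (\<exists>S. finite S \<and> S \<subseteq> rgrade R 1 \<and> generate_ring R (rgrade R 0 \<union> S) = carrier R)"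

definition irrelevant_ideal :: "'r gring \<Rightarrow> 'r set" where
  "irrelevant_ideal R = Idl\<^bsub>R\<^esub> (\<Union>d\<in>{0<..}. rgrade R d)"

definition graded_module :: "'r gring \<Rightarrow> ('r, 'b) gmodule \<Rightarrow> bool" where
  "graded_module R M \<longleftrightarrow> module R M \<and> direct_sum_decomp M (grade M) \<and>
     (\<forall>a j. \<forall>r\<in>rgrade R a. \<forall>x\<in>grade M j. r \<odot>\<^bsub>M\<^esub> x \<in> grade M (int a + j))"

text \<open>Homogeneous homomorphisms of degree \<open>0\<close>; values outside the carrier are irrelevant.\<close>

definition graded_hom ::
  "'r gring \<Rightarrow> ('r, 'b) gmodule \<Rightarrow> ('r, 'c) gmodule \<Rightarrow> ('b \<Rightarrow> 'c) set" where
  "graded_hom R M N = {f \<in> carrier M \<rightarrow> carrier N.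
     (\<forall>x\<in>carrier M. \<forall>y\<in>carrier M. f (x \<oplus>\<^bsub>M\<^esub> y) = f x \<oplus>\<^bsub>N\<^esub> f y) \<and>
     (\<forall>r\<in>carrier R. \<forall>x\<in>carrier M. f (r \<odot>\<^bsub>M\<^esub> x) = r \<odot>\<^bsub>N\<^esub> f x) \<and>
     (\<forall>j. f ` grade M j \<subseteq> grade N j)}"

definition zero_module :: "('r, 'b) gmodule \<Rightarrow> bool" where
  "zero_module M \<longleftrightarrow> carrier M = {\<zero>\<^bsub>M\<^esub>}"

text \<open>The subset \<open>N\<close> of \<open>M\<close>, regarded as a module; used for graded submodules \<open>N\<close> only.\<close>

definition gsub :: "('r, 'b) gmodule \<Rightarrow> 'b set \<Rightarrow> ('r, 'b) gmodule" where
  "gsub M N = M\<lparr>carrier := N, grade := (\<lambda>j. grade M j \<inter> N)\<rparr>"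

definition gquot :: "('r, 'b) gmodule \<Rightarrow> 'b set \<Rightarrow> ('r, 'b set) gmodule" where
  "gquot M N =
     \<lparr>carrier = a_rcosets\<^bsub>M\<^esub> N, monoid.mult = undefined, one = undefined, ring.zero = N, add = set_add M,
      smult = (\<lambda>r C. \<Union>x\<in>C. N +>\<^bsub>M\<^esub> (r \<odot>\<^bsub>M\<^esub> x)),
      grade = (\<lambda>j. (\<lambda>x. N +>\<^bsub>M\<^esub> x) ` grade M j)\<rparr>"

definition fin_gen_module :: "'r gring \<Rightarrow> ('r, 'b) gmodule \<Rightarrow> bool" where
  "fin_gen_module R M \<longleftrightarrow> (\<exists>S. finite S \<and> S \<subseteq> carrier M \<and>
     (\<forall>x\<in>carrier M. \<exists>a \<in> S \<rightarrow> carrier R. x = (\<Oplus>\<^bsub>M\<^esub>s\<in>S. a s \<odot>\<^bsub>M\<^esub> s)))"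

definition annihilator :: "'r gring \<Rightarrow> ('r, 'b) gmodule \<Rightarrow> 'r set" where
  "annihilator R M = {r \<in> carrier R. \<forall>x\<in>carrier M. r \<odot>\<^bsub>M\<^esub> x = \<zero>\<^bsub>M\<^esub>}"

text \<open>The Krull dimension of \<open>R / Ann M\<close>: the supremum of the lengths of chains of prime
  ideals of \<open>R\<close> containing \<open>Ann M\<close>. For \<open>M = 0\<close> there is no chain, and the value is
  \<open>Sup {} = - \<infinity>\<close>.\<close>

definition module_dim :: "'r gring \<Rightarrow> ('r, 'b) gmodule \<Rightarrow> ereal" where
  "module_dim R M = Sup {ereal (real n) | n. \<exists>P :: nat \<Rightarrow> 'r set.
     (\<forall>i\<le>n. primeideal (P i) R) \<and> (\<forall>i<n. P i \<subset> P (Suc i)) \<and> annihilator R M \<subseteq> P 0}"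

section \<open>Complexes\<close>

text \<open>Homological indexing: \<open>cdiff G i\<close> maps \<open>cobj G i\<close> to \<open>cobj G (i - 1)\<close>.\<close>

record ('a, 'b) gcomplex =
  cobj :: "int \<Rightarrow> ('a, 'b) gmodule"
  cdiff :: "int \<Rightarrow> 'b \<Rightarrow> 'b"

definition graded_complex :: "'r gring \<Rightarrow> ('r, 'b) gcomplex \<Rightarrow> bool" where
  "graded_complex R G \<longleftrightarrow> (\<forall>i. graded_module R (cobj G i) \<and>
     cdiff G i \<in> graded_hom R (cobj G i) (cobj G (i - 1)) \<and>
     (\<forall>x\<in>carrier (cobj G i). cdiff G (i - 1) (cdiff G i x) = \<zero>\<^bsub>cobj G (i - 2)\<^esub>))"

definition cycles :: "('r, 'b) gcomplex \<Rightarrow> int \<Rightarrow> 'b set" where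
  "cycles G i = {x \<in> carrier (cobj G i). cdiff G i x = \<zero>\<^bsub>cobj G (i - 1)\<^esub>}"

definition boundaries :: "('r, 'b) gcomplex \<Rightarrow> int \<Rightarrow> 'b set" where
  "boundaries G i = cdiff G (i + 1) ` carrier (cobj G (i + 1))"

definition homology :: "('r, 'b) gcomplex \<Rightarrow> int \<Rightarrow> ('r, 'b set) gmodule" where
  "homology G i = gquot (gsub (cobj G i) (cycles G i)) (boundaries G i)"

definition chain_map ::
  "'r gring \<Rightarrow> ('r, 'b) gcomplex \<Rightarrow> ('r, 'c) gcomplex \<Rightarrow> (int \<Rightarrow> 'b \<Rightarrow> 'c) \<Rightarrow> bool" where
  "chain_map R G K \<phi> \<longleftrightarrow> (\<forall>i. \<phi> i \<in> graded_hom R (cobj G i) (cobj K i) \<and>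
     (\<forall>x\<in>carrier (cobj G i). \<phi> (i - 1) (cdiff G i x) = cdiff K i (\<phi> i x)))"

text \<open>For a chain map \<open>\<phi>\<close>, sends the class of a cycle \<open>z\<close> to the class of \<open>\<phi> i z\<close>.\<close>

definition homology_map ::
  "('r, 'c) gcomplex \<Rightarrow> (int \<Rightarrow> 'b \<Rightarrow> 'c) \<Rightarrow> int \<Rightarrow> 'b set \<Rightarrow> 'c set" where
  "homology_map K \<phi> i C = (\<Union>z\<in>C. boundaries K i +>\<^bsub>cobj K i\<^esub> \<phi> i z)"

definition quasi_iso ::
  "'r gring \<Rightarrow> ('r, 'b) gcomplex \<Rightarrow> ('r, 'c) gcomplex \<Rightarrow> (int \<Rightarrow> 'b \<Rightarrow> 'c) \<Rightarrow> bool" where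
  "quasi_iso R G K \<phi> \<longleftrightarrow> chain_map R G K \<phi> \<and>
     (\<forall>i. bij_betw (homology_map K \<phi> i) (carrier (homology G i)) (carrier (homology K i)))"

text \<open>Complexes with bounded and degreewise finitely generated homology.\<close>

definition Dfb :: "'r gring \<Rightarrow> ('r, 'b) gcomplex \<Rightarrow> bool" where
  "Dfb R G \<longleftrightarrow> graded_complex R G \<and> (\<forall>i. fin_gen_module R (homology G i)) \<and>
     (\<exists>b. \<forall>i. \<bar>i\<bar> > b \<longrightarrow> zero_module (homology G i))"

text \<open>\<open>\<infinity>\<close> for an acyclic complex.\<close>

definition complex_inf :: "('r, 'b) gcomplex \<Rightarrow> ereal" where
  "complex_inf G = Inf {ereal (real_of_int i) | i. \<not> zero_module (homology G i)}"

definition stalk_complex :: "('r, 'b) gmodule \<Rightarrow> ('r, 'b) gcomplex" where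
  "stalk_complex M =
     \<lparr>cobj = (\<lambda>i. if i = 0 then M else gsub M {\<zero>\<^bsub>M\<^esub>}), cdiff = (\<lambda>i x. \<zero>\<^bsub>M\<^esub>)\<rparr>"

section \<open>Local cohomology and regularity\<close>

text \<open>Injective objects of the category of graded modules. A formula cannot quantify over
  types, so the test modules \<open>A\<close>, \<open>B\<close> have their carriers in the type \<open>'r\<close> of ring
  elements. This loses nothing, by the graded form of Baer's criterion: it suffices to test
  inclusions of graded ideals into \<open>R\<close> and their degree shifts, and these live in \<open>'r\<close>.\<close>

definition graded_injective :: "'r gring \<Rightarrow> ('r, 'e) gmodule \<Rightarrow> bool" where
  "graded_injective R E \<longleftrightarrow> graded_module R E \<and>
     (\<forall>(A :: ('r, 'r) gmodule) (B :: ('r, 'r) gmodule) f g.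
        graded_module R A \<longrightarrow> graded_module R B \<longrightarrow>
        f \<in> graded_hom R A B \<longrightarrow> inj_on f (carrier A) \<longrightarrow> g \<in> graded_hom R A E \<longrightarrow>
        (\<exists>h\<in>graded_hom R B E. \<forall>x\<in>carrier A. h (f x) = g x))"

text \<open>A quasi-isomorphism from \<open>G\<close> to a complex of injectives that vanishes in large
  homological degrees; the usual resolution for right derived functors of homologically
  bounded above complexes.\<close>

definition injective_resolution ::
  "'r gring \<Rightarrow> ('r, 'b) gcomplex \<Rightarrow> ('r, 'e) gcomplex \<Rightarrow> bool" where
  "injective_resolution R G I \<longleftrightarrow> graded_complex R I \<and>
     (\<forall>i. graded_injective R (cobj I i)) \<and> (\<exists>b. \<forall>i>b. zero_module (cobj I i)) \<and>
     (\<exists>\<phi>. quasi_iso R G I \<phi>)"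

definition torsion_set :: "'r gring \<Rightarrow> ('r, 'b) gmodule \<Rightarrow> 'b set" where
  "torsion_set R M = {x \<in> carrier M.
     \<exists>n::nat. \<forall>r \<in> irrelevant_ideal R [^]\<^bsub>ideals_set R\<^esub> n. r \<odot>\<^bsub>M\<^esub> x = \<zero>\<^bsub>M\<^esub>}"

definition torsion_complex :: "'r gring \<Rightarrow> ('r, 'b) gcomplex \<Rightarrow> ('r, 'b) gcomplex" where
  "torsion_complex R G =
     \<lparr>cobj = (\<lambda>i. gsub (cobj G i) (torsion_set R (cobj G i))), cdiff = cdiff G\<rparr>"

text \<open>The complex representing the right derived torsion functor, computed from a chosen
  injective resolution; up to quasi-isomorphism the choice is irrelevant. The type
  \<open>'r list \<Rightarrow> 'b\<close> is large enough to hold a resolution of every complex of modules over a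
  standard graded \<open>k\<close>-algebra \<open>R\<close> with carriers in \<open>'b\<close> whose homology is bounded above:
  one may truncate \<open>G\<close> (choosing coset representatives) so that it vanishes above some degree
  \<open>b\<close>, and take in degree \<open>n\<close> the sum over \<open>p \<le> b - n\<close> of the graded modules of
  \<open>k\<close>-multilinear functions from \<open>(p + 1)\<close>-tuples of elements of \<open>R\<close> to \<open>G\<^sub>n\<^sub>+\<^sub>p\<close>,
  with the total differential of the bar construction.\<close>

definition RGamma :: "'r gring \<Rightarrow> ('r, 'b) gcomplex \<Rightarrow> ('r, 'r list \<Rightarrow> 'b) gcomplex" where
  "RGamma R G = torsion_complex R (SOME I. injective_resolution R G I)"

definition local_cohomology ::
  "'r gring \<Rightarrow> int \<Rightarrow> ('r, 'b) gcomplex \<Rightarrow> ('r, ('r list \<Rightarrow> 'b) set) gmodule" where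
  "local_cohomology R i G = homology (RGamma R G) (- i)"

definition reg :: "'r gring \<Rightarrow> ('r, 'b) gcomplex \<Rightarrow> ereal" where
  "reg R G = Sup {ereal (real_of_int (i + j)) | i j.
     grade (local_cohomology R i G) j \<noteq> {\<zero>\<^bsub>local_cohomology R i G\<^esub>}}"

definition reg_module :: "'r gring \<Rightarrow> ('r, 'b) gmodule \<Rightarrow> ereal" where
  "reg_module R M = reg R (stalk_complex M)"

end

theory Submission
  imports Defs
begin

text \<open>Let \<open>t\<close> be the largest degree with \<open>H\<^sub>t(G) \<noteq> 0\<close>, \<open>I\<close> an injective resolution of \<open>G\<close> and
  \<open>J\<close> one of \<open>H\<^sub>t(G)\<close>. Since \<open>I\<close> splits above degree \<open>t\<close>, there is a chain map
  \<open>J[t] \<rightarrow> I\<close> that induces an isomorphism in degree \<open>t\<close>. Its cone \<open>C\<close> is a complex of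
  injectives with the homology of \<open>G\<close> below \<open>t\<close>, so the torsion of \<open>C\<close> is exact in degrees
  \<open>\<ge> t\<close>. If \<open>t > inf G\<close>, then \<open>dim H\<^sub>t(G) \<le> 1\<close>, so the torsion of \<open>J[t]\<close> is exact in
  degrees \<open>\<le> t - 2\<close>. Hence the connecting maps from the torsion homology of \<open>C\<close> to that of
  \<open>J[t]\<close> vanish, and the torsion homology of \<open>I\<close> is nonzero in some bidegree iff that of \<open>J[t]\<close>
  or of \<open>C\<close> is. If \<open>t = inf G\<close>, then \<open>C\<close> is exact. By induction the torsion homology of \<open>I\<close> is
  nonzero exactly where that of some shifted resolution of some \<open>H\<^sub>q(G)\<close> is.

  For the vanishing in dimension \<open>\<le> 1\<close>, choose a homogeneous \<open>x\<close> such that the irrelevant ideal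
  is the radical of \<open>Ann + (x)\<close>. Torsion cycles bound torsion elements as soon as one can divide by
  powers of \<open>x\<close> up to torsion, which injectivity of the terms provides.\<close>

section \<open>Components of a direct sum decomposition\<close>

text \<open>The bound 1 is exactly what the degrees require. The connecting map leads from degree
  \<open>n\<close> of the torsion homology of \<open>C\<close> to degree \<open>n - 1\<close> of
  that of \<open>J[t]\<close>; its source vanishes for \<open>n >= t\<close>, its target for
  \<open>n - 1 <= t - 2\<close>, and these two ranges cover all \<open>n\<close> without overlap.
  The obstacle is typing. A resolution is whatever \<open>SOME\<close> returns in a prescribed type,
  so existence must be proved in that very type, and each cone enlarges the carrier type while an
  induction must stay in one. Hence injectivity is carried in Baer's form, which makes sense over
  every carrier type, terms are coinduced from the ground field and encoded as functions on lists,
  and cones are copied along an injection into a type with a list component, which absorbs one more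
  coordinate at each step. Homology is compared through elements and relations instead of cosets,
  and the long exact sequence takes the form of three element chases, each about a single
  bidegree.\<close>

definition gcomp :: "('b, 'z) ring_scheme \<Rightarrow> ('i \<Rightarrow> 'b set) \<Rightarrow> 'i \<Rightarrow> 'b \<Rightarrow> 'b" where
  "gcomp M D i x = (THE c. (\<forall>i. c i \<in> D i) \<and> finite {i. c i \<noteq> \<zero>\<^bsub>M\<^esub>} \<and>
     x = (\<Oplus>\<^bsub>M\<^esub>i\<in>{i. c i \<noteq> \<zero>\<^bsub>M\<^esub>}. c i)) i"

text \<open>Stated for arbitrary additive maps between two structures, because besides homomorphisms
  it is applied to negation, to evaluation of a function at a ring element, and to the identity map
  between a module and a submodule, where it turns sums in one record into sums in the
  other.\<close>

lemma finsum_additive: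
  assumes "abelian_group M" "abelian_group N" "finite F" "c \<in> F \<rightarrow> carrier M"
    and h: "h \<in> carrier M \<rightarrow> carrier N" "h \<zero>\<^bsub>M\<^esub> = \<zero>\<^bsub>N\<^esub>"
    and add: "\<And>x y. x \<in> carrier M \<Longrightarrow> y \<in> carrier M \<Longrightarrow> h (x \<oplus>\<^bsub>M\<^esub> y) = h x \<oplus>\<^bsub>N\<^esub> h y"
  shows "h (\<Oplus>\<^bsub>M\<^esub>i\<in>F. c i) = (\<Oplus>\<^bsub>N\<^esub>i\<in>F. h (c i))"
proof -
  interpret M: abelian_group M by fact
  interpret N: abelian_group N by fact
  show ?thesis using assms(3,4)
  proof (induction rule: finite_induct)
    case empty then show ?case by (simp add: h)
  next
    case (insert i F)
    have "(\<Oplus>\<^bsub>M\<^esub>i\<in>insert i F. c i) = c i \<oplus>\<^bsub>M\<^esub> (\<Oplus>\<^bsub>M\<^esub>i\<in>F. c i)"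
      using insert by (subst M.finsum_insert) auto
    moreover have "(\<Oplus>\<^bsub>N\<^esub>i\<in>insert i F. h (c i)) = h (c i) \<oplus>\<^bsub>N\<^esub> (\<Oplus>\<^bsub>N\<^esub>i\<in>F. h (c i))"
      using insert h by (subst N.finsum_insert) (auto simp: Pi_def)
    moreover have "c i \<in> carrier M" "(\<Oplus>\<^bsub>M\<^esub>i\<in>F. c i) \<in> carrier M"
      using insert by (auto intro!: M.finsum_closed)
    ultimately show ?case using insert add by auto
  qed
qed

lemma (in abelian_group) minus_zero_iff:
  assumes "x \<in> carrier G" "y \<in> carrier G"
  shows "x \<ominus> y = \<zero> \<longleftrightarrow> x = y"
proof
  assume "x \<ominus> y = \<zero>"
  then have "\<ominus> (\<ominus> y) = x" using assms by (intro minus_equality) (auto simp: minus_eq)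
  then show "x = y" using assms by simp
qed (use assms in \<open>simp add: minus_eq r_neg\<close>)

lemma (in abelian_group) inv_zero [simp]: "\<ominus> \<zero> = \<zero>"
  by (rule minus_equality) auto

lemma (in abelian_group) finsum_eq_zero:
  assumes "\<And>i. i \<in> F \<Longrightarrow> c i = \<zero>"
  shows "(\<Oplus>i\<in>F. c i) = \<zero>"
proof -
  have "(\<Oplus>i\<in>F. c i) = (\<Oplus>i\<in>F. \<zero>)" using assms by (intro finsum_cong') auto
  then show ?thesis by simp
qed

lemma (in abelian_group) finsum_mono_zero:
  assumes "finite F'" "F \<subseteq> F'" "\<And>i. i \<in> F' - F \<Longrightarrow> c i = \<zero>" "c \<in> F' \<rightarrow> carrier G"
  shows "(\<Oplus>i\<in>F'. c i) = (\<Oplus>i\<in>F. c i)"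
proof -
  have "(\<Oplus>i\<in>F \<union> (F' - F). c i) = (\<Oplus>i\<in>F. c i) \<oplus> (\<Oplus>i\<in>F'-F. c i)"
    using assms by (intro finsum_Un_disjoint) (auto intro: finite_subset)
  moreover have "F \<union> (F' - F) = F'" using assms by auto
  moreover have "(\<Oplus>i\<in>F. c i) \<in> carrier G" using assms by (intro finsum_closed) auto
  moreover have "(\<Oplus>i\<in>F'-F. c i) = \<zero>" using assms(3) by (rule finsum_eq_zero)
  ultimately show ?thesis by simp
qed

lemma (in abelian_group) finsum_single:
  assumes "finite F" "i \<in> F" "x \<in> carrier G"
  shows "(\<Oplus>j\<in>F. if j = i then x else \<zero>) = x"
  using finsum_mono_zero[of F "{i}" "\<lambda>j. if j = i then x else \<zero>"] assms by (auto simp: Pi_def)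

text \<open>Uniqueness comes from independence, applied to the difference of two families. The
  definition sums over the support of a family, and two families have different supports, so both
  sums are first extended by zero terms to a common finite index set.\<close>

lemma direct_sum_decompI:
  assumes "abelian_group M" and sub: "\<And>i. additive_subgroup (D i) M"
    and ind: "\<And>c F i. finite F \<Longrightarrow> (\<And>i. c i \<in> D i) \<Longrightarrow> (\<Oplus>\<^bsub>M\<^esub>i\<in>F. c i) = \<zero>\<^bsub>M\<^esub> \<Longrightarrow> i \<in> F \<Longrightarrow> c i = \<zero>\<^bsub>M\<^esub>"
    and span: "\<And>x. x \<in> carrier M \<Longrightarrow> \<exists>c F. finite F \<and> (\<forall>i. c i \<in> D i) \<and> x = (\<Oplus>\<^bsub>M\<^esub>i\<in>F. c i)"
  shows "direct_sum_decomp M D"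
proof -
  interpret M: abelian_group M by fact
  have Dc: "D i \<subseteq> carrier M" for i using sub additive_subgroup.a_subset by blast
  have D0: "\<zero>\<^bsub>M\<^esub> \<in> D i" for i using sub additive_subgroup.zero_closed by blast
  have Da: "x \<oplus>\<^bsub>M\<^esub> y \<in> D i" if "x \<in> D i" "y \<in> D i" for x y i
    by (rule additive_subgroup.a_closed[OF sub that])
  have Dm: "\<ominus>\<^bsub>M\<^esub> x \<in> D i" if "x \<in> D i" for x i
    using subgroup.m_inv_closed[OF additive_subgroup.a_subgroup[OF sub[of i]] that]
    by (simp add: a_inv_def)
  show ?thesis unfolding direct_sum_decomp_def
  proof (intro conjI allI ballI)
    fix x assume "x \<in> carrier M"
    from span[OF this] obtain c F where F: "finite F" "\<forall>i. c i \<in> D i" "x = (\<Oplus>\<^bsub>M\<^esub>i\<in>F. c i)"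
      by (elim exE conjE)
    have cc: "c i \<in> carrier M" for i using F(2) Dc by blast
    let ?c = "\<lambda>i. if i \<in> F then c i else \<zero>\<^bsub>M\<^esub>"
    let ?P = "\<lambda>c. (\<forall>i. c i \<in> D i) \<and> finite {i. c i \<noteq> \<zero>\<^bsub>M\<^esub>} \<and> x = (\<Oplus>\<^bsub>M\<^esub>i\<in>{i. c i \<noteq> \<zero>\<^bsub>M\<^esub>}. c i)"
    show "\<exists>!c. ?P c"
    proof (rule ex1I)
      have fin: "{i. ?c i \<noteq> \<zero>\<^bsub>M\<^esub>} \<subseteq> F" by auto
      have "(\<Oplus>\<^bsub>M\<^esub>i\<in>F. ?c i) = (\<Oplus>\<^bsub>M\<^esub>i\<in>{i. ?c i \<noteq> \<zero>\<^bsub>M\<^esub>}. ?c i)"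
        using F(1) cc fin by (intro M.finsum_mono_zero) auto
      moreover have "(\<Oplus>\<^bsub>M\<^esub>i\<in>F. ?c i) = (\<Oplus>\<^bsub>M\<^esub>i\<in>F. c i)"
        using cc by (intro M.finsum_cong') auto
      ultimately have "x = (\<Oplus>\<^bsub>M\<^esub>i\<in>{i. ?c i \<noteq> \<zero>\<^bsub>M\<^esub>}. ?c i)" using F(3) by simp
      moreover have "finite {i. ?c i \<noteq> \<zero>\<^bsub>M\<^esub>}" using fin F(1) by (rule finite_subset)
      moreover have "\<forall>i. ?c i \<in> D i" using F(2) D0 by simp
      ultimately show "?P ?c" by blast
    next
      fix c' assume P: "?P c'"
      let ?F = "F \<union> {i. c' i \<noteq> \<zero>\<^bsub>M\<^esub>}"
      have c'D: "c' i \<in> D i" for i using P by blast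
      have c'c: "c' i \<in> carrier M" "?c i \<in> carrier M" for i using c'D Dc F(2) by auto
      have 1: "x = (\<Oplus>\<^bsub>M\<^esub>i\<in>?F. c' i)"
        using P F(1) c'c by (subst M.finsum_mono_zero[of ?F "{i. c' i \<noteq> \<zero>\<^bsub>M\<^esub>}"]) auto
      have "(\<Oplus>\<^bsub>M\<^esub>i\<in>F. ?c i) = (\<Oplus>\<^bsub>M\<^esub>i\<in>F. c i)"
        using cc by (intro M.finsum_cong') auto
      moreover have "(\<Oplus>\<^bsub>M\<^esub>i\<in>?F. ?c i) = (\<Oplus>\<^bsub>M\<^esub>i\<in>F. ?c i)"
        using P F(1) c'c(2) by (intro M.finsum_mono_zero) auto
      ultimately have 2: "x = (\<Oplus>\<^bsub>M\<^esub>i\<in>?F. ?c i)" using F(3) by simp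
      let ?d = "\<lambda>i. c' i \<oplus>\<^bsub>M\<^esub> \<ominus>\<^bsub>M\<^esub> (?c i)"
      have dD: "?d i \<in> D i" for i using c'D F(2) Da Dm D0 by simp
      have mn: "(\<Oplus>\<^bsub>M\<^esub>i\<in>?F. \<ominus>\<^bsub>M\<^esub> ?c i) = \<ominus>\<^bsub>M\<^esub> (\<Oplus>\<^bsub>M\<^esub>i\<in>?F. ?c i)"
        by (rule finsum_additive[symmetric, OF M.abelian_group_axioms M.abelian_group_axioms])
          (use P F(1) c'c(2) cc in \<open>simp_all add: M.minus_add Pi_def\<close>)
      have "(\<Oplus>\<^bsub>M\<^esub>i\<in>?F. ?d i) = (\<Oplus>\<^bsub>M\<^esub>i\<in>?F. c' i) \<oplus>\<^bsub>M\<^esub> (\<Oplus>\<^bsub>M\<^esub>i\<in>?F. \<ominus>\<^bsub>M\<^esub> ?c i)"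
        using c'c by (intro M.finsum_addf) auto
      also have "\<dots> = \<zero>\<^bsub>M\<^esub>" unfolding mn using 1 2 \<open>x \<in> carrier M\<close> by (metis M.r_neg)
      finally have z: "(\<Oplus>\<^bsub>M\<^esub>i\<in>?F. ?d i) = \<zero>\<^bsub>M\<^esub>" .
      have "?d i = \<zero>\<^bsub>M\<^esub>" for i
      proof (cases "i \<in> ?F")
        case True then show ?thesis using ind[of ?F ?d, OF _ dD z True] P F(1) by blast
      next
        case False then show ?thesis by auto
      qed
      then have "c' i = ?c i" for i
        using iffD1[OF M.minus_zero_iff[OF c'c]] by (simp only: M.minus_eq)
      then show "c' = ?c" by (rule ext)
    qed
  qed (use sub in auto)
qed

text \<open>Independence holds because the candidate projection \<open>p i\<close>, applied to a
  vanishing sum of homogeneous terms, leaves exactly the \<open>i\<close>-th one. This is the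
  convenient form when the projections are inherited from structures already known to be
  graded.\<close>

lemma direct_sum_decomp_projI:
  assumes "abelian_group M" and sub: "\<And>i. additive_subgroup (D i) M"
    and p: "\<And>i x. x \<in> carrier M \<Longrightarrow> p i x \<in> D i"
    and add: "\<And>i x y. x \<in> carrier M \<Longrightarrow> y \<in> carrier M \<Longrightarrow> p i (x \<oplus>\<^bsub>M\<^esub> y) = p i x \<oplus>\<^bsub>M\<^esub> p i y"
    and id: "\<And>i x. x \<in> D i \<Longrightarrow> p i x = x"
    and orth: "\<And>i j x. x \<in> D i \<Longrightarrow> i \<noteq> j \<Longrightarrow> p j x = \<zero>\<^bsub>M\<^esub>"
    and span: "\<And>x. x \<in> carrier M \<Longrightarrow> \<exists>F. finite F \<and> x = (\<Oplus>\<^bsub>M\<^esub>i\<in>F. p i x)"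
  shows "direct_sum_decomp M D"
proof (rule direct_sum_decompI[OF assms(1) sub])
  interpret M: abelian_group M by fact
  have Dc: "D i \<subseteq> carrier M" for i using sub additive_subgroup.a_subset by blast
  fix c F i assume *: "finite F" "\<And>i. c i \<in> D i" "(\<Oplus>\<^bsub>M\<^esub>i\<in>F. c i) = \<zero>\<^bsub>M\<^esub>" "i \<in> F"
  have p0: "p i \<zero>\<^bsub>M\<^esub> = \<zero>\<^bsub>M\<^esub>"
    using id[of "\<zero>\<^bsub>M\<^esub>" i] sub additive_subgroup.zero_closed by metis
  have "p i (\<Oplus>\<^bsub>M\<^esub>i\<in>F. c i) = (\<Oplus>\<^bsub>M\<^esub>j\<in>F. p i (c j))"
    using * Dc subsetD[OF Dc p] by (intro finsum_additive assms(1) p0 add) (auto simp: Pi_def subset_eq)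
  also have "\<dots> = (\<Oplus>\<^bsub>M\<^esub>j\<in>F. if j = i then c i else \<zero>\<^bsub>M\<^esub>)"
    using * Dc id orth[OF *(2), of _ i] by (intro M.finsum_cong') (auto simp: Pi_def subset_eq)
  also have "\<dots> = c i" using * Dc by (intro M.finsum_single) auto
  finally show "c i = \<zero>\<^bsub>M\<^esub>" using * p0 by simp
next
  fix x assume "x \<in> carrier M"
  then obtain F where "finite F" "x = (\<Oplus>\<^bsub>M\<^esub>i\<in>F. p i x)" "\<forall>i. p i x \<in> D i"
    using span p by meson
  then show "\<exists>c F. finite F \<and> (\<forall>i. c i \<in> D i) \<and> x = (\<Oplus>\<^bsub>M\<^esub>i\<in>F. c i)"
    by (intro exI[of _ "\<lambda>i. p i x"] exI[of _ F] conjI)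
qed

locale dsum = abelian_group M for M (structure) +
  fixes D :: "'i \<Rightarrow> 'a set"
  assumes dsd: "direct_sum_decomp M D"
begin

abbreviation "cp \<equiv> gcomp M D"

lemma subD: "additive_subgroup (D i) M" using dsd by (auto simp: direct_sum_decomp_def)
lemma D_carrier: "x \<in> D i \<Longrightarrow> x \<in> carrier M" using subD additive_subgroup.a_subset by blast
lemma D_zero [simp]: "\<zero> \<in> D i" using subD additive_subgroup.zero_closed by blast
lemma D_add: "x \<in> D i \<Longrightarrow> y \<in> D i \<Longrightarrow> x \<oplus> y \<in> D i" by (rule additive_subgroup.a_closed[OF subD])
lemma D_inv: "x \<in> D i \<Longrightarrow> \<ominus> x \<in> D i"
  using subgroup.m_inv_closed[OF additive_subgroup.a_subgroup[OF subD[of i]]] by (simp add: a_inv_def)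
lemma D_minus: "x \<in> D i \<Longrightarrow> y \<in> D i \<Longrightarrow> x \<ominus> y \<in> D i"
  by (simp add: a_minus_def D_add D_inv)

lemma cp_ex1:
  assumes "x \<in> carrier M"
  shows "\<exists>!c. (\<forall>i. c i \<in> D i) \<and> finite {i. c i \<noteq> \<zero>} \<and> x = (\<Oplus>i\<in>{i. c i \<noteq> \<zero>}. c i)"
  using dsd assms by (auto simp: direct_sum_decomp_def)

lemma cp_all:
  assumes "x \<in> carrier M"
  shows "\<forall>i. cp i x \<in> D i" "finite {i. cp i x \<noteq> \<zero>}" "x = (\<Oplus>i\<in>{i. cp i x \<noteq> \<zero>}. cp i x)"
  using theI'[OF cp_ex1[OF assms]] unfolding gcomp_def by auto

lemma cp_in: "x \<in> carrier M \<Longrightarrow> cp i x \<in> D i" using cp_all by blast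
lemma cp_closed [simp]: "x \<in> carrier M \<Longrightarrow> cp i x \<in> carrier M" using cp_in D_carrier by blast

lemma cp_sum:
  assumes "x \<in> carrier M" "finite F" "{i. cp i x \<noteq> \<zero>} \<subseteq> F"
  shows "x = (\<Oplus>i\<in>F. cp i x)"
  using assms cp_all(3)[OF assms(1)] by (subst finsum_mono_zero[of F "{i. cp i x \<noteq> \<zero>}"]) auto

lemma cp_eqI:
  assumes c: "\<And>i. c i \<in> D i" and F: "finite F" "\<And>i. i \<notin> F \<Longrightarrow> c i = \<zero>" and x: "x = (\<Oplus>i\<in>F. c i)"
  shows "cp i x = c i"
proof -
  have cc: "c i \<in> carrier M" for i using c D_carrier by blast
  have xc: "x \<in> carrier M" unfolding x using cc by auto
  have f: "{i. c i \<noteq> \<zero>} \<subseteq> F" using F by auto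
  have "x = (\<Oplus>i\<in>{i. c i \<noteq> \<zero>}. c i)" unfolding x using F f cc by (intro finsum_mono_zero) auto
  moreover have "finite {i. c i \<noteq> \<zero>}" using F f finite_subset by blast
  ultimately have "(THE c. (\<forall>i. c i \<in> D i) \<and> finite {i. c i \<noteq> \<zero>} \<and> x = (\<Oplus>i\<in>{i. c i \<noteq> \<zero>}. c i)) = c"
    using c by (intro the1_equality cp_ex1 xc) auto
  then show ?thesis by (simp add: gcomp_def)
qed

lemma cp_same [simp]: "x \<in> D i \<Longrightarrow> cp i x = x"
  using cp_eqI[of "\<lambda>j. if j = i then x else \<zero>" "{i}" x i] D_carrier[of x i] by (auto simp: Pi_def)

lemma cp_other: "x \<in> D i \<Longrightarrow> j \<noteq> i \<Longrightarrow> cp j x = \<zero>"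
  using cp_eqI[of "\<lambda>j. if j = i then x else \<zero>" "{i}" x j] D_carrier[of x i] by (auto simp: Pi_def)

lemma cp_add:
  assumes "x \<in> carrier M" "y \<in> carrier M"
  shows "cp i (x \<oplus> y) = cp i x \<oplus> cp i y"
proof (rule cp_eqI[where F = "{i. cp i x \<noteq> \<zero>} \<union> {i. cp i y \<noteq> \<zero>}"])
  let ?F = "{i. cp i x \<noteq> \<zero>} \<union> {i. cp i y \<noteq> \<zero>}"
  show "finite ?F" using assms cp_all(2) by auto
  have "(\<Oplus>i\<in>?F. cp i x \<oplus> cp i y) = (\<Oplus>i\<in>?F. cp i x) \<oplus> (\<Oplus>i\<in>?F. cp i y)"
    using assms by (intro finsum_addf) auto
  then show "x \<oplus> y = (\<Oplus>i\<in>?F. cp i x \<oplus> cp i y)"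
    using cp_sum[of x ?F] cp_sum[of y ?F] assms cp_all(2) by auto
qed (use assms in \<open>auto intro: D_add cp_in\<close>)

lemma cp_inv:
  assumes "x \<in> carrier M"
  shows "cp i (\<ominus> x) = \<ominus> cp i x"
proof (rule minus_equality[symmetric])
  show "cp i (\<ominus> x) \<oplus> cp i x = \<zero>" using cp_add[of "\<ominus> x" x i] assms by (simp add: l_neg)
qed (use assms in auto)

lemma cp_eq: "x \<in> carrier M \<Longrightarrow> y \<in> carrier M \<Longrightarrow> (\<And>i. cp i x = cp i y) \<Longrightarrow> x = y"
  using cp_all(3)[of x] cp_all(3)[of y] by simp

lemma finsum_in:
  assumes "finite F" "c \<in> F \<rightarrow> N" "\<zero> \<in> N" "N \<subseteq> carrier M" "\<And>x y. x \<in> N \<Longrightarrow> y \<in> N \<Longrightarrow> x \<oplus> y \<in> N"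
  shows "(\<Oplus>i\<in>F. c i) \<in> N"
  using assms(1,2)
proof (induction rule: finite_induct)
  case (insert i F)
  then have "(\<Oplus>i\<in>insert i F. c i) = c i \<oplus> (\<Oplus>i\<in>F. c i)"
    using assms(4) by (intro finsum_insert) (auto simp: Pi_def)
  then show ?case using insert assms(5) by auto
qed (use assms in simp)

lemma cp_closure:
  assumes "x \<in> carrier M" "\<zero> \<in> N" "N \<subseteq> carrier M" "\<And>x y. x \<in> N \<Longrightarrow> y \<in> N \<Longrightarrow> x \<oplus> y \<in> N" "\<And>i. cp i x \<in> N"
  shows "x \<in> N"
  using finsum_in[of "{i. cp i x \<noteq> \<zero>}" "\<lambda>i. cp i x" N] assms cp_all[OF assms(1)] by auto

lemma dsum_induct [consumes 1, case_names zero homog add]: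
  assumes "x \<in> carrier M" "P \<zero>" "\<And>i y. y \<in> D i \<Longrightarrow> P y"
    "\<And>y z. y \<in> carrier M \<Longrightarrow> z \<in> carrier M \<Longrightarrow> P y \<Longrightarrow> P z \<Longrightarrow> P (y \<oplus> z)"
  shows "P x"
proof -
  have "x \<in> {y \<in> carrier M. P y}"
    using assms(2-4) assms(3)[OF cp_in[OF assms(1)]] assms(1) by (intro cp_closure[OF assms(1)]) auto
  then show ?thesis by simp
qed

end

text \<open>The injective reindexing \<open>s\<close> covers three uses at once: degree-preserving
  homomorphisms, multiplication by a homogeneous ring element, which shifts degrees, and the map
  from \<open>r\<close> to \<open>r x\<close>, which leads from the natural grading of the ring to
  the integral grading of a module.\<close>

lemma dsum_additive_comp:
  assumes "dsum M D" "dsum N E" "h \<in> carrier M \<rightarrow> carrier N"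
    and add: "\<And>x y. x \<in> carrier M \<Longrightarrow> y \<in> carrier M \<Longrightarrow> h (x \<oplus>\<^bsub>M\<^esub> y) = h x \<oplus>\<^bsub>N\<^esub> h y"
    and deg: "\<And>i. h ` D i \<subseteq> E (s i)" and s: "inj s" and x: "x \<in> carrier M"
  shows "gcomp N E (s i) (h x) = h (gcomp M D i x)"
proof -
  interpret M: dsum M D by fact
  interpret N: dsum N E by fact
  have c: "h y \<in> carrier N" if "y \<in> carrier M" for y using assms that by auto
  have "h \<zero>\<^bsub>M\<^esub> \<oplus>\<^bsub>N\<^esub> h \<zero>\<^bsub>M\<^esub> = h \<zero>\<^bsub>M\<^esub>" using add[of "\<zero>\<^bsub>M\<^esub>" "\<zero>\<^bsub>M\<^esub>"] by simp
  then have h0: "h \<zero>\<^bsub>M\<^esub> = \<zero>\<^bsub>N\<^esub>" using c[of "\<zero>\<^bsub>M\<^esub>"] by (simp add: N.add.r_cancel_one)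
  show ?thesis using x
  proof (induction rule: M.dsum_induct)
    case zero then show ?case by (simp add: h0)
  next
    case (homog j y)
    then have hy: "h y \<in> E (s j)" using deg by blast
    show ?case
    proof (cases "i = j")
      case True then show ?thesis using homog hy by simp
    next
      case False
      then have "s i \<noteq> s j" using s by (auto dest: injD)
      then show ?thesis using N.cp_other[OF hy] M.cp_other[OF homog False] h0 by simp
    qed
  next
    case (add y z)
    then show ?case by (simp add: assms(4) M.cp_add N.cp_add c)
  qed
qed

section \<open>Graded rings, modules and submodules\<close>

abbreviation mcp :: "('r, 'b) gmodule \<Rightarrow> int \<Rightarrow> 'b \<Rightarrow> 'b" where
  "mcp M \<equiv> gcomp M (grade M)"

locale graded_ring = cring R + GR?: dsum R "rgrade R" for R :: "'r gring" (structure) +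
  assumes graded: "graded_cring R"
begin

lemma rgrade_mult: "r \<in> rgrade R a \<Longrightarrow> s \<in> rgrade R b \<Longrightarrow> r \<otimes> s \<in> rgrade R (a + b)"
  using graded by (auto simp: graded_cring_def)
lemma rgrade_one: "\<one> \<in> rgrade R 0" using graded by (auto simp: graded_cring_def)
lemma rgrade_carrier: "r \<in> rgrade R a \<Longrightarrow> r \<in> carrier R" by (rule D_carrier)
lemma rgrade_pow: "r \<in> rgrade R a \<Longrightarrow> r [^] (n::nat) \<in> rgrade R (n * a)"
proof (induction n)
  case 0 then show ?case by (simp add: rgrade_one)
next
  case (Suc n) then show ?case using rgrade_mult[of "r [^] n" "n * a" r a] by (simp add: add.commute)
qed

end

lemma graded_ringI: "graded_cring R \<Longrightarrow> graded_ring R"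
  by (simp add: graded_ring_def graded_ring_axioms_def dsum_def dsum_axioms_def graded_cring_def
      cring_def ring_def)

locale graded_mod = module R M + GM?: dsum M "grade M"
  for R :: "'r gring" and M :: "('r, 'b) gmodule" (structure) +
  assumes gm: "graded_module R M"
begin

lemma grade_smult: "r \<in> rgrade R a \<Longrightarrow> x \<in> grade M j \<Longrightarrow> r \<odot> x \<in> grade M (int a + j)"
  using gm by (auto simp: graded_module_def)
lemma grade_carrier: "x \<in> grade M a \<Longrightarrow> x \<in> carrier M" by (rule D_carrier)

end

lemma graded_modI: "graded_module R M \<Longrightarrow> graded_mod R M"
  by (simp add: graded_mod_def graded_mod_axioms_def dsum_def dsum_axioms_def graded_module_def
      module_def)

lemma graded_homI:
  assumes "\<And>x. x \<in> carrier M \<Longrightarrow> f x \<in> carrier N"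
    "\<And>x y. x \<in> carrier M \<Longrightarrow> y \<in> carrier M \<Longrightarrow> f (x \<oplus>\<^bsub>M\<^esub> y) = f x \<oplus>\<^bsub>N\<^esub> f y"
    "\<And>r x. r \<in> carrier R \<Longrightarrow> x \<in> carrier M \<Longrightarrow> f (r \<odot>\<^bsub>M\<^esub> x) = r \<odot>\<^bsub>N\<^esub> f x"
    "\<And>j x. x \<in> grade M j \<Longrightarrow> f x \<in> grade N j"
  shows "f \<in> graded_hom R M N"
  using assms unfolding graded_hom_def by auto

lemma hom_closed: "f \<in> graded_hom R M N \<Longrightarrow> x \<in> carrier M \<Longrightarrow> f x \<in> carrier N"
  and hom_add: "f \<in> graded_hom R M N \<Longrightarrow> x \<in> carrier M \<Longrightarrow> y \<in> carrier M \<Longrightarrow> f (x \<oplus>\<^bsub>M\<^esub> y) = f x \<oplus>\<^bsub>N\<^esub> f y"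
  and hom_smult: "f \<in> graded_hom R M N \<Longrightarrow> r \<in> carrier R \<Longrightarrow> x \<in> carrier M \<Longrightarrow> f (r \<odot>\<^bsub>M\<^esub> x) = r \<odot>\<^bsub>N\<^esub> f x"
  and hom_grade: "f \<in> graded_hom R M N \<Longrightarrow> x \<in> grade M j \<Longrightarrow> f x \<in> grade N j"
  unfolding graded_hom_def by (auto, blast)

lemma hom_zero:
  assumes "graded_module R M" "graded_module R N" "f \<in> graded_hom R M N"
  shows "f \<zero>\<^bsub>M\<^esub> = \<zero>\<^bsub>N\<^esub>"
proof -
  interpret M: graded_mod R M by (rule graded_modI) fact
  interpret N: graded_mod R N by (rule graded_modI) fact
  have "f (\<zero>\<^bsub>R\<^esub> \<odot>\<^bsub>M\<^esub> \<zero>\<^bsub>M\<^esub>) = \<zero>\<^bsub>R\<^esub> \<odot>\<^bsub>N\<^esub> f \<zero>\<^bsub>M\<^esub>" using assms(3) by (intro hom_smult) auto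
  then show ?thesis using hom_closed[OF assms(3), of "\<zero>\<^bsub>M\<^esub>"] by simp
qed

lemma hom_inv:
  assumes "graded_module R M" "graded_module R N" "f \<in> graded_hom R M N" "x \<in> carrier M"
  shows "f (\<ominus>\<^bsub>M\<^esub> x) = \<ominus>\<^bsub>N\<^esub> f x"
proof -
  interpret M: graded_mod R M by (rule graded_modI) fact
  interpret N: graded_mod R N by (rule graded_modI) fact
  have "f (\<ominus>\<^bsub>M\<^esub> x) \<oplus>\<^bsub>N\<^esub> f x = \<zero>\<^bsub>N\<^esub>"
    using hom_add[OF assms(3), of "\<ominus>\<^bsub>M\<^esub> x" x] assms(4) hom_zero[OF assms(1-3)]
    by (simp add: M.M.l_neg)
  then show ?thesis using hom_closed[OF assms(3)] assms(4) by (metis M.M.a_inv_closed N.M.minus_equality)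
qed

lemma hom_minus:
  assumes "graded_module R M" "graded_module R N" "f \<in> graded_hom R M N" "x \<in> carrier M" "y \<in> carrier M"
  shows "f (x \<ominus>\<^bsub>M\<^esub> y) = f x \<ominus>\<^bsub>N\<^esub> f y"
proof -
  interpret M: graded_mod R M by (rule graded_modI) fact
  show ?thesis using assms by (simp add: a_minus_def hom_add[OF assms(3)] hom_inv)
qed

lemma hom_mcp:
  assumes "graded_module R M" "graded_module R N" "f \<in> graded_hom R M N" "x \<in> carrier M"
  shows "mcp N i (f x) = f (mcp M i x)"
proof -
  interpret M: graded_mod R M by (rule graded_modI) fact
  interpret N: graded_mod R N by (rule graded_modI) fact
  show ?thesis
    using dsum_additive_comp[OF M.dsum_axioms N.dsum_axioms, of f id x i] assms
    by (auto simp: hom_add hom_closed image_subset_iff intro: hom_grade)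
qed

lemma hom_compose:
  "f \<in> graded_hom R M N \<Longrightarrow> g \<in> graded_hom R N K \<Longrightarrow> (\<lambda>x. g (f x)) \<in> graded_hom R M K"
  by (rule graded_homI) (auto simp: hom_closed hom_add hom_smult hom_grade)

text \<open>Gradedness is closure under homogeneous components; in this form it passes easily to
  kernels, images and unions of chains. Negation is multiplication by \<open>-1\<close> and is
  derived in \<open>gsubmod_inv\<close>.\<close>

definition gsubmod :: "'r gring \<Rightarrow> ('r, 'b) gmodule \<Rightarrow> 'b set \<Rightarrow> bool" where
  "gsubmod R M N \<longleftrightarrow> N \<subseteq> carrier M \<and> \<zero>\<^bsub>M\<^esub> \<in> N \<and> (\<forall>x\<in>N. \<forall>y\<in>N. x \<oplus>\<^bsub>M\<^esub> y \<in> N) \<and>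
     (\<forall>r\<in>carrier R. \<forall>x\<in>N. r \<odot>\<^bsub>M\<^esub> x \<in> N) \<and> (\<forall>i. \<forall>x\<in>N. mcp M i x \<in> N)"

lemma gsubmodI:
  assumes "N \<subseteq> carrier M" "\<zero>\<^bsub>M\<^esub> \<in> N" "\<And>x y. x \<in> N \<Longrightarrow> y \<in> N \<Longrightarrow> x \<oplus>\<^bsub>M\<^esub> y \<in> N"
    "\<And>r x. r \<in> carrier R \<Longrightarrow> x \<in> N \<Longrightarrow> r \<odot>\<^bsub>M\<^esub> x \<in> N" "\<And>i x. x \<in> N \<Longrightarrow> mcp M i x \<in> N"
  shows "gsubmod R M N"
  using assms by (auto simp: gsubmod_def)

lemma gsubmodD:
  assumes "gsubmod R M N"
  shows "N \<subseteq> carrier M" "\<zero>\<^bsub>M\<^esub> \<in> N" "x \<in> N \<Longrightarrow> y \<in> N \<Longrightarrow> x \<oplus>\<^bsub>M\<^esub> y \<in> N"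
    "r \<in> carrier R \<Longrightarrow> x \<in> N \<Longrightarrow> r \<odot>\<^bsub>M\<^esub> x \<in> N" "x \<in> N \<Longrightarrow> mcp M i x \<in> N" "x \<in> N \<Longrightarrow> x \<in> carrier M"
  using assms by (auto simp: gsubmod_def)

lemma gsubmod_inv:
  assumes "graded_module R M" "gsubmod R M N" "x \<in> N"
  shows "\<ominus>\<^bsub>M\<^esub> x \<in> N"
proof -
  interpret M: graded_mod R M by (rule graded_modI) fact
  have "\<ominus>\<^bsub>R\<^esub> \<one>\<^bsub>R\<^esub> \<odot>\<^bsub>M\<^esub> x \<in> N" using assms by (intro gsubmodD(4)) auto
  then show ?thesis using gsubmodD[OF assms(2)] assms(3) by (simp add: M.smult_l_minus)
qed

lemma gsubmod_minus:
  assumes "graded_module R M" "gsubmod R M N" "x \<in> N" "y \<in> N"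
  shows "x \<ominus>\<^bsub>M\<^esub> y \<in> N"
  using assms by (simp add: a_minus_def gsubmod_inv gsubmodD)

lemma gsub_simps [simp]:
  "carrier (gsub M N) = N" "\<zero>\<^bsub>gsub M N\<^esub> = \<zero>\<^bsub>M\<^esub>" "add (gsub M N) = add M"
  "smult (gsub M N) = smult M" "grade (gsub M N) j = grade M j \<inter> N"
  by (auto simp: gsub_def)

text \<open>The module axioms push forward along a surjection that respects the operations.
  Quotients and copies of modules arise this way, and, with the identity as the surjection, modules
  that share the operations of a submodule; this is why the two record schemes may differ.\<close>

lemma module_image:
  fixes M :: "('r, 'b, 'y) module_scheme" and Q :: "('r, 'c, 'z) module_scheme"
  assumes "module R M" and car: "p ` carrier M = carrier Q"
    and add: "\<And>x y. x \<in> carrier M \<Longrightarrow> y \<in> carrier M \<Longrightarrow> p (x \<oplus>\<^bsub>M\<^esub> y) = p x \<oplus>\<^bsub>Q\<^esub> p y"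
    and zero: "p \<zero>\<^bsub>M\<^esub> = \<zero>\<^bsub>Q\<^esub>"
    and smult: "\<And>r x. r \<in> carrier R \<Longrightarrow> x \<in> carrier M \<Longrightarrow> p (r \<odot>\<^bsub>M\<^esub> x) = r \<odot>\<^bsub>Q\<^esub> p x"
  shows "module R Q"
proof -
  interpret M: module R M by fact
  have surj: "\<exists>a\<in>carrier M. x = p a" if "x \<in> carrier Q" for x using car that by blast
  have pc: "p a \<in> carrier Q" if "a \<in> carrier M" for a using car that by blast
  show ?thesis
  proof (rule moduleI)
    show "cring R" by (rule M.R.cring_axioms)
    show "abelian_group Q"
    proof (rule abelian_groupI)
      fix x y assume "x \<in> carrier Q" "y \<in> carrier Q"
      then obtain a b where ab: "a \<in> carrier M" "b \<in> carrier M" "x = p a" "y = p b" using surj by meson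
      show "x \<oplus>\<^bsub>Q\<^esub> y \<in> carrier Q" using ab pc by (simp add: add[symmetric])
      show "x \<oplus>\<^bsub>Q\<^esub> y = y \<oplus>\<^bsub>Q\<^esub> x" using ab by (simp add: add[symmetric] M.M.a_comm)
    next
      fix x assume "x \<in> carrier Q"
      then obtain a where ab: "a \<in> carrier M" "x = p a" using surj by meson
      show "\<zero>\<^bsub>Q\<^esub> \<oplus>\<^bsub>Q\<^esub> x = x" using ab by (simp add: add[symmetric] zero[symmetric])
      show "\<exists>z\<in>carrier Q. z \<oplus>\<^bsub>Q\<^esub> x = \<zero>\<^bsub>Q\<^esub>"
        using ab pc by (intro bexI[of _ "p (\<ominus>\<^bsub>M\<^esub> a)"]) (auto simp: add[symmetric] zero[symmetric] M.M.l_neg)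
    next
      fix x y z assume "x \<in> carrier Q" "y \<in> carrier Q" "z \<in> carrier Q"
      then obtain a b c where ab: "a \<in> carrier M" "b \<in> carrier M" "c \<in> carrier M" "x = p a" "y = p b" "z = p c"
        using surj by meson
      then show "(x \<oplus>\<^bsub>Q\<^esub> y) \<oplus>\<^bsub>Q\<^esub> z = x \<oplus>\<^bsub>Q\<^esub> (y \<oplus>\<^bsub>Q\<^esub> z)" by (simp add: add[symmetric] M.M.a_assoc)
    next
      show "\<zero>\<^bsub>Q\<^esub> \<in> carrier Q" using pc[of "\<zero>\<^bsub>M\<^esub>"] zero by simp
    qed
  next
    fix r s x assume rs: "r \<in> carrier R" "s \<in> carrier R" and "x \<in> carrier Q"
    then obtain a where ab: "a \<in> carrier M" "x = p a" using surj by meson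
    show "(r \<oplus>\<^bsub>R\<^esub> s) \<odot>\<^bsub>Q\<^esub> x = r \<odot>\<^bsub>Q\<^esub> x \<oplus>\<^bsub>Q\<^esub> s \<odot>\<^bsub>Q\<^esub> x"
      using ab rs by (simp add: add[symmetric] smult[symmetric] M.smult_l_distr)
    show "(r \<otimes>\<^bsub>R\<^esub> s) \<odot>\<^bsub>Q\<^esub> x = r \<odot>\<^bsub>Q\<^esub> (s \<odot>\<^bsub>Q\<^esub> x)"
      using ab rs by (simp add: smult[symmetric] M.smult_assoc1)
  next
    fix r x y assume rs: "r \<in> carrier R" and "x \<in> carrier Q" "y \<in> carrier Q"
    then obtain a b where ab: "a \<in> carrier M" "b \<in> carrier M" "x = p a" "y = p b" using surj by meson
    show "r \<odot>\<^bsub>Q\<^esub> (x \<oplus>\<^bsub>Q\<^esub> y) = r \<odot>\<^bsub>Q\<^esub> x \<oplus>\<^bsub>Q\<^esub> r \<odot>\<^bsub>Q\<^esub> y"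
      using ab rs by (simp add: add[symmetric] smult[symmetric] M.smult_r_distr)
  next
    fix r x assume "r \<in> carrier R" and "x \<in> carrier Q"
    then obtain a where ab: "a \<in> carrier M" "x = p a" using surj by meson
    show "r \<odot>\<^bsub>Q\<^esub> x \<in> carrier Q"
      using ab \<open>r \<in> carrier R\<close> pc by (simp add: smult[symmetric])
  next
    fix x assume "x \<in> carrier Q"
    then obtain a where ab: "a \<in> carrier M" "x = p a" using surj by meson
    show "\<one>\<^bsub>R\<^esub> \<odot>\<^bsub>Q\<^esub> x = x" using ab by (simp add: smult[symmetric])
  qed
qed

lemma module_subset:
  fixes M :: "('r, 'b, 'y) module_scheme" and K :: "('r, 'b, 'z) module_scheme"
  assumes "module R M" "submodule N R M" "carrier K = N" "\<zero>\<^bsub>K\<^esub> = \<zero>\<^bsub>M\<^esub>" "add K = add M" "smult K = smult M"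
  shows "module R K"
  using module_image[OF submodule.submodule_is_module[OF assms(2,1)], of "\<lambda>x. x" K] assms(3-) by simp

context graded_ring
begin

text \<open>The hypothesis on the kernel makes the images of the graded pieces independent: lift a
  relation between homogeneous elements of \<open>Q\<close> to \<open>M\<close>; the sum of the
  lifts lies in the kernel, hence so do its components, which are the lifts themselves.\<close>

lemma graded_module_image:
  fixes M :: "('r, 'b) gmodule" and Q :: "('r, 'c) gmodule"
  assumes "graded_module R M" and car: "p ` carrier M = carrier Q"
    and add: "\<And>x y. x \<in> carrier M \<Longrightarrow> y \<in> carrier M \<Longrightarrow> p (x \<oplus>\<^bsub>M\<^esub> y) = p x \<oplus>\<^bsub>Q\<^esub> p y"
    and zero: "p \<zero>\<^bsub>M\<^esub> = \<zero>\<^bsub>Q\<^esub>"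
    and smult: "\<And>r x. r \<in> carrier R \<Longrightarrow> x \<in> carrier M \<Longrightarrow> p (r \<odot>\<^bsub>M\<^esub> x) = r \<odot>\<^bsub>Q\<^esub> p x"
    and grade: "\<And>j. grade Q j = p ` grade M j"
    and ker: "\<And>x i. x \<in> carrier M \<Longrightarrow> p x = \<zero>\<^bsub>Q\<^esub> \<Longrightarrow> p (mcp M i x) = \<zero>\<^bsub>Q\<^esub>"
  shows "graded_module R Q" "p \<in> graded_hom R M Q"
proof -
  interpret M: graded_mod R M by (rule graded_modI) fact
  have mQ: "module R Q" by (rule module_image[OF M.module_axioms car add zero smult])
  then interpret Q: module R Q .
  have pc: "p a \<in> carrier Q" if "a \<in> carrier M" for a using car that by blast
  have fs: "p (\<Oplus>\<^bsub>M\<^esub>i\<in>F. c i) = (\<Oplus>\<^bsub>Q\<^esub>i\<in>F. p (c i))" if "finite F" "c \<in> F \<rightarrow> carrier M" for c and F :: "int set"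
    by (rule finsum_additive[OF M.M.abelian_group_axioms Q.M.abelian_group_axioms that])
      (auto simp: pc zero add)
  have "direct_sum_decomp Q (grade Q)"
  proof (rule direct_sum_decompI)
    show "abelian_group Q" by (rule Q.M.abelian_group_axioms)
    show "additive_subgroup (grade Q i) Q" for i
    proof (intro additive_subgroup.intro Q.M.add.subgroupI)
      show "grade Q i \<subseteq> carrier Q" using M.D_carrier pc by (auto simp: grade)
      show "grade Q i \<noteq> {}" using M.D_zero[of i] unfolding grade by blast
      fix a assume "a \<in> grade Q i"
      then obtain x where x: "a = p x" "x \<in> grade M i" by (auto simp: grade)
      then have xc: "x \<in> carrier M" by (auto intro: M.D_carrier)
      have "\<ominus>\<^bsub>Q\<^esub> a = p (\<ominus>\<^bsub>M\<^esub> x)"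
        using x xc pc by (intro Q.M.minus_equality) (auto simp: add[symmetric] zero M.M.l_neg)
      then show "\<ominus>\<^bsub>Q\<^esub> a \<in> grade Q i" using x M.D_inv by (auto simp: grade)
      fix b assume "b \<in> grade Q i"
      then obtain y where x: "a = p x" "x \<in> grade M i" "b = p y" "y \<in> grade M i" using x by (auto simp: grade)
      then have xc: "x \<in> carrier M" "y \<in> carrier M" by (auto intro: M.D_carrier)
      show "a \<oplus>\<^bsub>Q\<^esub> b \<in> grade Q i" using x xc M.D_add by (auto simp: grade add[symmetric])
    qed
    fix c F i assume *: "finite F" "\<And>i. c i \<in> grade Q i" "(\<Oplus>\<^bsub>Q\<^esub>i\<in>F. c i) = \<zero>\<^bsub>Q\<^esub>" "i \<in> F"
    have "\<forall>i. \<exists>x. x \<in> grade M i \<and> c i = p x" using *(2) unfolding grade by blast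
    then obtain x where x: "\<And>i. x i \<in> grade M i" "\<And>i. c i = p (x i)" by metis
    have xc: "x i \<in> carrier M" for i using x(1) M.D_carrier by blast
    \<comment> \<open>Zero outside \<open>F\<close> is required by \<open>cp_eqI\<close>, which then
      identifies the lift of \<open>c i\<close> with the \<open>i\<close>-th component of the
      sum.\<close>
    let ?x = "\<lambda>i. if i \<in> F then x i else \<zero>\<^bsub>M\<^esub>"
    have "p (\<Oplus>\<^bsub>M\<^esub>i\<in>F. ?x i) = (\<Oplus>\<^bsub>Q\<^esub>i\<in>F. p (?x i))" using * xc by (intro fs) auto
    also have "\<dots> = (\<Oplus>\<^bsub>Q\<^esub>i\<in>F. c i)" using x xc pc by (intro Q.M.finsum_cong') auto
    finally have "p (\<Oplus>\<^bsub>M\<^esub>i\<in>F. ?x i) = \<zero>\<^bsub>Q\<^esub>" using * by simp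
    then have "p (mcp M i (\<Oplus>\<^bsub>M\<^esub>i\<in>F. ?x i)) = \<zero>\<^bsub>Q\<^esub>" using xc by (intro ker) auto
    moreover have "mcp M i (\<Oplus>\<^bsub>M\<^esub>i\<in>F. ?x i) = ?x i" using x(1) *(1) by (intro M.cp_eqI[where F = F]) auto
    ultimately show "c i = \<zero>\<^bsub>Q\<^esub>" using x *(4) by simp
  next
    fix y assume "y \<in> carrier Q"
    then obtain x where x: "y = p x" "x \<in> carrier M" using car by blast
    let ?F = "{i. mcp M i x \<noteq> \<zero>\<^bsub>M\<^esub>}"
    have "y = (\<Oplus>\<^bsub>Q\<^esub>i\<in>?F. p (mcp M i x))"
      using fs[of ?F "\<lambda>i. mcp M i x"] x M.cp_all[OF x(2)] by auto
    then show "\<exists>c F. finite F \<and> (\<forall>i. c i \<in> grade Q i) \<and> y = (\<Oplus>\<^bsub>Q\<^esub>i\<in>F. c i)"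
      using M.cp_in[OF x(2)] M.cp_all(2)[OF x(2)]
      by (intro exI[of _ "\<lambda>i. p (mcp M i x)"] exI[of _ ?F] conjI) (auto simp: grade)
  qed
  then show "graded_module R Q"
    using mQ unfolding graded_module_def
  proof (intro conjI allI ballI)
    fix a j r y assume r: "r \<in> rgrade R a" and y: "y \<in> grade Q j"
    obtain x where x: "y = p x" "x \<in> grade M j" using y by (auto simp: grade)
    have "r \<in> carrier R" using r by (rule rgrade_carrier)
    then have "r \<odot>\<^bsub>Q\<^esub> y = p (r \<odot>\<^bsub>M\<^esub> x)" using x M.D_carrier by (simp add: smult)
    then show "r \<odot>\<^bsub>Q\<^esub> y \<in> grade Q (int a + j)" using M.grade_smult[OF r x(2)] by (simp add: grade)
  qed
  show "p \<in> graded_hom R M Q"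
    by (rule graded_homI) (auto simp: pc add smult grade)
qed

lemma gsub_graded:
  assumes "graded_module R M" "gsubmod R M N"
  shows "graded_module R (gsub M N)"
proof -
  interpret M: graded_mod R M by (rule graded_modI) fact
  note N = gsubmodD[OF assms(2)]
  have sm: "submodule N R M" using N gsubmod_inv[OF assms] by (intro M.submoduleI) auto
  have m: "module R (gsub M N)" by (rule module_subset[OF M.module_axioms sm]) auto
  then interpret K: module R "gsub M N" .
  have fs: "finsum (gsub M N) c F = finsum M c F" if "finite F" "c \<in> F \<rightarrow> N" for c and F :: "int set"
    using finsum_additive[OF K.M.abelian_group_axioms M.M.abelian_group_axioms that(1), of c "\<lambda>x. x"] that N
    by auto
  have "direct_sum_decomp (gsub M N) (grade (gsub M N))"
  proof (rule direct_sum_decomp_projI[where p = "mcp M"])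
    show "abelian_group (gsub M N)" by (rule K.M.abelian_group_axioms)
    show "additive_subgroup (grade (gsub M N) i) (gsub M N)" for i
    proof (intro additive_subgroup.intro K.M.add.subgroupI)
      show "\<ominus>\<^bsub>gsub M N\<^esub> a \<in> grade (gsub M N) i" if "a \<in> grade (gsub M N) i" for a
      proof -
        have "\<ominus>\<^bsub>gsub M N\<^esub> a = \<ominus>\<^bsub>M\<^esub> a"
          using that N gsubmod_inv[OF assms] by (intro K.M.minus_equality) (auto simp: M.M.l_neg)
        then show ?thesis using that M.D_inv gsubmod_inv[OF assms] by auto
      qed
      show "grade (gsub M N) i \<noteq> {}" using N(2) M.D_zero[of i] by (metis IntI empty_iff gsub_simps(5))
    qed (use N in \<open>auto intro: M.D_add\<close>)
    show "\<exists>F. finite F \<and> x = (\<Oplus>\<^bsub>gsub M N\<^esub>i\<in>F. mcp M i x)" if "x \<in> carrier (gsub M N)" for x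
    proof (intro exI conjI)
      have xc: "x \<in> carrier M" using that N(1) by auto
      show "finite {i. mcp M i x \<noteq> \<zero>\<^bsub>M\<^esub>}" by (rule M.cp_all(2)[OF xc])
      then show "x = (\<Oplus>\<^bsub>gsub M N\<^esub>i\<in>{i. mcp M i x \<noteq> \<zero>\<^bsub>M\<^esub>}. mcp M i x)"
        using M.cp_all(3)[OF xc] N(5) that by (subst fs) auto
    qed
  next
    fix i j x assume "x \<in> grade (gsub M N) i" "i \<noteq> j"
    then show "mcp M j x = \<zero>\<^bsub>gsub M N\<^esub>" using M.cp_other[of x i j] by auto
  next
    fix i x assume "x \<in> carrier (gsub M N)"
    then show "mcp M i x \<in> grade (gsub M N) i" using N M.cp_in by auto
  next
    fix i x y assume "x \<in> carrier (gsub M N)" "y \<in> carrier (gsub M N)"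
    then show "mcp M i (x \<oplus>\<^bsub>gsub M N\<^esub> y) = mcp M i x \<oplus>\<^bsub>gsub M N\<^esub> mcp M i y"
      using N by (auto intro: M.cp_add)
  qed auto
  moreover have "r \<odot>\<^bsub>M\<^esub> x \<in> N" if "r \<in> rgrade R a" "x \<in> N" for r x a
    using that N(4) rgrade_carrier by blast
  ultimately show ?thesis using m M.grade_smult by (auto simp: graded_module_def)
qed

end

section \<open>Products of graded modules and copies along injections\<close>

definition prodm :: "('r, 'b) gmodule \<Rightarrow> ('r, 'c) gmodule \<Rightarrow> ('r, 'b \<times> 'c) gmodule" where
  "prodm M N = \<lparr>carrier = carrier M \<times> carrier N, monoid.mult = undefined, one = undefined,
     ring.zero = (\<zero>\<^bsub>M\<^esub>, \<zero>\<^bsub>N\<^esub>), add = (\<lambda>x y. (fst x \<oplus>\<^bsub>M\<^esub> fst y, snd x \<oplus>\<^bsub>N\<^esub> snd y)),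
     smult = (\<lambda>r x. (r \<odot>\<^bsub>M\<^esub> fst x, r \<odot>\<^bsub>N\<^esub> snd x)), grade = (\<lambda>j. grade M j \<times> grade N j)\<rparr>"

text \<open>A copy of \<open>M\<close> with another carrier type. The operations pass through the
  chosen inverse of \<open>p\<close>, so the copy is faithful when \<open>p\<close> is injective on
  the carrier.\<close>

definition imagem :: "('b \<Rightarrow> 'c) \<Rightarrow> ('r, 'b) gmodule \<Rightarrow> ('r, 'c) gmodule" where
  "imagem p M = (let q = inv_into (carrier M) p in
     \<lparr>carrier = p ` carrier M, monoid.mult = undefined, one = undefined,
     ring.zero = p \<zero>\<^bsub>M\<^esub>, add = (\<lambda>x y. p (q x \<oplus>\<^bsub>M\<^esub> q y)),
     smult = (\<lambda>r x. p (r \<odot>\<^bsub>M\<^esub> q x)), grade = (\<lambda>j. p ` grade M j)\<rparr>)"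

lemma prodm_simps [simp]:
  "carrier (prodm M N) = carrier M \<times> carrier N" "\<zero>\<^bsub>prodm M N\<^esub> = (\<zero>\<^bsub>M\<^esub>, \<zero>\<^bsub>N\<^esub>)"
  "x \<oplus>\<^bsub>prodm M N\<^esub> y = (fst x \<oplus>\<^bsub>M\<^esub> fst y, snd x \<oplus>\<^bsub>N\<^esub> snd y)"
  "r \<odot>\<^bsub>prodm M N\<^esub> x = (r \<odot>\<^bsub>M\<^esub> fst x, r \<odot>\<^bsub>N\<^esub> snd x)"
  "grade (prodm M N) j = grade M j \<times> grade N j"
  by (auto simp: prodm_def)

context graded_ring
begin

lemma gsub_incl: "gsubmod R M N \<Longrightarrow> (\<lambda>x. x) \<in> graded_hom R (gsub M N) M"
  by (rule graded_homI) (auto dest: gsubmodD)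

lemma gsub_mcp:
  assumes "graded_module R M" "gsubmod R M N" "x \<in> N"
  shows "mcp (gsub M N) i x = mcp M i x"
  using hom_mcp[OF gsub_graded[OF assms(1,2)] assms(1) gsub_incl[OF assms(2)]] assms(3) by simp

lemma gsub_hom:
  assumes "f \<in> graded_hom R M K" "A \<subseteq> carrier M" "\<And>x. x \<in> A \<Longrightarrow> f x \<in> B"
  shows "f \<in> graded_hom R (gsub M A) (gsub K B)"
  using assms(2,3) by (intro graded_homI) (auto intro: hom_grade[OF assms(1)] simp: hom_add[OF assms(1)] hom_smult[OF assms(1)] subset_eq)

lemma gsub_hom1:
  assumes "f \<in> graded_hom R M K" "A \<subseteq> carrier M"
  shows "f \<in> graded_hom R (gsub M A) K"
  using assms(2) by (intro graded_homI) (auto intro: hom_grade[OF assms(1)] simp: hom_closed[OF assms(1)] hom_add[OF assms(1)] hom_smult[OF assms(1)] subset_eq)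

lemma gsubmod_kernel:
  assumes "graded_module R M" "graded_module R N" "f \<in> graded_hom R M N"
  shows "gsubmod R M {x \<in> carrier M. f x = \<zero>\<^bsub>N\<^esub>}"
proof -
  interpret M: graded_mod R M by (rule graded_modI) fact
  interpret N: graded_mod R N by (rule graded_modI) fact
  show ?thesis
    using hom_zero[OF assms] by (intro gsubmodI)
      (auto simp: hom_add[OF assms(3)] hom_smult[OF assms(3)] hom_mcp[OF assms, symmetric])
qed

lemma gsubmod_image:
  assumes "graded_module R M" "graded_module R N" "f \<in> graded_hom R M N" "gsubmod R M A"
  shows "gsubmod R N (f ` A)"
proof -
  note A = gsubmodD[OF assms(4)]
  show ?thesis
  proof (rule gsubmodI)
    show "f ` A \<subseteq> carrier N" using A(6) hom_closed[OF assms(3)] by auto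
    show "\<zero>\<^bsub>N\<^esub> \<in> f ` A" using A(2) hom_zero[OF assms(1-3)] by (metis imageI)
    fix x y assume "x \<in> f ` A" "y \<in> f ` A"
    then show "x \<oplus>\<^bsub>N\<^esub> y \<in> f ` A" using A(3,6) by (auto simp: hom_add[OF assms(3), symmetric])
  next
    fix r x assume "r \<in> carrier R" "x \<in> f ` A"
    then show "r \<odot>\<^bsub>N\<^esub> x \<in> f ` A" using A(4,6) by (auto simp: hom_smult[OF assms(3), symmetric])
  next
    fix i x assume "x \<in> f ` A"
    then show "mcp N i x \<in> f ` A" using A(5,6) by (auto simp: hom_mcp[OF assms(1-3)])
  qed
qed

lemma gsubmod_carrier: "graded_module R M \<Longrightarrow> gsubmod R M (carrier M)"
proof -
  assume "graded_module R M"
  then interpret M: graded_mod R M by (rule graded_modI)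
  show ?thesis by (rule gsubmodI) auto
qed

lemma gsubmod_zero: "graded_module R M \<Longrightarrow> gsubmod R M {\<zero>\<^bsub>M\<^esub>}"
proof -
  assume "graded_module R M"
  then interpret M: graded_mod R M by (rule graded_modI)
  show ?thesis by (rule gsubmodI) auto
qed

lemma gsubmod_gsub:
  assumes "graded_module R M" "gsubmod R M N" "gsubmod R M A" "A \<subseteq> N"
  shows "gsubmod R (gsub M N) A"
  using assms(4) gsubmodD[OF assms(3)] gsub_mcp[OF assms(1,2)] by (intro gsubmodI) (auto simp: subset_eq)

lemma additive_subgroup_gsubmod:
  assumes "graded_module R M" "gsubmod R M N"
  shows "abelian_subgroup N M"
proof -
  interpret M: graded_mod R M by (rule graded_modI) fact
  note N = gsubmodD[OF assms(2)]
  have "additive_subgroup N M"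
    using N gsubmod_inv[OF assms] by (intro additive_subgroup.intro M.add.subgroupI) auto
  then show ?thesis by (rule abelian_subgroupI3) (rule M.M.abelian_group_axioms)
qed

lemma mem_coset: "z \<in> N +>\<^bsub>M\<^esub> x \<longleftrightarrow> (\<exists>n\<in>N. z = n \<oplus>\<^bsub>M\<^esub> x)"
  by (auto simp: a_r_coset_def')

lemma coset_eq_iff:
  assumes "graded_module R M" "gsubmod R M N" "x \<in> carrier M" "y \<in> carrier M"
  shows "N +>\<^bsub>M\<^esub> x = N +>\<^bsub>M\<^esub> y \<longleftrightarrow> x \<ominus>\<^bsub>M\<^esub> y \<in> N"
proof -
  interpret M: graded_mod R M by (rule graded_modI) fact
  interpret N: abelian_subgroup N M by (rule additive_subgroup_gsubmod) fact+
  note N = gsubmodD[OF assms(2)]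
  show ?thesis
  proof
    assume "N +>\<^bsub>M\<^esub> x = N +>\<^bsub>M\<^esub> y"
    then have "x \<in> N +>\<^bsub>M\<^esub> y" using N.a_rcos_self assms(3) by blast
    then obtain n where n: "n \<in> N" "x = n \<oplus>\<^bsub>M\<^esub> y" by (auto simp: mem_coset)
    then have "x \<ominus>\<^bsub>M\<^esub> y = n" using assms(4) N(6) by (simp add: M.M.minus_eq M.M.a_assoc M.M.r_neg)
    then show "x \<ominus>\<^bsub>M\<^esub> y \<in> N" using n by simp
  next
    assume *: "x \<ominus>\<^bsub>M\<^esub> y \<in> N"
    have "x = (x \<ominus>\<^bsub>M\<^esub> y) \<oplus>\<^bsub>M\<^esub> y" using assms(3,4) by (simp add: M.M.minus_eq M.M.a_assoc M.M.l_neg)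
    then have "x \<in> N +>\<^bsub>M\<^esub> y" using * by (auto simp: mem_coset)
    then show "N +>\<^bsub>M\<^esub> x = N +>\<^bsub>M\<^esub> y" using M.M.a_repr_independence[of x N y] assms(4) N.a_subgroup by simp
  qed
qed

lemma gquot_proj:
  assumes "graded_module R M" "gsubmod R M N"
  shows "graded_module R (gquot M N)" "(\<lambda>x. N +>\<^bsub>M\<^esub> x) \<in> graded_hom R M (gquot M N)"
    "carrier (gquot M N) = (\<lambda>x. N +>\<^bsub>M\<^esub> x) ` carrier M"
    "\<zero>\<^bsub>gquot M N\<^esub> = N" "grade (gquot M N) j = (\<lambda>x. N +>\<^bsub>M\<^esub> x) ` grade M j"
proof -
  interpret M: graded_mod R M by (rule graded_modI) fact
  interpret N: abelian_subgroup N M by (rule additive_subgroup_gsubmod) fact+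
  note N = gsubmodD[OF assms(2)]
  let ?p = "\<lambda>x. N +>\<^bsub>M\<^esub> x"
  show car: "carrier (gquot M N) = ?p ` carrier M"
    by (auto simp: gquot_def A_RCOSETS_def')
  show gr: "grade (gquot M N) j = ?p ` grade M j" for j by (simp add: gquot_def)
  show z: "\<zero>\<^bsub>gquot M N\<^esub> = N" by (simp add: gquot_def)
  have z': "?p \<zero>\<^bsub>M\<^esub> = N" using N by (auto simp: mem_coset subset_eq)
  have ker: "?p x = N \<longleftrightarrow> x \<in> N" if "x \<in> carrier M" for x
    using coset_eq_iff[OF assms that M.M.zero_closed] that z' by (simp add: M.M.minus_eq)
  have sm: "r \<odot>\<^bsub>gquot M N\<^esub> ?p x = ?p (r \<odot>\<^bsub>M\<^esub> x)" if "r \<in> carrier R" "x \<in> carrier M" for r x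
  proof -
    have "?p (r \<odot>\<^bsub>M\<^esub> z) = ?p (r \<odot>\<^bsub>M\<^esub> x)" if z: "z \<in> ?p x" for z
    proof -
      obtain n where n: "n \<in> N" "z = n \<oplus>\<^bsub>M\<^esub> x" using z by (auto simp: mem_coset)
      then have "r \<odot>\<^bsub>M\<^esub> z \<ominus>\<^bsub>M\<^esub> r \<odot>\<^bsub>M\<^esub> x = r \<odot>\<^bsub>M\<^esub> n"
        using \<open>r \<in> carrier R\<close> \<open>x \<in> carrier M\<close> N(6)
        by (simp add: M.smult_r_distr M.M.minus_eq M.M.a_assoc M.M.r_neg)
      then show ?thesis using n N \<open>r \<in> carrier R\<close> \<open>x \<in> carrier M\<close>
        by (subst coset_eq_iff[OF assms]) auto
    qed
    note all = this
    have "x \<in> ?p x" by (rule N.a_rcos_self[OF that(2)])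
    \<comment> \<open>\<open>gquot\<close> defines scalar multiplication as a union over the
      representatives of a coset; all members of that union are equal.\<close>
    have "(\<Union>z\<in>?p x. ?p (r \<odot>\<^bsub>M\<^esub> z)) = ?p (r \<odot>\<^bsub>M\<^esub> x)"
      using \<open>x \<in> ?p x\<close> all by (intro equalityI UN_least UN_upper) blast+
    then show ?thesis by (simp add: gquot_def)
  qed
  have z'': "?p \<zero>\<^bsub>M\<^esub> = \<zero>\<^bsub>gquot M N\<^esub>" using z' z by (rule trans[OF _ sym])
  have ad: "?p (x \<oplus>\<^bsub>M\<^esub> y) = ?p x \<oplus>\<^bsub>gquot M N\<^esub> ?p y" if "x \<in> carrier M" "y \<in> carrier M" for x y
    using that by (simp add: gquot_def N.a_rcos_sum)
  have kr: "?p (mcp M i x) = \<zero>\<^bsub>gquot M N\<^esub>" if "x \<in> carrier M" "?p x = \<zero>\<^bsub>gquot M N\<^esub>" for x i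
  proof -
    have "x \<in> N" by (rule iffD1[OF ker[OF that(1)] that(2)[unfolded z]])
    then have "mcp M i x \<in> N" by (rule N(5))
    then show ?thesis unfolding z by (intro iffD2[OF ker] N(6))
  qed
  show "graded_module R (gquot M N)" "?p \<in> graded_hom R M (gquot M N)"
    by (rule graded_module_image[where p = ?p, OF assms(1) car[symmetric] ad z'' sm[symmetric] gr kr]; assumption)+
qed

lemma imagem_graded:
  assumes "graded_module R M" "inj_on p (carrier M)"
  shows "graded_module R (imagem p M)" "p \<in> graded_hom R M (imagem p M)"
    "inv_into (carrier M) p \<in> graded_hom R (imagem p M) M" "carrier (imagem p M) = p ` carrier M"
    "grade (imagem p M) j = p ` grade M j"
proof -
  interpret M: graded_mod R M by (rule graded_modI) fact
  have q [simp]: "inv_into (carrier M) p (p x) = x" if "x \<in> carrier M" for x using that assms(2) by simp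
  show car: "carrier (imagem p M) = p ` carrier M" by (simp add: imagem_def Let_def)
  show gr: "grade (imagem p M) j = p ` grade M j" for j by (simp add: imagem_def Let_def)
  have h1: "p (x \<oplus>\<^bsub>M\<^esub> y) = p x \<oplus>\<^bsub>imagem p M\<^esub> p y" if "x \<in> carrier M" "y \<in> carrier M" for x y
    using that by (simp add: imagem_def Let_def)
  have h2: "p \<zero>\<^bsub>M\<^esub> = \<zero>\<^bsub>imagem p M\<^esub>" by (simp add: imagem_def Let_def)
  have h3: "p (r \<odot>\<^bsub>M\<^esub> x) = r \<odot>\<^bsub>imagem p M\<^esub> p x" if "x \<in> carrier M" for x r
    using that by (simp add: imagem_def Let_def)
  have h4: "p (mcp M i x) = \<zero>\<^bsub>imagem p M\<^esub>" if "x \<in> carrier M" "p x = \<zero>\<^bsub>imagem p M\<^esub>" for x i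
  proof -
    have "x = \<zero>\<^bsub>M\<^esub>" using that assms(2) h2 by (auto simp: inj_on_def)
    then show ?thesis using h2 by simp
  qed
  show "graded_module R (imagem p M)" "p \<in> graded_hom R M (imagem p M)"
    by (rule graded_module_image[where p = p, OF assms(1) car[symmetric] h1 h2 h3 gr h4]; assumption)+
  show "inv_into (carrier M) p \<in> graded_hom R (imagem p M) M"
    by (rule graded_homI) (auto simp: car gr imagem_def Let_def M.D_carrier)
qed

lemma prodm_graded:
  assumes "graded_module R M" "graded_module R N"
  shows "graded_module R (prodm M N)" "x \<in> carrier M \<Longrightarrow> y \<in> carrier N \<Longrightarrow> mcp (prodm M N) i (x, y) = (mcp M i x, mcp N i y)"
proof -
  interpret M: graded_mod R M by (rule graded_modI) fact
  interpret N: graded_mod R N by (rule graded_modI) fact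
  have mod: "module R (prodm M N)"
  proof (rule moduleI)
    show "cring R" by (rule cring_axioms)
    show "abelian_group (prodm M N)"
    proof (rule abelian_groupI)
      fix x assume "x \<in> carrier (prodm M N)"
      then show "\<exists>y\<in>carrier (prodm M N). y \<oplus>\<^bsub>prodm M N\<^esub> x = \<zero>\<^bsub>prodm M N\<^esub>"
        by (intro bexI[of _ "(\<ominus>\<^bsub>M\<^esub> fst x, \<ominus>\<^bsub>N\<^esub> snd x)"]) (auto simp: M.M.l_neg N.M.l_neg)
    qed (auto simp: M.M.a_assoc N.M.a_assoc M.M.a_comm N.M.a_comm M.M.a_lcomm N.M.a_lcomm)
  qed (auto simp: M.smult_l_distr N.smult_l_distr M.smult_r_distr N.smult_r_distr M.smult_assoc1 N.smult_assoc1)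
  then interpret P: module R "prodm M N" .
  have fs: "(\<Oplus>\<^bsub>prodm M N\<^esub>i\<in>F. (c i, d i)) = ((\<Oplus>\<^bsub>M\<^esub>i\<in>F. c i), (\<Oplus>\<^bsub>N\<^esub>i\<in>F. d i))"
    if "finite F" "c \<in> F \<rightarrow> carrier M" "d \<in> F \<rightarrow> carrier N" for c d and F :: "int set"
  proof -
    have "fst (\<Oplus>\<^bsub>prodm M N\<^esub>i\<in>F. (c i, d i)) = (\<Oplus>\<^bsub>M\<^esub>i\<in>F. fst (c i, d i))"
      using that by (intro finsum_additive[OF P.M.abelian_group_axioms M.M.abelian_group_axioms]) auto
    moreover have "snd (\<Oplus>\<^bsub>prodm M N\<^esub>i\<in>F. (c i, d i)) = (\<Oplus>\<^bsub>N\<^esub>i\<in>F. snd (c i, d i))"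
      using that by (intro finsum_additive[OF P.M.abelian_group_axioms N.M.abelian_group_axioms]) auto
    ultimately show ?thesis by (simp add: prod_eq_iff)
  qed
  have "direct_sum_decomp (prodm M N) (grade (prodm M N))"
  proof (rule direct_sum_decomp_projI[where p = "\<lambda>i x. (mcp M i (fst x), mcp N i (snd x))"])
    show "abelian_group (prodm M N)" by (rule P.M.abelian_group_axioms)
    fix i
    show "additive_subgroup (grade (prodm M N) i) (prodm M N)"
    proof (intro additive_subgroup.intro P.M.add.subgroupI)
      fix a assume a: "a \<in> grade (prodm M N) i"
      then have "\<ominus>\<^bsub>prodm M N\<^esub> a = (\<ominus>\<^bsub>M\<^esub> fst a, \<ominus>\<^bsub>N\<^esub> snd a)"
        by (intro P.M.minus_equality) (auto simp: M.M.l_neg N.M.l_neg M.D_carrier N.D_carrier)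
      then show "\<ominus>\<^bsub>prodm M N\<^esub> a \<in> grade (prodm M N) i" using a by (auto intro: M.D_inv N.D_inv)
    next
      have "(\<zero>\<^bsub>M\<^esub>, \<zero>\<^bsub>N\<^esub>) \<in> grade (prodm M N) i" by simp
      then show "grade (prodm M N) i \<noteq> {}" by blast
    qed (auto simp: M.D_carrier N.D_carrier M.D_add N.D_add)
  next
    fix x assume x: "x \<in> carrier (prodm M N)"
    let ?F = "{i. mcp M i (fst x) \<noteq> \<zero>\<^bsub>M\<^esub>} \<union> {i. mcp N i (snd x) \<noteq> \<zero>\<^bsub>N\<^esub>}"
    have F: "finite ?F" using x M.cp_all(2) N.cp_all(2) by auto
    have "fst x = (\<Oplus>\<^bsub>M\<^esub>i\<in>?F. mcp M i (fst x))" "snd x = (\<Oplus>\<^bsub>N\<^esub>i\<in>?F. mcp N i (snd x))"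
      using x F by (auto intro!: M.cp_sum N.cp_sum)
    then have "x = (\<Oplus>\<^bsub>prodm M N\<^esub>i\<in>?F. (mcp M i (fst x), mcp N i (snd x)))"
      using x F by (subst fs) (auto simp: prod_eq_iff)
    then show "\<exists>F. finite F \<and> x = (\<Oplus>\<^bsub>prodm M N\<^esub>i\<in>F. (mcp M i (fst x), mcp N i (snd x)))" using F by blast
  qed (auto simp: M.cp_in N.cp_in M.cp_add N.cp_add M.cp_other N.cp_other)
  then show g: "graded_module R (prodm M N)"
    using mod by (auto simp: graded_module_def M.grade_smult N.grade_smult)
  have "fst \<in> graded_hom R (prodm M N) M" "snd \<in> graded_hom R (prodm M N) N"
    by (auto intro!: graded_homI)
  note h = hom_mcp[OF g assms(1) this(1)] hom_mcp[OF g assms(2) this(2)]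
  show "mcp (prodm M N) i (x, y) = (mcp M i x, mcp N i y)" if "x \<in> carrier M" "y \<in> carrier N"
    using h[of "(x, y)" i] that by (simp add: prod_eq_iff)
qed

end

section \<open>Baer's criterion\<close>

definition gideal :: "'r gring \<Rightarrow> 'r set \<Rightarrow> bool" where
  "gideal R A \<longleftrightarrow> ideal A R \<and> (\<forall>i. \<forall>a\<in>A. gcomp R (rgrade R) i a \<in> A)"

text \<open>The free module of rank one whose generator \<open>\<one>\<close> sits in degree
  \<open>s\<close>, often written R(-s). Degree-preserving maps out of it correspond to elements of
  degree \<open>s\<close>, and graded ideals with shifted degrees are its graded submodules.\<close>

definition shift_ring :: "'r gring \<Rightarrow> int \<Rightarrow> ('r, 'r) gmodule" where
  "shift_ring R s = \<lparr>carrier = carrier R, monoid.mult = undefined, one = undefined,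
     ring.zero = \<zero>\<^bsub>R\<^esub>, add = add R, smult = monoid.mult R,
     grade = (\<lambda>j. if s \<le> j then rgrade R (nat (j - s)) else {\<zero>\<^bsub>R\<^esub>})\<rparr>"

text \<open>Unlike injectivity itself, this condition mentions no test modules, so it yields extensions of
  homomorphisms between modules of arbitrary carrier types.\<close>

definition baer_inj :: "'r gring \<Rightarrow> ('r, 'e) gmodule \<Rightarrow> bool" where
  "baer_inj R E \<longleftrightarrow> (\<forall>A s g. gideal R A \<longrightarrow> (\<forall>a\<in>A. g a \<in> carrier E) \<longrightarrow>
     (\<forall>a\<in>A. \<forall>b\<in>A. g (a \<oplus>\<^bsub>R\<^esub> b) = g a \<oplus>\<^bsub>E\<^esub> g b) \<longrightarrow>
     (\<forall>r\<in>carrier R. \<forall>a\<in>A. g (r \<otimes>\<^bsub>R\<^esub> a) = r \<odot>\<^bsub>E\<^esub> g a) \<longrightarrow>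
     (\<forall>i. \<forall>a\<in>A \<inter> rgrade R i. g a \<in> grade E (int i + s)) \<longrightarrow>
     (\<exists>e\<in>grade E s. \<forall>a\<in>A. g a = a \<odot>\<^bsub>E\<^esub> e))"

lemma baer_injD:
  assumes "baer_inj R E" "gideal R A" "\<And>a. a \<in> A \<Longrightarrow> g a \<in> carrier E"
     "\<And>a b. a \<in> A \<Longrightarrow> b \<in> A \<Longrightarrow> g (a \<oplus>\<^bsub>R\<^esub> b) = g a \<oplus>\<^bsub>E\<^esub> g b"
     "\<And>r a. r \<in> carrier R \<Longrightarrow> a \<in> A \<Longrightarrow> g (r \<otimes>\<^bsub>R\<^esub> a) = r \<odot>\<^bsub>E\<^esub> g a"
     "\<And>i a. a \<in> A \<Longrightarrow> a \<in> rgrade R i \<Longrightarrow> g a \<in> grade E (int i + s)"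
  obtains e where "e \<in> grade E s" "\<And>a. a \<in> A \<Longrightarrow> g a = a \<odot>\<^bsub>E\<^esub> e"
proof -
  have "\<exists>e\<in>grade E s. \<forall>a\<in>A. g a = a \<odot>\<^bsub>E\<^esub> e"
    using assms(1) unfolding baer_inj_def
    by (elim allE[of _ A] allE[of _ s] allE[of _ g] impE) (use assms(2-) in auto)
  then show ?thesis using that by blast
qed

context graded_ring
begin

lemma shift_ring_simps [simp]:
  "carrier (shift_ring R s) = carrier R" "\<zero>\<^bsub>shift_ring R s\<^esub> = \<zero>" "x \<oplus>\<^bsub>shift_ring R s\<^esub> y = x \<oplus> y"
  "x \<odot>\<^bsub>shift_ring R s\<^esub> y = x \<otimes> y"
  "grade (shift_ring R s) j = (if s \<le> j then rgrade R (nat (j - s)) else {\<zero>})"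
  by (auto simp: shift_ring_def)

lemma shift_ring_graded:
  shows "graded_module R (shift_ring R s)"
    "x \<in> carrier R \<Longrightarrow> mcp (shift_ring R s) j x = (if s \<le> j then gcomp R (rgrade R) (nat (j - s)) x else \<zero>)"
proof -
  let ?S = "shift_ring R s"
  let ?p = "\<lambda>j x. if s \<le> j then gcomp R (rgrade R) (nat (j - s)) x else \<zero>"
  have mod: "module R ?S"
  proof (rule moduleI)
    show "abelian_group ?S"
    proof (rule abelian_groupI)
      fix x assume "x \<in> carrier ?S"
      then show "\<exists>y\<in>carrier ?S. y \<oplus>\<^bsub>?S\<^esub> x = \<zero>\<^bsub>?S\<^esub>" by (intro bexI[of _ "\<ominus> x"]) (auto simp: l_neg)
    qed (auto simp: a_assoc intro: a_comm)
  qed (auto simp: l_distr r_distr m_assoc intro: cring_axioms)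
  then interpret S: module R ?S .
  have as: "additive_subgroup (grade ?S j) ?S" for j
  proof (intro additive_subgroup.intro S.M.add.subgroupI)
    show "grade ?S j \<subseteq> carrier ?S" using D_carrier by auto
    have "\<zero> \<in> grade ?S j" by simp
    then show "grade ?S j \<noteq> {}" by blast
    fix a assume a: "a \<in> grade ?S j"
    then have ac: "a \<in> carrier R" using D_carrier by (auto split: if_splits)
    have "\<ominus>\<^bsub>?S\<^esub> a = \<ominus> a" using ac by (intro S.M.minus_equality) (auto simp: l_neg)
    then show "\<ominus>\<^bsub>?S\<^esub> a \<in> grade ?S j" using a by (auto intro: D_inv split: if_splits)
    fix b assume b: "b \<in> grade ?S j"
    show "a \<oplus>\<^bsub>?S\<^esub> b \<in> grade ?S j" using a b by (auto intro: D_add split: if_splits)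
  qed
  have fsg: "finsum ?S c F = finsum R c F" if "finite F" "c \<in> F \<rightarrow> carrier R" for c and F :: "int set"
    using finsum_additive[OF S.M.abelian_group_axioms abelian_group_axioms that(1), of c "\<lambda>x. x"] that by auto
  have span: "\<exists>F. finite F \<and> x = (\<Oplus>\<^bsub>?S\<^esub>j\<in>F. ?p j x)" if x: "x \<in> carrier R" for x
  proof -
    let ?F = "{i. gcomp R (rgrade R) i x \<noteq> \<zero>}"
    let ?h = "\<lambda>i::nat. int i + s"
    have F: "finite ?F" by (rule cp_all(2)[OF x])
    have "(\<Oplus>\<^bsub>?S\<^esub>j\<in>?h ` ?F. ?p j x) = (\<Oplus>j\<in>?h ` ?F. ?p j x)" using F x by (intro fsg) auto
    also have "\<dots> = (\<Oplus>i\<in>?F. ?p (?h i) x)" using x by (intro finsum_reindex) (auto simp: inj_on_def)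
    also have "\<dots> = (\<Oplus>i\<in>?F. gcomp R (rgrade R) i x)" using x by (intro finsum_cong') auto
    also have "\<dots> = x" by (rule cp_all(3)[OF x, symmetric])
    finally show ?thesis using F by (intro exI[of _ "?h ` ?F"]) auto
  qed
  have "direct_sum_decomp ?S (grade ?S)"
  proof (rule direct_sum_decomp_projI[where p = ?p, OF S.M.abelian_group_axioms as])
    fix i j x assume x: "x \<in> grade ?S i" "i \<noteq> j"
    show "?p j x = \<zero>\<^bsub>?S\<^esub>"
    proof (cases "s \<le> i \<and> s \<le> j")
      case True
      then have "nat (j - s) \<noteq> nat (i - s)" using x(2) by linarith
      then show ?thesis using x(1) True cp_other by auto
    qed (use x in \<open>auto split: if_splits\<close>)
  qed (use span in \<open>auto simp: cp_in cp_add\<close>)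
  then show gm: "graded_module R ?S" using mod
  proof (unfold graded_module_def, intro conjI allI ballI)
    fix a j r x assume r: "r \<in> rgrade R a" and x: "x \<in> grade ?S j"
    show "r \<odot>\<^bsub>?S\<^esub> x \<in> grade ?S (int a + j)"
    proof (cases "s \<le> j")
      case True
      then have "nat (int a + j - s) = a + nat (j - s)" by simp
      then show ?thesis using rgrade_mult[OF r, of x "nat (j - s)"] x True by simp
    next
      case False
      then show ?thesis using x rgrade_carrier[OF r] by auto
    qed
  qed
  interpret S': graded_mod R ?S by (rule graded_modI) fact
  show "mcp ?S j x = ?p j x" if x: "x \<in> carrier R"
  proof -
    obtain F where F: "finite F" "x = (\<Oplus>\<^bsub>?S\<^esub>j\<in>F. ?p j x)" using span[OF x] by blast
    let ?G = "{i. gcomp R (rgrade R) i x \<noteq> \<zero>}"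
    let ?F = "F \<union> (\<lambda>i. int i + s) ` ?G"
    have fin: "finite ?F" using F(1) cp_all(2)[OF x] by simp
    have z: "?p i x = \<zero>\<^bsub>?S\<^esub>" if "i \<notin> (\<lambda>i. int i + s) ` ?G" for i
    proof (rule ccontr)
      assume "?p i x \<noteq> \<zero>\<^bsub>?S\<^esub>"
      then have "s \<le> i" "nat (i - s) \<in> ?G" by (auto split: if_splits)
      then have "i \<in> (\<lambda>i. int i + s) ` ?G" by (intro image_eqI[of _ _ "nat (i - s)"]) auto
      with that show False by blast
    qed
    let ?h = "\<lambda>i::nat. int i + s"
    have "(\<Oplus>\<^bsub>?S\<^esub>j\<in>?h ` ?G. ?p j x) = (\<Oplus>j\<in>?h ` ?G. ?p j x)" using cp_all(2)[OF x] x by (intro fsg) auto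
    also have "\<dots> = (\<Oplus>i\<in>?G. ?p (?h i) x)" using x by (intro finsum_reindex) (auto simp: inj_on_def)
    also have "\<dots> = (\<Oplus>i\<in>?G. gcomp R (rgrade R) i x)" using x by (intro finsum_cong') auto
    also have "\<dots> = x" by (rule cp_all(3)[OF x, symmetric])
    finally have e: "x = (\<Oplus>\<^bsub>?S\<^esub>j\<in>?h ` ?G. ?p j x)" by simp
    show ?thesis
    proof (rule S'.cp_eqI[where c = "\<lambda>j. ?p j x" and F = "?h ` ?G"])
      show "?p i x \<in> grade ?S i" for i using x cp_in by simp
      show "finite (?h ` ?G)" using cp_all(2)[OF x] by simp
    qed (use z e in auto)
  qed
qed

lemma smult_hom:
  assumes "graded_module R M" "x \<in> grade M j"
  shows "(\<lambda>r. r \<odot>\<^bsub>M\<^esub> x) \<in> graded_hom R (shift_ring R j) M"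
proof -
  interpret M: graded_mod R M by (rule graded_modI) fact
  note xc = M.D_carrier[OF assms(2)]
  show ?thesis
  proof (rule graded_homI)
    fix i r assume r: "r \<in> grade (shift_ring R j) i"
    show "r \<odot>\<^bsub>M\<^esub> x \<in> grade M i"
    proof (cases "j \<le> i")
      case True then show ?thesis using M.grade_smult[of r "nat (i - j)" x j] r assms by simp
    qed (use r xc in auto)
  qed (use xc in \<open>auto simp: M.smult_l_distr M.smult_assoc1\<close>)
qed

text \<open>A map on an ideal that raises degrees by \<open>s\<close> is degree-preserving on the
  same ideal inside \<open>shift_ring R s\<close>. Both test modules then consist of ring elements,
  as \<open>graded_injective\<close> demands, and the extension is determined by its value at
  \<open>\<one>\<close>, an element of degree \<open>s\<close>.\<close>

lemma graded_injective_imp_baer: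
  assumes "graded_injective R E"
  shows "baer_inj R E"
  unfolding baer_inj_def
proof (intro allI impI)
  have gE: "graded_module R E" using assms by (simp add: graded_injective_def)
  interpret E: graded_mod R E by (rule graded_modI) fact
  fix A s g assume A: "gideal R A" and g: "\<forall>a\<in>A. g a \<in> carrier E"
    "\<forall>a\<in>A. \<forall>b\<in>A. g (a \<oplus> b) = g a \<oplus>\<^bsub>E\<^esub> g b" "\<forall>r\<in>carrier R. \<forall>a\<in>A. g (r \<otimes> a) = r \<odot>\<^bsub>E\<^esub> g a"
    "\<forall>i. \<forall>a\<in>A \<inter> rgrade R i. g a \<in> grade E (int i + s)"
  interpret A: ideal A R using A by (simp add: gideal_def)
  let ?S = "shift_ring R s"
  have sub: "gsubmod R ?S A"
    using A by (intro gsubmodI) (auto simp: A.I_l_closed shift_ring_graded gideal_def)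
  have g0: "g \<zero> = \<zero>\<^bsub>E\<^esub>" using g(3)[rule_format, of \<zero> \<zero>] g(1) by simp
  have "g \<in> graded_hom R (gsub ?S A) E"
  proof (rule graded_homI)
    fix j x assume x: "x \<in> grade (gsub ?S A) j"
    show "g x \<in> grade E j"
    proof (cases "s \<le> j")
      case True
      then have "int (nat (j - s)) + s = j" by simp
      then show ?thesis using g(4)[rule_format, of x "nat (j - s)"] x True by auto
    qed (use x g0 in auto)
  qed (use g in auto)
  moreover have "(\<lambda>x. x) \<in> graded_hom R (gsub ?S A) ?S" by (rule gsub_incl[OF sub])
  moreover have "graded_module R (gsub ?S A)" by (rule gsub_graded[OF shift_ring_graded(1) sub])
  ultimately obtain h where h: "h \<in> graded_hom R ?S E" "\<forall>x\<in>A. h x = g x"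
    using assms[unfolded graded_injective_def, THEN conjunct2, rule_format, of "gsub ?S A" ?S "\<lambda>x. x" g]
      shift_ring_graded(1) by auto
  have "h \<one> \<in> grade E s" using hom_grade[OF h(1), of \<one> s] rgrade_one by simp
  moreover have "g a = a \<odot>\<^bsub>E\<^esub> h \<one>" if "a \<in> A" for a
    using hom_smult[OF h(1), of a \<one>] h(2) that A.Icarr by simp
  ultimately show "\<exists>e\<in>grade E s. \<forall>a\<in>A. g a = a \<odot>\<^bsub>E\<^esub> e" by blast
qed

text \<open>Zorn's lemma on graphs of partial homomorphisms, realized as graded submodules of
  \<open>prodm M E\<close>. If a homogeneous \<open>x\<close> were missing from the domain of a
  maximal graph, Baer's condition for the ideal of all \<open>r\<close> with \<open>r x\<close> in
  the domain would produce a value for \<open>x\<close>.\<close>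

theorem baer_extension:
  fixes M :: "('r, 'b) gmodule" and E :: "('r, 'e) gmodule"
  assumes M: "graded_module R M" and E: "graded_module R E" and inj: "baer_inj R E"
    and N: "gsubmod R M N" and f: "f \<in> graded_hom R (gsub M N) E"
  obtains h where "h \<in> graded_hom R M E" "\<And>x. x \<in> N \<Longrightarrow> h x = f x"
proof -
  interpret M: graded_mod R M by (rule graded_modI) fact
  interpret E: graded_mod R E by (rule graded_modI) fact
  let ?P = "prodm M E"
  have gP: "graded_module R ?P" by (rule prodm_graded(1)[OF M E])
  interpret P: graded_mod R ?P by (rule graded_modI) fact
  note ND = gsubmodD[OF N]
  have gN: "graded_module R (gsub M N)" by (rule gsub_graded[OF M N])
  let ?gr = "(\<lambda>x. (x, f x)) ` N"
  \<comment> \<open>A submodule of pairs is single-valued as soon as only zero lies over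
    zero.\<close>
  define XX where "XX = {G. gsubmod R ?P G \<and> (\<forall>e. (\<zero>\<^bsub>M\<^esub>, e) \<in> G \<longrightarrow> e = \<zero>\<^bsub>E\<^esub>) \<and> ?gr \<subseteq> G}"
  have "?gr \<in> XX"
    unfolding XX_def
  proof (intro CollectI conjI allI impI)
    show "gsubmod R ?P ?gr"
    proof (rule gsubmodI)
      show "?gr \<subseteq> carrier ?P" using ND(1) hom_closed[OF f] by auto
      show "\<zero>\<^bsub>?P\<^esub> \<in> ?gr" using ND(2) hom_zero[OF gN E f] by auto
    next
      fix x y assume "x \<in> ?gr" "y \<in> ?gr"
      then show "x \<oplus>\<^bsub>?P\<^esub> y \<in> ?gr" using ND(3) hom_add[OF f] by auto
    next
      fix r x assume "r \<in> carrier R" "x \<in> ?gr"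
      then show "r \<odot>\<^bsub>?P\<^esub> x \<in> ?gr" using ND(4) hom_smult[OF f] by auto
    next
      fix i x assume "x \<in> ?gr"
      then obtain a where a: "a \<in> N" "x = (a, f a)" by auto
      then have "mcp ?P i x = (mcp M i a, f (mcp M i a))"
        using hom_closed[OF f, of a] ND hom_mcp[OF gN E f, of a i] prodm_graded(2)[OF M E]
          gsub_mcp[OF M N] by simp
      then show "mcp ?P i x \<in> ?gr" using ND(5)[OF a(1)] by simp
    qed
    fix e assume "(\<zero>\<^bsub>M\<^esub>, e) \<in> ?gr"
    then show "e = \<zero>\<^bsub>E\<^esub>" using hom_zero[OF gN E f] by auto
  qed simp
  have "\<exists>G\<in>XX. \<forall>Y\<in>XX. G \<subseteq> Y \<longrightarrow> Y = G"
  proof (rule subset_Zorn_nonempty)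
    show "XX \<noteq> {}" using \<open>?gr \<in> XX\<close> by blast
    fix C assume C: "C \<noteq> {}" "subset.chain XX C"
    then have CX: "\<And>G. G \<in> C \<Longrightarrow> gsubmod R ?P G \<and> (\<forall>e. (\<zero>\<^bsub>M\<^esub>, e) \<in> G \<longrightarrow> e = \<zero>\<^bsub>E\<^esub>) \<and> ?gr \<subseteq> G"
      unfolding subset.chain_def XX_def by blast
    have lin: "G \<subseteq> H \<or> H \<subseteq> G" if "G \<in> C" "H \<in> C" for G H using C(2) that unfolding subset.chain_def by blast
    obtain G0 where G0: "G0 \<in> C" using C(1) by blast
    have "gsubmod R ?P (\<Union>C)"
    proof (rule gsubmodI)
      show "\<Union>C \<subseteq> carrier ?P" using CX gsubmodD(1) by blast
      show "\<zero>\<^bsub>?P\<^esub> \<in> \<Union>C" using CX[OF G0] gsubmodD(2) G0 by blast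
    next
      fix x y assume "x \<in> \<Union>C" "y \<in> \<Union>C"
      then obtain G H where GH: "G \<in> C" "H \<in> C" "x \<in> G" "y \<in> H" by blast
      then obtain K where "K \<in> C" "x \<in> K" "y \<in> K" using lin[of G H] by blast
      then show "x \<oplus>\<^bsub>?P\<^esub> y \<in> \<Union>C" using CX[of K] gsubmodD(3)[of R ?P K x y] by blast
    next
      fix r x assume "r \<in> carrier R" "x \<in> \<Union>C"
      then show "r \<odot>\<^bsub>?P\<^esub> x \<in> \<Union>C" using CX gsubmodD(4)[of R ?P _ r x] by blast
    next
      fix i x assume "x \<in> \<Union>C"
      then show "mcp ?P i x \<in> \<Union>C" using CX gsubmodD(5)[of R ?P _ x i] by blast
    qed
    moreover have "?gr \<subseteq> \<Union>C" using CX[OF G0] G0 by blast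
    ultimately show "\<Union>C \<in> XX" using CX unfolding XX_def by blast
  qed
  then obtain G where G: "G \<in> XX" "\<And>Y. Y \<in> XX \<Longrightarrow> G \<subseteq> Y \<Longrightarrow> Y = G" by blast
  have Gs: "gsubmod R ?P G" and G0: "\<And>e. (\<zero>\<^bsub>M\<^esub>, e) \<in> G \<Longrightarrow> e = \<zero>\<^bsub>E\<^esub>" and Gf: "?gr \<subseteq> G"
    using G(1) by (auto simp: XX_def)
  note GD = gsubmodD[OF Gs]
  have Gc: "x \<in> carrier M" "e \<in> carrier E" if "(x, e) \<in> G" for x e using GD(6)[OF that] by auto
  have Ga: "(x \<oplus>\<^bsub>M\<^esub> y, e \<oplus>\<^bsub>E\<^esub> d) \<in> G" if "(x, e) \<in> G" "(y, d) \<in> G" for x e y d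
    using GD(3)[OF that] by simp
  have Gm: "(r \<odot>\<^bsub>M\<^esub> x, r \<odot>\<^bsub>E\<^esub> e) \<in> G" if "(x, e) \<in> G" "r \<in> carrier R" for x e r
    using GD(4)[OF that(2,1)] by simp
  have Gi: "(\<ominus>\<^bsub>M\<^esub> x, \<ominus>\<^bsub>E\<^esub> e) \<in> G" if "(x, e) \<in> G" for x e
    using Gm[OF that, of "\<ominus> \<one>"] Gc[OF that] by (simp add: M.smult_l_minus E.smult_l_minus)
  have Gp: "(mcp M i x, mcp E i e) \<in> G" if "(x, e) \<in> G" for x e i
    using GD(5)[OF that, of i] Gc[OF that] by (simp add: prodm_graded(2)[OF M E])
  have fnl: "e = d" if "(x, e) \<in> G" "(x, d) \<in> G" for x e d
  proof -
    have "(x \<oplus>\<^bsub>M\<^esub> \<ominus>\<^bsub>M\<^esub> x, e \<oplus>\<^bsub>E\<^esub> \<ominus>\<^bsub>E\<^esub> d) \<in> G" using that by (intro Ga Gi)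
    then have "e \<ominus>\<^bsub>E\<^esub> d = \<zero>\<^bsub>E\<^esub>" using G0 Gc that by (simp add: M.M.r_neg E.M.minus_eq)
    then show ?thesis using E.M.minus_zero_iff Gc that by blast
  qed
  define Dm where "Dm = {x. \<exists>e. (x, e) \<in> G}"
  \<comment> \<open>Homogeneous elements suffice, since the domain is closed under addition.\<close>
  have hom_dom: "x \<in> Dm" if x: "x \<in> grade M j" for x j
  proof (rule ccontr)
    assume nx: "x \<notin> Dm"
    have xc: "x \<in> carrier M" using x by (rule M.D_carrier)
    define A where "A = {r \<in> carrier R. r \<odot>\<^bsub>M\<^esub> x \<in> Dm}"
    define g where "g r = (THE e. (r \<odot>\<^bsub>M\<^esub> x, e) \<in> G)" for r
    have gI: "g r = e" if "(r \<odot>\<^bsub>M\<^esub> x, e) \<in> G" for r e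
      unfolding g_def using that fnl by blast
    have gG: "(r \<odot>\<^bsub>M\<^esub> x, g r) \<in> G" if rA: "r \<in> A" for r
    proof -
      obtain e where "(r \<odot>\<^bsub>M\<^esub> x, e) \<in> G" using rA by (auto simp: A_def Dm_def)
      then show ?thesis using gI by simp
    qed
    have Ac: "r \<in> carrier R" if "r \<in> A" for r using that by (simp add: A_def)
    have AI: "r \<in> A" if "r \<in> carrier R" "(r \<odot>\<^bsub>M\<^esub> x, e) \<in> G" for r e using that by (auto simp: A_def Dm_def)
    have add: "a \<oplus> b \<in> A \<and> g (a \<oplus> b) = g a \<oplus>\<^bsub>E\<^esub> g b" if "a \<in> A" "b \<in> A" for a b
    proof -
      have "((a \<oplus> b) \<odot>\<^bsub>M\<^esub> x, g a \<oplus>\<^bsub>E\<^esub> g b) \<in> G"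
        using Ga[OF gG[OF that(1)] gG[OF that(2)]] Ac that xc by (simp add: M.smult_l_distr)
      then show ?thesis using gI AI Ac that by blast
    qed
    have mul: "r \<otimes> a \<in> A \<and> g (r \<otimes> a) = r \<odot>\<^bsub>E\<^esub> g a" if "r \<in> carrier R" "a \<in> A" for r a
    proof -
      have "((r \<otimes> a) \<odot>\<^bsub>M\<^esub> x, r \<odot>\<^bsub>E\<^esub> g a) \<in> G"
        using Gm[OF gG[OF that(2)] that(1)] Ac that xc by (simp add: M.smult_assoc1)
      then show ?thesis using gI AI[of "r \<otimes> a"] Ac[OF that(2)] that by blast
    qed
    have cmp: "mcp M (int i + j) (r \<odot>\<^bsub>M\<^esub> x) = gcomp R (rgrade R) i r \<odot>\<^bsub>M\<^esub> x" if "r \<in> carrier R" for r i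
      using dsum_additive_comp[OF dsum_axioms M.dsum_axioms, of "\<lambda>r. r \<odot>\<^bsub>M\<^esub> x" "\<lambda>i. int i + j" r i] that xc M.grade_smult x
      by (auto simp: M.smult_l_distr inj_on_def)
    have id: "gideal R A"
      unfolding gideal_def
    proof (intro conjI allI ballI)
      have z: "\<zero> \<in> A" using GD(2) xc AI[of \<zero> "\<zero>\<^bsub>E\<^esub>"] by auto
      show "ideal A R"
      proof (rule idealI)
        show "ring R" by (rule ring_axioms)
        show "subgroup A (add_monoid R)"
        proof (rule add.subgroupI)
          fix a assume "a \<in> A"
          then show "\<ominus> a \<in> A" using mul[of "\<ominus> \<one>" a] Ac by (simp add: l_minus)
        qed (use z add Ac in auto)
        fix a r assume "a \<in> A" "r \<in> carrier R"
        then show "r \<otimes> a \<in> A" "a \<otimes> r \<in> A" using mul Ac by (auto simp: m_comm[of a r])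
      qed
      fix i a assume a: "a \<in> A"
      show "gcomp R (rgrade R) i a \<in> A"
        using Gp[OF gG[OF a], of "int i + j"] cmp[OF Ac[OF a], of i] Ac[OF a] by (intro AI) auto
    qed
    obtain e where e: "e \<in> grade E j" "\<And>a. a \<in> A \<Longrightarrow> g a = a \<odot>\<^bsub>E\<^esub> e"
    proof (rule baer_injD[OF inj id, of g j])
      fix a assume "a \<in> A" then show "g a \<in> carrier E" using gG Gc by blast
    next
      fix i a assume a: "a \<in> A" "a \<in> rgrade R i"
      have "a \<odot>\<^bsub>M\<^esub> x \<in> grade M (int i + j)" by (rule M.grade_smult[OF a(2) x])
      \<comment> \<open>Components of a pair in the graph stay in the graph; as \<open>a x\<close>
        is homogeneous, its value must equal the component of that value in the same degree.\<close>
      then have "(a \<odot>\<^bsub>M\<^esub> x, mcp E (int i + j) (g a)) \<in> G" using Gp[OF gG[OF a(1)], of "int i + j"] by simp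
      then have "g a = mcp E (int i + j) (g a)" by (rule gI)
      then show "g a \<in> grade E (int i + j)" using E.cp_in[of "g a" "int i + j"] Gc(2)[OF gG[OF a(1)]] by simp
    qed (use add mul in auto)
    have ec: "e \<in> carrier E" using e(1) by (rule E.D_carrier)
    \<comment> \<open>The graph enlarged by the multiples of the pair \<open>(x, e)\<close>.\<close>
    define G' where "G' = {(m \<oplus>\<^bsub>M\<^esub> r \<odot>\<^bsub>M\<^esub> x, n \<oplus>\<^bsub>E\<^esub> r \<odot>\<^bsub>E\<^esub> e) | m n r. (m, n) \<in> G \<and> r \<in> carrier R}"
    have G'I: "(m, n) \<in> G \<Longrightarrow> r \<in> carrier R \<Longrightarrow> (m \<oplus>\<^bsub>M\<^esub> r \<odot>\<^bsub>M\<^esub> x, n \<oplus>\<^bsub>E\<^esub> r \<odot>\<^bsub>E\<^esub> e) \<in> G'" for m n r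
      unfolding G'_def by blast
    have G'E: "\<exists>m n r. p = (m \<oplus>\<^bsub>M\<^esub> r \<odot>\<^bsub>M\<^esub> x, n \<oplus>\<^bsub>E\<^esub> r \<odot>\<^bsub>E\<^esub> e) \<and> (m, n) \<in> G \<and> r \<in> carrier R" if "p \<in> G'" for p
      using that unfolding G'_def by blast
    have z: "(\<zero>\<^bsub>M\<^esub>, \<zero>\<^bsub>E\<^esub>) \<in> G" using GD(2) by simp
    have GG': "G \<subseteq> G'"
    proof
      fix p assume "p \<in> G"
      then show "p \<in> G'" using G'I[of "fst p" "snd p" \<zero>] Gc[of "fst p" "snd p"] xc ec by simp
    qed
    have "gsubmod R ?P G'"
    proof (rule gsubmodI)
      show "G' \<subseteq> carrier ?P" using G'E Gc xc ec by fastforce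
      show "\<zero>\<^bsub>?P\<^esub> \<in> G'" using GG' z by auto
    next
      fix p q assume "p \<in> G'" "q \<in> G'"
      then obtain m n r m' n' r' where *: "p = (m \<oplus>\<^bsub>M\<^esub> r \<odot>\<^bsub>M\<^esub> x, n \<oplus>\<^bsub>E\<^esub> r \<odot>\<^bsub>E\<^esub> e)" "(m, n) \<in> G" "r \<in> carrier R"
        "q = (m' \<oplus>\<^bsub>M\<^esub> r' \<odot>\<^bsub>M\<^esub> x, n' \<oplus>\<^bsub>E\<^esub> r' \<odot>\<^bsub>E\<^esub> e)" "(m', n') \<in> G" "r' \<in> carrier R"
        using G'E by meson
      note c = Gc[OF *(2)] Gc[OF *(5)]
      have "p \<oplus>\<^bsub>?P\<^esub> q = ((m \<oplus>\<^bsub>M\<^esub> m') \<oplus>\<^bsub>M\<^esub> (r \<oplus> r') \<odot>\<^bsub>M\<^esub> x, (n \<oplus>\<^bsub>E\<^esub> n') \<oplus>\<^bsub>E\<^esub> (r \<oplus> r') \<odot>\<^bsub>E\<^esub> e)"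
        using * c xc ec by (simp add: M.smult_l_distr E.smult_l_distr M.M.a_ac E.M.a_ac)
      then show "p \<oplus>\<^bsub>?P\<^esub> q \<in> G'" using G'I[OF Ga[OF *(2,5)], of "r \<oplus> r'"] * by simp
    next
      fix s p assume s: "s \<in> carrier R" "p \<in> G'"
      then obtain m n r where *: "p = (m \<oplus>\<^bsub>M\<^esub> r \<odot>\<^bsub>M\<^esub> x, n \<oplus>\<^bsub>E\<^esub> r \<odot>\<^bsub>E\<^esub> e)" "(m, n) \<in> G" "r \<in> carrier R"
        using G'E by meson
      then have "s \<odot>\<^bsub>?P\<^esub> p = (s \<odot>\<^bsub>M\<^esub> m \<oplus>\<^bsub>M\<^esub> (s \<otimes> r) \<odot>\<^bsub>M\<^esub> x, s \<odot>\<^bsub>E\<^esub> n \<oplus>\<^bsub>E\<^esub> (s \<otimes> r) \<odot>\<^bsub>E\<^esub> e)"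
        using Gc[OF *(2)] xc ec s by (simp add: M.smult_r_distr E.smult_r_distr M.smult_assoc1 E.smult_assoc1)
      then show "s \<odot>\<^bsub>?P\<^esub> p \<in> G'" using G'I[OF Gm[OF *(2) s(1)], of "s \<otimes> r"] * s by simp
    next
      fix i p assume s: "p \<in> G'"
      then obtain m n r where *: "p = (m \<oplus>\<^bsub>M\<^esub> r \<odot>\<^bsub>M\<^esub> x, n \<oplus>\<^bsub>E\<^esub> r \<odot>\<^bsub>E\<^esub> e)" "(m, n) \<in> G" "r \<in> carrier R"
        using G'E by meson
      \<comment> \<open>The coefficient that yields the \<open>i\<close>-th component of
        \<open>r x\<close>: a component of \<open>r\<close> in \<open>shift_ring R j\<close>, where
        \<open>\<one>\<close> has the degree of \<open>x\<close>.\<close>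
      define r' where "r' = mcp (shift_ring R j) i r"
      have r'c: "r' \<in> carrier R" using shift_ring_graded(2)[of r j i] *(3) by (simp add: r'_def)
      have "mcp M i (r \<odot>\<^bsub>M\<^esub> x) = r' \<odot>\<^bsub>M\<^esub> x" "mcp E i (r \<odot>\<^bsub>E\<^esub> e) = r' \<odot>\<^bsub>E\<^esub> e"
        using hom_mcp[OF shift_ring_graded(1) M smult_hom[OF M x], of r i]
          hom_mcp[OF shift_ring_graded(1) E smult_hom[OF E e(1)], of r i] *(3) by (auto simp: r'_def)
      then have "mcp ?P i p = (mcp M i m \<oplus>\<^bsub>M\<^esub> r' \<odot>\<^bsub>M\<^esub> x, mcp E i n \<oplus>\<^bsub>E\<^esub> r' \<odot>\<^bsub>E\<^esub> e)"
        using * Gc[OF *(2)] xc ec prodm_graded(2)[OF M E] by (simp add: M.cp_add E.cp_add)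
      then show "mcp ?P i p \<in> G'" using G'I[OF Gp[OF *(2)] r'c] by simp
    qed
    moreover have "d = \<zero>\<^bsub>E\<^esub>" if d: "(\<zero>\<^bsub>M\<^esub>, d) \<in> G'" for d
    proof -
      obtain m n r where *: "\<zero>\<^bsub>M\<^esub> = m \<oplus>\<^bsub>M\<^esub> r \<odot>\<^bsub>M\<^esub> x" "d = n \<oplus>\<^bsub>E\<^esub> r \<odot>\<^bsub>E\<^esub> e" "(m, n) \<in> G" "r \<in> carrier R"
        using G'E[OF d] by auto
      note c = Gc[OF *(3)]
      \<comment> \<open>A pair over zero puts \<open>r\<close> into the ideal \<open>A\<close>,
        where the value prescribed by the old graph agrees with the multiple of
        \<open>e\<close>.\<close>
      have "r \<odot>\<^bsub>M\<^esub> x = \<ominus>\<^bsub>M\<^esub> m" using *(1) c xc *(4) by (metis M.M.minus_equality M.M.a_comm M.M.minus_minus M.smult_closed)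
      then have mr: "(r \<odot>\<^bsub>M\<^esub> x, \<ominus>\<^bsub>E\<^esub> n) \<in> G" using Gi[OF *(3)] by simp
      then have "r \<in> A" "g r = \<ominus>\<^bsub>E\<^esub> n" using AI gI *(4) by blast+
      then have "r \<odot>\<^bsub>E\<^esub> e = \<ominus>\<^bsub>E\<^esub> n" using e(2) by simp
      then show ?thesis using *(2) c by (simp add: E.M.r_neg)
    qed
    ultimately have "G' \<in> XX" using GG' Gf unfolding XX_def by blast
    then have "G' = G" using G(2) GG' by blast
    moreover have "(\<zero>\<^bsub>M\<^esub> \<oplus>\<^bsub>M\<^esub> \<one> \<odot>\<^bsub>M\<^esub> x, \<zero>\<^bsub>E\<^esub> \<oplus>\<^bsub>E\<^esub> \<one> \<odot>\<^bsub>E\<^esub> e) \<in> G'" by (rule G'I[OF z]) simp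
    ultimately show False using nx xc unfolding Dm_def by auto
  qed
  have dom: "x \<in> Dm" if "x \<in> carrier M" for x
    using that
  proof (induction rule: M.dsum_induct)
    case zero
    then show ?case using GD(2) by (auto simp: Dm_def)
  next
    case (add y z)
    then show ?case using Ga unfolding Dm_def by blast
  qed (rule hom_dom)
  define h where "h x = (THE e. (x, e) \<in> G)" for x
  have hI: "h x = e" if "(x, e) \<in> G" for x e unfolding h_def using that fnl by blast
  have hG: "(x, h x) \<in> G" if "x \<in> carrier M" for x using dom[OF that] hI by (auto simp: Dm_def)
  have "h \<in> graded_hom R M E"
  proof (rule graded_homI)
    fix x assume "x \<in> carrier M" then show "h x \<in> carrier E" using hG Gc by blast
  next
    fix x y assume "x \<in> carrier M" "y \<in> carrier M"
    then show "h (x \<oplus>\<^bsub>M\<^esub> y) = h x \<oplus>\<^bsub>E\<^esub> h y" by (intro hI Ga hG)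
  next
    fix r x assume "r \<in> carrier R" "x \<in> carrier M"
    then show "h (r \<odot>\<^bsub>M\<^esub> x) = r \<odot>\<^bsub>E\<^esub> h x" by (intro hI Gm hG)
  next
    fix j x assume x: "x \<in> grade M j"
    then have xc: "x \<in> carrier M" by (rule M.D_carrier)
    have "h x = mcp E j (h x)" using Gp[OF hG[OF xc], of j] x by (intro hI) simp
    then show "h x \<in> grade E j" using E.cp_in[of "h x" j] Gc(2)[OF hG[OF xc]] by simp
  qed
  moreover have "h x = f x" if "x \<in> N" for x using that Gf by (intro hI) auto
  ultimately show ?thesis using that by blast
qed

end

section \<open>Coinduced modules\<close>

text \<open>The degree zero part as a graded ring concentrated in degree zero, with the operations
  of \<open>R\<close>. Presenting it as a \<open>gring\<close> allows \<open>baer_extension\<close>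
  to be used over it, which extends graded linear maps between vector spaces.\<close>

definition ground :: "'r gring \<Rightarrow> 'r gring" where
  "ground R = R\<lparr>carrier := rgrade R 0, rgrade := (\<lambda>a. if a = 0 then rgrade R 0 else {\<zero>\<^bsub>R\<^esub>})\<rparr>"

lemma ground_simps [simp]:
  "carrier (ground R) = rgrade R 0" "\<zero>\<^bsub>ground R\<^esub> = \<zero>\<^bsub>R\<^esub>" "\<one>\<^bsub>ground R\<^esub> = \<one>\<^bsub>R\<^esub>"
  "x \<oplus>\<^bsub>ground R\<^esub> y = x \<oplus>\<^bsub>R\<^esub> y" "x \<otimes>\<^bsub>ground R\<^esub> y = x \<otimes>\<^bsub>R\<^esub> y"
  "rgrade (ground R) a = (if a = 0 then rgrade R 0 else {\<zero>\<^bsub>R\<^esub>})"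
  by (auto simp: ground_def)

text \<open>An inductive span replaces explicit finite sums by rule induction. \<open>D\<close> is
  left arbitrary, since the notion serves both the graded pieces of a module and the monomials of a
  given degree, which need not be closed under addition.\<close>

inductive_set dspan :: "('b, 'z) ring_scheme \<Rightarrow> ('i \<Rightarrow> 'b set) \<Rightarrow> 'b set"
  for M :: "('b, 'z) ring_scheme" and D :: "'i \<Rightarrow> 'b set" where
  dspan_zero: "\<zero>\<^bsub>M\<^esub> \<in> dspan M D"
| dspan_base: "x \<in> D i \<Longrightarrow> x \<in> dspan M D"
| dspan_add: "x \<in> dspan M D \<Longrightarrow> y \<in> dspan M D \<Longrightarrow> x \<oplus>\<^bsub>M\<^esub> y \<in> dspan M D"

context graded_ring
begin

lemma ground_cring: "cring (ground R)"
proof (rule cringI)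
  show "abelian_group (ground R)"
  proof (rule abelian_groupI)
    fix x assume "x \<in> carrier (ground R)"
    then show "\<exists>y\<in>carrier (ground R). y \<oplus>\<^bsub>ground R\<^esub> x = \<zero>\<^bsub>ground R\<^esub>"
      by (intro bexI[of _ "\<ominus> x"]) (auto simp: l_neg rgrade_carrier D_inv)
  qed (auto simp: D_add rgrade_carrier a_assoc intro: a_comm rgrade_carrier)
  show "comm_monoid (ground R)"
  proof (rule comm_monoidI)
    show "x \<otimes>\<^bsub>ground R\<^esub> y \<in> carrier (ground R)" if "x \<in> carrier (ground R)" "y \<in> carrier (ground R)" for x y
      using that rgrade_mult[of x 0 y 0] by simp
  qed (auto simp: rgrade_one rgrade_carrier m_assoc intro: m_comm rgrade_carrier)
qed (auto simp: l_distr rgrade_carrier)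

lemma ground_graded: "graded_ring (ground R)"
proof (rule graded_ringI)
  interpret K: cring "ground R" by (rule ground_cring)
  have as: "additive_subgroup (rgrade (ground R) i) (ground R)" for i
  proof (intro additive_subgroup.intro K.add.subgroupI)
    have "\<zero> \<in> rgrade (ground R) i" by simp
    then show "rgrade (ground R) i \<noteq> {}" by blast
    fix a assume a: "a \<in> rgrade (ground R) i"
    then have ac: "a \<in> carrier R" using D_carrier by (auto split: if_splits)
    have "\<ominus>\<^bsub>ground R\<^esub> a = \<ominus> a" using a ac by (intro K.minus_equality) (auto simp: l_neg D_inv split: if_splits)
    then show "\<ominus>\<^bsub>ground R\<^esub> a \<in> rgrade (ground R) i" using a by (auto intro: D_inv split: if_splits)
  qed (auto intro: D_add split: if_splits)
  have "direct_sum_decomp (ground R) (rgrade (ground R))"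
  proof (rule direct_sum_decomp_projI[where p = "\<lambda>i x. if i = 0 then x else \<zero>", OF K.abelian_group_axioms as])
    fix x assume x: "x \<in> carrier (ground R)"
    have "(\<Oplus>\<^bsub>ground R\<^esub>i\<in>{0::nat}. if i = 0 then x else \<zero>\<^bsub>ground R\<^esub>) = x"
      using x by (intro K.finsum_single) auto
    then show "\<exists>F. finite F \<and> x = (\<Oplus>\<^bsub>ground R\<^esub>i\<in>F. if i = (0::nat) then x else \<zero>)"
      by (intro exI[of _ "{0}"]) (simp only: ground_simps finite.intros simp_thms)
  qed (auto split: if_splits)
  then show "graded_cring (ground R)"
    unfolding graded_cring_def using K.cring_axioms rgrade_one rgrade_mult[of _ 0 _ 0] rgrade_carrier
    by (auto split: if_splits)
qed

lemma ground_module: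
  assumes "graded_module R M"
  shows "graded_module (ground R) M"
proof -
  interpret M: graded_mod R M by (rule graded_modI) fact
  have "module (ground R) M"
    by (rule moduleI) (auto simp: ground_cring M.M.abelian_group_axioms rgrade_carrier M.smult_l_distr
        M.smult_r_distr M.smult_assoc1)
  then show ?thesis using M.dsd M.grade_smult[of _ 0]
    by (auto simp: graded_module_def M.D_carrier split: if_splits)
qed

lemma ground_hom: "f \<in> graded_hom R M N \<Longrightarrow> f \<in> graded_hom (ground R) M N"
  by (rule graded_homI) (auto simp: hom_closed hom_add hom_smult rgrade_carrier intro: hom_grade)

lemma ground_gsubmod: "gsubmod R M N \<Longrightarrow> gsubmod (ground R) M N"
  by (auto simp: gsubmod_def rgrade_carrier)

text \<open>An ideal of a field is everything or zero: in the first case the value at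
  \<open>\<one>\<close> represents \<open>g\<close>, in the second zero does.\<close>

lemma ground_baer:
  assumes k: "subfield (rgrade R 0) R" and M: "graded_module R M"
  shows "baer_inj (ground R) M"
  unfolding baer_inj_def
proof (intro allI impI)
  interpret M: graded_mod R M by (rule graded_modI) fact
  interpret K: cring "ground R" by (rule ground_cring)
  fix A s g assume A: "gideal (ground R) A" and g: "\<forall>a\<in>A. g a \<in> carrier M"
    "\<forall>a\<in>A. \<forall>b\<in>A. g (a \<oplus>\<^bsub>ground R\<^esub> b) = g a \<oplus>\<^bsub>M\<^esub> g b"
    "\<forall>r\<in>carrier (ground R). \<forall>a\<in>A. g (r \<otimes>\<^bsub>ground R\<^esub> a) = r \<odot>\<^bsub>M\<^esub> g a"
    "\<forall>i. \<forall>a\<in>A \<inter> rgrade (ground R) i. g a \<in> grade M (int i + s)"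
  interpret A: ideal A "ground R" using A by (simp add: gideal_def)
  have Ac: "a \<in> rgrade R 0" if "a \<in> A" for a using A.Icarr[OF that] by simp
  show "\<exists>e\<in>grade M s. \<forall>a\<in>A. g a = a \<odot>\<^bsub>M\<^esub> e"
  proof (cases "\<one> \<in> A")
    case True
    then have "g \<one> \<in> grade M s" using g(4)[rule_format, of \<one> 0] rgrade_one by simp
    moreover have "g a = a \<odot>\<^bsub>M\<^esub> g \<one>" if "a \<in> A" for a
      using g(3)[rule_format, of a \<one>] Ac[OF that] True rgrade_carrier by simp
    ultimately show ?thesis by blast
  next
    case False
    have "a = \<zero>" if a: "a \<in> A" for a
    proof (rule ccontr)
      assume "a \<noteq> \<zero>"
      then have "a \<in> Units (R\<lparr>carrier := rgrade R 0\<rparr>)"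
        using subfield.subfield_Units[OF k] Ac[OF a] by simp
      then obtain b where "b \<in> rgrade R 0" "b \<otimes> a = \<one>" by (auto simp: Units_def)
      then show False using A.I_l_closed[OF a, of b] False by simp
    qed
    moreover have "g \<zero> = \<zero>\<^bsub>M\<^esub>" using g(3)[rule_format, of \<zero> \<zero>] g(1) A.zero_closed by simp
    moreover have "a \<odot>\<^bsub>M\<^esub> \<zero>\<^bsub>M\<^esub> = \<zero>\<^bsub>M\<^esub>" if "a \<in> A" for a using rgrade_carrier[OF Ac[OF that]] by simp
    ultimately show ?thesis by (intro bexI[of _ "\<zero>\<^bsub>M\<^esub>"]) auto
  qed
qed

text \<open>Extracts a graded module from a module \<open>X0\<close> that may be too large to be
  graded itself: the span of independent pieces on which homogeneous scalars act with the right
  degrees.\<close>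

lemma dspan_graded:
  fixes X0 :: "('r, 'b) gmodule"
  assumes X: "module R X0" and D: "\<And>j. additive_subgroup (D j) X0"
    and sm: "\<And>a j r x. r \<in> rgrade R a \<Longrightarrow> x \<in> D j \<Longrightarrow> r \<odot>\<^bsub>X0\<^esub> x \<in> D (int a + j)"
    and ind: "\<And>c F i. finite F \<Longrightarrow> (\<And>i. c i \<in> D i) \<Longrightarrow> (\<Oplus>\<^bsub>X0\<^esub>i\<in>F. c i) = \<zero>\<^bsub>X0\<^esub> \<Longrightarrow> i \<in> F \<Longrightarrow> c i = \<zero>\<^bsub>X0\<^esub>"
    and Q: "carrier Q = dspan X0 D" "\<zero>\<^bsub>Q\<^esub> = \<zero>\<^bsub>X0\<^esub>" "add Q = add X0" "smult Q = smult X0" "grade Q = D"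
  shows "graded_module R Q"
proof -
  interpret X: module R X0 by fact
  let ?S = "dspan X0 D"
  have Dc: "x \<in> carrier X0" if "x \<in> D j" for x j
    using additive_subgroup.a_subset[OF D] that by blast
  have Dz: "\<zero>\<^bsub>X0\<^esub> \<in> D j" for j by (rule additive_subgroup.zero_closed[OF D])
  have Da: "x \<oplus>\<^bsub>X0\<^esub> y \<in> D j" if "x \<in> D j" "y \<in> D j" for x y j
    by (rule additive_subgroup.a_closed[OF D that])
  have Sc: "x \<in> carrier X0" if "x \<in> ?S" for x using that by (induction) (auto intro: Dc)
  have smh: "r \<odot>\<^bsub>X0\<^esub> x \<in> ?S" if r: "r \<in> rgrade R a" and x: "x \<in> ?S" for r x a
    using x
  proof (induction)
    case dspan_zero then show ?case using rgrade_carrier[OF r] by (simp add: dspan.dspan_zero)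
  next
    case (dspan_base x i) then show ?case using sm[OF r] dspan.dspan_base by metis
  next
    case (dspan_add x y)
    then show ?case using rgrade_carrier[OF r] Sc by (simp add: X.smult_r_distr dspan.dspan_add)
  qed
  \<comment> \<open>Two inductions in turn: over the element for a homogeneous scalar above, over
    the components of the scalar here.\<close>
  have sm': "r \<odot>\<^bsub>X0\<^esub> x \<in> ?S" if r: "r \<in> carrier R" and x: "x \<in> ?S" for r x
    using r
  proof (induction rule: dsum_induct)
    case zero then show ?case using Sc[OF x] by (simp add: dspan.dspan_zero)
  next
    case (homog i y) then show ?case using smh x by blast
  next
    case (add y z) then show ?case using Sc[OF x] by (simp add: X.smult_l_distr dspan.dspan_add)
  qed
  have neg: "\<ominus>\<^bsub>X0\<^esub> x \<in> ?S" if "x \<in> ?S" for x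
    using sm'[of "\<ominus> \<one>" x] that Sc[OF that] by (simp add: X.smult_l_minus)
  have "submodule ?S R X0"
    using Sc neg sm' by (intro X.submoduleI) (auto intro: dspan.intros)
  then have mQ: "module R Q" using module_subset[OF X] Q by blast
  then interpret Q: module R Q .
  have fs: "finsum Q c F = finsum X0 c F" if "finite F" "c \<in> F \<rightarrow> ?S" for c and F :: "int set"
    using finsum_additive[OF Q.M.abelian_group_axioms X.M.abelian_group_axioms that(1), of c "\<lambda>x. x"] that Sc Q
    by auto
  have rep: "\<exists>c F. finite F \<and> (\<forall>i. c i \<in> D i) \<and> x = (\<Oplus>\<^bsub>X0\<^esub>i\<in>F. c i)" if "x \<in> ?S" for x
    using that
  proof (induction)
    case dspan_zero
    then show ?case using Dz by (intro exI[of _ "\<lambda>_. \<zero>\<^bsub>X0\<^esub>"] exI[of _ "{}"]) auto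
  next
    case (dspan_base x i)
    have "(\<Oplus>\<^bsub>X0\<^esub>j\<in>{i}. if j = i then x else \<zero>\<^bsub>X0\<^esub>) = x"
      using dspan_base Dc by (intro X.M.finsum_single) auto
    then show ?case using dspan_base Dz
      by (intro exI[of _ "\<lambda>j. if j = i then x else \<zero>\<^bsub>X0\<^esub>"] exI[of _ "{i}"]) auto
  next
    case (dspan_add x y)
    obtain c F d H where cd: "finite F" "\<forall>i. c i \<in> D i" "x = (\<Oplus>\<^bsub>X0\<^esub>i\<in>F. c i)"
      "finite H" "\<forall>i. d i \<in> D i" "y = (\<Oplus>\<^bsub>X0\<^esub>i\<in>H. d i)"
      using dspan_add.IH by (elim exE conjE)
    let ?c = "\<lambda>i. if i \<in> F then c i else \<zero>\<^bsub>X0\<^esub>"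
    let ?d = "\<lambda>i. if i \<in> H then d i else \<zero>\<^bsub>X0\<^esub>"
    have cc: "c i \<in> carrier X0" "d i \<in> carrier X0" for i using cd(2,5) Dc by blast+
    have "(\<Oplus>\<^bsub>X0\<^esub>i\<in>F \<union> H. ?c i) = (\<Oplus>\<^bsub>X0\<^esub>i\<in>F. ?c i)" using cd(1,4) cc by (intro X.M.finsum_mono_zero) auto
    moreover have "(\<Oplus>\<^bsub>X0\<^esub>i\<in>F. ?c i) = (\<Oplus>\<^bsub>X0\<^esub>i\<in>F. c i)" using cc by (intro X.M.finsum_cong') auto
    moreover have "(\<Oplus>\<^bsub>X0\<^esub>i\<in>F \<union> H. ?d i) = (\<Oplus>\<^bsub>X0\<^esub>i\<in>H. ?d i)" using cd(1,4) cc by (intro X.M.finsum_mono_zero) auto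
    moreover have "(\<Oplus>\<^bsub>X0\<^esub>i\<in>H. ?d i) = (\<Oplus>\<^bsub>X0\<^esub>i\<in>H. d i)" using cc by (intro X.M.finsum_cong') auto
    moreover have "(\<Oplus>\<^bsub>X0\<^esub>i\<in>F \<union> H. ?c i \<oplus>\<^bsub>X0\<^esub> ?d i) = (\<Oplus>\<^bsub>X0\<^esub>i\<in>F \<union> H. ?c i) \<oplus>\<^bsub>X0\<^esub> (\<Oplus>\<^bsub>X0\<^esub>i\<in>F \<union> H. ?d i)"
      using cc by (intro X.M.finsum_addf) auto
    ultimately have "x \<oplus>\<^bsub>X0\<^esub> y = (\<Oplus>\<^bsub>X0\<^esub>i\<in>F \<union> H. ?c i \<oplus>\<^bsub>X0\<^esub> ?d i)" using cd(3,6) by simp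
    moreover have "\<forall>i. ?c i \<oplus>\<^bsub>X0\<^esub> ?d i \<in> D i" using cd(2,5) Da Dz by simp
    moreover have "finite (F \<union> H)" using cd(1,4) by simp
    ultimately show ?case by (intro exI[of _ "\<lambda>i. ?c i \<oplus>\<^bsub>X0\<^esub> ?d i"] exI[of _ "F \<union> H"] conjI)
  qed
  have DS: "x \<in> ?S" if "x \<in> D j" for x j using that by (rule dspan.dspan_base)
  have "direct_sum_decomp Q (grade Q)"
  proof (rule direct_sum_decompI[OF Q.M.abelian_group_axioms])
    show "additive_subgroup (grade Q i) Q" for i
    proof (intro additive_subgroup.intro Q.M.add.subgroupI)
      show "grade Q i \<subseteq> carrier Q" using DS Q by auto
      show "grade Q i \<noteq> {}" using Dz[of i] Q by auto
      fix a assume a: "a \<in> grade Q i"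
      have "\<ominus> \<one> \<odot>\<^bsub>X0\<^esub> a \<in> D (int 0 + i)" using sm[of "\<ominus> \<one>" 0 a i] a Q rgrade_one by (simp add: D_inv)
      then have "\<ominus>\<^bsub>X0\<^esub> a \<in> D i" using a Q Dc[of a i] by (simp add: X.smult_l_minus)
      moreover have "\<ominus>\<^bsub>Q\<^esub> a = \<ominus>\<^bsub>X0\<^esub> a"
        using a Q Dc[of a i] DS[of a i] neg by (intro Q.M.minus_equality) (auto simp: X.M.l_neg)
      ultimately show "\<ominus>\<^bsub>Q\<^esub> a \<in> grade Q i" using Q by simp
    qed (use Da Q in auto)
    show "c i = \<zero>\<^bsub>Q\<^esub>" if "finite F" "\<And>i. c i \<in> grade Q i" "(\<Oplus>\<^bsub>Q\<^esub>i\<in>F. c i) = \<zero>\<^bsub>Q\<^esub>" "i \<in> F" for c F i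
    proof -
      have "c i \<in> ?S" for i using that(2)[of i] DS Q by auto
      then have "(\<Oplus>\<^bsub>X0\<^esub>i\<in>F. c i) = \<zero>\<^bsub>X0\<^esub>" using that(3) fs[OF that(1), of c] Q by auto
      then show ?thesis using ind[OF that(1) _ _ that(4), of c] that(2) Q by auto
    qed
    fix x assume "x \<in> carrier Q"
    then have "x \<in> ?S" using Q(1) by simp
    from rep[OF this] obtain c F where cF: "finite F" "\<forall>i. c i \<in> D i" "x = (\<Oplus>\<^bsub>X0\<^esub>i\<in>F. c i)"
      by (elim exE conjE)
    moreover have "c i \<in> ?S" for i using cF(2) DS by blast
    ultimately show "\<exists>c F. finite F \<and> (\<forall>i. c i \<in> grade Q i) \<and> x = (\<Oplus>\<^bsub>Q\<^esub>i\<in>F. c i)"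
      using fs[OF cF(1), of c] Q by (intro exI[of _ c] exI[of _ F]) auto
  qed
  then show ?thesis using mQ sm Q by (auto simp: graded_module_def)
qed

text \<open>Linear maps over the ground field from \<open>R\<close> to \<open>M\<close>, with
  \<open>R\<close> acting on the argument. Fixing the value zero off the carrier makes equality of
  maps the same as equality of functions. The empty grading is a placeholder that
  \<open>coind\<close> overwrites.\<close>

definition linmaps :: "('r, 'b) gmodule \<Rightarrow> ('r, 'r \<Rightarrow> 'b) gmodule" where
  "linmaps M = \<lparr>carrier = {t. (\<forall>r\<in>carrier R. t r \<in> carrier M) \<and>
       (\<forall>r\<in>carrier R. \<forall>s\<in>carrier R. t (r \<oplus> s) = t r \<oplus>\<^bsub>M\<^esub> t s) \<and>
       (\<forall>c\<in>rgrade R 0. \<forall>r\<in>carrier R. t (c \<otimes> r) = c \<odot>\<^bsub>M\<^esub> t r) \<and>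
       (\<forall>r. r \<notin> carrier R \<longrightarrow> t r = \<zero>\<^bsub>M\<^esub>)},
     monoid.mult = undefined, one = undefined, ring.zero = (\<lambda>_. \<zero>\<^bsub>M\<^esub>), add = (\<lambda>t u r. t r \<oplus>\<^bsub>M\<^esub> u r),
     smult = (\<lambda>s t r. if r \<in> carrier R then t (r \<otimes> s) else \<zero>\<^bsub>M\<^esub>),
     grade = (\<lambda>j. {})\<rparr>"

definition lingrade :: "('r, 'b) gmodule \<Rightarrow> int \<Rightarrow> ('r \<Rightarrow> 'b) set" where
  "lingrade M j = {t \<in> carrier (linmaps M). \<forall>a. \<forall>r\<in>rgrade R a. t r \<in> grade M (int a + j)}"

text \<open>Coinduction from the ground field: every graded vector space is injective there, hence so is
  the coinduced module over \<open>R\<close>. Sums of homogeneous maps are taken because the module of all linear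
  maps is not graded.\<close>

definition coind :: "('r, 'b) gmodule \<Rightarrow> ('r, 'r \<Rightarrow> 'b) gmodule" where
  "coind M = (linmaps M)\<lparr>carrier := dspan (linmaps M) (lingrade M), grade := lingrade M\<rparr>"

lemma linmaps_simps [simp]:
  "\<zero>\<^bsub>linmaps M\<^esub> = (\<lambda>_. \<zero>\<^bsub>M\<^esub>)" "t \<oplus>\<^bsub>linmaps M\<^esub> u = (\<lambda>r. t r \<oplus>\<^bsub>M\<^esub> u r)"
  "s \<odot>\<^bsub>linmaps M\<^esub> t = (\<lambda>r. if r \<in> carrier R then t (r \<otimes> s) else \<zero>\<^bsub>M\<^esub>)"
  by (auto simp: linmaps_def)

lemma coind_simps [simp]:
  "carrier (coind M) = dspan (linmaps M) (lingrade M)" "\<zero>\<^bsub>coind M\<^esub> = (\<lambda>_. \<zero>\<^bsub>M\<^esub>)"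
  "add (coind M) = add (linmaps M)" "smult (coind M) = smult (linmaps M)"
  "grade (coind M) = lingrade M"
  by (auto simp: coind_def linmaps_def)

lemma linmapsD:
  assumes "t \<in> carrier (linmaps M)"
  shows "r \<in> carrier R \<Longrightarrow> t r \<in> carrier M"
    "r \<in> carrier R \<Longrightarrow> s \<in> carrier R \<Longrightarrow> t (r \<oplus> s) = t r \<oplus>\<^bsub>M\<^esub> t s"
    "c \<in> rgrade R 0 \<Longrightarrow> r \<in> carrier R \<Longrightarrow> t (c \<otimes> r) = c \<odot>\<^bsub>M\<^esub> t r"
    "r \<notin> carrier R \<Longrightarrow> t r = \<zero>\<^bsub>M\<^esub>"
  using assms by (auto simp: linmaps_def)

lemma linmapsI:
  assumes "\<And>r. r \<in> carrier R \<Longrightarrow> t r \<in> carrier M"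
    "\<And>r s. r \<in> carrier R \<Longrightarrow> s \<in> carrier R \<Longrightarrow> t (r \<oplus> s) = t r \<oplus>\<^bsub>M\<^esub> t s"
    "\<And>c r. c \<in> rgrade R 0 \<Longrightarrow> r \<in> carrier R \<Longrightarrow> t (c \<otimes> r) = c \<odot>\<^bsub>M\<^esub> t r"
    "\<And>r. r \<notin> carrier R \<Longrightarrow> t r = \<zero>\<^bsub>M\<^esub>"
  shows "t \<in> carrier (linmaps M)"
  using assms by (auto simp: linmaps_def)

lemma linmaps_module:
  assumes "graded_module R M"
  shows "module R (linmaps M)"
proof -
  interpret M: graded_mod R M by (rule graded_modI) fact
  let ?X = "linmaps M"
  have cc: "t r \<in> carrier M" if "t \<in> carrier ?X" for t r
    using that linmapsD[OF that] by (cases "r \<in> carrier R") auto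
  note [simp] = rgrade_carrier
  show ?thesis
  proof (rule moduleI)
    show "cring R" by (rule cring_axioms)
    show "abelian_group ?X"
    proof (rule abelian_groupI)
      fix t u assume tu: "t \<in> carrier ?X" "u \<in> carrier ?X"
      show "t \<oplus>\<^bsub>?X\<^esub> u \<in> carrier ?X"
        using linmapsD[OF tu(1)] linmapsD[OF tu(2)]
        by (intro linmapsI) (auto simp: M.smult_r_distr M.M.a_ac)
      show "t \<oplus>\<^bsub>?X\<^esub> u = u \<oplus>\<^bsub>?X\<^esub> t" using tu cc by (auto simp: fun_eq_iff intro: M.M.a_comm)
    next
      show "\<zero>\<^bsub>?X\<^esub> \<in> carrier ?X" by (intro linmapsI) auto
    next
      fix t u v assume tu: "t \<in> carrier ?X" "u \<in> carrier ?X" "v \<in> carrier ?X"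
      show "t \<oplus>\<^bsub>?X\<^esub> u \<oplus>\<^bsub>?X\<^esub> v = t \<oplus>\<^bsub>?X\<^esub> (u \<oplus>\<^bsub>?X\<^esub> v)"
        using tu cc by (auto simp: fun_eq_iff M.M.a_assoc)
    next
      fix t assume t: "t \<in> carrier ?X"
      show "\<zero>\<^bsub>?X\<^esub> \<oplus>\<^bsub>?X\<^esub> t = t" using cc[OF t] by auto
      show "\<exists>u\<in>carrier ?X. u \<oplus>\<^bsub>?X\<^esub> t = \<zero>\<^bsub>?X\<^esub>"
      proof (rule bexI[of _ "\<lambda>r. \<ominus>\<^bsub>M\<^esub> t r"])
        show "(\<lambda>r. \<ominus>\<^bsub>M\<^esub> t r) \<in> carrier ?X"
          using linmapsD[OF t] by (intro linmapsI) (auto simp: M.smult_r_minus M.M.minus_add)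
      qed (use cc[OF t] in \<open>auto simp: M.M.l_neg\<close>)
    qed
  next
    fix s t assume s: "s \<in> carrier R" and t: "t \<in> carrier ?X"
    show "s \<odot>\<^bsub>?X\<^esub> t \<in> carrier ?X"
      using s linmapsD[OF t] by (intro linmapsI) (auto simp: l_distr m_assoc)
    fix s' assume s': "s' \<in> carrier R"
    show "(s \<oplus> s') \<odot>\<^bsub>?X\<^esub> t = s \<odot>\<^bsub>?X\<^esub> t \<oplus>\<^bsub>?X\<^esub> s' \<odot>\<^bsub>?X\<^esub> t"
      using s s' linmapsD[OF t] by (auto simp: fun_eq_iff r_distr)
    show "(s \<otimes> s') \<odot>\<^bsub>?X\<^esub> t = s \<odot>\<^bsub>?X\<^esub> (s' \<odot>\<^bsub>?X\<^esub> t)"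
      using s s' linmapsD[OF t] by (auto simp: fun_eq_iff m_assoc)
  next
    fix t assume t: "t \<in> carrier ?X"
    show "\<one> \<odot>\<^bsub>?X\<^esub> t = t" using linmapsD[OF t] by (auto simp: fun_eq_iff)
  next
    fix s t u assume s: "s \<in> carrier R" and t: "t \<in> carrier ?X" "u \<in> carrier ?X"
    show "s \<odot>\<^bsub>?X\<^esub> (t \<oplus>\<^bsub>?X\<^esub> u) = s \<odot>\<^bsub>?X\<^esub> t \<oplus>\<^bsub>?X\<^esub> s \<odot>\<^bsub>?X\<^esub> u"
      by (auto simp: fun_eq_iff)
  qed
qed

lemma coind_graded:
  fixes M :: "('r, 'b) gmodule"
  assumes "graded_module R M"
  shows "graded_module R (coind M)"
proof -
  interpret M: graded_mod R M by (rule graded_modI) fact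
  interpret X: module R "linmaps M" by (rule linmaps_module) fact
  let ?X = "linmaps M"
  have gX: "t \<in> carrier ?X" if "t \<in> lingrade M j" for t j using that by (simp add: lingrade_def)
  have gd: "t r \<in> grade M (int a + j)" if "t \<in> lingrade M j" "r \<in> rgrade R a" for t j r a
    using that by (simp add: lingrade_def)
  have Xinv: "\<ominus>\<^bsub>?X\<^esub> t = (\<ominus> \<one>) \<odot>\<^bsub>?X\<^esub> t" if "t \<in> carrier ?X" for t using that by (simp add: X.smult_l_minus del: linmaps_simps)
  show ?thesis
  proof (rule dspan_graded[OF X.module_axioms, where D = "lingrade M"])
    fix a j r t assume r: "r \<in> rgrade R a" and t: "t \<in> lingrade M j"
    show "r \<odot>\<^bsub>?X\<^esub> t \<in> lingrade M (int a + j)"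
      unfolding lingrade_def
    proof (intro CollectI conjI allI ballI)
      show "r \<odot>\<^bsub>?X\<^esub> t \<in> carrier ?X" using gX[OF t] rgrade_carrier[OF r] by (rule X.smult_closed[rotated])
      fix b s assume s: "s \<in> rgrade R b"
      show "(r \<odot>\<^bsub>?X\<^esub> t) s \<in> grade M (int b + (int a + j))"
        using gd[OF t rgrade_mult[OF s r]] rgrade_carrier[OF s] by (simp add: add.assoc)
    qed
    note this
  next
    fix j
    show "additive_subgroup (lingrade M j) ?X"
    proof (intro additive_subgroup.intro X.M.add.subgroupI)
      show "lingrade M j \<subseteq> carrier ?X" using gX by blast
      show "lingrade M j \<noteq> {}" using X.M.zero_closed by (auto simp: lingrade_def)
      fix t assume t: "t \<in> lingrade M j"
      have "(\<ominus>\<^bsub>?X\<^esub> t) r \<in> grade M (int a + j)" if "r \<in> rgrade R a" for r a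
      proof -
        have "r \<otimes> \<ominus> \<one> = \<ominus> r" using rgrade_carrier[OF that] by (simp add: r_minus)
        then show ?thesis using gd[OF t, of "\<ominus> r" a] D_inv[OF that] rgrade_carrier[OF that] Xinv[OF gX[OF t]] by simp
      qed
      then show "\<ominus>\<^bsub>?X\<^esub> t \<in> lingrade M j" using gX[OF t] by (simp add: lingrade_def)
      fix u assume u: "u \<in> lingrade M j"
      show "t \<oplus>\<^bsub>?X\<^esub> u \<in> lingrade M j"
        using X.M.a_closed[OF gX[OF t] gX[OF u]] gd[OF t] gd[OF u] M.D_add by (simp add: lingrade_def)
    qed
  next
    fix c :: "int \<Rightarrow> 'r \<Rightarrow> 'b" and F i
    assume F: "finite F" and c: "\<And>i. c i \<in> lingrade M i" and z: "(\<Oplus>\<^bsub>?X\<^esub>i\<in>F. c i) = \<zero>\<^bsub>?X\<^esub>" and i: "i \<in> F"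
    have cc: "c j r \<in> carrier M" if "r \<in> carrier R" for j r using linmapsD(1)[OF gX[OF c] that] .
    \<comment> \<open>Evaluated at a homogeneous \<open>r\<close>, the summands of the relation lie
      in the distinct degrees \<open>int a + i\<close>, so each of them vanishes.\<close>
    have hz: "c i r = \<zero>\<^bsub>M\<^esub>" if r: "r \<in> rgrade R a" for r a
    proof -
      have rc: "r \<in> carrier R" using r by (rule rgrade_carrier)
      have "(\<Oplus>\<^bsub>?X\<^esub>i\<in>F. c i) r = (\<Oplus>\<^bsub>M\<^esub>i\<in>F. c i r)"
        using F gX[OF c] linmapsD(1) rc
        by (intro finsum_additive[OF X.M.abelian_group_axioms M.M.abelian_group_axioms, of F c "\<lambda>t. t r"]) auto
      then have "\<zero>\<^bsub>M\<^esub> = (\<Oplus>\<^bsub>M\<^esub>i\<in>F. c i r)" using z by simp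
      also have "(\<Oplus>\<^bsub>M\<^esub>i\<in>F. c i r) = (\<Oplus>\<^bsub>M\<^esub>k\<in>(\<lambda>i. int a + i) ` F. c (k - int a) r)"
        using cc[OF rc] by (subst M.M.finsum_reindex) (auto simp: inj_on_def)
      finally have e: "\<zero>\<^bsub>M\<^esub> = (\<Oplus>\<^bsub>M\<^esub>k\<in>(\<lambda>i. int a + i) ` F. c (k - int a) r)" .
      have kF: "k \<in> (\<lambda>i. int a + i) ` F \<longleftrightarrow> k - int a \<in> F" for k by (auto simp: image_iff) (metis add_diff_cancel_left' diff_add_cancel add.commute)
      have "\<zero>\<^bsub>M\<^esub> = (\<Oplus>\<^bsub>M\<^esub>k\<in>(\<lambda>i. int a + i) ` F. if k - int a \<in> F then c (k - int a) r else \<zero>\<^bsub>M\<^esub>)"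
        using e kF cc[OF rc] by (subst M.M.finsum_cong'[where g = "\<lambda>k. c (k - int a) r"]) auto
      then have "mcp M (int a + i) \<zero>\<^bsub>M\<^esub> = (if (int a + i) - int a \<in> F then c ((int a + i) - int a) r else \<zero>\<^bsub>M\<^esub>)"
        using F gd[OF c r] kF
        by (intro M.cp_eqI[where F = "(\<lambda>i. int a + i) ` F" and c = "\<lambda>k. if k - int a \<in> F then c (k - int a) r else \<zero>\<^bsub>M\<^esub>"])
          (auto simp: algebra_simps, metis add.commute diff_add_cancel)
      then show ?thesis using i by simp
    qed
    have "c i r = \<zero>\<^bsub>M\<^esub>" for r
    proof (cases "r \<in> carrier R")
      case True
      then show ?thesis
      proof (induction rule: dsum_induct)
        case zero then show ?case using hz[of \<zero> 0] by simp
      next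
        case (homog a y) then show ?case using hz by blast
      next
        case (add y z) then show ?case using linmapsD(2)[OF gX[OF c]] by simp
      qed
    qed (use linmapsD(4)[OF gX[OF c]] in auto)
    then show "c i = \<zero>\<^bsub>?X\<^esub>" by auto
  qed auto
qed

lemma coind_carrier:
  assumes "graded_module R M" "t \<in> carrier (coind M)"
  shows "t \<in> carrier (linmaps M)"
proof -
  interpret X: module R "linmaps M" by (rule linmaps_module) fact
  have "t \<in> dspan (linmaps M) (lingrade M)" using assms(2) by simp
  then show ?thesis
  proof induction
    case (dspan_add x y) then show ?case using X.M.a_closed by blast
  qed (use X.M.zero_closed in \<open>auto simp: lingrade_def\<close>)
qed

text \<open>The unit of coinduction; evaluating at \<open>\<one>\<close> recovers the element,
  whence injectivity.\<close>

lemma coind_embed: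
  assumes M: "graded_module R M"
  shows "(\<lambda>x r. if r \<in> carrier R then r \<odot>\<^bsub>M\<^esub> x else \<zero>\<^bsub>M\<^esub>) \<in> graded_hom R M (coind M)" (is "?e \<in> _")
    and "inj_on (\<lambda>x r. if r \<in> carrier R then r \<odot>\<^bsub>M\<^esub> x else \<zero>\<^bsub>M\<^esub>) (carrier M)"
proof -
  interpret M: graded_mod R M by (rule graded_modI) fact
  interpret C: graded_mod R "coind M" by (rule graded_modI[OF coind_graded[OF M]])
  note [simp] = rgrade_carrier
  have lin: "?e x \<in> carrier (linmaps M)" if "x \<in> carrier M" for x
    using that by (intro linmapsI) (auto simp: M.smult_l_distr M.smult_assoc1)
  have gr: "?e x \<in> lingrade M j" if "x \<in> grade M j" for x j
    using lin[of x] M.D_carrier[OF that] that M.grade_smult by (auto simp: lingrade_def)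
  have ead: "?e (x \<oplus>\<^bsub>M\<^esub> y) = ?e x \<oplus>\<^bsub>coind M\<^esub> ?e y" if "x \<in> carrier M" "y \<in> carrier M" for x y
    using that by (auto simp: fun_eq_iff M.smult_r_distr)
  have car: "?e x \<in> carrier (coind M)" if "x \<in> carrier M" for x
    using that
  proof (induction rule: M.dsum_induct)
    case zero
    have "?e \<zero>\<^bsub>M\<^esub> = \<zero>\<^bsub>coind M\<^esub>" by auto
    then show ?case using C.M.zero_closed by metis
  next
    case (homog i y) then show ?case using gr[of y i] by (auto intro: dspan.dspan_base)
  next
    case (add y z)
    show ?case using C.M.a_closed[OF add.IH] ead[OF add.hyps] by (simp only:)
  qed
  show "?e \<in> graded_hom R M (coind M)"
  proof (rule graded_homI)
    show "?e (r \<odot>\<^bsub>M\<^esub> x) = r \<odot>\<^bsub>coind M\<^esub> ?e x" if "r \<in> carrier R" "x \<in> carrier M" for r x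
      using that by (auto simp: fun_eq_iff M.smult_assoc1)
  qed (use car ead gr in auto)
  show "inj_on ?e (carrier M)"
  proof (rule inj_onI)
    fix x y assume *: "x \<in> carrier M" "y \<in> carrier M" "?e x = ?e y"
    show "x = y" using fun_cong[OF *(3), of \<one>] *(1,2) by simp
  qed
qed

text \<open>Adjunction between restriction to the ground field and coinduction: \<open>g\<close>
  corresponds to the linear map \<open>x\<close> to \<open>g x \<one>\<close>, which extends along
  \<open>f\<close> by \<open>ground_baer\<close>, and the extension \<open>u\<close> corresponds to
  the map that sends \<open>b\<close> to the function \<open>r\<close> to
  \<open>u (r b)\<close>.\<close>

lemma coind_injective:
  fixes A :: "('r, 'c) gmodule"
  assumes k: "subfield (rgrade R 0) R" and M: "graded_module R M"
    and A: "graded_module R A" and B: "graded_module R B"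
    and f: "f \<in> graded_hom R A B" "inj_on f (carrier A)" and g: "g \<in> graded_hom R A (coind M)"
  obtains h where "h \<in> graded_hom R B (coind M)" "\<And>x. x \<in> carrier A \<Longrightarrow> h (f x) = g x"
proof -
  interpret M: graded_mod R M by (rule graded_modI) fact
  interpret A: graded_mod R A by (rule graded_modI) fact
  interpret B: graded_mod R B by (rule graded_modI) fact
  interpret C: graded_mod R "coind M" by (rule graded_modI[OF coind_graded[OF M]])
  interpret K: graded_ring "ground R" by (rule ground_graded)
  let ?N = "f ` carrier A"
  let ?q = "inv_into (carrier A) f"
  have q [simp]: "?q (f x) = x" if "x \<in> carrier A" for x using that f(2) by simp
  have N: "gsubmod R B ?N" by (rule gsubmod_image[OF A B f(1) gsubmod_carrier[OF A]])
  have qh: "?q \<in> graded_hom R (gsub B ?N) A"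
  proof (rule graded_homI)
    fix j x assume "x \<in> grade (gsub B ?N) j"
    then obtain a where a: "x = f a" "a \<in> carrier A" "f a \<in> grade B j" by auto
    \<comment> \<open>\<open>f\<close> commutes with components, so the preimage of a homogeneous
      element under an injective \<open>f\<close> is homogeneous.\<close>
    then have "f (mcp A j a) = f a" using hom_mcp[OF A B f(1) a(2), of j] by simp
    then have "mcp A j a = a" using f(2) a(2) by (auto simp: inj_on_def)
    then show "?q x \<in> grade A j" using a A.cp_in[of a j] by simp
  next
    fix x y assume "x \<in> carrier (gsub B ?N)" "y \<in> carrier (gsub B ?N)"
    then show "?q (x \<oplus>\<^bsub>gsub B ?N\<^esub> y) = ?q x \<oplus>\<^bsub>A\<^esub> ?q y"
      by (auto simp: hom_add[OF f(1), symmetric])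
  next
    fix r x assume "r \<in> carrier R" "x \<in> carrier (gsub B ?N)"
    then show "?q (r \<odot>\<^bsub>gsub B ?N\<^esub> x) = r \<odot>\<^bsub>A\<^esub> ?q x" by (auto simp: hom_smult[OF f(1), symmetric])
  qed auto
  have ev: "(\<lambda>t. t \<one>) \<in> graded_hom (ground R) (coind M) M"
  proof (rule graded_homI)
    fix t assume t: "t \<in> carrier (coind M)"
    note tl = linmapsD[OF coind_carrier[OF M t]]
    show "t \<one> \<in> carrier M" using tl(1) by simp
    fix r assume r: "r \<in> carrier (ground R)"
    show "(r \<odot>\<^bsub>coind M\<^esub> t) \<one> = r \<odot>\<^bsub>M\<^esub> t \<one>" using tl(3)[of r \<one>] r rgrade_carrier by simp
  next
    fix j t assume "t \<in> grade (coind M) j"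
    then show "t \<one> \<in> grade M j" using rgrade_one by (fastforce simp: lingrade_def)
  qed auto
  have u0: "(\<lambda>x. g (?q x) \<one>) \<in> graded_hom (ground R) (gsub B ?N) M"
    by (rule hom_compose[OF ground_hom[OF hom_compose[OF qh g]] ev])
  obtain u where u: "u \<in> graded_hom (ground R) B M" "\<And>x. x \<in> ?N \<Longrightarrow> u x = g (?q x) \<one>"
    using K.baer_extension[OF ground_module[OF B] ground_module[OF M] ground_baer[OF k M] ground_gsubmod[OF N] u0]
    by blast
  let ?h = "\<lambda>b r. if r \<in> carrier R then u (r \<odot>\<^bsub>B\<^esub> b) else \<zero>\<^bsub>M\<^esub>"
  note [simp] = rgrade_carrier
  have lin: "?h b \<in> carrier (linmaps M)" if "b \<in> carrier B" for b
    using that hom_closed[OF u(1)] hom_add[OF u(1)] hom_smult[OF u(1)]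
    by (intro linmapsI) (auto simp: B.smult_l_distr B.smult_assoc1)
  have gr: "?h b \<in> lingrade M j" if "b \<in> grade B j" for b j
    using lin[of b] B.D_carrier[OF that] hom_grade[OF u(1)] B.grade_smult[OF _ that] by (auto simp: lingrade_def)
  have ead: "?h (x \<oplus>\<^bsub>B\<^esub> y) = ?h x \<oplus>\<^bsub>coind M\<^esub> ?h y" if "x \<in> carrier B" "y \<in> carrier B" for x y
    using that hom_add[OF u(1)] by (auto simp: fun_eq_iff B.smult_r_distr)
  have u0: "u \<zero>\<^bsub>B\<^esub> = \<zero>\<^bsub>M\<^esub>" by (rule hom_zero[OF ground_module[OF B] ground_module[OF M] u(1)])
  have car: "?h x \<in> carrier (coind M)" if "x \<in> carrier B" for x
    using that
  proof (induction rule: B.dsum_induct)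
    case zero
    have "?h \<zero>\<^bsub>B\<^esub> = \<zero>\<^bsub>coind M\<^esub>" using u0 by auto
    then show ?case using C.M.zero_closed by metis
  next
    case (homog i y) then show ?case using gr[of y i] by (auto intro: dspan.dspan_base)
  next
    case (add y z)
    show ?case using C.M.a_closed[OF add.IH] ead[OF add.hyps] by (simp only:)
  qed
  have hh: "?h \<in> graded_hom R B (coind M)"
  proof (rule graded_homI)
    show "?h (r \<odot>\<^bsub>B\<^esub> x) = r \<odot>\<^bsub>coind M\<^esub> ?h x" if "r \<in> carrier R" "x \<in> carrier B" for r x
      using that by (auto simp: fun_eq_iff B.smult_assoc1)
  qed (use car ead gr in auto)
  have "?h (f x) = g x" if x: "x \<in> carrier A" for x
  proof
    fix r
    note gl = linmapsD[OF coind_carrier[OF M hom_closed[OF g x]]]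
    show "?h (f x) r = g x r"
    proof (cases "r \<in> carrier R")
      case True
      then have "u (r \<odot>\<^bsub>B\<^esub> f x) = u (f (r \<odot>\<^bsub>A\<^esub> x))" using hom_smult[OF f(1) True x] by simp
      also have "\<dots> = g (r \<odot>\<^bsub>A\<^esub> x) \<one>" using u(2)[of "f (r \<odot>\<^bsub>A\<^esub> x)"] x True by simp
      also have "\<dots> = (r \<odot>\<^bsub>coind M\<^esub> g x) \<one>" using hom_smult[OF g True x] by simp
      finally show ?thesis using True by simp
    qed (use gl in simp)
  qed
  with hh that show ?thesis by blast
qed

lemma imagem_injective:
  assumes "graded_injective R E" "inj_on p (carrier E)"
  shows "graded_injective R (imagem p E)"
  unfolding graded_injective_def
proof (intro conjI allI impI)
  have E: "graded_module R E" using assms(1) by (simp add: graded_injective_def)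
  note im = imagem_graded[OF E assms(2)]
  show "graded_module R (imagem p E)" by (rule im)
  fix A B :: "('r, 'r) gmodule" and f g
  assume *: "graded_module R A" "graded_module R B" "f \<in> graded_hom R A B" "inj_on f (carrier A)"
    "g \<in> graded_hom R A (imagem p E)"
  let ?q = "inv_into (carrier E) p"
  obtain h where h: "h \<in> graded_hom R B E" "\<forall>x\<in>carrier A. h (f x) = ?q (g x)"
    using assms(1)[unfolded graded_injective_def, THEN conjunct2, rule_format, OF *(1-4) hom_compose[OF *(5) im(3)]] by blast
  have "p (h (f x)) = g x" if "x \<in> carrier A" for x
    using h(2) that hom_closed[OF *(5) that] im(4) by (simp add: f_inv_into_f)
  then show "\<exists>h\<in>graded_hom R B (imagem p E). \<forall>x\<in>carrier A. h (f x) = g x"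
    using hom_compose[OF h(1) im(2)] by (intro bexI[of _ "\<lambda>x. p (h x)"]) auto
qed

end

section \<open>Homology\<close>

context graded_ring
begin

context
  fixes G :: "('r, 'b) gcomplex"
  assumes G: "graded_complex R G"
begin

lemma cobj_graded: "graded_module R (cobj G i)" using G by (simp add: graded_complex_def)
lemma cdiff_hom: "cdiff G i \<in> graded_hom R (cobj G i) (cobj G (i - 1))" using G by (simp add: graded_complex_def)
lemma cdiff_hom': "cdiff G (i + 1) \<in> graded_hom R (cobj G (i + 1)) (cobj G i)"
  using cdiff_hom[of "i + 1"] by simp
lemma cdiff_cdiff: "x \<in> carrier (cobj G (i + 1)) \<Longrightarrow> cdiff G i (cdiff G (i + 1) x) = \<zero>\<^bsub>cobj G (i - 1)\<^esub>"
proof -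
  assume x: "x \<in> carrier (cobj G (i + 1))"
  have "cdiff G (i + 1 - 1) (cdiff G (i + 1) x) = \<zero>\<^bsub>cobj G (i + 1 - 2)\<^esub>"
    using G x unfolding graded_complex_def by blast
  moreover have "i + 1 - 2 = i - 1" by simp
  ultimately show ?thesis by simp
qed

lemma cycles_gsubmod: "gsubmod R (cobj G i) (cycles G i)"
  using gsubmod_kernel[OF cobj_graded cobj_graded cdiff_hom] by (simp add: cycles_def)

lemma boundaries_gsubmod: "gsubmod R (cobj G i) (boundaries G i)"
  using gsubmod_image[OF cobj_graded cobj_graded cdiff_hom' gsubmod_carrier[OF cobj_graded]]
  by (simp add: boundaries_def)

lemma boundaries_cycles: "boundaries G i \<subseteq> cycles G i"
  using cdiff_cdiff hom_closed[OF cdiff_hom'] by (auto simp: boundaries_def cycles_def)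

abbreviation "hcl i z \<equiv> boundaries G i +>\<^bsub>cobj G i\<^esub> z"

lemma homology_facts:
  shows homology_graded: "graded_module R (homology G i)"
    and homology_proj: "hcl i \<in> graded_hom R (gsub (cobj G i) (cycles G i)) (homology G i)"
    and homology_carrier: "carrier (homology G i) = hcl i ` cycles G i"
    and homology_zero: "\<zero>\<^bsub>homology G i\<^esub> = boundaries G i"
    and homology_grade: "grade (homology G i) j = hcl i ` (grade (cobj G i) j \<inter> cycles G i)"
proof -
  have 1: "graded_module R (gsub (cobj G i) (cycles G i))" by (rule gsub_graded[OF cobj_graded cycles_gsubmod])
  have 2: "gsubmod R (gsub (cobj G i) (cycles G i)) (boundaries G i)"
    by (rule gsubmod_gsub[OF cobj_graded cycles_gsubmod boundaries_gsubmod boundaries_cycles])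
  have 3: "boundaries G i +>\<^bsub>gsub (cobj G i) (cycles G i)\<^esub> z = hcl i z" for z by (simp add: a_r_coset_def')
  note q = gquot_proj[OF 1 2, unfolded 3, folded homology_def]
  show "graded_module R (homology G i)" "hcl i \<in> graded_hom R (gsub (cobj G i) (cycles G i)) (homology G i)"
    "\<zero>\<^bsub>homology G i\<^esub> = boundaries G i"
    by (fact q)+
  show "carrier (homology G i) = hcl i ` cycles G i" using q(3) by simp
  show "grade (homology G i) j = hcl i ` (grade (cobj G i) j \<inter> cycles G i)" using q(5)[of j] by simp
qed

lemma hcl_eq: "z \<in> carrier (cobj G i) \<Longrightarrow> z' \<in> carrier (cobj G i) \<Longrightarrow>
    hcl i z = hcl i z' \<longleftrightarrow> z \<ominus>\<^bsub>cobj G i\<^esub> z' \<in> boundaries G i"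
  by (rule coset_eq_iff[OF cobj_graded boundaries_gsubmod])

lemma hcl_zero: "z \<in> carrier (cobj G i) \<Longrightarrow> hcl i z = boundaries G i \<longleftrightarrow> z \<in> boundaries G i"
proof -
  assume z: "z \<in> carrier (cobj G i)"
  interpret M: graded_mod R "cobj G i" by (rule graded_modI[OF cobj_graded])
  have zc: "\<zero>\<^bsub>cobj G i\<^esub> \<in> cycles G i" using gsubmodD(2)[OF cycles_gsubmod] .
  have "hcl i \<zero>\<^bsub>cobj G i\<^esub> = boundaries G i"
    using hom_zero[OF gsub_graded[OF cobj_graded cycles_gsubmod] homology_graded homology_proj, of i] homology_zero
    by simp
  then show ?thesis using hcl_eq[OF z, of "\<zero>\<^bsub>cobj G i\<^esub>"] z by (simp add: M.M.minus_eq)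
qed

lemma hcl_self: "z \<in> carrier (cobj G i) \<Longrightarrow> z \<in> hcl i z"
  using abelian_subgroup.a_rcos_self[OF additive_subgroup_gsubmod[OF cobj_graded boundaries_gsubmod]] .

lemma hcl_mem:
  assumes "z \<in> carrier (cobj G i)" "y \<in> hcl i z"
  shows "y \<in> carrier (cobj G i)" "hcl i y = hcl i z" "y \<ominus>\<^bsub>cobj G i\<^esub> z \<in> boundaries G i"
proof -
  interpret M: graded_mod R "cobj G i" by (rule graded_modI[OF cobj_graded])
  obtain n where n: "n \<in> boundaries G i" "y = n \<oplus>\<^bsub>cobj G i\<^esub> z" using assms(2) by (auto simp: mem_coset)
  have nc: "n \<in> carrier (cobj G i)" using n gsubmodD(6)[OF boundaries_gsubmod] by blast
  then show y: "y \<in> carrier (cobj G i)" using n assms by simp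
  have "y \<ominus>\<^bsub>cobj G i\<^esub> z = n" using n nc assms(1) by (simp add: M.M.minus_eq M.M.a_assoc M.M.r_neg)
  then show "y \<ominus>\<^bsub>cobj G i\<^esub> z \<in> boundaries G i" using n by simp
  then show "hcl i y = hcl i z" using hcl_eq[OF y assms(1)] by simp
qed

lemma zero_homology_iff: "zero_module (homology G i) \<longleftrightarrow> cycles G i \<subseteq> boundaries G i"
proof -
  have "zero_module (homology G i) \<longleftrightarrow> hcl i ` cycles G i = {boundaries G i}"
    by (simp add: zero_module_def homology_carrier homology_zero)
  also have "\<dots> \<longleftrightarrow> (\<forall>z\<in>cycles G i. hcl i z = boundaries G i)" (is "?a ` ?Z = {?B} \<longleftrightarrow> _")
  proof
    assume *: "?a ` ?Z = {?B}"
    show "\<forall>z\<in>?Z. ?a z = ?B"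
    proof
      fix z assume "z \<in> ?Z"
      then have "?a z \<in> ?a ` ?Z" by (rule imageI)
      then show "?a z = ?B" unfolding * by (rule singletonD)
    qed
  next
    assume *: "\<forall>z\<in>?Z. ?a z = ?B"
    have "?Z \<noteq> {}" using gsubmodD(2)[OF cycles_gsubmod[of i]] by auto
    then have "(\<lambda>z. ?B) ` ?Z = {?B}" by (simp add: image_constant_conv)
    then show "?a ` ?Z = {?B}" using * by (metis (no_types, lifting) image_cong)
  qed
  also have "\<dots> \<longleftrightarrow> cycles G i \<subseteq> boundaries G i"
    using hcl_zero gsubmodD(6)[OF cycles_gsubmod] by blast
  finally show ?thesis .
qed

lemma grade_homology_ne:
  "grade (homology G i) j \<noteq> {\<zero>\<^bsub>homology G i\<^esub>} \<longleftrightarrow>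
     (\<exists>z\<in>grade (cobj G i) j. z \<in> cycles G i \<and> z \<notin> boundaries G i)"
proof -
  interpret M: graded_mod R "cobj G i" by (rule graded_modI[OF cobj_graded])
  let ?A = "grade (cobj G i) j \<inter> cycles G i" and ?B = "boundaries G i"
  have z: "\<zero>\<^bsub>cobj G i\<^esub> \<in> ?A" using gsubmodD(2)[OF cycles_gsubmod] by simp
  have "hcl i ` ?A \<noteq> {?B} \<longleftrightarrow> (\<exists>z\<in>?A. hcl i z \<noteq> ?B)"
  proof
    assume *: "hcl i ` ?A \<noteq> {?B}"
    show "\<exists>z\<in>?A. hcl i z \<noteq> ?B"
    proof (rule ccontr)
      assume "\<not> ?thesis"
      then have "hcl i ` ?A \<subseteq> {?B}" by auto
      moreover have "hcl i ` ?A \<noteq> {}" using z by (simp only: image_is_empty) blast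
      ultimately show False using * by (simp add: subset_singleton_iff)
    qed
  next
    assume "\<exists>z\<in>?A. hcl i z \<noteq> ?B"
    then obtain z where "z \<in> ?A" "hcl i z \<noteq> ?B" by auto
    then show "hcl i ` ?A \<noteq> {?B}" using imageI[of z ?A "hcl i"] by auto
  qed
  then have "grade (homology G i) j \<noteq> {\<zero>\<^bsub>homology G i\<^esub>} \<longleftrightarrow> (\<exists>z\<in>?A. hcl i z \<noteq> ?B)"
    unfolding homology_grade homology_zero .
  also have "\<dots> \<longleftrightarrow> (\<exists>z\<in>grade (cobj G i) j. z \<in> cycles G i \<and> z \<notin> boundaries G i)"
    using hcl_zero M.D_carrier by blast
  finally show ?thesis .
qed

text \<open>Any preimage may be replaced by its component in degree \<open>j\<close>, since the
  differential commutes with components.\<close>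

lemma boundary_homog:
  assumes "z \<in> grade (cobj G i) j" "z \<in> boundaries G i"
  obtains w where "w \<in> grade (cobj G (i + 1)) j" "cdiff G (i + 1) w = z"
proof -
  interpret M: graded_mod R "cobj G (i + 1)" by (rule graded_modI[OF cobj_graded])
  interpret N: graded_mod R "cobj G i" by (rule graded_modI[OF cobj_graded])
  obtain y where y: "y \<in> carrier (cobj G (i + 1))" "z = cdiff G (i + 1) y" using assms(2) by (auto simp: boundaries_def)
  have "cdiff G (i + 1) (mcp (cobj G (i + 1)) j y) = z"
    using hom_mcp[OF cobj_graded cobj_graded cdiff_hom' y(1), of j] y(2) assms(1) by simp
  then show ?thesis using that M.cp_in[OF y(1)] by blast
qed

end

text \<open>All members of the union that defines \<open>homology_map\<close> agree, because a chain
  map carries boundaries to boundaries.\<close>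

lemma homology_map_coset:
  assumes G: "graded_complex R G" and K: "graded_complex R K" and ch: "chain_map R G K \<phi>"
    and z: "z \<in> cycles G i"
  shows "homology_map K \<phi> i (boundaries G i +>\<^bsub>cobj G i\<^esub> z) = boundaries K i +>\<^bsub>cobj K i\<^esub> \<phi> i z"
    "\<phi> i z \<in> cycles K i"
proof -
  have hom: "\<phi> i \<in> graded_hom R (cobj G i) (cobj K i)" for i using ch by (simp add: chain_map_def)
  have com: "\<phi> (i - 1) (cdiff G i x) = cdiff K i (\<phi> i x)" if "x \<in> carrier (cobj G i)" for x i
    using ch that by (simp add: chain_map_def)
  have zc: "z \<in> carrier (cobj G i)" using z by (simp add: cycles_def)
  have bb: "\<phi> i b \<in> boundaries K i" if b: "b \<in> boundaries G i" for b
  proof -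
    obtain x where x: "x \<in> carrier (cobj G (i + 1))" "b = cdiff G (i + 1) x" using b by (auto simp: boundaries_def)
    then have "\<phi> i b = cdiff K (i + 1) (\<phi> (i + 1) x)" using com[of x "i + 1"] by simp
    then show ?thesis using hom_closed[OF hom x(1)] by (auto simp: boundaries_def)
  qed
  show cyc: "\<phi> i z \<in> cycles K i"
    using z com[OF zc] hom_closed[OF hom] hom_zero[OF cobj_graded[OF G] cobj_graded[OF K] hom[of "i - 1"]]
    by (simp add: cycles_def)
  then have pc: "\<phi> i z \<in> carrier (cobj K i)" by (simp add: cycles_def)
  have "boundaries K i +>\<^bsub>cobj K i\<^esub> \<phi> i y = boundaries K i +>\<^bsub>cobj K i\<^esub> \<phi> i z"
    if y: "y \<in> boundaries G i +>\<^bsub>cobj G i\<^esub> z" for y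
  proof -
    note m = hcl_mem[OF G zc y]
    have "\<phi> i y \<ominus>\<^bsub>cobj K i\<^esub> \<phi> i z = \<phi> i (y \<ominus>\<^bsub>cobj G i\<^esub> z)"
      by (rule hom_minus[OF cobj_graded[OF G] cobj_graded[OF K] hom m(1) zc, symmetric])
    then show ?thesis using hcl_eq[OF K hom_closed[OF hom m(1)] pc] bb[OF m(3)] by simp
  qed
  moreover have "z \<in> boundaries G i +>\<^bsub>cobj G i\<^esub> z" by (rule hcl_self[OF G zc])
  ultimately show "homology_map K \<phi> i (boundaries G i +>\<^bsub>cobj G i\<^esub> z) = boundaries K i +>\<^bsub>cobj K i\<^esub> \<phi> i z"
    unfolding homology_map_def by (intro equalityI UN_least) blast+
qed

text \<open>Bijectivity on homology in terms of cycles and boundaries alone, the form in which the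
  later element chases use it.\<close>

lemma quasi_iso_iff:
  assumes G: "graded_complex R G" and K: "graded_complex R K"
  shows "quasi_iso R G K \<phi> \<longleftrightarrow> chain_map R G K \<phi> \<and>
     (\<forall>i. \<forall>z\<in>cycles G i. \<phi> i z \<in> boundaries K i \<longrightarrow> z \<in> boundaries G i) \<and>
     (\<forall>i. \<forall>u\<in>cycles K i. \<exists>z\<in>cycles G i. u \<ominus>\<^bsub>cobj K i\<^esub> \<phi> i z \<in> boundaries K i)"
proof (cases "chain_map R G K \<phi>")
  case ch: True
  have hom: "\<phi> i \<in> graded_hom R (cobj G i) (cobj K i)" for i using ch by (simp add: chain_map_def)
  have "bij_betw (homology_map K \<phi> i) (carrier (homology G i)) (carrier (homology K i)) \<longleftrightarrow>
      (\<forall>z\<in>cycles G i. \<phi> i z \<in> boundaries K i \<longrightarrow> z \<in> boundaries G i) \<and>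
      (\<forall>u\<in>cycles K i. \<exists>z\<in>cycles G i. u \<ominus>\<^bsub>cobj K i\<^esub> \<phi> i z \<in> boundaries K i)" (is "_ \<longleftrightarrow> ?I \<and> ?S") for i
  proof -
    let ?g = "\<lambda>z. boundaries G i +>\<^bsub>cobj G i\<^esub> z"
    let ?k = "\<lambda>z. boundaries K i +>\<^bsub>cobj K i\<^esub> z"
    note hm = homology_map_coset[OF G K ch]
    have cG: "z \<in> carrier (cobj G i)" if "z \<in> cycles G i" for z using that by (simp add: cycles_def)
    have cK: "z \<in> carrier (cobj K i)" if "z \<in> cycles K i" for z using that by (simp add: cycles_def)
    have e: "?k (\<phi> i z) = ?k (\<phi> i z') \<longleftrightarrow> \<phi> i (z \<ominus>\<^bsub>cobj G i\<^esub> z') \<in> boundaries K i"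
      if "z \<in> cycles G i" "z' \<in> cycles G i" for z z'
      using hcl_eq[OF K hom_closed[OF hom cG[OF that(1)]] hom_closed[OF hom cG[OF that(2)]]]
        hom_minus[OF cobj_graded[OF G] cobj_graded[OF K] hom cG[OF that(1)] cG[OF that(2)]] by simp
    have "inj_on (homology_map K \<phi> i) (?g ` cycles G i) \<longleftrightarrow>
        (\<forall>z\<in>cycles G i. \<forall>z'\<in>cycles G i. ?k (\<phi> i z) = ?k (\<phi> i z') \<longrightarrow> ?g z = ?g z')"
      by (simp add: inj_on_def hm)
    also have "\<dots> \<longleftrightarrow> (\<forall>z\<in>cycles G i. \<forall>z'\<in>cycles G i. \<phi> i (z \<ominus>\<^bsub>cobj G i\<^esub> z') \<in> boundaries K i \<longrightarrow> z \<ominus>\<^bsub>cobj G i\<^esub> z' \<in> boundaries G i)"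
      using e hcl_eq[OF G cG cG] by simp
    also have "\<dots> \<longleftrightarrow> ?I"
    proof
      assume *: "\<forall>z\<in>cycles G i. \<forall>z'\<in>cycles G i. \<phi> i (z \<ominus>\<^bsub>cobj G i\<^esub> z') \<in> boundaries K i \<longrightarrow> z \<ominus>\<^bsub>cobj G i\<^esub> z' \<in> boundaries G i"
      interpret M: graded_mod R "cobj G i" by (rule graded_modI[OF cobj_graded[OF G]])
      have z0: "\<zero>\<^bsub>cobj G i\<^esub> \<in> cycles G i" by (rule gsubmodD(2)[OF cycles_gsubmod[OF G]])
      show ?I
      proof (intro ballI impI)
        fix z assume z: "z \<in> cycles G i" "\<phi> i z \<in> boundaries K i"
        have "z \<ominus>\<^bsub>cobj G i\<^esub> \<zero>\<^bsub>cobj G i\<^esub> = z" using cG[OF z(1)] by (simp add: M.M.minus_eq)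
        then show "z \<in> boundaries G i" using *[rule_format, OF z(1) z0] z(2) by simp
      qed
    next
      assume ?I
      then show "\<forall>z\<in>cycles G i. \<forall>z'\<in>cycles G i. \<phi> i (z \<ominus>\<^bsub>cobj G i\<^esub> z') \<in> boundaries K i \<longrightarrow> z \<ominus>\<^bsub>cobj G i\<^esub> z' \<in> boundaries G i"
        using gsubmod_minus[OF cobj_graded[OF G] cycles_gsubmod[OF G]] by blast
    qed
    finally have inj: "inj_on (homology_map K \<phi> i) (carrier (homology G i)) \<longleftrightarrow> ?I" by (simp add: homology_carrier[OF G])
    have "homology_map K \<phi> i ` ?g ` cycles G i = (\<lambda>z. ?k (\<phi> i z)) ` cycles G i"
      unfolding image_image by (rule image_cong[OF refl]) (rule hm(1))
    then have "homology_map K \<phi> i ` carrier (homology G i) = carrier (homology K i) \<longleftrightarrow>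
       (\<lambda>z. ?k (\<phi> i z)) ` cycles G i = ?k ` cycles K i"
      by (simp add: homology_carrier[OF G] homology_carrier[OF K])
    also have "\<dots> \<longleftrightarrow> (\<forall>u\<in>cycles K i. \<exists>z\<in>cycles G i. ?k u = ?k (\<phi> i z))"
      using hm(2) by (auto simp: image_iff set_eq_iff)
    also have "\<dots> \<longleftrightarrow> ?S" using hcl_eq[OF K cK hom_closed[OF hom]] cG by simp
    finally show ?thesis using inj by (simp add: bij_betw_def)
  qed
  then show ?thesis using ch by (simp add: quasi_iso_def) blast
qed (simp add: quasi_iso_def)

end

section \<open>Existence of injective resolutions\<close>

context graded_ring
begin

lemma zero_module_hom: "zero_module N \<Longrightarrow> graded_module R N \<Longrightarrow> graded_module R M \<Longrightarrow> (\<lambda>_. \<zero>\<^bsub>N\<^esub>) \<in> graded_hom R M N"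
proof -
  assume "graded_module R N"
  then interpret N: graded_mod R N by (rule graded_modI)
  show ?thesis by (rule graded_homI) auto
qed

lemma zero_module_injective:
  fixes E :: "('r, 'e) gmodule"
  assumes "graded_module R E" "zero_module E"
  shows "graded_injective R E"
  unfolding graded_injective_def
proof (intro conjI allI impI)
  show "graded_module R E" by fact
  fix A B :: "('r, 'r) gmodule" and f g
  assume *: "graded_module R A" "graded_module R B" "g \<in> graded_hom R A E"
  have "g x = \<zero>\<^bsub>E\<^esub>" if "x \<in> carrier A" for x
    using hom_closed[OF *(3) that] assms(2) by (simp add: zero_module_def)
  then show "\<exists>h\<in>graded_hom R B E. \<forall>x\<in>carrier A. h (f x) = g x"
    using zero_module_hom[OF assms(2,1) *(2)] by (intro bexI[of _ "\<lambda>_. \<zero>\<^bsub>E\<^esub>"]) auto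
qed

text \<open>Keeps all terms of the resolution in one type, although each is coinduced from a quotient of
  pairs of elements of the previous term and of \<open>G\<close>.\<close>

definition encode :: "('r \<Rightarrow> ('r list \<Rightarrow> 'b) \<times> 'b) \<Rightarrow> 'r list \<Rightarrow> 'b" where
  "encode f l = (case l of [] \<Rightarrow> undefined | r # l' \<Rightarrow> (case l' of [] \<Rightarrow> snd (f r) | a # l'' \<Rightarrow> fst (f r) l''))"

lemma encode_inj: "encode f = encode g \<Longrightarrow> f = g"
proof
  fix r assume e: "encode f = encode g"
  have "snd (f r) = snd (g r)" using fun_cong[OF e, of "[r]"] by (simp add: encode_def)
  moreover have "fst (f r) l = fst (g r) l" for l using fun_cong[OF e, of "r # r # l"] by (simp add: encode_def)
  ultimately show "f r = g r" by (auto simp: prod_eq_iff)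
qed

text \<open>The quotient of the pairs by \<open>K\<close> embeds into its coinduced module;
  \<open>d\<close> and \<open>\<psi>\<close> are the restrictions to the two factors of the quotient
  map followed by this embedding, so their sum vanishes exactly on \<open>K\<close>. What remains is
  to bring the injective module back to the carrier type of \<open>U\<close>.\<close>

lemma embed_pair_quotient:
  fixes U :: "('r, 'r list \<Rightarrow> 'b) gmodule" and V :: "('r, 'b) gmodule"
  assumes k: "subfield (rgrade R 0) R" and U: "graded_module R U" and V: "graded_module R V"
    and K: "gsubmod R (prodm U V) K"
  obtains E :: "('r, 'r list \<Rightarrow> 'b) gmodule" and d \<psi> where "graded_injective R E"
    "d \<in> graded_hom R U E" "\<psi> \<in> graded_hom R V E"
    "\<forall>u\<in>carrier U. \<forall>v\<in>carrier V. d u \<oplus>\<^bsub>E\<^esub> \<psi> v = \<zero>\<^bsub>E\<^esub> \<longleftrightarrow> (u, v) \<in> K"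
proof -
  let ?N = "prodm U V"
  interpret U: graded_mod R U by (rule graded_modI) fact
  interpret V: graded_mod R V by (rule graded_modI) fact
  note N = prodm_graded(1)[OF U V]
  interpret N: graded_mod R ?N by (rule graded_modI[OF N])
  let ?Q = "gquot ?N K"
  note q = gquot_proj[OF N K]
  interpret Q: graded_mod R ?Q by (rule graded_modI[OF q(1)])
  interpret C: graded_mod R "coind ?Q" by (rule graded_modI[OF coind_graded[OF q(1)]])
  \<comment> \<open>The values of coinduced maps are cosets of pairs. Choosing representatives turns
    them into pairs, so that \<open>encode\<close> applies and no type of sets arises.\<close>
  define \<rho> where "\<rho> C = (SOME x. x \<in> C)" for C :: "(('r list \<Rightarrow> 'b) \<times> 'b) set"
  have \<rho>: "\<rho> C \<in> C" if C: "C \<in> carrier ?Q" for C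
  proof -
    obtain x where "x \<in> carrier ?N" "C = K +>\<^bsub>?N\<^esub> x" using C q(3) by auto
    then have "x \<in> C" using abelian_subgroup.a_rcos_self[OF additive_subgroup_gsubmod[OF N K]] by blast
    then show ?thesis unfolding \<rho>_def by (rule someI)
  qed
  have \<rho>i: "C = C'" if C: "C \<in> carrier ?Q" "C' \<in> carrier ?Q" and e: "\<rho> C = \<rho> C'" for C C'
  proof -
    have "C = K +>\<^bsub>?N\<^esub> \<rho> C" if C: "C \<in> carrier ?Q" for C
    proof -
      obtain x where x: "x \<in> carrier ?N" "C = K +>\<^bsub>?N\<^esub> x" using C q(3) by auto
      then show ?thesis using N.M.a_repr_independence[OF _ x(1), of "\<rho> C" K] \<rho>[OF C]
          abelian_subgroup.axioms(1)[OF additive_subgroup_gsubmod[OF N K]]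
        by (metis additive_subgroup.a_subgroup)
    qed
    then show ?thesis using C e by metis
  qed
  let ?p = "\<lambda>t. encode (\<lambda>r. \<rho> (t r))"
  have inj: "inj_on ?p (carrier (coind ?Q))"
  proof (rule inj_onI)
    fix t t' assume t: "t \<in> carrier (coind ?Q)" "t' \<in> carrier (coind ?Q)" "?p t = ?p t'"
    have c: "s r \<in> carrier ?Q" if "s \<in> carrier (coind ?Q)" for s r
      using linmapsD(1,4)[OF coind_carrier[OF q(1) that], of r] by (cases "r \<in> carrier R") auto
    have "(\<lambda>r. \<rho> (t r)) = (\<lambda>r. \<rho> (t' r))" by (rule encode_inj[OF t(3)])
    then show "t = t'" using \<rho>i[OF c[OF t(1)] c[OF t(2)]] by (auto simp: fun_eq_iff)
  qed
  let ?E = "imagem ?p (coind ?Q)"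
  have injC: "graded_injective R (coind ?Q)"
    unfolding graded_injective_def
  proof (intro conjI allI impI)
    show "graded_module R (coind ?Q)" by (rule coind_graded[OF q(1)])
    fix A B :: "('r, 'r) gmodule" and f g
    assume *: "graded_module R A" "graded_module R B" "f \<in> graded_hom R A B" "inj_on f (carrier A)"
      "g \<in> graded_hom R A (coind ?Q)"
    show "\<exists>h\<in>graded_hom R B (coind ?Q). \<forall>x\<in>carrier A. h (f x) = g x"
      by (rule coind_injective[OF k q(1) *]) blast
  qed
  note im = imagem_graded[OF coind_graded[OF q(1)] inj]
  interpret E: graded_mod R ?E by (rule graded_modI[OF im(1)])
  let ?e = "\<lambda>x r. if r \<in> carrier R then r \<odot>\<^bsub>?Q\<^esub> x else \<zero>\<^bsub>?Q\<^esub>"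
  note em = coind_embed[OF q(1)]
  let ?h = "\<lambda>x. ?p (?e (K +>\<^bsub>?N\<^esub> x))"
  have h: "?h \<in> graded_hom R ?N ?E"
    by (rule hom_compose[OF hom_compose[OF q(2) em(1)] im(2)])
  have h0: "?h x = \<zero>\<^bsub>?E\<^esub> \<longleftrightarrow> x \<in> K" if x: "x \<in> carrier ?N" for x
  proof -
    have c: "K +>\<^bsub>?N\<^esub> y \<in> carrier ?Q" if "y \<in> carrier ?N" for y using that q(3) by blast
    have "?h x = \<zero>\<^bsub>?E\<^esub> \<longleftrightarrow> ?h x = ?h \<zero>\<^bsub>?N\<^esub>" using hom_zero[OF N im(1) h] by metis
    also have "\<dots> \<longleftrightarrow> ?e (K +>\<^bsub>?N\<^esub> x) = ?e (K +>\<^bsub>?N\<^esub> \<zero>\<^bsub>?N\<^esub>)"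
      by (rule inj_on_eq_iff[OF inj hom_closed[OF em(1) c[OF x]] hom_closed[OF em(1) c[OF N.M.zero_closed]]])
    also have "\<dots> \<longleftrightarrow> K +>\<^bsub>?N\<^esub> x = K +>\<^bsub>?N\<^esub> \<zero>\<^bsub>?N\<^esub>"
      by (rule inj_on_eq_iff[OF em(2) c[OF x] c[OF N.M.zero_closed]])
    also have "\<dots> \<longleftrightarrow> x \<ominus>\<^bsub>?N\<^esub> \<zero>\<^bsub>?N\<^esub> \<in> K" by (rule coset_eq_iff[OF N K x N.M.zero_closed])
    also have "x \<ominus>\<^bsub>?N\<^esub> \<zero>\<^bsub>?N\<^esub> = x" unfolding N.M.minus_eq N.M.inv_zero using x by (rule N.M.r_zero)
    finally show ?thesis .
  qed
  have i1: "(\<lambda>u. (u, \<zero>\<^bsub>V\<^esub>)) \<in> graded_hom R U ?N" by (rule graded_homI) auto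
  have i2: "(\<lambda>v. (\<zero>\<^bsub>U\<^esub>, v)) \<in> graded_hom R V ?N" by (rule graded_homI) auto
  show ?thesis
  proof (rule that[of ?E "\<lambda>u. ?h (u, \<zero>\<^bsub>V\<^esub>)" "\<lambda>v. ?h (\<zero>\<^bsub>U\<^esub>, v)"])
    show "graded_injective R ?E" by (rule imagem_injective[OF injC inj])
    show "(\<lambda>u. ?h (u, \<zero>\<^bsub>V\<^esub>)) \<in> graded_hom R U ?E" by (rule hom_compose[OF i1 h])
    show "(\<lambda>v. ?h (\<zero>\<^bsub>U\<^esub>, v)) \<in> graded_hom R V ?E" by (rule hom_compose[OF i2 h])
    show "\<forall>u\<in>carrier U. \<forall>v\<in>carrier V. ?h (u, \<zero>\<^bsub>V\<^esub>) \<oplus>\<^bsub>?E\<^esub> ?h (\<zero>\<^bsub>U\<^esub>, v) = \<zero>\<^bsub>?E\<^esub> \<longleftrightarrow> (u, v) \<in> K"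
    proof (intro ballI)
    fix u v assume uv: "u \<in> carrier U" "v \<in> carrier V"
    have "?h (u, \<zero>\<^bsub>V\<^esub>) \<oplus>\<^bsub>?E\<^esub> ?h (\<zero>\<^bsub>U\<^esub>, v) = ?h ((u, \<zero>\<^bsub>V\<^esub>) \<oplus>\<^bsub>?N\<^esub> (\<zero>\<^bsub>U\<^esub>, v))"
      using uv by (intro hom_add[OF h, symmetric]) auto
    also have "(u, \<zero>\<^bsub>V\<^esub>) \<oplus>\<^bsub>?N\<^esub> (\<zero>\<^bsub>U\<^esub>, v) = (u, v)" using uv by simp
    finally show "?h (u, \<zero>\<^bsub>V\<^esub>) \<oplus>\<^bsub>?E\<^esub> ?h (\<zero>\<^bsub>U\<^esub>, v) = \<zero>\<^bsub>?E\<^esub> \<longleftrightarrow> (u, v) \<in> K"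
      using h0[of "(u, v)"] uv by simp
    qed
  qed
qed

text \<open>The terms are built downwards from degree \<open>b + 1\<close>. Given a term
  \<open>U\<close>, a map \<open>\<psi>\<close> into it from the term of \<open>G\<close> in the
  same degree and the boundaries \<open>B\<close> arriving from above, the next term contains the
  pairs \<open>(u, v)\<close> modulo all \<open>(y + \<psi> x, - d x)\<close> with \<open>y\<close>
  in \<open>B\<close>: the pushout of \<open>U\<close> modulo \<open>B\<close> and of the next term
  of \<open>G\<close>. This one equivalence contains the chain map property, \<open>d d = 0\<close>,
  and injectivity and surjectivity on homology.\<close>

theorem injective_resolution_exists:
  fixes G :: "('r, 'b) gcomplex"
  assumes k: "subfield (rgrade R 0) R" and G: "graded_complex R G"
    and b: "\<And>i. b < i \<Longrightarrow> zero_module (homology G i)"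
  shows "\<exists>I :: ('r, 'r list \<Rightarrow> 'b) gcomplex. injective_resolution R G I"
proof -
  \<comment> \<open>The construction starts in degree \<open>b + 1\<close>, above all homology of
    \<open>G\<close>, where the zero module may stand.\<close>
  define deg where "deg n = b + 1 - int n" for n
  note cg = cobj_graded[OF G]
  \<comment> \<open>A zero module with carrier in the type of the resolution, cut out of a copy of a
    term of \<open>G\<close>.\<close>
  define Z where "Z = (let E = imagem (\<lambda>x (l :: 'r list). x) (cobj G 0) in gsub E {\<zero>\<^bsub>E\<^esub>})"
  have gE: "graded_module R (imagem (\<lambda>x (l :: 'r list). x) (cobj G 0))"
    by (rule imagem_graded[OF cg]) (auto simp: inj_on_def fun_eq_iff)
  have gZ: "graded_module R Z" unfolding Z_def Let_def by (rule gsub_graded[OF gE gsubmod_zero[OF gE]])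
  have zZ: "zero_module Z" by (simp add: zero_module_def Z_def Let_def)
  let ?St = "\<lambda>n (U :: ('r, 'r list \<Rightarrow> 'b) gmodule, \<psi>, B). graded_injective R U \<and>
     \<psi> \<in> graded_hom R (cobj G (deg n)) U \<and> gsubmod R U B \<and> (n = 0 \<longrightarrow> zero_module U \<and> (\<forall>x. \<psi> x = \<zero>\<^bsub>U\<^esub>))"
  \<comment> \<open>\<open>B'\<close> records the image of \<open>d\<close>, since these boundaries
    are divided out in the following step.\<close>
  let ?Nx = "\<lambda>n (U :: ('r, 'r list \<Rightarrow> 'b) gmodule, \<psi>, B) (U', \<psi>', B'). \<exists>d\<in>graded_hom R U U'. B' = d ` carrier U \<and>
     (\<forall>u\<in>carrier U. \<forall>v\<in>carrier (cobj G (deg (Suc n))). d u \<oplus>\<^bsub>U'\<^esub> \<psi>' v = \<zero>\<^bsub>U'\<^esub> \<longleftrightarrow>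
       (\<exists>y\<in>B. \<exists>x\<in>carrier (cobj G (deg n)). u = y \<oplus>\<^bsub>U\<^esub> \<psi> x \<and> v = \<ominus>\<^bsub>cobj G (deg (Suc n))\<^esub> cdiff G (deg n) x))"
  have "\<exists>f. \<forall>n. ?St n (f n) \<and> ?Nx n (f n) (f (Suc n))"
  proof (rule dependent_nat_choice)
    show "\<exists>x. ?St 0 x"
      using zero_module_injective[OF gZ zZ] zero_module_hom[OF zZ gZ cg] gsubmod_zero[OF gZ] zZ
      by (intro exI[of _ "(Z, \<lambda>_. \<zero>\<^bsub>Z\<^esub>, {\<zero>\<^bsub>Z\<^esub>})"]) auto
  next
    fix s n assume st: "?St n s"
    obtain U \<psi> B where s: "s = (U, \<psi>, B)" by (cases s) auto
    have U: "graded_injective R U" "\<psi> \<in> graded_hom R (cobj G (deg n)) U" "gsubmod R U B"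
      using st s by auto
    have gU: "graded_module R U" using U(1) by (simp add: graded_injective_def)
    have dS: "deg (Suc n) = deg n - 1" by (simp add: deg_def)
    let ?V = "cobj G (deg (Suc n))" and ?W = "cobj G (deg n)"
    have d: "cdiff G (deg n) \<in> graded_hom R ?W ?V" unfolding dS by (rule cdiff_hom[OF G])
    interpret U: graded_mod R U by (rule graded_modI[OF gU])
    interpret V: graded_mod R ?V by (rule graded_modI[OF cg])
    interpret W: graded_mod R ?W by (rule graded_modI[OF cg])
    note BD = gsubmodD[OF U(3)]
    let ?P = "prodm (gsub U B) ?W"
    let ?F = "\<lambda>p. (fst p \<oplus>\<^bsub>U\<^esub> \<psi> (snd p), \<ominus>\<^bsub>?V\<^esub> cdiff G (deg n) (snd p))"
    have gB: "graded_module R (gsub U B)" by (rule gsub_graded[OF gU U(3)])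
    have "?F \<in> graded_hom R ?P (prodm U ?V)"
    proof (rule graded_homI)
      show "?F x \<in> carrier (prodm U ?V)" if "x \<in> carrier ?P" for x
        using that BD(6) hom_closed[OF U(2)] hom_closed[OF d] by auto
      show "?F x \<in> grade (prodm U ?V) j" if "x \<in> grade ?P j" for x j
        using that hom_grade[OF U(2)] hom_grade[OF d] by (auto intro: U.D_add V.D_inv)
      show "?F (x \<oplus>\<^bsub>?P\<^esub> y) = ?F x \<oplus>\<^bsub>prodm U ?V\<^esub> ?F y" if "x \<in> carrier ?P" "y \<in> carrier ?P" for x y
        using that BD(6) hom_closed[OF U(2)] hom_closed[OF d]
        by (auto simp: hom_add[OF U(2)] hom_add[OF d] U.M.a_ac V.M.minus_add)
      show "?F (r \<odot>\<^bsub>?P\<^esub> x) = r \<odot>\<^bsub>prodm U ?V\<^esub> ?F x" if "r \<in> carrier R" "x \<in> carrier ?P" for r x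
        using that BD(6) hom_closed[OF U(2)] hom_closed[OF d]
        by (auto simp: hom_smult[OF U(2)] hom_smult[OF d] U.smult_r_distr V.smult_r_minus)
    qed
    from gsubmod_image[OF prodm_graded(1)[OF gB cg] prodm_graded(1)[OF gU cg] this gsubmod_carrier[OF prodm_graded(1)[OF gB cg]]]
    have K: "gsubmod R (prodm U ?V) (?F ` carrier ?P)" .
    obtain E :: "('r, 'r list \<Rightarrow> 'b) gmodule" and d' \<psi>' where E: "graded_injective R E" "d' \<in> graded_hom R U E" "\<psi>' \<in> graded_hom R ?V E"
      "\<forall>u\<in>carrier U. \<forall>v\<in>carrier ?V. d' u \<oplus>\<^bsub>E\<^esub> \<psi>' v = \<zero>\<^bsub>E\<^esub> \<longleftrightarrow> (u, v) \<in> ?F ` carrier ?P"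
      by (rule embed_pair_quotient[OF k gU cg K])
    have gE: "graded_module R E" using E(1) by (simp add: graded_injective_def)
    have mem: "(u, v) \<in> ?F ` carrier ?P \<longleftrightarrow> (\<exists>y\<in>B. \<exists>x\<in>carrier ?W. u = y \<oplus>\<^bsub>U\<^esub> \<psi> x \<and> v = \<ominus>\<^bsub>?V\<^esub> cdiff G (deg n) x)" for u v
      by (auto simp: image_iff)
    have "?Nx n s (E, \<psi>', d' ` carrier U)"
      unfolding s prod.case
    proof (intro bexI[of _ d'] conjI ballI)
      fix u v assume "u \<in> carrier U" "v \<in> carrier ?V"
      then show "d' u \<oplus>\<^bsub>E\<^esub> \<psi>' v = \<zero>\<^bsub>E\<^esub> \<longleftrightarrow> (\<exists>y\<in>B. \<exists>x\<in>carrier ?W. u = y \<oplus>\<^bsub>U\<^esub> \<psi> x \<and> v = \<ominus>\<^bsub>?V\<^esub> cdiff G (deg n) x)"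
        using E(4)[rule_format, of u v] mem[of u v] by blast
    qed (use E(2) in auto)
    moreover have "?St (Suc n) (E, \<psi>', d' ` carrier U)"
      unfolding prod.case
      using E(1,3) gsubmod_image[OF gU gE E(2) gsubmod_carrier[OF gU]] by blast
    ultimately show "\<exists>y. ?St (Suc n) y \<and> ?Nx n s y" by blast
  qed
  then obtain f where ff: "\<forall>n. ?St n (f n) \<and> ?Nx n (f n) (f (Suc n))" by (rule exE)
  have f1: "?St n (f n)" for n by (rule conjunct1[OF spec[OF ff]])
  have f2: "?Nx n (f n) (f (Suc n))" for n by (rule conjunct2[OF spec[OF ff]])
  define U where "U n = fst (f n)" for n
  define \<psi> where "\<psi> n = fst (snd (f n))" for n
  define B where "B n = snd (snd (f n))" for n
  have fe: "f n = (U n, \<psi> n, B n)" for n by (simp add: U_def \<psi>_def B_def)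
  have S: "graded_injective R (U n)" "\<psi> n \<in> graded_hom R (cobj G (deg n)) (U n)" "gsubmod R (U n) (B n)"
    "n = 0 \<Longrightarrow> zero_module (U n)" "n = 0 \<Longrightarrow> \<psi> n x = \<zero>\<^bsub>U n\<^esub>" for n x
    using f1[of n] unfolding fe prod.case by blast+
  have gU: "graded_module R (U n)" for n using S(1)[of n] by (simp add: graded_injective_def)
  have nx: "\<exists>d. d \<in> graded_hom R (U n) (U (Suc n)) \<and> B (Suc n) = d ` carrier (U n) \<and>
     (\<forall>u\<in>carrier (U n). \<forall>v\<in>carrier (cobj G (deg (Suc n))). d u \<oplus>\<^bsub>U (Suc n)\<^esub> \<psi> (Suc n) v = \<zero>\<^bsub>U (Suc n)\<^esub> \<longleftrightarrow>
       (\<exists>y\<in>B n. \<exists>x\<in>carrier (cobj G (deg n)). u = y \<oplus>\<^bsub>U n\<^esub> \<psi> n x \<and> v = \<ominus>\<^bsub>cobj G (deg (Suc n))\<^esub> cdiff G (deg n) x))" for n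
    using f2[of n] unfolding fe prod.case by (elim bexE conjE) (intro exI conjI)
  then obtain d where d: "\<And>n. d n \<in> graded_hom R (U n) (U (Suc n))" "\<And>n. B (Suc n) = d n ` carrier (U n)"
    "\<And>n u v. u \<in> carrier (U n) \<Longrightarrow> v \<in> carrier (cobj G (deg (Suc n))) \<Longrightarrow>
       d n u \<oplus>\<^bsub>U (Suc n)\<^esub> \<psi> (Suc n) v = \<zero>\<^bsub>U (Suc n)\<^esub> \<longleftrightarrow>
       (\<exists>y\<in>B n. \<exists>x\<in>carrier (cobj G (deg n)). u = y \<oplus>\<^bsub>U n\<^esub> \<psi> n x \<and> v = \<ominus>\<^bsub>cobj G (deg (Suc n))\<^esub> cdiff G (deg n) x)"
  proof -
    assume that: "\<And>d. (\<And>n. d n \<in> graded_hom R (U n) (U (Suc n))) \<Longrightarrow> (\<And>n. B (Suc n) = d n ` carrier (U n)) \<Longrightarrow>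
      (\<And>n u v. u \<in> carrier (U n) \<Longrightarrow> v \<in> carrier (cobj G (deg (Suc n))) \<Longrightarrow>
       d n u \<oplus>\<^bsub>U (Suc n)\<^esub> \<psi> (Suc n) v = \<zero>\<^bsub>U (Suc n)\<^esub> \<longleftrightarrow>
       (\<exists>y\<in>B n. \<exists>x\<in>carrier (cobj G (deg n)). u = y \<oplus>\<^bsub>U n\<^esub> \<psi> n x \<and> v = \<ominus>\<^bsub>cobj G (deg (Suc n))\<^esub> cdiff G (deg n) x)) \<Longrightarrow> thesis"
    obtain d where d: "\<forall>n. d n \<in> graded_hom R (U n) (U (Suc n)) \<and> B (Suc n) = d n ` carrier (U n) \<and>
     (\<forall>u\<in>carrier (U n). \<forall>v\<in>carrier (cobj G (deg (Suc n))). d n u \<oplus>\<^bsub>U (Suc n)\<^esub> \<psi> (Suc n) v = \<zero>\<^bsub>U (Suc n)\<^esub> \<longleftrightarrow>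
       (\<exists>y\<in>B n. \<exists>x\<in>carrier (cobj G (deg n)). u = y \<oplus>\<^bsub>U n\<^esub> \<psi> n x \<and> v = \<ominus>\<^bsub>cobj G (deg (Suc n))\<^esub> cdiff G (deg n) x))"
      using choice[OF allI[OF nx]] by (rule exE)
    show thesis by (rule that[of d]) (use d in \<open>simp_all only: simp_thms\<close>)
  qed
  \<comment> \<open>\<open>nat\<close> gives index \<open>0\<close>, hence the zero module, in all
    degrees from \<open>b + 1\<close> on.\<close>
  define ix where "ix i = nat (b + 1 - i)" for i
  define I where "I = \<lparr>cobj = (\<lambda>i. U (ix i)), cdiff = (\<lambda>i. if i \<le> b + 1 then d (ix i) else (\<lambda>_. \<zero>\<^bsub>U 0\<^esub>))\<rparr>"
  define \<phi> where "\<phi> i = \<psi> (ix i)" for i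
  have ix1: "deg (ix i) = i" "ix (i - 1) = Suc (ix i)" if "i \<le> b + 1" for i
    using that by (auto simp: deg_def ix_def)
  have ix0: "ix i = 0" if "b + 1 \<le> i" for i using that by (simp add: ix_def)
  have z0: "\<zero>\<^bsub>cobj G i\<^esub> \<in> carrier (cobj G i)" for i
    using gsubmodD(2)[OF gsubmod_carrier[OF cg]] .
  have zU: "\<zero>\<^bsub>U i\<^esub> \<in> carrier (U i)" for i
    using gsubmodD(2)[OF gsubmod_carrier[OF gU]] .
  have hom\<phi>: "\<phi> i \<in> graded_hom R (cobj G i) (U (ix i))" for i
  proof (cases "i \<le> b + 1")
    case True then show ?thesis using S(2)[of "ix i"] ix1 by (simp add: \<phi>_def)
  next
    case False
    then have e: "\<phi> i = (\<lambda>_. \<zero>\<^bsub>U 0\<^esub>)" "ix i = 0" using S(5)[of 0] ix0[of i] by (auto simp: \<phi>_def)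
    show ?thesis unfolding e by (rule zero_module_hom[OF S(4)[OF refl] gU cg])
  qed
  have homd: "cdiff I i \<in> graded_hom R (U (ix i)) (U (ix (i - 1)))" for i
  proof (cases "i \<le> b + 1")
    case True then show ?thesis using d(1) ix1 by (simp add: I_def)
  next
    case False
    then have "ix i = 0" "ix (i - 1) = 0" using ix0 by auto
    then show ?thesis using False zero_module_hom[OF S(4)[OF refl] gU gU] by (simp add: I_def)
  qed
  have star: "d (ix i) u \<oplus>\<^bsub>U (ix (i - 1))\<^esub> \<phi> (i - 1) v = \<zero>\<^bsub>U (ix (i - 1))\<^esub> \<longleftrightarrow>
       (\<exists>y\<in>B (ix i). \<exists>x\<in>carrier (cobj G i). u = y \<oplus>\<^bsub>U (ix i)\<^esub> \<phi> i x \<and> v = \<ominus>\<^bsub>cobj G (i - 1)\<^esub> cdiff G i x)"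
    if "i \<le> b + 1" "u \<in> carrier (U (ix i))" "v \<in> carrier (cobj G (i - 1))" for i u v
  proof -
    have "deg (Suc (ix i)) = i - 1" using that(1) by (auto simp: deg_def ix_def)
    then show ?thesis using d(3)[of u "ix i" v] that ix1[OF that(1)] by (simp add: \<phi>_def)
  qed
  have Bd: "B (ix i) = d (ix (i + 1)) ` carrier (U (ix (i + 1)))" if "i \<le> b" for i
  proof -
    have "ix i = Suc (ix (i + 1))" using that by (auto simp: ix_def)
    then show ?thesis using d(2) by simp
  qed
  have \<phi>0: "\<phi> i \<zero>\<^bsub>cobj G i\<^esub> = \<zero>\<^bsub>U (ix i)\<^esub>" for i by (rule hom_zero[OF cg gU hom\<phi>])
  have ch: "\<phi> (i - 1) (cdiff G i x) = cdiff I i (\<phi> i x)" if x: "x \<in> carrier (cobj G i)" for x i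
  proof (cases "i \<le> b + 1")
    case True
    interpret V: graded_mod R "cobj G (i - 1)" by (rule graded_modI[OF cg])
    interpret W: graded_mod R "U (ix (i - 1))" by (rule graded_modI[OF gU])
    interpret W': graded_mod R "U (ix i)" by (rule graded_modI[OF gU])
    have dx: "cdiff G i x \<in> carrier (cobj G (i - 1))" by (rule hom_closed[OF cdiff_hom[OF G] x])
    have px: "\<phi> i x \<in> carrier (U (ix i))" by (rule hom_closed[OF hom\<phi> x])
    \<comment> \<open>The instance of the defining equivalence with \<open>y\<close> zero.\<close>
    have "d (ix i) (\<phi> i x) \<oplus>\<^bsub>U (ix (i - 1))\<^esub> \<phi> (i - 1) (\<ominus>\<^bsub>cobj G (i - 1)\<^esub> cdiff G i x) = \<zero>\<^bsub>U (ix (i - 1))\<^esub>"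
      using star[OF True px V.M.a_inv_closed[OF dx]] gsubmodD(2)[OF S(3)] x px
      by (auto intro!: bexI[of _ "\<zero>\<^bsub>U (ix i)\<^esub>"] bexI[of _ x])
    then have "d (ix i) (\<phi> i x) \<ominus>\<^bsub>U (ix (i - 1))\<^esub> \<phi> (i - 1) (cdiff G i x) = \<zero>\<^bsub>U (ix (i - 1))\<^esub>"
      using hom_inv[OF cg gU hom\<phi> dx] by (simp add: W.M.minus_eq)
    moreover have "d (ix i) (\<phi> i x) \<in> carrier (U (ix (i - 1)))"
      using hom_closed[OF homd[of i] px] True by (simp add: I_def)
    ultimately have "d (ix i) (\<phi> i x) = \<phi> (i - 1) (cdiff G i x)"
      using W.M.minus_zero_iff hom_closed[OF hom\<phi> dx] by blast
    then show ?thesis using True by (simp add: I_def)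
  next
    case False
    then show ?thesis using S(5)[of 0] ix0[of "i - 1"] by (simp add: I_def \<phi>_def)
  qed
  have dd: "cdiff I (i - 1) (cdiff I i u) = \<zero>\<^bsub>U (ix (i - 2))\<^esub>" if u: "u \<in> carrier (U (ix i))" for u i
  proof (cases "i \<le> b + 1")
    case True
    let ?u = "d (ix i) u"
    interpret W: graded_mod R "U (ix (i - 1))" by (rule graded_modI[OF gU])
    interpret W': graded_mod R "U (ix (i - 2))" by (rule graded_modI[OF gU])
    interpret V: graded_mod R "cobj G (i - 2)" by (rule graded_modI[OF cg])
    have uc: "?u \<in> carrier (U (ix (i - 1)))" using hom_closed[OF homd[of i] u] True by (simp add: I_def)
    have uB: "?u \<in> B (ix (i - 1))" using Bd[of "i - 1"] True u by simp
    have c0: "cdiff G (i - 1) \<zero>\<^bsub>cobj G (i - 1)\<^esub> = \<zero>\<^bsub>cobj G (i - 1 - 1)\<^esub>"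
      by (rule hom_zero[OF cg cg cdiff_hom[OF G]])
    \<comment> \<open>The instance of the defining equivalence with \<open>x\<close> zero.\<close>
    have "d (ix (i - 1)) ?u \<oplus>\<^bsub>U (ix (i - 1 - 1))\<^esub> \<phi> (i - 1 - 1) \<zero>\<^bsub>cobj G (i - 1 - 1)\<^esub> = \<zero>\<^bsub>U (ix (i - 1 - 1))\<^esub>"
    proof (subst star[of "i - 1" ?u])
      show "\<exists>y\<in>B (ix (i - 1)). \<exists>x\<in>carrier (cobj G (i - 1)). ?u = y \<oplus>\<^bsub>U (ix (i - 1))\<^esub> \<phi> (i - 1) x \<and>
          \<zero>\<^bsub>cobj G (i - 1 - 1)\<^esub> = \<ominus>\<^bsub>cobj G (i - 1 - 1)\<^esub> cdiff G (i - 1) x"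
        using uB uc z0[of "i - 1"] \<phi>0[of "i - 1"] c0
        by (intro bexI[of _ ?u] bexI[of _ "\<zero>\<^bsub>cobj G (i - 1)\<^esub>"]) auto
    qed (use True uc z0 in auto)
    then have "d (ix (i - 1)) ?u = \<zero>\<^bsub>U (ix (i - 1 - 1))\<^esub>"
      using \<phi>0[of "i - 1 - 1"] hom_closed[OF homd[of "i - 1"] uc] True by (simp add: I_def)
    then show ?thesis using True by (simp add: I_def)
  next
    case False
    then have *: "ix (i - 1) = 0" "ix i = 0" "\<And>x. cdiff I i x = \<zero>\<^bsub>U 0\<^esub>" using ix0 by (auto simp: I_def)
    show ?thesis using hom_zero[OF gU gU homd[of "i - 1"]] * by simp
  qed
  have GI: "graded_complex R I"
    unfolding graded_complex_def using gU homd dd by (simp add: I_def)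
  have cI: "cobj I i = U (ix i)" for i by (simp add: I_def)
  have cm: "chain_map R G I \<phi>" unfolding chain_map_def using hom\<phi> ch by (simp add: cI)
  have bG: "cycles G i \<subseteq> boundaries G i" if "b < i" for i
    using b[OF that] zero_homology_iff[OF G] by simp
  have "quasi_iso R G I \<phi>"
    unfolding quasi_iso_iff[OF G GI]
  proof (intro conjI allI ballI impI)
    show "chain_map R G I \<phi>" by (rule cm)
  next
    fix i z assume z: "z \<in> cycles G i" "\<phi> i z \<in> boundaries I i"
    show "z \<in> boundaries G i"
    proof (cases "b < i")
      case True then show ?thesis using bG z by blast
    next
      case False
      then have le: "i + 1 \<le> b + 1" by simp
      have zc: "z \<in> carrier (cobj G i)" using z(1) by (simp add: cycles_def)
      obtain u where u: "u \<in> carrier (U (ix (i + 1)))" "\<phi> i z = d (ix (i + 1)) u"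
        using z(2) le by (auto simp: boundaries_def I_def)
      interpret W: graded_mod R "U (ix (i + 1))" by (rule graded_modI[OF gU])
      interpret W': graded_mod R "U (ix i)" by (rule graded_modI[OF gU])
      interpret V: graded_mod R "cobj G (i + 1)" by (rule graded_modI[OF cg])
      interpret V': graded_mod R "cobj G i" by (rule graded_modI[OF cg])
      have hd: "d (ix (i + 1)) \<in> graded_hom R (U (ix (i + 1))) (U (ix i))"
        using homd[of "i + 1"] le by (simp add: I_def)
      \<comment> \<open>The pair formed by \<open>- u\<close> and \<open>z\<close> satisfies the
        equivalence, which exhibits \<open>z\<close> as minus a boundary of
        \<open>G\<close>.\<close>
      have "d (ix (i + 1)) (\<ominus>\<^bsub>U (ix (i + 1))\<^esub> u) \<oplus>\<^bsub>U (ix i)\<^esub> \<phi> i z = \<zero>\<^bsub>U (ix i)\<^esub>"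
        using hom_inv[OF gU gU hd u(1)] hom_closed[OF hd u(1)] u(2) by (simp add: W'.M.l_neg)
      then obtain x where x: "x \<in> carrier (cobj G (i + 1))" "z = \<ominus>\<^bsub>cobj G i\<^esub> cdiff G (i + 1) x"
        using star[OF le W.M.a_inv_closed[OF u(1)], of z] zc by auto
      then have "z = cdiff G (i + 1) (\<ominus>\<^bsub>cobj G (i + 1)\<^esub> x)" using hom_inv[OF cg cg cdiff_hom'[OF G] x(1)] by simp
      then show ?thesis using x(1) by (auto simp: boundaries_def)
    qed
  next
    fix i u assume u: "u \<in> cycles I i"
    interpret W: graded_mod R "U (ix i)" by (rule graded_modI[OF gU])
    interpret V: graded_mod R "cobj G i" by (rule graded_modI[OF cg])
    interpret V': graded_mod R "cobj G (i - 1)" by (rule graded_modI[OF cg])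
    have uc: "u \<in> carrier (U (ix i))" and du: "cdiff I i u = \<zero>\<^bsub>U (ix (i - 1))\<^esub>"
      using u by (auto simp: cycles_def cI)
    show "\<exists>z\<in>cycles G i. u \<ominus>\<^bsub>cobj I i\<^esub> \<phi> i z \<in> boundaries I i"
    proof (cases "b < i")
      case True
      have "u = \<zero>\<^bsub>U (ix i)\<^esub>" using S(4)[of "ix i"] ix0[of i] True uc by (simp add: zero_module_def)
      then have "u \<ominus>\<^bsub>cobj I i\<^esub> \<phi> i \<zero>\<^bsub>cobj G i\<^esub> = \<zero>\<^bsub>cobj I i\<^esub>" using \<phi>0 by (simp add: cI W.M.minus_eq)
      then show ?thesis using gsubmodD(2)[OF cycles_gsubmod[OF G]] gsubmodD(2)[OF boundaries_gsubmod[OF GI]] by metis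
    next
      case False
      then have le: "i \<le> b + 1" by simp
      \<comment> \<open>With zero as second entry the equivalence writes \<open>u\<close> as a
        boundary plus the image of a cycle of \<open>G\<close>.\<close>
      have "d (ix i) u \<oplus>\<^bsub>U (ix (i - 1))\<^esub> \<phi> (i - 1) \<zero>\<^bsub>cobj G (i - 1)\<^esub> = \<zero>\<^bsub>U (ix (i - 1))\<^esub>"
        using du \<phi>0[of "i - 1"] le zU gU[of "ix (i - 1)"]
        by (simp add: I_def abelian_monoid.l_zero module_def graded_module_def abelian_group_def)
      then obtain y x where yx: "y \<in> B (ix i)" "x \<in> carrier (cobj G i)" "u = y \<oplus>\<^bsub>U (ix i)\<^esub> \<phi> i x"
        "\<zero>\<^bsub>cobj G (i - 1)\<^esub> = \<ominus>\<^bsub>cobj G (i - 1)\<^esub> cdiff G i x"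
        using star[OF le uc z0] by auto
      have "cdiff G i x = \<zero>\<^bsub>cobj G (i - 1)\<^esub>"
        using yx(4) hom_closed[OF cdiff_hom[OF G] yx(2)] by (metis V'.M.inv_zero V'.M.minus_minus)
      then have xc: "x \<in> cycles G i" using yx(2) by (simp add: cycles_def)
      have yb: "y \<in> boundaries I i" using yx(1) Bd[of i] False by (simp add: boundaries_def I_def)
      then have yc: "y \<in> carrier (U (ix i))" using gsubmodD(6)[OF boundaries_gsubmod[OF GI]] cI by metis
      have "u \<ominus>\<^bsub>U (ix i)\<^esub> \<phi> i x = y"
        using yx(3) yc hom_closed[OF hom\<phi> yx(2)] by (simp add: W.M.minus_eq W.M.a_assoc W.M.r_neg)
      then show ?thesis using yb xc by (auto simp: cI)
    qed
  qed
  moreover have "zero_module (cobj I i)" if "i > b + 1" for i using S(4)[of 0] ix0[of i] that by (simp add: cI)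
  ultimately have "injective_resolution R G I"
    unfolding injective_resolution_def using GI S(1) by (auto simp: cI)
  then show ?thesis by blast
qed

end

section \<open>Hilbert's basis theorem\<close>

text \<open>Rings are represented as subsets of the ambient ring, so that generators can be adjoined
  one after the other without a change of type.\<close>

definition (in cring) sub_ring :: "'a set \<Rightarrow> bool" where
  "sub_ring A \<longleftrightarrow> A \<subseteq> carrier R \<and> \<zero> \<in> A \<and> \<one> \<in> A \<and> (\<forall>x\<in>A. \<forall>y\<in>A. x \<oplus> y \<in> A \<and> x \<otimes> y \<in> A) \<and> (\<forall>x\<in>A. \<ominus> x \<in> A)"

definition (in cring) ideal_in :: "'a set \<Rightarrow> 'a set \<Rightarrow> bool" where
  "ideal_in A I \<longleftrightarrow> I \<subseteq> A \<and> \<zero> \<in> I \<and> (\<forall>x\<in>I. \<forall>y\<in>I. x \<oplus> y \<in> I) \<and> (\<forall>a\<in>A. \<forall>x\<in>I. a \<otimes> x \<in> I)"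

definition (in cring) noeth :: "'a set \<Rightarrow> bool" where
  "noeth A \<longleftrightarrow> (\<forall>J :: nat \<Rightarrow> 'a set. (\<forall>n. ideal_in A (J n)) \<longrightarrow> (\<forall>n. J n \<subseteq> J (Suc n)) \<longrightarrow> (\<exists>N. \<forall>n\<ge>N. J n = J N))"

text \<open>Values at \<open>x\<close> of polynomials of degree less than \<open>n\<close> over
  \<open>A\<close>. Coefficients need not be unique; Hilbert's argument works with any
  representation.\<close>

primrec (in cring) polys :: "'a set \<Rightarrow> 'a \<Rightarrow> nat \<Rightarrow> 'a set" where
  "polys A x 0 = {\<zero>}"
| "polys A x (Suc n) = {f \<oplus> a \<otimes> x [^] n | f a. f \<in> polys A x n \<and> a \<in> A}"

context cring
begin

lemma noethD:
  assumes "noeth A" "\<And>n. ideal_in A (J n)" "\<And>n. J n \<subseteq> J (Suc n)"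
  shows "\<exists>N. \<forall>n\<ge>N. J n = J N"
  using assms unfolding noeth_def by blast

context
  fixes A x
  assumes A: "sub_ring A" and x: "x \<in> carrier R"
begin

lemma A_c: "a \<in> A \<Longrightarrow> a \<in> carrier R" and A_0: "\<zero> \<in> A" and A_1: "\<one> \<in> A"
  and A_add: "a \<in> A \<Longrightarrow> b \<in> A \<Longrightarrow> a \<oplus> b \<in> A" and A_mult: "a \<in> A \<Longrightarrow> b \<in> A \<Longrightarrow> a \<otimes> b \<in> A"
  and A_inv: "a \<in> A \<Longrightarrow> \<ominus> a \<in> A"
  using A by (auto simp: sub_ring_def)

lemma polys_SucI: "f \<in> polys A x n \<Longrightarrow> a \<in> A \<Longrightarrow> f \<oplus> a \<otimes> x [^] n \<in> polys A x (Suc n)"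
  by auto

lemma polys_carrier: "f \<in> polys A x n \<Longrightarrow> f \<in> carrier R"
  using x by (induction n arbitrary: f) (auto dest: A_c)

lemma polys_zero: "\<zero> \<in> polys A x n"
proof (induction n)
  case (Suc n) then show ?case using polys_SucI[OF Suc A_0] x by simp
qed simp

lemma polys_Suc: "f \<in> polys A x n \<Longrightarrow> f \<in> polys A x (Suc n)"
  using polys_SucI[OF _ A_0, of f n] x polys_carrier[of f n] by simp

lemma polys_mono: "n \<le> m \<Longrightarrow> polys A x n \<subseteq> polys A x m"
  by (rule lift_Suc_mono_le) (auto intro: polys_Suc simp del: polys.simps)

lemma polys_add: "f \<in> polys A x n \<Longrightarrow> g \<in> polys A x n \<Longrightarrow> f \<oplus> g \<in> polys A x n"
proof (induction n arbitrary: f g)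
  case (Suc n)
  then obtain f' a g' b where *: "f = f' \<oplus> a \<otimes> x [^] n" "f' \<in> polys A x n" "a \<in> A"
    "g = g' \<oplus> b \<otimes> x [^] n" "g' \<in> polys A x n" "b \<in> A" by auto
  have "f \<oplus> g = (f' \<oplus> g') \<oplus> (a \<oplus> b) \<otimes> x [^] n"
    using * polys_carrier A_c x by (simp add: l_distr a_ac)
  then show ?case using polys_SucI[OF Suc.IH[OF *(2,5)] A_add[OF *(3,6)]] by simp
qed simp

lemma polys_smult: "f \<in> polys A x n \<Longrightarrow> a \<in> A \<Longrightarrow> a \<otimes> f \<in> polys A x n"
proof (induction n arbitrary: f)
  case (Suc n)
  then obtain f' b where *: "f = f' \<oplus> b \<otimes> x [^] n" "f' \<in> polys A x n" "b \<in> A" by auto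
  have "a \<otimes> f = a \<otimes> f' \<oplus> (a \<otimes> b) \<otimes> x [^] n"
    using * polys_carrier A_c x Suc.prems by (simp add: r_distr m_ac)
  then show ?case using polys_SucI[OF Suc.IH[OF *(2) Suc.prems(2)] A_mult[OF Suc.prems(2) *(3)]] by simp
qed (use A_c in simp)

lemma polys_x: "f \<in> polys A x n \<Longrightarrow> x \<otimes> f \<in> polys A x (Suc n)"
proof (induction n arbitrary: f)
  case 0
  then have "x \<otimes> f = \<zero>" using x by simp
  then show ?case using polys_zero[of "Suc 0"] by simp
next
  case (Suc n)
  then obtain f' b where *: "f = f' \<oplus> b \<otimes> x [^] n" "f' \<in> polys A x n" "b \<in> A" by auto
  have "x \<otimes> f = x \<otimes> f' \<oplus> b \<otimes> x [^] (Suc n)"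
    using * polys_carrier A_c x Suc.prems by (simp add: r_distr m_ac)
  then show ?case using polys_SucI[OF Suc.IH[OF *(2)] *(3)] by simp
qed

lemma polys_x_pow: "f \<in> polys A x n \<Longrightarrow> x [^] (m::nat) \<otimes> f \<in> polys A x (n + m)"
proof (induction m)
  case 0 then show ?case using polys_carrier by simp
next
  case (Suc m)
  then have "x [^] Suc m \<otimes> f = x \<otimes> (x [^] m \<otimes> f)" using x polys_carrier by (simp add: m_ac)
  then show ?case using polys_x[OF Suc.IH[OF Suc.prems]] by simp
qed

lemma polys_mult: "f \<in> polys A x n \<Longrightarrow> g \<in> polys A x m \<Longrightarrow> f \<otimes> g \<in> polys A x (n + m)"
proof (induction m arbitrary: g)
  case 0 then show ?case using polys_carrier polys_zero by simp
next
  case (Suc m)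
  then obtain g' b where *: "g = g' \<oplus> b \<otimes> x [^] m" "g' \<in> polys A x m" "b \<in> A" by auto
  have "f \<otimes> g = f \<otimes> g' \<oplus> b \<otimes> (x [^] m \<otimes> f)"
    using * polys_carrier[OF Suc.prems(1)] polys_carrier[OF *(2)] A_c x by (simp add: r_distr m_ac)
  moreover have "f \<otimes> g' \<in> polys A x (n + m)" by (rule Suc.IH[OF Suc.prems(1) *(2)])
  moreover have "b \<otimes> (x [^] m \<otimes> f) \<in> polys A x (n + m)" by (intro polys_smult polys_x_pow Suc.prems *)
  ultimately show ?case using polys_add polys_Suc by (simp del: polys.simps)
qed

definition adjoin :: "'a set" where "adjoin = (\<Union>n. polys A x n)"

lemma adjoin_A: "a \<in> A \<Longrightarrow> a \<in> adjoin"
proof -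
  assume "a \<in> A"
  then have "\<zero> \<oplus> a \<otimes> x [^] (0::nat) \<in> polys A x (Suc 0)" by (intro polys_SucI polys_zero)
  moreover have "\<zero> \<oplus> a \<otimes> x [^] (0::nat) = a" using A_c[OF \<open>a \<in> A\<close>] by simp
  ultimately show ?thesis unfolding adjoin_def by (metis UN_I UNIV_I)
qed

lemma adjoin_x: "x \<in> adjoin"
proof -
  have "\<zero> \<oplus> \<one> \<otimes> x [^] Suc 0 \<in> polys A x (Suc (Suc 0))" by (intro polys_SucI polys_zero A_1)
  moreover have "\<zero> \<oplus> \<one> \<otimes> x [^] Suc 0 = x" using x by simp
  ultimately show ?thesis unfolding adjoin_def by (metis UN_I UNIV_I)
qed

lemma adjoin_sub_ring: "sub_ring adjoin"
  unfolding sub_ring_def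
proof (intro conjI ballI)
  show "adjoin \<subseteq> carrier R" using polys_carrier by (auto simp: adjoin_def)
  show "\<zero> \<in> adjoin" "\<one> \<in> adjoin" by (auto intro: adjoin_A A_0 A_1)
  fix f assume f: "f \<in> adjoin"
  then obtain n where n: "f \<in> polys A x n" by (auto simp: adjoin_def)
  have "(\<ominus> \<one>) \<otimes> f \<in> polys A x n" by (intro polys_smult n A_inv A_1)
  then show "\<ominus> f \<in> adjoin" using polys_carrier[OF n] by (auto simp: adjoin_def l_minus)
  fix g assume g: "g \<in> adjoin"
  then obtain m where m: "g \<in> polys A x m" by (auto simp: adjoin_def)
  have "f \<in> polys A x (max n m)" "g \<in> polys A x (max n m)"
    using n m polys_mono[of n "max n m"] polys_mono[of m "max n m"] by auto
  then show "f \<oplus> g \<in> adjoin" using polys_add by (auto simp: adjoin_def)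
  show "f \<otimes> g \<in> adjoin" using polys_mult[OF n m] by (auto simp: adjoin_def)
qed

text \<open>Hilbert's argument with the ideals \<open>L n k\<close> of coefficients of the
  \<open>n\<close>-th power in elements of \<open>J k\<close> that are polynomials of degree at most
  \<open>n\<close>. They grow in \<open>n\<close> and in \<open>k\<close>. The diagonal becomes
  stationary at \<open>N\<close>, each of the finitely many rows below \<open>N\<close> becomes
  stationary on its own, and from the maximum \<open>K\<close> of these bounds on every row is
  constant in \<open>k\<close>.\<close>

lemma adjoin_noeth:
  assumes "noeth A"
  shows "noeth adjoin"
  unfolding noeth_def
proof (intro allI impI)
  fix J :: "nat \<Rightarrow> 'a set"
  assume J: "\<forall>n. ideal_in adjoin (J n)" and inc: "\<forall>n. J n \<subseteq> J (Suc n)"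
  have Jmono: "J k \<subseteq> J l" if "k \<le> l" for k l by (rule lift_Suc_mono_le[of J, OF spec[OF inc] that])
  have Jadd: "f \<oplus> g \<in> J k" if "f \<in> J k" "g \<in> J k" for f g k using J that by (auto simp: ideal_in_def)
  have Jmul: "a \<otimes> f \<in> J k" if "a \<in> adjoin" "f \<in> J k" for a f k using J that by (auto simp: ideal_in_def)
  have J0: "\<zero> \<in> J k" for k using J by (auto simp: ideal_in_def)
  have Jad: "f \<in> adjoin" if "f \<in> J k" for f k using J that by (auto simp: ideal_in_def)
  have Jc: "f \<in> carrier R" if "f \<in> J k" for f k using Jad[OF that] adjoin_sub_ring by (auto simp: sub_ring_def)
  define L where "L n k = {a \<in> A. \<exists>f\<in>polys A x n. f \<oplus> a \<otimes> x [^] n \<in> J k}" for n k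
  have xp: "x [^] n \<in> carrier R" for n :: nat using x by simp
  have Lid: "ideal_in A (L n k)" for n k
    unfolding ideal_in_def
  proof (intro conjI ballI)
    show "L n k \<subseteq> A" by (auto simp: L_def)
    show "\<zero> \<in> L n k" using polys_zero[of n] J0 xp A_0 by (auto simp: L_def intro!: bexI[of _ \<zero>])
    fix a assume a: "a \<in> L n k"
    then obtain f where f: "a \<in> A" "f \<in> polys A x n" "f \<oplus> a \<otimes> x [^] n \<in> J k" by (auto simp: L_def)
    {
      fix b assume "b \<in> L n k"
      then obtain g where g: "b \<in> A" "g \<in> polys A x n" "g \<oplus> b \<otimes> x [^] n \<in> J k" by (auto simp: L_def)
      have "(f \<oplus> g) \<oplus> (a \<oplus> b) \<otimes> x [^] n = (f \<oplus> a \<otimes> x [^] n) \<oplus> (g \<oplus> b \<otimes> x [^] n)"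
        using f g polys_carrier A_c xp by (simp add: l_distr a_ac)
      then have "(f \<oplus> g) \<oplus> (a \<oplus> b) \<otimes> x [^] n \<in> J k" using Jadd[OF f(3) g(3)] by simp
      then show "a \<oplus> b \<in> L n k" using polys_add[OF f(2) g(2)] A_add[OF f(1) g(1)] by (auto simp: L_def)
    }
    fix c assume c: "c \<in> A"
    have "c \<otimes> f \<oplus> (c \<otimes> a) \<otimes> x [^] n = c \<otimes> (f \<oplus> a \<otimes> x [^] n)"
      using f c polys_carrier A_c xp by (simp add: r_distr m_assoc)
    then have "c \<otimes> f \<oplus> (c \<otimes> a) \<otimes> x [^] n \<in> J k" using Jmul[OF adjoin_A[OF c] f(3)] by simp
    then show "c \<otimes> a \<in> L n k" using polys_smult[OF f(2) c] A_mult[OF c f(1)] by (auto simp: L_def)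
  qed
  have Lk: "L n k \<subseteq> L n l" if "k \<le> l" for n k l using Jmono[OF that] by (auto simp: L_def)
  have Ln1: "L n k \<subseteq> L (Suc n) k" for n k
  proof
    fix a assume "a \<in> L n k"
    then obtain f where f: "a \<in> A" "f \<in> polys A x n" "f \<oplus> a \<otimes> x [^] n \<in> J k" by (auto simp: L_def)
    have "x \<otimes> f \<oplus> a \<otimes> x [^] (Suc n) = x \<otimes> (f \<oplus> a \<otimes> x [^] n)"
      using f polys_carrier A_c xp x by (simp add: r_distr m_ac)
    then have "x \<otimes> f \<oplus> a \<otimes> x [^] (Suc n) \<in> J k" using Jmul[OF adjoin_x f(3)] by simp
    then show "a \<in> L (Suc n) k" using polys_x[OF f(2)] f(1) by (auto simp: L_def simp del: polys.simps)
  qed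
  have Ln: "L n k \<subseteq> L m k" if "n \<le> m" for n m k by (rule lift_Suc_mono_le[of "\<lambda>n. L n k", OF Ln1 that])
  obtain N where N': "\<forall>n\<ge>N. L n n = L N N"
  proof -
    have "L n n \<subseteq> L (Suc n) (Suc n)" for n by (rule order.trans[OF Ln1 Lk]) simp
    then show thesis by (rule exE[OF noethD[OF assms, of "\<lambda>n. L n n", OF Lid]]) (rule that)
  qed
  note N = N'[rule_format]
  have "\<exists>M. \<forall>k\<ge>M. L n k = L n M" for n
  proof -
    have "L n k \<subseteq> L n (Suc k)" for k by (rule Lk) simp
    then show ?thesis by (rule noethD[OF assms, of "L n", OF Lid])
  qed
  then have "\<forall>n. \<exists>M. \<forall>k\<ge>M. L n k = L n M" by (rule allI)
  from choice[OF this] obtain M where M': "\<forall>n. \<forall>k\<ge>M n. L n k = L n (M n)" by (rule exE)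
  note M = M'[rule_format]
  define K where "K = Max (insert N (M ` {..<N}))"
  have KN: "N \<le> K" unfolding K_def by (rule Max_ge) auto
  have KM: "M n \<le> K" if "n < N" for n unfolding K_def using that by (intro Max_ge) auto
  \<comment> \<open>An entry with both indices at least \<open>N\<close> is squeezed between two
    diagonal entries.\<close>
  have big: "L n k = L N N" if "N \<le> n" "N \<le> k" for n k
  proof
    show "L N N \<subseteq> L n k" using Ln[OF that(1), of N] Lk[OF that(2), of n] by blast
    have "L n k \<subseteq> L (max n k) (max n k)" using Ln[of n "max n k" k] Lk[of k "max n k" "max n k"] by auto
    then show "L n k \<subseteq> L N N" using N[of "max n k"] that by auto
  qed
  have Leq: "L n k = L n K" if "K \<le> k" for n k
  proof (cases "n < N")
    case True then show ?thesis using M[of n k] M[of n K] KM[OF True] that by auto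
  next
    case False then show ?thesis using big[of n k] big[of n K] that KN by auto
  qed
  have main: "f \<in> J K" if "K \<le> k" "f \<in> J k" "f \<in> polys A x n" for f k n
    using that(2,3)
  proof (induction n arbitrary: f)
    case 0 then show ?case using J0 by simp
  next
    case (Suc n)
    then obtain f' a where f: "f = f' \<oplus> a \<otimes> x [^] n" "f' \<in> polys A x n" "a \<in> A" by auto
    have "a \<in> L n k" using f Suc.prems by (auto simp: L_def)
    then have "a \<in> L n K" using Leq[OF that(1)] by simp
    then obtain g where g: "g \<in> polys A x n" "g \<oplus> a \<otimes> x [^] n \<in> J K" by (auto simp: L_def)
    \<comment> \<open>Subtracting an element of \<open>J K\<close> with the same top coefficient
      lowers the formal degree.\<close>
    let ?h = "g \<oplus> a \<otimes> x [^] n"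
    have hk: "?h \<in> J k" using g(2) Jmono[OF that(1)] by blast
    have m1: "\<ominus> \<one> \<in> adjoin" by (intro adjoin_A A_inv A_1)
    have c: "f' \<in> carrier R" "g \<in> carrier R" "a \<in> carrier R" using f g polys_carrier A_c by auto
    have e: "f' \<oplus> (\<ominus> \<one>) \<otimes> g = f \<oplus> (\<ominus> \<one>) \<otimes> ?h"
      using c xp by (simp add: f(1) l_minus r_distr minus_add a_ac r_neg1 r_neg2 r_neg l_neg)
    have "f' \<oplus> (\<ominus> \<one>) \<otimes> g \<in> J k" unfolding e by (intro Jadd Jmul Suc.prems hk m1)
    moreover have "f' \<oplus> (\<ominus> \<one>) \<otimes> g \<in> polys A x n" by (intro polys_add polys_smult f g A_inv A_1)
    ultimately have "f' \<oplus> (\<ominus> \<one>) \<otimes> g \<in> J K" by (rule Suc.IH)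
    then have "(f' \<oplus> (\<ominus> \<one>) \<otimes> g) \<oplus> ?h \<in> J K" using g(2) by (rule Jadd)
    moreover have "(f' \<oplus> (\<ominus> \<one>) \<otimes> g) \<oplus> ?h = f" using c xp by (simp add: f(1) l_minus a_ac r_neg1 r_neg2 r_neg l_neg)
    ultimately show ?case by simp
  qed
  have "J k = J K" if "K \<le> k" for k
  proof
    show "J K \<subseteq> J k" by (rule Jmono[OF that])
    show "J k \<subseteq> J K"
    proof
      fix f assume f: "f \<in> J k"
      then obtain n where "f \<in> polys A x n" using Jad by (auto simp: adjoin_def)
      then show "f \<in> J K" using main[OF that f] by blast
    qed
  qed
  then show "\<exists>N. \<forall>n\<ge>N. J n = J N" by blast
qed

end

text \<open>A nonzero ideal of a field contains one, so a chain is constant as soon as it leaves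
  zero.\<close>

lemma field_noeth:
  assumes "subfield K R"
  shows "sub_ring K" "noeth K"
proof -
  note sr = subringE[OF subfieldE(1)[OF assms]]
  show "sub_ring K"
    unfolding sub_ring_def by (intro conjI ballI sr; assumption)
  show "noeth K"
    unfolding noeth_def
  proof (intro allI impI)
    fix J :: "nat \<Rightarrow> 'a set"
    assume J: "\<forall>n. ideal_in K (J n)" and inc: "\<forall>n. J n \<subseteq> J (Suc n)"
    have Jmono: "J k \<subseteq> J l" if "k \<le> l" for k l by (rule lift_Suc_mono_le[of J, OF spec[OF inc] that])
    have full: "J n = K" if a: "a \<in> J n" "a \<noteq> \<zero>" for a n
    proof
      show "J n \<subseteq> K" using J by (auto simp: ideal_in_def)
      have aK: "a \<in> K" using J a(1) by (auto simp: ideal_in_def)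
      then have "a \<in> Units (R\<lparr>carrier := K\<rparr>)" using subfield.subfield_Units[OF assms] a(2) by simp
      then obtain b where b: "b \<in> K" "b \<otimes> a = \<one>" by (auto simp: Units_def)
      have "\<one> \<in> J n" using J b a(1) by (force simp: ideal_in_def)
      then have "c \<otimes> \<one> \<in> J n" if "c \<in> K" for c using J that by (auto simp: ideal_in_def)
      then show "K \<subseteq> J n" using sr(1) by (metis r_one subsetD subsetI)
    qed
    show "\<exists>N. \<forall>n\<ge>N. J n = J N"
    proof (cases "\<exists>N a. a \<in> J N \<and> a \<noteq> \<zero>")
      case True
      then obtain N a where "a \<in> J N" "a \<noteq> \<zero>" by blast
      then have "\<forall>n\<ge>N. J n = J N" using full Jmono by (metis subsetD)
      then show ?thesis by blast
    next
      case False
      then have "J n = {\<zero>}" for n using J by (auto simp: ideal_in_def)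
      then show ?thesis by auto
    qed
  qed
qed

theorem hilbert_basis:
  assumes K: "subfield K R" and S: "finite S" "S \<subseteq> carrier R" and gen: "generate_ring R (K \<union> S) = carrier R"
  shows "noeth (carrier R)"
proof -
  have "\<exists>A. sub_ring A \<and> noeth A \<and> K \<union> S \<subseteq> A"
    using S
  proof (induction rule: finite_induct)
    case empty then show ?case using field_noeth[OF K] by auto
  next
    case (insert x F)
    then obtain A where A: "sub_ring A" "noeth A" "K \<union> F \<subseteq> A" by auto
    have x: "x \<in> carrier R" using insert by simp
    show ?case
      using adjoin_sub_ring[OF A(1) x] adjoin_noeth[OF A(1) x A(2)] adjoin_A[OF A(1) x] adjoin_x[OF A(1) x] A(3)
      by (intro exI[of _ "adjoin A x"]) auto
  qed
  then obtain A where A: "sub_ring A" "noeth A" "K \<union> S \<subseteq> A" by blast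
  have "y \<in> A" if "y \<in> generate_ring R (K \<union> S)" for y
    using that A(1,3) by (induction) (auto simp: sub_ring_def)
  then have "A = carrier R" using gen A(1) by (auto simp: sub_ring_def)
  then show ?thesis using A by simp
qed

end

section \<open>Homogeneous primes\<close>

context graded_ring
begin

abbreviation "rc \<equiv> gcomp R (rgrade R)"

lemma idealD:
  assumes "ideal A R"
  shows "a \<in> A \<Longrightarrow> a \<in> carrier R" "\<zero> \<in> A" "a \<in> A \<Longrightarrow> b \<in> A \<Longrightarrow> a \<oplus> b \<in> A"
    "a \<in> A \<Longrightarrow> r \<in> carrier R \<Longrightarrow> r \<otimes> a \<in> A" "a \<in> A \<Longrightarrow> r \<in> carrier R \<Longrightarrow> a \<otimes> r \<in> A" "a \<in> A \<Longrightarrow> \<ominus> a \<in> A"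
proof -
  interpret ideal A R by fact
  show "a \<in> A \<Longrightarrow> a \<in> carrier R" "\<zero> \<in> A" "a \<in> A \<Longrightarrow> b \<in> A \<Longrightarrow> a \<oplus> b \<in> A"
    "a \<in> A \<Longrightarrow> r \<in> carrier R \<Longrightarrow> r \<otimes> a \<in> A" "a \<in> A \<Longrightarrow> r \<in> carrier R \<Longrightarrow> a \<otimes> r \<in> A" "a \<in> A \<Longrightarrow> \<ominus> a \<in> A"
    by (auto simp: I_l_closed I_r_closed Icarr a_closed a_inv_closed)
qed

lemma idealI':
  assumes "A \<subseteq> carrier R" "\<zero> \<in> A" "\<And>a b. a \<in> A \<Longrightarrow> b \<in> A \<Longrightarrow> a \<oplus> b \<in> A"
    "\<And>a r. a \<in> A \<Longrightarrow> r \<in> carrier R \<Longrightarrow> r \<otimes> a \<in> A"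
  shows "ideal A R"
proof (rule idealI)
  show "ring R" by (rule ring_axioms)
  show "subgroup A (add_monoid R)"
  proof (rule add.subgroupI)
    fix a assume a: "a \<in> A"
    then have "(\<ominus> \<one>) \<otimes> a \<in> A" by (intro assms) auto
    then show "\<ominus> a \<in> A" using a assms(1) by (auto simp: l_minus)
  qed (use assms in auto)
  fix a r assume "a \<in> A" "r \<in> carrier R"
  then show "r \<otimes> a \<in> A" "a \<otimes> r \<in> A" using assms(4)[of a r] assms(1) by (auto simp: m_comm[of a r])
qed

lemma gidealD: "gideal R A \<Longrightarrow> ideal A R" "gideal R A \<Longrightarrow> a \<in> A \<Longrightarrow> rc i a \<in> A"
  by (auto simp: gideal_def)

lemma rc_mult_homog:
  assumes x: "x \<in> rgrade R d" and r: "r \<in> carrier R"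
  shows "rc i (r \<otimes> x) = (if d \<le> i then rc (i - d) r \<otimes> x else \<zero>)"
  using r
proof (induction rule: dsum_induct)
  case zero then show ?case using rgrade_carrier[OF x] by simp
next
  case (homog k y)
  have yx: "y \<otimes> x \<in> rgrade R (k + d)" by (rule rgrade_mult[OF homog x])
  show ?case
  proof (cases "i = k + d")
    case True then show ?thesis using homog yx by simp
  next
    case False
    then have "rc i (y \<otimes> x) = \<zero>" using cp_other[OF yx] by simp
    moreover have "d \<le> i \<Longrightarrow> i - d \<noteq> k" using False by auto
    ultimately show ?thesis using cp_other[OF homog] rgrade_carrier[OF x] by auto
  qed
next
  case (add y z)
  then show ?case using rgrade_carrier[OF x] by (simp add: l_distr cp_add)
qed

definition ext_ideal :: "'r set \<Rightarrow> 'r \<Rightarrow> 'r set" where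
  "ext_ideal A x = {a \<oplus> r \<otimes> x | a r. a \<in> A \<and> r \<in> carrier R}"

lemma ext_ideal:
  assumes A: "gideal R A" and x: "x \<in> rgrade R d"
  shows "gideal R (ext_ideal A x)" "A \<subseteq> ext_ideal A x" "x \<in> ext_ideal A x"
proof -
  note AD = idealD[OF gidealD(1)[OF A]]
  have xc: "x \<in> carrier R" by (rule rgrade_carrier[OF x])
  have I: "a \<oplus> r \<otimes> x \<in> ext_ideal A x" if "a \<in> A" "r \<in> carrier R" for a r
    using that by (auto simp: ext_ideal_def)
  show sub: "A \<subseteq> ext_ideal A x"
  proof
    fix a assume "a \<in> A" then show "a \<in> ext_ideal A x" using I[of a \<zero>] AD(1) xc by simp
  qed
  show "x \<in> ext_ideal A x" using I[OF AD(2) one_closed] xc by simp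
  show "gideal R (ext_ideal A x)"
    unfolding gideal_def
  proof (intro conjI allI ballI)
    show "ideal (ext_ideal A x) R"
    proof (rule idealI')
      show "ext_ideal A x \<subseteq> carrier R" using AD(1) xc by (auto simp: ext_ideal_def)
      show "\<zero> \<in> ext_ideal A x" using sub AD(2) by blast
    next
      fix p q assume "p \<in> ext_ideal A x" "q \<in> ext_ideal A x"
      then obtain a r b s where *: "p = a \<oplus> r \<otimes> x" "a \<in> A" "r \<in> carrier R" "q = b \<oplus> s \<otimes> x" "b \<in> A" "s \<in> carrier R"
        by (auto simp: ext_ideal_def)
      have "p \<oplus> q = (a \<oplus> b) \<oplus> (r \<oplus> s) \<otimes> x" using * AD(1) xc by (simp add: l_distr a_ac)
      then show "p \<oplus> q \<in> ext_ideal A x" using I AD(3) * by simp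
    next
      fix p s assume s: "p \<in> ext_ideal A x" "s \<in> carrier R"
      then obtain a r where *: "p = a \<oplus> r \<otimes> x" "a \<in> A" "r \<in> carrier R" by (auto simp: ext_ideal_def)
      have "s \<otimes> p = s \<otimes> a \<oplus> (s \<otimes> r) \<otimes> x" using * s AD(1) xc by (simp add: r_distr m_assoc)
      then show "s \<otimes> p \<in> ext_ideal A x" using I AD(4) * s by simp
    qed
    fix i p assume "p \<in> ext_ideal A x"
    then obtain a r where *: "p = a \<oplus> r \<otimes> x" "a \<in> A" "r \<in> carrier R" by (auto simp: ext_ideal_def)
    have "rc i p = rc i a \<oplus> (if d \<le> i then rc (i - d) r else \<zero>) \<otimes> x"
      using * AD(1) xc by (simp add: cp_add rc_mult_homog[OF x])
    moreover have "(if d \<le> i then rc (i - d) r else \<zero>) \<in> carrier R" using * by simp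
    ultimately show "rc i p \<in> ext_ideal A x" using I gidealD(2)[OF A *(2)] by simp
  qed
qed

text \<open>Primality is tested on homogeneous elements only, because its failure must supply
  homogeneous elements by which \<open>gprime_decomp\<close> enlarges a graded ideal;
  \<open>gprime_prime\<close> recovers ordinary primality.\<close>

definition gprime :: "'r set \<Rightarrow> bool" where
  "gprime P \<longleftrightarrow> gideal R P \<and> \<one> \<notin> P \<and>
     (\<forall>i j. \<forall>a\<in>rgrade R i. \<forall>b\<in>rgrade R j. a \<otimes> b \<in> P \<longrightarrow> a \<in> P \<or> b \<in> P)"

lemma gprimeD:
  assumes "gprime P"
  shows "gideal R P" "\<one> \<notin> P" "a \<in> rgrade R i \<Longrightarrow> b \<in> rgrade R j \<Longrightarrow> a \<otimes> b \<in> P \<Longrightarrow> a \<in> P \<or> b \<in> P"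
  using assms unfolding gprime_def by blast+

text \<open>Degrees below \<open>m\<close> and below \<open>n\<close> add up to at most
  \<open>m + n - 2\<close>, which explains \<open>Suc k\<close> in the bound.\<close>

lemma low_degree_mult:
  assumes u: "u \<in> carrier R" "\<And>k. m \<le> k \<Longrightarrow> rc k u = \<zero>" and v: "v \<in> carrier R" "\<And>k. n \<le> k \<Longrightarrow> rc k v = \<zero>"
    and k: "m + n \<le> Suc k"
  shows "rc k (u \<otimes> v) = \<zero>"
proof -
  have 1: "u \<in> {u \<in> carrier R. rc k (u \<otimes> w) = \<zero>}" if w: "w \<in> rgrade R l" "l < n" for w l
  proof (rule cp_closure[OF u(1)])
    fix i
    have wc: "w \<in> carrier R" by (rule rgrade_carrier[OF w(1)])
    show "rc i u \<in> {u \<in> carrier R. rc k (u \<otimes> w) = \<zero>}"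
    proof (cases "m \<le> i")
      case True then show ?thesis using u wc by simp
    next
      case False
      then have "k \<noteq> i + l" using w(2) k by simp
      then show ?thesis using cp_other[OF rgrade_mult[OF cp_in[OF u(1), of i] w(1)]] u(1) by simp
    qed
  qed (use rgrade_carrier[OF w(1)] in \<open>auto simp: l_distr cp_add\<close>)
  have "v \<in> {v \<in> carrier R. rc k (u \<otimes> v) = \<zero>}"
  proof (rule cp_closure[OF v(1)])
    fix i
    show "rc i v \<in> {v \<in> carrier R. rc k (u \<otimes> v) = \<zero>}"
    proof (cases "n \<le> i")
      case True then show ?thesis using v u by simp
    next
      case False
      then show ?thesis using 1[OF cp_in[OF v(1), of i]] v(1) by simp
    qed
  qed (use u in \<open>auto simp: r_distr cp_add\<close>)
  then show ?thesis by simp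
qed

text \<open>Induction on the total number of nonzero components. A component lying in
  \<open>P\<close> may be subtracted without affecting the claim. If no nonzero component lies in
  \<open>P\<close>, the component of the product in the sum of the two top degrees is the product of
  the top components, against homogeneous primality.\<close>

lemma gprime_prime:
  assumes P: "gprime P"
  shows "primeideal P R"
proof -
  note PD = idealD[OF gidealD(1)[OF gprimeD(1)[OF P]]]
  have pr: "a \<in> P \<or> b \<in> P" if "a \<in> carrier R" "b \<in> carrier R" "a \<otimes> b \<in> P" for a b
    using that
  proof (induction "card {k. rc k a \<noteq> \<zero>} + card {k. rc k b \<noteq> \<zero>}" arbitrary: a b rule: less_induct)
    case less
    note ab = less.prems
    have drop: "card {k. rc k (c \<ominus> rc i c) \<noteq> \<zero>} < card {k. rc k c \<noteq> \<zero>}" if c: "c \<in> carrier R" "rc i c \<noteq> \<zero>" for c i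
    proof (rule psubset_card_mono)
      show "finite {k. rc k c \<noteq> \<zero>}" by (rule cp_all(2)[OF c(1)])
      have e: "rc k (c \<ominus> rc i c) = (if k = i then \<zero> else rc k c)" for k
        using c(1) cp_other[OF cp_in[OF c(1), of i], of k] by (simp add: cp_add cp_inv minus_eq r_neg cp_in)
      show "{k. rc k (c \<ominus> rc i c) \<noteq> \<zero>} \<subset> {k. rc k c \<noteq> \<zero>}" unfolding e using c(2) by auto
    qed
    have bck: "c \<in> P" if "c \<ominus> d \<in> P" "d \<in> P" "c \<in> carrier R" for c d
    proof -
      have "(c \<ominus> d) \<oplus> d \<in> P" by (rule PD(3)[OF that(1,2)])
      then show ?thesis using that PD(1)[OF that(2)] by (simp add: minus_eq a_assoc l_neg)
    qed
    show ?case
    proof (cases "\<exists>i. rc i a \<noteq> \<zero> \<and> rc i a \<in> P")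
      case True
      then obtain i where i: "rc i a \<noteq> \<zero>" "rc i a \<in> P" by blast
      have "(a \<ominus> rc i a) \<otimes> b = a \<otimes> b \<oplus> \<ominus> (rc i a \<otimes> b)" using ab by (simp add: minus_eq l_distr l_minus)
      moreover have "\<dots> \<in> P" by (intro PD(3) PD(6) PD(5) ab i)
      ultimately have "a \<ominus> rc i a \<in> P \<or> b \<in> P"
        using less.hyps[of "a \<ominus> rc i a" b] drop[OF ab(1) i(1)] ab by simp
      then show ?thesis using bck[OF _ i(2) ab(1)] by blast
    next
      case nA: False
      show ?thesis
      proof (cases "\<exists>i. rc i b \<noteq> \<zero> \<and> rc i b \<in> P")
        case True
        then obtain i where i: "rc i b \<noteq> \<zero>" "rc i b \<in> P" by blast
        have "a \<otimes> (b \<ominus> rc i b) = a \<otimes> b \<oplus> \<ominus> (a \<otimes> rc i b)" using ab by (simp add: minus_eq r_distr r_minus)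
        moreover have "\<dots> \<in> P" by (intro PD(3) PD(6) PD(4) ab i)
        ultimately have "a \<in> P \<or> b \<ominus> rc i b \<in> P"
          using less.hyps[of a "b \<ominus> rc i b"] drop[OF ab(2) i(1)] ab by simp
        then show ?thesis using bck[OF _ i(2) ab(2)] by blast
      next
        case nB: False
        show ?thesis
        proof (rule ccontr)
          assume n: "\<not> (a \<in> P \<or> b \<in> P)"
          have ne: "{k. rc k c \<noteq> \<zero>} \<noteq> {}" if "c \<in> carrier R" "c \<notin> P" for c
          proof
            assume "{k. rc k c \<noteq> \<zero>} = {}"
            then have "c = \<zero>" using cp_eq[OF that(1) zero_closed] by simp
            then show False using that(2) PD(2) by simp
          qed
          have top: "\<exists>i. rc i c \<noteq> \<zero> \<and> (\<forall>k\<ge>Suc i. rc k c = \<zero>)" if c: "c \<in> carrier R" "c \<notin> P" for c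
          proof -
            let ?S = "{k. rc k c \<noteq> \<zero>}"
            have fin: "finite ?S" by (rule cp_all(2)[OF c(1)])
            have "Max ?S \<in> ?S" by (rule Max_in[OF fin ne[OF c]])
            moreover have "rc k c = \<zero>" if "Suc (Max ?S) \<le> k" for k
              using Max_ge[OF fin, of k] that by (cases "rc k c = \<zero>") auto
            ultimately show ?thesis by blast
          qed
          obtain i where i: "rc i a \<noteq> \<zero>" "\<forall>k\<ge>Suc i. rc k a = \<zero>" using top[OF ab(1)] n by blast
          obtain j where j: "rc j b \<noteq> \<zero>" "\<forall>k\<ge>Suc j. rc k b = \<zero>" using top[OF ab(2)] n by blast
          have rr: "rc k (rc l c) = (if k = l then rc l c else \<zero>)" if "c \<in> carrier R" for k l c
            using cp_other[OF cp_in[OF that, of l], of k] cp_same[OF cp_in[OF that, of l]] by auto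
          have low: "rc k (c \<ominus> rc l c) = \<zero>" if "c \<in> carrier R" "\<forall>k\<ge>Suc l. rc k c = \<zero>" "l \<le> k" for c k l
            using that(1,3) that(2)[rule_format, of k] by (cases "k = l") (auto simp: cp_add cp_inv rr minus_eq r_neg)
          let ?a = "a \<ominus> rc i a" and ?b = "b \<ominus> rc j b"
          have e1: "a \<otimes> b = rc i a \<otimes> rc j b \<oplus> (rc i a \<otimes> ?b \<oplus> ?a \<otimes> b)"
          proof -
            have a: "a = rc i a \<oplus> ?a" and b: "b = rc j b \<oplus> ?b" using ab by (auto simp: minus_eq a_lcomm r_neg)
            have "a \<otimes> b = (rc i a \<oplus> ?a) \<otimes> b" using a by simp
            also have "\<dots> = rc i a \<otimes> b \<oplus> ?a \<otimes> b" using ab by (simp add: l_distr)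
            also have "rc i a \<otimes> b = rc i a \<otimes> (rc j b \<oplus> ?b)" using b by simp
            also have "\<dots> = rc i a \<otimes> rc j b \<oplus> rc i a \<otimes> ?b" using ab by (simp add: r_distr)
            finally show ?thesis using ab by (simp add: a_assoc)
          qed
          \<comment> \<open>Apart from the two top components, nothing contributes to degree
            \<open>i + j\<close>.\<close>
          have z1: "rc (i + j) (rc i a \<otimes> ?b) = \<zero>"
          proof (rule low_degree_mult[where m = "Suc i" and n = j])
            show "\<And>k. Suc i \<le> k \<Longrightarrow> rc k (rc i a) = \<zero>" using rr[OF ab(1)] by auto
            show "\<And>k. j \<le> k \<Longrightarrow> rc k ?b = \<zero>" using low[OF ab(2) j(2)] by auto
          qed (use ab in auto)
          have z2: "rc (i + j) (?a \<otimes> b) = \<zero>"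
          proof (rule low_degree_mult[where m = i and n = "Suc j"])
            show "\<And>k. i \<le> k \<Longrightarrow> rc k ?a = \<zero>" using low[OF ab(1) i(2)] by auto
            show "\<And>k. Suc j \<le> k \<Longrightarrow> rc k b = \<zero>" using j(2) by auto
          qed (use ab in auto)
          have "rc (i + j) (a \<otimes> b) = rc i a \<otimes> rc j b"
            unfolding e1 using ab z1 z2 rgrade_mult[OF cp_in[OF ab(1), of i] cp_in[OF ab(2), of j]]
            by (simp add: cp_add)
          then have "rc i a \<otimes> rc j b \<in> P" using gidealD(2)[OF gprimeD(1)[OF P] ab(3)] by metis
          then have "rc i a \<in> P \<or> rc j b \<in> P" using gprimeD(3)[OF P cp_in[OF ab(1)] cp_in[OF ab(2)]] by blast
          then show False using nA nB i j by blast
        qed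
      qed
    qed
  qed
  show ?thesis
  proof (rule primeidealI)
    show "ideal P R" by (rule gidealD(1)[OF gprimeD(1)[OF P]])
    show "cring R" by (rule cring_axioms)
    show "carrier R \<noteq> P" using gprimeD(2)[OF P] by auto
  qed (use pr in blast)
qed

section \<open>Homogeneous prime avoidance\<close>

lemma gprime_pow:
  assumes P: "gprime P" and y: "y \<in> rgrade R d" "y [^] (n::nat) \<in> P"
  shows "y \<in> P"
  using y(2)
proof (induction n)
  case 0 then show ?case using gprimeD(2)[OF P] by simp
next
  case (Suc n)
  then have "y [^] n \<otimes> y \<in> P" by simp
  then show ?case using gprimeD(3)[OF P rgrade_pow[OF y(1)] y(1)] Suc.IH by blast
qed

lemma gideal_pow: "gideal R Q \<Longrightarrow> y \<in> Q \<Longrightarrow> 0 < n \<Longrightarrow> y [^] (n::nat) \<in> Q"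
  by (cases n) (auto intro: idealD(4)[OF gidealD(1)] simp: idealD(1)[OF gidealD(1)])

lemma homog_not_in:
  assumes "gideal R P" "Q \<subseteq> carrier R" "\<And>i a. a \<in> Q \<Longrightarrow> rc i a \<in> Q" "\<not> Q \<subseteq> P"
  obtains y d where "y \<in> rgrade R d" "y \<in> Q" "y \<notin> P"
proof -
  obtain a where a: "a \<in> Q" "a \<notin> P" using assms(4) by blast
  note PD = idealD[OF gidealD(1)[OF assms(1)]]
  have ac: "a \<in> carrier R" using a assms(2) by blast
  have "\<exists>i. rc i a \<notin> P"
  proof (rule ccontr)
    assume "\<not> ?thesis"
    then have "a \<in> P" using cp_closure[OF ac, of P] PD by blast
    then show False using a by simp
  qed
  then show ?thesis using that cp_in[OF ac] assms(3)[OF a(1)] by blast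
qed

text \<open>A product of homogeneous elements, one from each \<open>Q\<close> and each outside
  \<open>P\<close>, stays outside \<open>P\<close>.\<close>

lemma prod_avoid:
  assumes P: "gprime P" and F: "finite F" "\<And>Q. Q \<in> F \<Longrightarrow> gideal R Q \<and> \<not> Q \<subseteq> P"
  shows "\<exists>y d. y \<in> rgrade R d \<and> y \<notin> P \<and> (\<forall>Q\<in>F. y \<in> Q)"
  using F
proof (induction rule: finite_induct)
  case empty
  then show ?case using rgrade_one gprimeD(2)[OF P] by blast
next
  case (insert Q F)
  then obtain y d where y: "y \<in> rgrade R d" "y \<notin> P" "\<forall>Q\<in>F. y \<in> Q" by auto
  have Q: "gideal R Q" "\<not> Q \<subseteq> P" using insert.prems by auto
  obtain z e where z: "z \<in> rgrade R e" "z \<in> Q" "z \<notin> P"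
    by (rule homog_not_in[OF gprimeD(1)[OF P] _ _ Q(2)]) (use idealD(1)[OF gidealD(1)[OF Q(1)]] gidealD(2)[OF Q(1)] in auto)
  have "y \<otimes> z \<in> rgrade R (d + e)" by (rule rgrade_mult[OF y(1) z(1)])
  moreover have "y \<otimes> z \<notin> P" using gprimeD(3)[OF P y(1) z(1)] y z by blast
  moreover have "y \<otimes> z \<in> Q'" if "Q' \<in> insert Q F" for Q'
  proof (cases "Q' = Q")
    case True then show ?thesis using idealD(4)[OF gidealD(1)[OF Q(1)] z(2)] rgrade_carrier[OF y(1)] by simp
  next
    case False
    then have "gideal R Q'" "y \<in> Q'" using that insert.prems y(3) by auto
    then show ?thesis using idealD(5)[OF gidealD(1)] rgrade_carrier[OF z(1)] by simp
  qed
  ultimately show ?case by blast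
qed

text \<open>The usual induction on the number of primes. Since a sum must stay homogeneous, the two
  summands are first raised to powers that equalize their degrees.\<close>

lemma prime_avoidance:
  assumes "finite F" "\<And>P. P \<in> F \<Longrightarrow> gprime P \<and> (\<exists>z d. z \<in> rgrade R d \<and> 0 < d \<and> z \<notin> P)"
  shows "\<exists>x d. x \<in> rgrade R d \<and> 0 < d \<and> (\<forall>P\<in>F. x \<notin> P)"
  using assms
proof (induction "card F" arbitrary: F rule: less_induct)
  case less
  show ?case
  proof (cases "F = {}")
    \<comment> \<open>Zero serves the empty family, being homogeneous of every degree.\<close>
    case True then show ?thesis by (intro exI[of _ \<zero>] exI[of _ 1]) auto
  next
    case ne: False
    show ?thesis
    proof (cases "\<exists>P\<in>F. \<exists>Q\<in>F. P \<noteq> Q \<and> Q \<subseteq> P")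
      case True
      then obtain P Q where PQ: "P \<in> F" "Q \<in> F" "P \<noteq> Q" "Q \<subseteq> P" by blast
      have "card (F - {Q}) < card F" using PQ less.prems(1) by (intro psubset_card_mono) auto
      then obtain x d where x: "x \<in> rgrade R d" "0 < d" "\<forall>P\<in>F - {Q}. x \<notin> P"
        using less.hyps[of "F - {Q}"] less.prems by auto
      then show ?thesis using PQ by blast
    next
      case inc: False
      obtain P where P: "P \<in> F" using ne by blast
      have gP: "gprime P" using less.prems(2) P by blast
      note PI = idealD[OF gidealD(1)[OF gprimeD(1)[OF gP]]]
      have "card (F - {P}) < card F" using P less.prems(1) by (intro psubset_card_mono) auto
      then obtain x d where x: "x \<in> rgrade R d" "0 < d" "\<forall>P'\<in>F - {P}. x \<notin> P'"
        using less.hyps[of "F - {P}"] less.prems by auto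
      show ?thesis
      proof (cases "x \<in> P")
        case False then show ?thesis using x by blast
      next
        case xP: True
        have "\<exists>y e. y \<in> rgrade R e \<and> y \<notin> P \<and> (\<forall>Q\<in>F - {P}. y \<in> Q)"
          using less.prems inc P gprimeD(1) by (intro prod_avoid[OF gP]) auto
        then obtain y e where y: "y \<in> rgrade R e" "y \<notin> P" "\<forall>Q\<in>F - {P}. y \<in> Q" by blast
        obtain z c where z: "z \<in> rgrade R c" "0 < c" "z \<notin> P" using less.prems(2)[OF P] by blast
        \<comment> \<open>The factor \<open>z\<close> makes the degree positive, so that
          \<open>x\<close> is raised to a positive power and this power remains in
          \<open>P\<close>.\<close>
        let ?u = "y \<otimes> z"
        have u: "?u \<in> rgrade R (e + c)" "?u \<notin> P" using rgrade_mult[OF y(1) z(1)] gprimeD(3)[OF gP y(1) z(1)] y z by auto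
        have xcr: "x \<in> carrier R" and ucr: "?u \<in> carrier R" using x(1) u(1) rgrade_carrier by blast+
        let ?p = "x [^] (e + c)" and ?q = "?u [^] d"
        have pq: "?p \<in> rgrade R (d * (e + c))" "?q \<in> rgrade R (d * (e + c))"
          using rgrade_pow[OF x(1), of "e + c"] rgrade_pow[OF u(1), of d] by (simp_all add: mult.commute)
        have pqc: "?p \<in> carrier R" "?q \<in> carrier R" using xcr ucr by auto
        have back1: "b \<in> I" if "gideal R I" "a \<oplus> b \<in> I" "a \<in> I" "b \<in> carrier R" for I a b
        proof -
          note ID = idealD[OF gidealD(1)[OF that(1)]]
          have "\<ominus> a \<oplus> (a \<oplus> b) \<in> I" by (intro ID(3) ID(6) that)
          then show ?thesis using ID(1)[OF that(3)] that(4) by (simp add: r_neg1)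
        qed
        have wP: "?p \<oplus> ?q \<notin> P"
        proof
          assume "?p \<oplus> ?q \<in> P"
          moreover have "?p \<in> P" using gideal_pow[OF gprimeD(1)[OF gP] xP] z(2) by simp
          ultimately have "?q \<in> P" using back1[OF gprimeD(1)[OF gP]] pqc by blast
          then show False using gprime_pow[OF gP u(1)] u(2) by blast
        qed
        have wQ: "?p \<oplus> ?q \<notin> Q" if Q: "Q \<in> F - {P}" for Q
        proof
          assume a: "?p \<oplus> ?q \<in> Q"
          have gQ: "gprime Q" using less.prems(2) Q by blast
          have "?u \<in> Q" using y(3) Q idealD(5)[OF gidealD(1)[OF gprimeD(1)[OF gQ]]] rgrade_carrier[OF z(1)] by blast
          then have "?q \<in> Q" using gideal_pow[OF gprimeD(1)[OF gQ]] x(2) by blast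
          then have "?p \<in> Q" using back1[OF gprimeD(1)[OF gQ], of ?q ?p] a pqc by (simp add: a_comm)
          then show False using gprime_pow[OF gQ x(1)] x(3) Q by blast
        qed
        have "?p \<oplus> ?q \<in> rgrade R (d * (e + c))" by (rule D_add[OF pq])
        moreover have "0 < d * (e + c)" using x(2) z(2) by simp
        ultimately show ?thesis using wP wQ by blast
      qed
    qed
  qed
qed

end

section \<open>Parameters and torsion over a standard graded algebra\<close>

locale std_graded = graded_ring +
  fixes S
  assumes ground_field: "subfield (rgrade R 0) R" and S: "finite S" "S \<subseteq> rgrade R 1"
    and gen: "generate_ring R (rgrade R 0 \<union> S) = carrier R"
begin

lemma S_carrier: "s \<in> S \<Longrightarrow> s \<in> carrier R" using S(2) rgrade_carrier by blast

section \<open>Consequences of the Noetherian property\<close>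

lemma R_noeth: "noeth (carrier R)"
  by (rule hilbert_basis[OF ground_field S(1) _ gen]) (use S_carrier in blast)

lemma ideal_in_carrier: "ideal A R \<Longrightarrow> ideal_in (carrier R) A"
  unfolding ideal_in_def using idealD by blast

text \<open>A counterexample would start, by dependent choice, an infinite strictly ascending chain
  of ideals.\<close>

lemma gideal_induct [consumes 1, case_names step]:
  assumes "gideal R A" and step: "\<And>A. gideal R A \<Longrightarrow> (\<And>B. gideal R B \<Longrightarrow> A \<subset> B \<Longrightarrow> P B) \<Longrightarrow> P A"
  shows "P A"
proof (rule ccontr)
  assume "\<not> P A"
  have "\<exists>f. \<forall>n::nat. (gideal R (f n) \<and> \<not> P (f n)) \<and> f n \<subset> f (Suc n)"
  proof (rule dependent_nat_choice)
    show "\<exists>x. gideal R x \<and> \<not> P x" using assms(1) \<open>\<not> P A\<close> by blast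
    fix x :: "'a set" and n assume "gideal R x \<and> \<not> P x"
    then show "\<exists>y. (gideal R y \<and> \<not> P y) \<and> x \<subset> y" using step[of x] by blast
  qed
  then obtain f where f': "\<forall>n::nat. (gideal R (f n) \<and> \<not> P (f n)) \<and> f n \<subset> f (Suc n)" by (rule exE)
  then have f: "gideal R (f n)" "f n \<subset> f (Suc n)" for n by blast+
  have "\<exists>N. \<forall>n\<ge>N. f n = f N"
    by (rule noethD[OF R_noeth]) (use f ideal_in_carrier[OF gidealD(1)] in auto)
  then obtain N where "f (Suc N) = f N" by (meson le_Suc_eq le_refl)
  then show False using f(2)[of N] by simp
qed

text \<open>The colon ideals of \<open>b\<close> by the powers of \<open>y\<close> form an ascending
  chain; \<open>e\<close> is an index from which it is stationary.\<close>

lemma colon_stable: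
  assumes b: "ideal b R" and y: "y \<in> carrier R"
  obtains e :: nat where "\<And>n r. r \<in> carrier R \<Longrightarrow> y [^] (n + e) \<otimes> r \<in> b \<Longrightarrow> y [^] e \<otimes> r \<in> b"
proof -
  note bD = idealD[OF b]
  let ?J = "\<lambda>n::nat. {r \<in> carrier R. y [^] n \<otimes> r \<in> b}"
  have id: "ideal_in (carrier R) (?J n)" for n
    unfolding ideal_in_def
  proof (intro conjI ballI)
    fix a r assume "a \<in> carrier R" "r \<in> ?J n"
    then have "y [^] n \<otimes> (a \<otimes> r) = a \<otimes> (y [^] n \<otimes> r)" "a \<otimes> (y [^] n \<otimes> r) \<in> b" "r \<in> carrier R" "a \<in> carrier R"
      using y bD(4) by (auto simp: m_ac)
    then show "a \<otimes> r \<in> ?J n" by simp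
  qed (use y bD in \<open>auto simp: r_distr\<close>)
  have mono: "?J n \<subseteq> ?J (Suc n)" for n
  proof
    fix r assume r: "r \<in> ?J n"
    then have "y [^] Suc n \<otimes> r = y \<otimes> (y [^] n \<otimes> r)" using y by (simp add: m_ac)
    then show "r \<in> ?J (Suc n)" using r y bD(4) by simp
  qed
  obtain e where e: "\<forall>n\<ge>e. ?J n = ?J e" using noethD[where J = ?J, OF R_noeth id mono] by (rule exE)
  show ?thesis
  proof (rule that[of e])
    fix n r assume r: "r \<in> carrier R" "y [^] (n + e) \<otimes> r \<in> b"
    then have "r \<in> ?J (n + e)" by simp
    then have "r \<in> ?J e" using e[rule_format, of "n + e"] by (metis (no_types, lifting) le_add2)
    then show "y [^] e \<otimes> r \<in> b" by simp
  qed
qed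

text \<open>Finitely many graded primes cut out the radical of a graded ideal. If \<open>A\<close>
  is not prime, choose homogeneous \<open>a\<close> and \<open>b\<close> outside \<open>A\<close>
  with product in \<open>A\<close>: the primes found for \<open>A + (a)\<close> and for
  \<open>A + (b)\<close> together serve for \<open>A\<close>, because the product of these two
  ideals lies in \<open>A\<close>.\<close>

lemma gprime_decomp:
  assumes "gideal R A"
  shows "\<exists>F. finite F \<and> (\<forall>P\<in>F. gprime P \<and> A \<subseteq> P) \<and> (\<forall>y\<in>carrier R. (\<forall>P\<in>F. y \<in> P) \<longrightarrow> (\<exists>n::nat. y [^] n \<in> A))"
  using assms
proof (induction rule: gideal_induct)
  case (step A)
  note AD = idealD[OF gidealD(1)[OF step(1)]]
  show ?case
  proof (cases "\<one> \<in> A")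
    case True
    then have "\<exists>n::nat. y [^] n \<in> A" for y by (intro exI[of _ 0]) simp
    then show ?thesis by (intro exI[of _ "{}"]) auto
  next
    case n1: False
    show ?thesis
    proof (cases "gprime A")
      case True
      have "\<exists>n::nat. y [^] n \<in> A" if "y \<in> A" for y using that AD(1) by (intro exI[of _ 1]) simp
      then show ?thesis using True by (intro exI[of _ "{A}"]) auto
    next
      case False
      then obtain i j a b where ab: "a \<in> rgrade R i" "b \<in> rgrade R j" "a \<otimes> b \<in> A" "a \<notin> A" "b \<notin> A"
        using n1 step(1) unfolding gprime_def by blast
      have "\<exists>F. finite F \<and> (\<forall>P\<in>F. gprime P \<and> A \<subseteq> P) \<and> (\<forall>y\<in>carrier R. (\<forall>P\<in>F. y \<in> P) \<longrightarrow> (\<exists>n::nat. y [^] n \<in> ext_ideal A x))"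
        if x: "x \<in> rgrade R k" "x \<notin> A" for x k
      proof -
        note e = ext_ideal[OF step(1) x(1)]
        have "A \<subset> ext_ideal A x" using e x(2) by blast
        from step(2)[OF e(1) this] obtain F where F: "finite F" "\<forall>P\<in>F. gprime P \<and> ext_ideal A x \<subseteq> P"
            "\<forall>y\<in>carrier R. (\<forall>P\<in>F. y \<in> P) \<longrightarrow> (\<exists>n::nat. y [^] n \<in> ext_ideal A x)" by blast
        show ?thesis using F e(2) by (intro exI[of _ F] conjI) blast+
      qed
      note ex = this
      obtain F where F: "finite F" "\<forall>P\<in>F. gprime P \<and> A \<subseteq> P" "\<forall>y\<in>carrier R. (\<forall>P\<in>F. y \<in> P) \<longrightarrow> (\<exists>n::nat. y [^] n \<in> ext_ideal A a)"
        using ex[OF ab(1,4)] by blast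
      obtain H where H: "finite H" "\<forall>P\<in>H. gprime P \<and> A \<subseteq> P" "\<forall>y\<in>carrier R. (\<forall>P\<in>H. y \<in> P) \<longrightarrow> (\<exists>n::nat. y [^] n \<in> ext_ideal A b)"
        using ex[OF ab(2,5)] by blast
      have "\<exists>n::nat. y [^] n \<in> A" if y: "y \<in> carrier R" "\<forall>P\<in>F \<union> H. y \<in> P" for y
      proof -
        obtain n :: nat where n: "y [^] n \<in> ext_ideal A a" using F(3) y by blast
        obtain m :: nat where m: "y [^] m \<in> ext_ideal A b" using H(3) y by blast
        obtain c r where c: "y [^] n = c \<oplus> r \<otimes> a" "c \<in> A" "r \<in> carrier R" using n by (auto simp: ext_ideal_def)
        obtain d s where d: "y [^] m = d \<oplus> s \<otimes> b" "d \<in> A" "s \<in> carrier R" using m by (auto simp: ext_ideal_def)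
        have cr: "a \<in> carrier R" "b \<in> carrier R" "c \<in> carrier R" "d \<in> carrier R"
          using ab rgrade_carrier c d AD(1) by blast+
        have "y [^] (n + m) = (c \<oplus> r \<otimes> a) \<otimes> (d \<oplus> s \<otimes> b)" using y(1) c(1) d(1) by (simp add: nat_pow_mult[symmetric])
        also have "\<dots> = c \<otimes> (d \<oplus> s \<otimes> b) \<oplus> (r \<otimes> a) \<otimes> (d \<oplus> s \<otimes> b)" using cr c d by (simp add: l_distr)
        also have "(r \<otimes> a) \<otimes> (d \<oplus> s \<otimes> b) = (r \<otimes> a) \<otimes> d \<oplus> (r \<otimes> s) \<otimes> (a \<otimes> b)"
          using cr c d by (simp add: r_distr m_ac)
        also have "c \<otimes> (d \<oplus> s \<otimes> b) \<oplus> ((r \<otimes> a) \<otimes> d \<oplus> (r \<otimes> s) \<otimes> (a \<otimes> b)) \<in> A"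
        proof (intro AD(3))
          show "c \<otimes> (d \<oplus> s \<otimes> b) \<in> A" using cr c d by (intro AD(5)) auto
          show "(r \<otimes> a) \<otimes> d \<in> A" using cr c d by (intro AD(4)) auto
          show "(r \<otimes> s) \<otimes> (a \<otimes> b) \<in> A" using c d by (intro AD(4)[OF ab(3)]) auto
        qed
        finally show ?thesis by blast
      qed
      then show ?thesis using F H by (intro exI[of _ "F \<union> H"]) auto
    qed
  qed
qed

text \<open>The graded maximal ideal, described by a vanishing component so that membership is a
  computation in degree zero.\<close>

definition mm :: "'a set" where "mm = {a \<in> carrier R. rc 0 a = \<zero>}"

lemma rc0_mult: "r \<in> carrier R \<Longrightarrow> a \<in> carrier R \<Longrightarrow> rc 0 (r \<otimes> a) = rc 0 r \<otimes> rc 0 a"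
proof (induction r rule: dsum_induct)
  case (homog k y)
  have yc: "y \<in> carrier R" by (rule rgrade_carrier[OF homog(1)])
  have "y \<otimes> a = a \<otimes> y" using yc homog by (simp add: m_comm)
  then show ?case
    using rc_mult_homog[OF homog(1,2), of 0] cp_other[OF homog(1), of 0] homog yc
    by (cases "k = 0") (auto simp: m_comm)
qed (auto simp: l_distr cp_add)

lemma mm_gprime: "gprime mm"
  unfolding gprime_def
proof (intro conjI allI ballI impI)
  show "gideal R mm"
    unfolding gideal_def
  proof (intro conjI allI ballI)
    show "ideal mm R" by (rule idealI') (auto simp: mm_def cp_add rc0_mult)
    fix i a assume a: "a \<in> mm"
    then have ac: "a \<in> carrier R" "rc 0 a = \<zero>" by (auto simp: mm_def)
    have "rc 0 (rc i a) = \<zero>" using cp_other[OF cp_in[OF ac(1), of i], of 0] ac by (cases "i = 0") auto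
    then show "rc i a \<in> mm" using ac by (simp add: mm_def)
  qed
  have "\<one> \<noteq> \<zero>" using subfieldE(6)[OF ground_field] by simp
  then show "\<one> \<notin> mm" using rgrade_one by (simp add: mm_def)
  fix i j a b assume a: "a \<in> rgrade R i" and b: "b \<in> rgrade R j" and ab: "a \<otimes> b \<in> mm"
  show "a \<in> mm \<or> b \<in> mm"
  proof (cases "i = 0 \<and> j = 0")
    case True
    then have "rc 0 (a \<otimes> b) = a \<otimes> b" using rgrade_mult[OF a b] by simp
    then have "a \<otimes> b = \<zero>" using ab by (simp add: mm_def)
    then have "a = \<zero> \<or> b = \<zero>" using subfieldE(5)[OF ground_field] a b True by blast
    then show ?thesis by (auto simp: mm_def)
  next
    case False
    then show ?thesis using cp_other[OF a, of 0] cp_other[OF b, of 0] rgrade_carrier[OF a] rgrade_carrier[OF b]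
      by (auto simp: mm_def)
  qed
qed

text \<open>A member with nonzero degree zero component would, by gradedness, yield a unit in the
  prime.\<close>

lemma gprime_mm:
  assumes "gprime P"
  shows "P \<subseteq> mm"
proof
  note PD = idealD[OF gidealD(1)[OF gprimeD(1)[OF assms]]]
  fix c assume c: "c \<in> P"
  have cc: "c \<in> carrier R" by (rule PD(1)[OF c])
  have "rc 0 c = \<zero>"
  proof (rule ccontr)
    assume n: "rc 0 c \<noteq> \<zero>"
    then have "rc 0 c \<in> Units (R\<lparr>carrier := rgrade R 0\<rparr>)"
      using subfield.subfield_Units[OF ground_field] cp_in[OF cc, of 0] by simp
    then obtain b where b: "b \<in> rgrade R 0" "b \<otimes> rc 0 c = \<one>" by (auto simp: Units_def)
    have "b \<otimes> rc 0 c \<in> P" using PD(4) gidealD(2)[OF gprimeD(1)[OF assms] c] rgrade_carrier[OF b(1)] by blast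
    then show False using b(2) gprimeD(2)[OF assms] by simp
  qed
  then show "c \<in> mm" using cc by (simp add: mm_def)
qed

text \<open>Take \<open>x\<close> outside those minimal primes over \<open>A\<close> that miss some element of positive degree. A
  homogeneous prime \<open>Q\<close> over \<open>A + (x)\<close> that misses an element of \<open>S\<close> would be the middle of a
  chain of length \<open>2\<close>.\<close>

lemma parameter_exists:
  assumes A: "gideal R A"
    and dim: "\<And>P0 P1 P2. primeideal P0 R \<Longrightarrow> primeideal P1 R \<Longrightarrow> primeideal P2 R \<Longrightarrow> A \<subseteq> P0 \<Longrightarrow> P0 \<subset> P1 \<Longrightarrow> \<not> P1 \<subset> P2"
  obtains x d where "x \<in> rgrade R d" "0 < d" "\<And>s. s \<in> S \<Longrightarrow> \<exists>n::nat. s [^] n \<in> ext_ideal A x"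
proof -
  obtain F where F: "finite F" "\<forall>P\<in>F. gprime P \<and> A \<subseteq> P" "\<forall>y\<in>carrier R. (\<forall>P\<in>F. y \<in> P) \<longrightarrow> (\<exists>n::nat. y [^] n \<in> A)"
    using gprime_decomp[OF A] by blast
  \<comment> \<open>A prime containing every homogeneous element of positive degree cannot be
    avoided by such an element, so only the others are kept.\<close>
  let ?F = "{P \<in> F. \<exists>z d. z \<in> rgrade R d \<and> 0 < d \<and> z \<notin> P}"
  have "\<exists>x d. x \<in> rgrade R d \<and> 0 < d \<and> (\<forall>P\<in>?F. x \<notin> P)"
    by (rule prime_avoidance) (use F in auto)
  then obtain x d where x: "x \<in> rgrade R d" "0 < d" "\<forall>P\<in>?F. x \<notin> P" by blast
  note e = ext_ideal[OF A x(1)]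
  have "\<exists>n::nat. s [^] n \<in> ext_ideal A x" if s: "s \<in> S" for s
  proof (rule ccontr)
    assume no: "\<not> ?thesis"
    have s1: "s \<in> rgrade R 1" using s S(2) by blast
    have sc: "s \<in> carrier R" by (rule S_carrier[OF s])
    obtain H where H: "\<forall>P\<in>H. gprime P \<and> ext_ideal A x \<subseteq> P" "\<forall>y\<in>carrier R. (\<forall>P\<in>H. y \<in> P) \<longrightarrow> (\<exists>n::nat. y [^] n \<in> ext_ideal A x)"
      using gprime_decomp[OF e(1)] by blast
    obtain Q where Q: "Q \<in> H" "s \<notin> Q" using H(2) sc no by blast
    have gQ: "gprime Q" "ext_ideal A x \<subseteq> Q" using H(1) Q by auto
    \<comment> \<open>Otherwise some homogeneous element of all primes in \<open>F\<close> lies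
      outside \<open>Q\<close>, yet a power of it lies in \<open>A\<close> and hence in
      \<open>Q\<close>.\<close>
    have "\<exists>P\<in>F. P \<subseteq> Q"
    proof (rule ccontr)
      assume "\<not> ?thesis"
      then have "\<exists>y d. y \<in> rgrade R d \<and> y \<notin> Q \<and> (\<forall>P\<in>F. y \<in> P)"
        using F(1,2) gprimeD(1) by (intro prod_avoid[OF gQ(1)]) auto
      then obtain y d where y: "y \<in> rgrade R d" "y \<notin> Q" "\<forall>P\<in>F. y \<in> P" by blast
      then obtain n :: nat where "y [^] n \<in> A" using F(3) rgrade_carrier by blast
      then have "y [^] n \<in> Q" using e(2) gQ(2) by blast
      then show False using gprime_pow[OF gQ(1) y(1)] y(2) by blast
    qed
    then obtain P where P: "P \<in> F" "P \<subseteq> Q" by blast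
    have "s \<notin> P" using P Q by blast
    then have "P \<in> ?F" using P(1) s1 by (auto intro!: exI[of _ s] exI[of _ 1])
    then have "x \<notin> P" using x(3) by blast
    then have PQ: "P \<subset> Q" using P(2) e(3) gQ(2) by blast
    have "s \<in> mm" using sc cp_other[OF s1, of 0] by (simp add: mm_def)
    \<comment> \<open>\<open>s\<close> separates \<open>Q\<close> from the graded maximal ideal,
      which completes the forbidden chain \<open>P\<close>, \<open>Q\<close>,
      \<open>mm\<close>.\<close>
    then have Qm: "Q \<subset> mm" using gprime_mm[OF gQ(1)] Q(2) by blast
    show False using dim[OF _ _ _ _ PQ] Qm gprime_prime gQ(1) mm_gprime F(2) P(1) by blast
  qed
  with x(1,2) that show ?thesis by blast
qed

section \<open>Powers of the irrelevant ideal and monomials in the generators\<close>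

definition GE :: "nat \<Rightarrow> 'a set" where "GE n = {r \<in> carrier R. \<forall>k<n. rc k r = \<zero>}"

lemma GE_mult:
  assumes "u \<in> GE m" "v \<in> GE n"
  shows "u \<otimes> v \<in> GE (m + n)"
proof -
  have u: "u \<in> carrier R" "\<And>k. k < m \<Longrightarrow> rc k u = \<zero>" and v: "v \<in> carrier R" "\<And>k. k < n \<Longrightarrow> rc k v = \<zero>"
    using assms by (auto simp: GE_def)
  have "rc k (u \<otimes> v) = \<zero>" if k: "k < m + n" for k
  proof -
    have "v \<in> {v \<in> carrier R. rc k (u \<otimes> v) = \<zero>}"
    proof (rule cp_closure[OF v(1)])
      fix i
      show "rc i v \<in> {v \<in> carrier R. rc k (u \<otimes> v) = \<zero>}"
      proof (cases "i < n")
        case True then show ?thesis using u v by simp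
      next
        case False
        have "rc k (u \<otimes> rc i v) = \<zero>"
          using rc_mult_homog[OF cp_in[OF v(1), of i] u(1), of k] u(2)[of "k - i"] False k v(1) by auto
        then show ?thesis using v(1) by simp
      qed
    qed (use u in \<open>auto simp: r_distr cp_add\<close>)
    then show ?thesis by simp
  qed
  then show ?thesis using u v by (simp add: GE_def)
qed

lemma irrelevant_GE: "irrelevant_ideal R \<subseteq> GE 1"
proof -
  have "GE 1 = mm" by (auto simp: GE_def mm_def)
  moreover have "irrelevant_ideal R \<subseteq> mm"
    unfolding irrelevant_ideal_def
  proof (rule genideal_minimal[OF gidealD(1)[OF gprimeD(1)[OF mm_gprime]]])
    show "(\<Union>d\<in>{0<..}. rgrade R d) \<subseteq> mm"
      using cp_other rgrade_carrier by (fastforce simp: mm_def)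
  qed
  ultimately show ?thesis by simp
qed

text \<open>One half of the comparison between the adic filtration and the filtration by degree;
  \<open>high_degree_in_ideal\<close> supplies the other.\<close>

lemma irrelevant_pow_GE: "irrelevant_ideal R [^]\<^bsub>ideals_set R\<^esub> n \<subseteq> GE n"
proof (induction n)
  case 0 then show ?case by (auto simp: GE_def ideals_set_def)
next
  case (Suc n)
  show ?case
  proof
    fix r assume "r \<in> irrelevant_ideal R [^]\<^bsub>ideals_set R\<^esub> Suc n"
    then have "r \<in> ideal_prod R (irrelevant_ideal R [^]\<^bsub>ideals_set R\<^esub> n) (irrelevant_ideal R)"
      by (simp add: ideals_set_def)
    then show "r \<in> GE (Suc n)"
    proof (induction rule: ideal_prod.induct)
      case (prod i j)
      then show ?case using GE_mult[of i n j 1] Suc.IH irrelevant_GE by auto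
    qed (auto simp: GE_def cp_add)
  qed
qed

lemma S_irrelevant: "s \<in> S \<Longrightarrow> s \<in> irrelevant_ideal R"
proof -
  assume "s \<in> S"
  then have "s \<in> (\<Union>d\<in>{0<..}. rgrade R d)" using S(2) by auto
  moreover have "(\<Union>d\<in>{0<..}. rgrade R d) \<subseteq> carrier R" using rgrade_carrier by auto
  ultimately show ?thesis unfolding irrelevant_ideal_def using genideal_self by blast
qed

lemma S_pow_irrelevant: "s \<in> S \<Longrightarrow> s [^] n \<in> irrelevant_ideal R [^]\<^bsub>ideals_set R\<^esub> (n::nat)"
proof (induction n)
  case 0 then show ?case by (simp add: ideals_set_def)
next
  case (Suc n)
  then have "s [^] n \<otimes> s \<in> ideal_prod R (irrelevant_ideal R [^]\<^bsub>ideals_set R\<^esub> n) (irrelevant_ideal R)"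
    using S_irrelevant by (intro ideal_prod.prod) auto
  then show ?case by (simp add: ideals_set_def)
qed

text \<open>Words in the generators stand for monomials: multiplication is concatenation, the degree
  is the length, and the exponent of \<open>s\<close> is given by \<open>count_list\<close>.\<close>

definition monom_of :: "'a list \<Rightarrow> 'a" where "monom_of l = foldr (\<otimes>) l \<one>"

definition monos_deg :: "nat \<Rightarrow> 'a set" where
  "monos_deg n = {c \<otimes> monom_of l | c l. c \<in> rgrade R 0 \<and> set l \<subseteq> S \<and> length l = n}"

lemma monom_of_grade: "set l \<subseteq> S \<Longrightarrow> monom_of l \<in> rgrade R (length l)"
proof (induction l)
  case Nil then show ?case by (simp add: monom_of_def rgrade_one)
next
  case (Cons s l) then show ?case using rgrade_mult[of s 1 "monom_of l" "length l"] S(2) by (auto simp: monom_of_def)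
qed

lemma monom_of_append: "set l \<subseteq> S \<Longrightarrow> set l' \<subseteq> S \<Longrightarrow> monom_of (l @ l') = monom_of l \<otimes> monom_of l'"
proof (induction l)
  case Nil then show ?case using rgrade_carrier[OF monom_of_grade, of l'] by (simp add: monom_of_def)
next
  case (Cons s l)
  then show ?case using rgrade_carrier[OF monom_of_grade, of l'] rgrade_carrier[OF monom_of_grade, of l] S_carrier[of s]
    by (simp add: monom_of_def m_assoc)
qed

lemma monos_grade: "x \<in> monos_deg n \<Longrightarrow> x \<in> rgrade R n"
  using rgrade_mult[of _ 0 _ n] monom_of_grade by (force simp: monos_deg_def)

lemma dspan_monos_carrier: "x \<in> dspan R monos_deg \<Longrightarrow> x \<in> carrier R"
  by (induction rule: dspan.induct) (auto dest: monos_grade rgrade_carrier)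

lemma monos_mult: "x \<in> monos_deg m \<Longrightarrow> y \<in> monos_deg n \<Longrightarrow> x \<otimes> y \<in> monos_deg (m + n)"
proof -
  assume "x \<in> monos_deg m" "y \<in> monos_deg n"
  then obtain c l d l' where *: "x = c \<otimes> monom_of l" "c \<in> rgrade R 0" "set l \<subseteq> S" "length l = m"
    "y = d \<otimes> monom_of l'" "d \<in> rgrade R 0" "set l' \<subseteq> S" "length l' = n" by (auto simp: monos_deg_def)
  have "x \<otimes> y = (c \<otimes> d) \<otimes> monom_of (l @ l')"
    using * rgrade_carrier[OF *(2)] rgrade_carrier[OF *(6)] rgrade_carrier[OF monom_of_grade[OF *(3)]]
      rgrade_carrier[OF monom_of_grade[OF *(7)]] by (simp add: monom_of_append m_ac)
  moreover have "c \<otimes> d \<in> rgrade R 0" using rgrade_mult[OF *(2,6)] by simp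
  ultimately show ?thesis unfolding monos_deg_def using * by (intro CollectI exI[of _ "c \<otimes> d"] exI[of _ "l @ l'"]) auto
qed

lemma dspan_monos_mult: "x \<in> dspan R monos_deg \<Longrightarrow> y \<in> dspan R monos_deg \<Longrightarrow> x \<otimes> y \<in> dspan R monos_deg"
proof (induction x rule: dspan.induct)
  case dspan_zero
  then show ?case using dspan_monos_carrier by (simp add: dspan.dspan_zero)
next
  case (dspan_base x m)
  have xc: "x \<in> carrier R" by (rule rgrade_carrier[OF monos_grade[OF dspan_base(1)]])
  from dspan_base(2) show ?case
  proof (induction y rule: dspan.induct)
    case dspan_zero then show ?case using xc by (simp add: dspan.dspan_zero)
  next
    case (dspan_base y n) then show ?case using monos_mult[OF \<open>x \<in> monos_deg m\<close>] dspan.dspan_base by metis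
  next
    case (dspan_add y z) then show ?case using xc dspan_monos_carrier by (simp add: r_distr dspan.dspan_add)
  qed
next
  case (dspan_add x z)
  then show ?case using dspan_monos_carrier by (simp add: l_distr dspan.dspan_add)
qed

text \<open>Induction along \<open>generate_ring\<close>. This converts generation in degree one
  into a statement about degrees: homogeneous elements of degree \<open>n\<close> come from words of
  length \<open>n\<close>.\<close>

lemma dspan_monos_all: "r \<in> carrier R \<Longrightarrow> r \<in> dspan R monos_deg"
proof -
  assume "r \<in> carrier R"
  then have "r \<in> generate_ring R (rgrade R 0 \<union> S)" using gen by simp
  then show ?thesis
  proof (induction rule: generate_ring.induct)
    have ground: "c \<in> dspan R monos_deg" if "c \<in> rgrade R 0" for c
    proof -
      have "c \<otimes> monom_of [] \<in> monos_deg 0" using that by (auto simp: monos_deg_def)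
      then show ?thesis using that rgrade_carrier by (auto simp: monom_of_def intro: dspan.dspan_base)
    qed
    {
      case one then show ?case using ground[OF rgrade_one] .
    next
      case (incl h)
      then show ?case
      proof
        assume "h \<in> S"
        then have "\<one> \<otimes> monom_of [h] \<in> monos_deg 1" using rgrade_one by (force simp: monos_deg_def)
        then show ?thesis using \<open>h \<in> S\<close> S_carrier by (auto simp: monom_of_def intro: dspan.dspan_base)
      qed (rule ground)
    next
      case (a_inv h)
      have "(\<ominus> \<one>) \<otimes> h \<in> dspan R monos_deg" by (intro dspan_monos_mult ground D_inv rgrade_one a_inv)
      then show ?case using dspan_monos_carrier[OF a_inv.IH] by (simp add: l_minus)
    next
      case (eng_add h1 h2) then show ?case by (intro dspan.dspan_add)
    next
      case (eng_mult h1 h2) then show ?case by (intro dspan_monos_mult)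
    }
  qed
qed

lemma monom_of_count:
  assumes "set l \<subseteq> S" "s \<in> S"
  shows "\<exists>r\<in>carrier R. monom_of l = s [^] (count_list l s) \<otimes> r"
  using assms(1)
proof (induction l)
  case Nil then show ?case by (auto simp: monom_of_def)
next
  case (Cons t l)
  then obtain r where r: "r \<in> carrier R" "monom_of l = s [^] (count_list l s) \<otimes> r" by auto
  have tc: "t \<in> carrier R" "s \<in> carrier R" using Cons.prems assms(2) S_carrier by auto
  have e: "monom_of (t # l) = t \<otimes> (s [^] (count_list l s) \<otimes> r)" using r by (simp add: monom_of_def)
  show ?case
  proof (cases "t = s")
    case True
    then show ?thesis using e r tc by (intro bexI[of _ r]) (auto simp: m_ac)
  next
    case False
    then show ?thesis using e r tc by (intro bexI[of _ "t \<otimes> r"]) (auto simp: m_ac)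
  qed
qed

text \<open>Pigeonhole: a word in \<open>S\<close> longer than the sum of the exponents
  \<open>p s\<close> contains some \<open>s\<close> at least \<open>p s\<close> times. Elements of
  larger degree are combinations of such words.\<close>

lemma high_degree_in_ideal:
  assumes J: "ideal J R" and p: "\<And>s. s \<in> S \<Longrightarrow> s [^] (p s :: nat) \<in> J"
  shows "GE (Suc (\<Sum>s\<in>S. p s)) \<subseteq> J"
proof
  note JD = idealD[OF J]
  let ?N = "\<Sum>s\<in>S. p s"
  have mon: "x \<in> J" if x: "x \<in> monos_deg n" "?N < n" for x n
  proof -
    obtain c l where *: "x = c \<otimes> monom_of l" "c \<in> rgrade R 0" "set l \<subseteq> S" "length l = n" using x by (auto simp: monos_deg_def)
    have "\<exists>s\<in>S. p s \<le> count_list l s"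
    proof (rule ccontr)
      assume "\<not> ?thesis"
      then have "(\<Sum>s\<in>S. count_list l s) \<le> ?N" by (intro sum_mono) (simp add: not_le less_imp_le)
      moreover have "(\<Sum>s\<in>S. count_list l s) = length l" using sum_count_set[OF *(3) S(1)] .
      ultimately show False using x(2) *(4) by simp
    qed
    then obtain s where s: "s \<in> S" "p s \<le> count_list l s" by blast
    obtain r where r: "r \<in> carrier R" "monom_of l = s [^] (count_list l s) \<otimes> r" using monom_of_count[OF *(3) s(1)] by blast
    have sc: "s \<in> carrier R" by (rule S_carrier[OF s(1)])
    have "s [^] (count_list l s) = s [^] (p s) \<otimes> s [^] (count_list l s - p s)" using s(2) sc by (simp add: nat_pow_mult)
    then have "monom_of l \<in> J" using r p[OF s(1)] sc JD(5) by simp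
    then show ?thesis using * rgrade_carrier JD(4) by simp
  qed
  have comp: "rc k x \<in> J" if "x \<in> dspan R monos_deg" "?N < k" for x k
    using that(1)
  proof (induction rule: dspan.induct)
    case (dspan_base x n)
    then show ?case using mon[of x n] that(2) cp_other[OF monos_grade[OF dspan_base], of k] monos_grade[OF dspan_base] JD(2)
      by (cases "k = n") auto
  next
    case (dspan_add x y)
    then show ?case using JD(3) dspan_monos_carrier by (simp add: cp_add)
  qed (use JD in simp)
  fix r assume r: "r \<in> GE (Suc ?N)"
  then have rcr: "r \<in> carrier R" by (simp add: GE_def)
  show "r \<in> J"
  proof (rule cp_closure[OF rcr])
    fix k show "rc k r \<in> J"
      using comp[OF dspan_monos_all[OF rcr], of k] r JD(2) by (cases "?N < k") (auto simp: GE_def)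
  qed (use JD in auto)
qed

section \<open>Torsion with respect to the irrelevant ideal\<close>

lemma annihilator_of_ideal:
  assumes "graded_module R M" "v \<in> carrier M"
  shows "ideal {r \<in> carrier R. r \<odot>\<^bsub>M\<^esub> v = \<zero>\<^bsub>M\<^esub>} R"
proof -
  interpret M: graded_mod R M by (rule graded_modI) fact
  show ?thesis using assms(2) by (intro idealI') (auto simp: M.smult_l_distr M.smult_assoc1)
qed

text \<open>Powers of an ideal are replaced by powers of finitely many generators. If powers of all
  generators kill \<open>v\<close>, so do all elements of high degree, and a high power of the
  irrelevant ideal consists of such elements.\<close>

lemma torsion_iff:
  assumes M: "graded_module R M"
  shows "v \<in> torsion_set R M \<longleftrightarrow> v \<in> carrier M \<and> (\<forall>s\<in>S. \<exists>n::nat. s [^] n \<odot>\<^bsub>M\<^esub> v = \<zero>\<^bsub>M\<^esub>)"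
proof
  assume "v \<in> torsion_set R M"
  then show "v \<in> carrier M \<and> (\<forall>s\<in>S. \<exists>n::nat. s [^] n \<odot>\<^bsub>M\<^esub> v = \<zero>\<^bsub>M\<^esub>)"
    using S_pow_irrelevant unfolding torsion_set_def by blast
next
  assume *: "v \<in> carrier M \<and> (\<forall>s\<in>S. \<exists>n::nat. s [^] n \<odot>\<^bsub>M\<^esub> v = \<zero>\<^bsub>M\<^esub>)"
  then obtain p where p: "\<forall>s\<in>S. s [^] (p s :: nat) \<odot>\<^bsub>M\<^esub> v = \<zero>\<^bsub>M\<^esub>" using bchoice[of S "\<lambda>s n. s [^] (n::nat) \<odot>\<^bsub>M\<^esub> v = \<zero>\<^bsub>M\<^esub>"] by blast
  have "GE (Suc (\<Sum>s\<in>S. p s)) \<subseteq> {r \<in> carrier R. r \<odot>\<^bsub>M\<^esub> v = \<zero>\<^bsub>M\<^esub>}"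
    using * p S_carrier by (intro high_degree_in_ideal annihilator_of_ideal[OF M]) auto
  then have "irrelevant_ideal R [^]\<^bsub>ideals_set R\<^esub> (Suc (\<Sum>s\<in>S. p s)) \<subseteq> {r \<in> carrier R. r \<odot>\<^bsub>M\<^esub> v = \<zero>\<^bsub>M\<^esub>}"
    using irrelevant_pow_GE by blast
  then show "v \<in> torsion_set R M" unfolding torsion_set_def using * by blast
qed

lemma pow_smult_zero_mono:
  assumes M: "graded_module R M" and v: "v \<in> carrier M" and s: "s \<in> carrier R" and z: "s [^] (n::nat) \<odot>\<^bsub>M\<^esub> v = \<zero>\<^bsub>M\<^esub>" and "n \<le> m"
  shows "s [^] m \<odot>\<^bsub>M\<^esub> v = \<zero>\<^bsub>M\<^esub>"
proof -
  interpret M: graded_mod R M by (rule graded_modI) fact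
  have "s [^] m = s [^] (m - n) \<otimes> s [^] n" using s \<open>n \<le> m\<close> by (simp add: nat_pow_mult)
  then show ?thesis using v s z by (simp add: M.smult_assoc1)
qed

lemma mcp_smult:
  assumes M: "graded_module R M" and r: "r \<in> rgrade R a" and v: "v \<in> carrier M"
  shows "mcp M (int a + j) (r \<odot>\<^bsub>M\<^esub> v) = r \<odot>\<^bsub>M\<^esub> mcp M j v"
proof -
  interpret M: graded_mod R M by (rule graded_modI) fact
  show ?thesis
    using dsum_additive_comp[OF M.dsum_axioms M.dsum_axioms, of "\<lambda>v. r \<odot>\<^bsub>M\<^esub> v" "\<lambda>j. int a + j" v j]
      rgrade_carrier[OF r] M.grade_smult[OF r] v
    by (auto simp: M.smult_r_distr inj_on_def)
qed

lemma torsion_gsubmod: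
  assumes M: "graded_module R M"
  shows "gsubmod R M (torsion_set R M)"
proof -
  interpret M: graded_mod R M by (rule graded_modI) fact
  show ?thesis
  proof (rule gsubmodI)
    show "torsion_set R M \<subseteq> carrier M" by (auto simp: torsion_iff[OF M])
    show "\<zero>\<^bsub>M\<^esub> \<in> torsion_set R M" using S_carrier by (auto simp: torsion_iff[OF M])
  next
    fix x y assume x: "x \<in> torsion_set R M" and y: "y \<in> torsion_set R M"
    show "x \<oplus>\<^bsub>M\<^esub> y \<in> torsion_set R M"
      unfolding torsion_iff[OF M]
    proof (intro conjI ballI)
      show "x \<oplus>\<^bsub>M\<^esub> y \<in> carrier M" using x y by (auto simp: torsion_iff[OF M])
      fix s assume s: "s \<in> S"
      obtain n :: nat where n: "s [^] n \<odot>\<^bsub>M\<^esub> x = \<zero>\<^bsub>M\<^esub>" "x \<in> carrier M"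
        using x s by (auto simp: torsion_iff[OF M])
      obtain m :: nat where m: "s [^] m \<odot>\<^bsub>M\<^esub> y = \<zero>\<^bsub>M\<^esub>" "y \<in> carrier M"
        using y s by (auto simp: torsion_iff[OF M])
      from n m have "s [^] max n m \<odot>\<^bsub>M\<^esub> (x \<oplus>\<^bsub>M\<^esub> y) = \<zero>\<^bsub>M\<^esub>"
        using pow_smult_zero_mono[OF M, of x s n "max n m"] pow_smult_zero_mono[OF M, of y s m "max n m"] S_carrier[OF s]
        by (simp add: M.smult_r_distr)
      then show "\<exists>n::nat. s [^] n \<odot>\<^bsub>M\<^esub> (x \<oplus>\<^bsub>M\<^esub> y) = \<zero>\<^bsub>M\<^esub>" by blast
    qed
  next
    fix r x assume r: "r \<in> carrier R" and x: "x \<in> torsion_set R M"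
    show "r \<odot>\<^bsub>M\<^esub> x \<in> torsion_set R M"
      unfolding torsion_iff[OF M]
    proof (intro conjI ballI)
      show "r \<odot>\<^bsub>M\<^esub> x \<in> carrier M" using x r by (auto simp: torsion_iff[OF M])
      fix s assume s: "s \<in> S"
      obtain n :: nat where n: "s [^] n \<odot>\<^bsub>M\<^esub> x = \<zero>\<^bsub>M\<^esub>" "x \<in> carrier M" using x s by (auto simp: torsion_iff[OF M])
      have "s [^] n \<odot>\<^bsub>M\<^esub> (r \<odot>\<^bsub>M\<^esub> x) = (s [^] n \<otimes> r) \<odot>\<^bsub>M\<^esub> x" using n r S_carrier[OF s] by (simp add: M.smult_assoc1)
      also have "\<dots> = (r \<otimes> s [^] n) \<odot>\<^bsub>M\<^esub> x" using r S_carrier[OF s] by (simp add: m_comm)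
      also have "\<dots> = \<zero>\<^bsub>M\<^esub>" using n r S_carrier[OF s] by (simp add: M.smult_assoc1)
      finally show "\<exists>n::nat. s [^] n \<odot>\<^bsub>M\<^esub> (r \<odot>\<^bsub>M\<^esub> x) = \<zero>\<^bsub>M\<^esub>" by blast
    qed
  next
    fix i x assume x: "x \<in> torsion_set R M"
    show "mcp M i x \<in> torsion_set R M"
      unfolding torsion_iff[OF M]
    proof (intro conjI ballI)
      show "mcp M i x \<in> carrier M" using x by (auto simp: torsion_iff[OF M])
      fix s assume s: "s \<in> S"
      obtain n :: nat where n: "s [^] n \<odot>\<^bsub>M\<^esub> x = \<zero>\<^bsub>M\<^esub>" "x \<in> carrier M" using x s by (auto simp: torsion_iff[OF M])
      have "s \<in> rgrade R 1" using s S(2) by blast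
      from mcp_smult[OF M rgrade_pow[OF this, of n] n(2), of i]
      have "s [^] n \<odot>\<^bsub>M\<^esub> mcp M i x = \<zero>\<^bsub>M\<^esub>" using n by simp
      then show "\<exists>n::nat. s [^] n \<odot>\<^bsub>M\<^esub> mcp M i x = \<zero>\<^bsub>M\<^esub>" by blast
    qed
  qed
qed

lemma torsion_hom:
  assumes M: "graded_module R M" and N: "graded_module R N" and f: "f \<in> graded_hom R M N" and v: "v \<in> torsion_set R M"
  shows "f v \<in> torsion_set R N"
  unfolding torsion_iff[OF N]
proof (intro conjI ballI)
  have vc: "v \<in> carrier M" using v by (simp add: torsion_iff[OF M])
  show "f v \<in> carrier N" by (rule hom_closed[OF f vc])
  fix s assume s: "s \<in> S"
  obtain n :: nat where n: "s [^] n \<odot>\<^bsub>M\<^esub> v = \<zero>\<^bsub>M\<^esub>" using v s by (auto simp: torsion_iff[OF M])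
  have "s [^] n \<odot>\<^bsub>N\<^esub> f v = f (s [^] n \<odot>\<^bsub>M\<^esub> v)" using hom_smult[OF f _ vc] S_carrier[OF s] by simp
  then have "s [^] n \<odot>\<^bsub>N\<^esub> f v = \<zero>\<^bsub>N\<^esub>" using n hom_zero[OF M N f] by simp
  then show "\<exists>n::nat. s [^] n \<odot>\<^bsub>N\<^esub> f v = \<zero>\<^bsub>N\<^esub>" by blast
qed

end

section \<open>Vanishing for modules of dimension at most one\<close>

lemma smult_hom_mcp:
  assumes "graded_ring R" "graded_module R M" "x \<in> grade M j" "r \<in> carrier R"
  shows "mcp M (int i + j) (r \<odot>\<^bsub>M\<^esub> x) = gcomp R (rgrade R) i r \<odot>\<^bsub>M\<^esub> x"
proof -
  interpret graded_ring R by fact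
  show ?thesis
    using hom_mcp[OF shift_ring_graded(1) assms(2) smult_hom[OF assms(2,3)], of r "int i + j"]
      shift_ring_graded(2)[of r j "int i + j"] assms(4) by simp
qed

text \<open>Torsion for the ideal generated by \<open>Y\<close>, expressed on the generators;
  \<open>Y = S\<close> gives \<open>torsion_set\<close> by \<open>torsion_iff\<close>. General
  \<open>Y\<close> allows adjoining elements one at a time.\<close>

definition tset :: "'r gring \<Rightarrow> ('r, 'b) gmodule \<Rightarrow> 'r set \<Rightarrow> 'b set" where
  "tset R M Y = {v \<in> carrier M. \<forall>y\<in>Y. \<exists>n::nat. y [^]\<^bsub>R\<^esub> n \<odot>\<^bsub>M\<^esub> v = \<zero>\<^bsub>M\<^esub>}"

context std_graded
begin

text \<open>Baer's condition for the ideal \<open>Ann v + (y\<^sup>c\<^sup>+\<^sup>e)\<close>, where \<open>e\<close> is chosen such that the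
  ascending chain of the ideals \<open>Ann (y\<^sup>n v)\<close> is stationary from \<open>e\<close> on.\<close>

lemma divisible_mod_torsion:
  fixes c :: nat
  assumes E: "graded_module R E" and inj: "baer_inj R E" and v: "v \<in> grade E j" and y: "y \<in> rgrade R d"
  obtains v' and e :: nat where "v' \<in> grade E (j - int (c * d))"
    "y [^] (c + e) \<odot>\<^bsub>E\<^esub> v' = y [^] e \<odot>\<^bsub>E\<^esub> v"
    "\<And>r. r \<in> carrier R \<Longrightarrow> r \<odot>\<^bsub>E\<^esub> v = \<zero>\<^bsub>E\<^esub> \<Longrightarrow> r \<odot>\<^bsub>E\<^esub> v' = \<zero>\<^bsub>E\<^esub>"
proof -
  interpret E: graded_mod R E by (rule graded_modI) fact
  have vc: "v \<in> carrier E" using v by (rule E.D_carrier)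
  have yc: "y \<in> carrier R" using y by (rule rgrade_carrier)
  define b where "b = {r \<in> carrier R. r \<odot>\<^bsub>E\<^esub> v = \<zero>\<^bsub>E\<^esub>}"
  have gb: "gideal R b"
    unfolding gideal_def
  proof (intro conjI allI ballI)
    show "ideal b R" unfolding b_def by (rule annihilator_of_ideal[OF E vc])
    fix i r assume r: "r \<in> b"
    then show "rc i r \<in> b"
      using smult_hom_mcp[OF graded_ring_axioms E v, of r i] by (simp add: b_def)
  qed
  note bD = idealD[OF gidealD(1)[OF gb]]
  obtain e :: nat where e: "\<And>n r. r \<in> carrier R \<Longrightarrow> y [^] (n + e) \<otimes> r \<in> b \<Longrightarrow> y [^] e \<otimes> r \<in> b"
    by (rule colon_stable[OF gidealD(1)[OF gb] yc]) blast
  define p where "p = y [^] (c + e)"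
  define D where "D = (c + e) * d"
  have p: "p \<in> rgrade R D" unfolding p_def D_def by (rule rgrade_pow[OF y])
  have pc: "p \<in> carrier R" by (rule rgrade_carrier[OF p])
  define A where "A = ext_ideal b p"
  have gA: "gideal R A" unfolding A_def by (rule ext_ideal(1)[OF gb p])
  have AI: "s \<oplus> r \<otimes> p \<in> A" if "s \<in> b" "r \<in> carrier R" for s r using that by (auto simp: A_def ext_ideal_def)
  have AE: "\<exists>s r. a = s \<oplus> r \<otimes> p \<and> s \<in> b \<and> r \<in> carrier R" if "a \<in> A" for a using that by (auto simp: A_def ext_ideal_def)
  \<comment> \<open>\<open>g\<close> is to act as division of \<open>v\<close> by \<open>y^c\<close>
    on this ideal: \<open>s + r p\<close> goes to \<open>y^e r v\<close>.\<close>
  define g where "g a = (THE w. \<exists>s r. a = s \<oplus> r \<otimes> p \<and> s \<in> b \<and> r \<in> carrier R \<and> w = (y [^] e \<otimes> r) \<odot>\<^bsub>E\<^esub> v)" for a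
  \<comment> \<open>The choice of \<open>e\<close> enters here: a difference of coefficients that
    annihilates \<open>v\<close> after multiplication by \<open>y^(c+e)\<close> does so already
    after multiplication by \<open>y^e\<close>.\<close>
  have uniq: "(y [^] e \<otimes> r) \<odot>\<^bsub>E\<^esub> v = (y [^] e \<otimes> r') \<odot>\<^bsub>E\<^esub> v"
    if "s \<oplus> r \<otimes> p = s' \<oplus> r' \<otimes> p" "s \<in> b" "r \<in> carrier R" "s' \<in> b" "r' \<in> carrier R" for s r s' r'
  proof -
    have sc: "s \<in> carrier R" "s' \<in> carrier R" using that bD(1) by auto
    have "p \<otimes> (r \<ominus> r') = \<ominus> s \<oplus> ((s \<oplus> r \<otimes> p) \<oplus> \<ominus> (r' \<otimes> p))"
      using sc that(3,5) pc by (simp add: minus_eq r_distr r_minus m_comm a_assoc r_neg1)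
    also have "\<dots> = \<ominus> s \<oplus> s'" unfolding that(1) using sc that(3,5) pc by (simp add: a_assoc r_neg)
    also have "\<dots> \<in> b" using that bD by auto
    finally have "y [^] e \<otimes> (r \<ominus> r') \<in> b" using e[of "r \<ominus> r'" c] that(3,5) unfolding p_def by simp
    then have "(y [^] e \<otimes> (r \<ominus> r')) \<odot>\<^bsub>E\<^esub> v = \<zero>\<^bsub>E\<^esub>" by (simp add: b_def)
    then have "(y [^] e \<otimes> r) \<odot>\<^bsub>E\<^esub> v \<ominus>\<^bsub>E\<^esub> (y [^] e \<otimes> r') \<odot>\<^bsub>E\<^esub> v = \<zero>\<^bsub>E\<^esub>"
      using that(3,5) yc vc by (simp add: minus_eq r_distr r_minus E.smult_l_distr E.smult_l_minus E.M.minus_eq)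
    then show ?thesis using E.M.minus_zero_iff that(3,5) yc vc by simp
  qed
  have gI: "g (s \<oplus> r \<otimes> p) = (y [^] e \<otimes> r) \<odot>\<^bsub>E\<^esub> v" if sr: "s \<in> b" "r \<in> carrier R" for s r
    unfolding g_def
  proof (rule the_equality)
    show "\<exists>s' r'. s \<oplus> r \<otimes> p = s' \<oplus> r' \<otimes> p \<and> s' \<in> b \<and> r' \<in> carrier R \<and> (y [^] e \<otimes> r) \<odot>\<^bsub>E\<^esub> v = (y [^] e \<otimes> r') \<odot>\<^bsub>E\<^esub> v"
      using sr by (intro exI[of _ s] exI[of _ r]) simp
    fix w assume "\<exists>s' r'. s \<oplus> r \<otimes> p = s' \<oplus> r' \<otimes> p \<and> s' \<in> b \<and> r' \<in> carrier R \<and> w = (y [^] e \<otimes> r') \<odot>\<^bsub>E\<^esub> v"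
    then obtain s' r' where "s \<oplus> r \<otimes> p = s' \<oplus> r' \<otimes> p" "s' \<in> b" "r' \<in> carrier R" "w = (y [^] e \<otimes> r') \<odot>\<^bsub>E\<^esub> v" by (elim exE conjE)
    then show "w = (y [^] e \<otimes> r) \<odot>\<^bsub>E\<^esub> v" using uniq[of s r s' r'] sr by simp
  qed
  obtain v' where v': "v' \<in> grade E (j - int (c * d))" "\<And>a. a \<in> A \<Longrightarrow> g a = a \<odot>\<^bsub>E\<^esub> v'"
  proof (rule baer_injD[OF inj gA, of g "j - int (c * d)"])
    fix a assume "a \<in> A"
    then obtain s r where a: "a = s \<oplus> r \<otimes> p" "s \<in> b" "r \<in> carrier R" using AE by blast
    show "g a \<in> carrier E" unfolding a(1) gI[OF a(2,3)] using a yc vc by simp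
    {
      fix a' assume "a' \<in> A"
      then obtain s' r' where a': "a' = s' \<oplus> r' \<otimes> p" "s' \<in> b" "r' \<in> carrier R" using AE by blast
      have sc: "s \<in> carrier R" "s' \<in> carrier R" using a(2) a'(2) bD(1) by auto
      have "a \<oplus> a' = (s \<oplus> s') \<oplus> (r \<oplus> r') \<otimes> p" using a a' sc pc by (simp add: l_distr a_ac)
      then have "g (a \<oplus> a') = (y [^] e \<otimes> (r \<oplus> r')) \<odot>\<^bsub>E\<^esub> v" using gI[OF bD(3)[OF a(2) a'(2)], of "r \<oplus> r'"] a a' by simp
      then show "g (a \<oplus> a') = g a \<oplus>\<^bsub>E\<^esub> g a'"
        unfolding a(1) a'(1) gI[OF a(2,3)] gI[OF a'(2,3)] using a(3) a'(3) yc vc by (simp add: r_distr E.smult_l_distr)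
    }
    {
      fix q assume q: "q \<in> carrier R"
      have sc: "s \<in> carrier R" using a(2) bD(1) by auto
      have "q \<otimes> a = q \<otimes> s \<oplus> (q \<otimes> r) \<otimes> p" using a q sc pc by (simp add: r_distr m_assoc)
      then have "g (q \<otimes> a) = (y [^] e \<otimes> (q \<otimes> r)) \<odot>\<^bsub>E\<^esub> v" using gI[OF bD(4)[OF a(2) q], of "q \<otimes> r"] a q by simp
      also have "y [^] e \<otimes> (q \<otimes> r) = q \<otimes> (y [^] e \<otimes> r)" using a q yc by (simp add: m_lcomm)
      finally show "g (q \<otimes> a) = q \<odot>\<^bsub>E\<^esub> g a"
        unfolding a(1) gI[OF a(2,3)] using a q yc vc by (simp add: E.smult_assoc1)
    }
    fix i assume ai: "a \<in> rgrade R i"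
    have sc: "s \<in> carrier R" using a(2) bD(1) by auto
    \<comment> \<open>For homogeneous \<open>a\<close> the coefficient may be replaced by its
      component of the fitting degree, which is zero when \<open>i < D\<close>.\<close>
    define r' where "r' = (if D \<le> i then rc (i - D) r else \<zero>)"
    have "a = rc i a" using ai by simp
    also have "\<dots> = rc i s \<oplus> r' \<otimes> p" unfolding a(1) using sc a(3) pc by (simp add: cp_add rc_mult_homog[OF p] r'_def)
    finally have a': "a = rc i s \<oplus> r' \<otimes> p" .
    have r'c: "r' \<in> carrier R" using a(3) by (simp add: r'_def)
    have ga: "g a = (y [^] e \<otimes> r') \<odot>\<^bsub>E\<^esub> v" by (subst a') (rule gI[OF gidealD(2)[OF gb a(2)] r'c])
    show "g a \<in> grade E (int i + (j - int (c * d)))"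
    proof (cases "D \<le> i")
      case True
      then have "r' \<in> rgrade R (i - D)" using a(3) cp_in by (simp add: r'_def)
      then have "(y [^] e \<otimes> r') \<odot>\<^bsub>E\<^esub> v \<in> grade E (int (e * d + (i - D)) + j)"
        by (intro E.grade_smult rgrade_mult rgrade_pow y v)
      moreover have "int (e * d + (i - D)) + j = int i + (j - int (c * d))"
        using True by (simp add: D_def of_nat_diff algebra_simps)
      ultimately show ?thesis unfolding ga by (simp only:)
    next
      case False
      then have "g a = \<zero>\<^bsub>E\<^esub>" using ga yc vc by (simp add: r'_def)
      then show ?thesis by simp
    qed
  qed blast
  have "\<zero> \<oplus> \<one> \<otimes> p = p" using pc by simp
  then have "p \<odot>\<^bsub>E\<^esub> v' = y [^] e \<odot>\<^bsub>E\<^esub> v"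
    using v'(2)[OF AI[OF bD(2) one_closed]] gI[OF bD(2) one_closed] yc by simp
  moreover have "r \<odot>\<^bsub>E\<^esub> v' = \<zero>\<^bsub>E\<^esub>" if r: "r \<in> carrier R" "r \<odot>\<^bsub>E\<^esub> v = \<zero>\<^bsub>E\<^esub>" for r
  proof -
    have rb: "r \<in> b" using r by (simp add: b_def)
    have "r \<oplus> \<zero> \<otimes> p = r" using r pc by simp
    then show ?thesis using v'(2)[OF AI[OF rb zero_closed]] gI[OF rb zero_closed] yc vc by simp
  qed
  ultimately show ?thesis using that[of v' e] v'(1) by (simp add: p_def)
qed

lemma tset_smult:
  assumes M: "graded_module R M" and Y: "Y \<subseteq> carrier R" and v: "v \<in> tset R M Y" and r: "r \<in> carrier R"
  shows "r \<odot>\<^bsub>M\<^esub> v \<in> tset R M Y"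
proof -
  interpret M: graded_mod R M by (rule graded_modI) fact
  have "\<exists>n::nat. y [^] n \<odot>\<^bsub>M\<^esub> (r \<odot>\<^bsub>M\<^esub> v) = \<zero>\<^bsub>M\<^esub>" if y: "y \<in> Y" for y
  proof -
    obtain n :: nat where n: "y [^] n \<odot>\<^bsub>M\<^esub> v = \<zero>\<^bsub>M\<^esub>" "v \<in> carrier M" using v y by (auto simp: tset_def)
    have yc: "y \<in> carrier R" using y Y by blast
    have "y [^] n \<odot>\<^bsub>M\<^esub> (r \<odot>\<^bsub>M\<^esub> v) = (y [^] n \<otimes> r) \<odot>\<^bsub>M\<^esub> v" using n r yc by (simp add: M.smult_assoc1)
    also have "y [^] n \<otimes> r = r \<otimes> y [^] n" using r yc by (simp add: m_comm)
    also have "\<dots> \<odot>\<^bsub>M\<^esub> v = \<zero>\<^bsub>M\<^esub>" using n r yc by (simp add: M.smult_assoc1)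
    finally show ?thesis by blast
  qed
  then show ?thesis using v r by (auto simp: tset_def)
qed

lemma tset_minus:
  assumes M: "graded_module R M" and Y: "Y \<subseteq> carrier R" and v: "v \<in> tset R M Y" "w \<in> tset R M Y"
  shows "v \<ominus>\<^bsub>M\<^esub> w \<in> tset R M Y"
proof -
  interpret M: graded_mod R M by (rule graded_modI) fact
  have c: "v \<in> carrier M" "w \<in> carrier M" using v by (auto simp: tset_def)
  have "\<exists>n::nat. y [^] n \<odot>\<^bsub>M\<^esub> (v \<ominus>\<^bsub>M\<^esub> w) = \<zero>\<^bsub>M\<^esub>" if y: "y \<in> Y" for y
  proof -
    have yc: "y \<in> carrier R" using y Y by blast
    obtain n :: nat where n: "y [^] n \<odot>\<^bsub>M\<^esub> v = \<zero>\<^bsub>M\<^esub>" using v y by (auto simp: tset_def)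
    obtain m :: nat where m: "y [^] m \<odot>\<^bsub>M\<^esub> w = \<zero>\<^bsub>M\<^esub>" using v y by (auto simp: tset_def)
    have "y [^] max n m \<odot>\<^bsub>M\<^esub> (v \<ominus>\<^bsub>M\<^esub> w) = \<zero>\<^bsub>M\<^esub>"
      using pow_smult_zero_mono[OF M c(1) yc n, of "max n m"] pow_smult_zero_mono[OF M c(2) yc m, of "max n m"] c yc
      by (simp add: M.M.minus_eq M.smult_r_distr M.smult_r_minus)
    then show ?thesis by blast
  qed
  then show ?thesis using c by (auto simp: tset_def)
qed

lemma tset_hom:
  assumes M: "graded_module R M" and N: "graded_module R N" and f: "f \<in> graded_hom R M N" and Y: "Y \<subseteq> carrier R" and v: "v \<in> tset R M Y"
  shows "f v \<in> tset R N Y"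
proof -
  have vc: "v \<in> carrier M" using v by (simp add: tset_def)
  have "\<exists>n::nat. y [^] n \<odot>\<^bsub>N\<^esub> f v = \<zero>\<^bsub>N\<^esub>" if y: "y \<in> Y" for y
  proof -
    obtain n :: nat where n: "y [^] n \<odot>\<^bsub>M\<^esub> v = \<zero>\<^bsub>M\<^esub>" using v y by (auto simp: tset_def)
    have yc: "y \<in> carrier R" using y Y by blast
    have "y [^] n \<odot>\<^bsub>N\<^esub> f v = f (y [^] n \<odot>\<^bsub>M\<^esub> v)" using hom_smult[OF f _ vc] yc by simp
    then show ?thesis using n hom_zero[OF M N f] by auto
  qed
  then show ?thesis using hom_closed[OF f vc] by (auto simp: tset_def)
qed

text \<open>As \<open>y\<close> has positive degree, its powers eventually pass the threshold of
  \<open>high_degree_in_ideal\<close>.\<close>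

lemma torsion_kill:
  assumes M: "graded_module R M" and v: "v \<in> torsion_set R M" and y: "y \<in> rgrade R d" "0 < d"
  shows "\<exists>n::nat. y [^] n \<odot>\<^bsub>M\<^esub> v = \<zero>\<^bsub>M\<^esub>"
proof -
  have vc: "v \<in> carrier M" and "\<forall>s\<in>S. \<exists>n::nat. s [^] n \<odot>\<^bsub>M\<^esub> v = \<zero>\<^bsub>M\<^esub>" using v by (auto simp: torsion_iff[OF M])
  then obtain p where p: "\<forall>s\<in>S. s [^] (p s :: nat) \<odot>\<^bsub>M\<^esub> v = \<zero>\<^bsub>M\<^esub>"
    using bchoice[of S "\<lambda>s n. s [^] (n::nat) \<odot>\<^bsub>M\<^esub> v = \<zero>\<^bsub>M\<^esub>"] by blast
  let ?N = "Suc (\<Sum>s\<in>S. p s)"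
  have G: "GE ?N \<subseteq> {r \<in> carrier R. r \<odot>\<^bsub>M\<^esub> v = \<zero>\<^bsub>M\<^esub>}"
    using vc p S_carrier by (intro high_degree_in_ideal annihilator_of_ideal[OF M]) auto
  have yN: "y [^] ?N \<in> rgrade R (?N * d)" by (rule rgrade_pow[OF y(1)])
  have "rc k (y [^] ?N) = \<zero>" if "k < ?N" for k
  proof (rule cp_other[OF yN])
    have "?N \<le> ?N * d" using y(2) by (cases d) auto
    then show "k \<noteq> ?N * d" using that by linarith
  qed
  then have "y [^] ?N \<in> GE ?N" using rgrade_carrier[OF yN] unfolding GE_def by blast
  then show ?thesis using G by blast
qed

text \<open>The binomial argument without binomial coefficients: one factor of the power is split
  into \<open>a\<close> and \<open>b\<close>, and each of the two resulting terms lowers one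
  exponent.\<close>

lemma ideal_pow_add:
  assumes J: "ideal J R" and a: "a \<in> carrier R" "b \<in> carrier R"
  shows "c \<in> carrier R \<Longrightarrow> a [^] (p::nat) \<otimes> c \<in> J \<Longrightarrow> b [^] (q::nat) \<otimes> c \<in> J \<Longrightarrow> (a \<oplus> b) [^] (p + q) \<otimes> c \<in> J"
proof (induction "p + q" arbitrary: p q c)
  case 0
  then show ?case by simp
next
  case (Suc n)
  note JD = idealD[OF J]
  consider "p = 0" | "q = 0" | p' q' where "p = Suc p'" "q = Suc q'" by (cases p; cases q) auto
  then show ?case
  proof cases
    case 1
    then have "c \<in> J" using Suc.prems by simp
    then show ?thesis using JD(4) a by simp
  next
    case 2
    then have "c \<in> J" using Suc.prems by simp
    then show ?thesis using JD(4) a by simp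
  next
    case 3
    have n: "n = p' + q" "n = p + q'" using Suc.hyps(2) 3 by auto
    have c: "c \<in> carrier R" by fact
    have "a [^] p' \<otimes> (a \<otimes> c) \<in> J" using Suc.prems(2) 3(1) a c by (simp add: m_assoc)
    moreover have "b [^] q \<otimes> (a \<otimes> c) \<in> J" using JD(4)[OF Suc.prems(3), of a] a c by (simp add: m_lcomm)
    ultimately have 1: "(a \<oplus> b) [^] n \<otimes> (a \<otimes> c) \<in> J" using Suc.hyps(1)[OF n(1), of "a \<otimes> c"] a c n(1) by simp
    have "b [^] q' \<otimes> (b \<otimes> c) \<in> J" using Suc.prems(3) 3(2) a c by (simp add: m_assoc)
    moreover have "a [^] p \<otimes> (b \<otimes> c) \<in> J" using JD(4)[OF Suc.prems(2), of b] a c by (simp add: m_lcomm)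
    ultimately have 2: "(a \<oplus> b) [^] n \<otimes> (b \<otimes> c) \<in> J" using Suc.hyps(1)[OF n(2), of "b \<otimes> c"] a c n(2) by simp
    have "(a \<oplus> b) [^] (p + q) \<otimes> c = (a \<oplus> b) [^] n \<otimes> ((a \<oplus> b) \<otimes> c)"
      using a c Suc.hyps(2)[symmetric] by (simp add: m_assoc)
    also have "\<dots> = (a \<oplus> b) [^] n \<otimes> (a \<otimes> c) \<oplus> (a \<oplus> b) [^] n \<otimes> (b \<otimes> c)" using a c by (simp add: l_distr r_distr)
    finally show ?thesis using JD(3)[OF 1 2] by simp
  qed
qed

section \<open>Torsion boundaries as boundaries of torsion elements\<close>

context
  fixes J :: "('a, 'e) gcomplex"
  assumes J: "graded_complex R J" and inj: "\<And>i. baer_inj R (cobj J i)"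
begin

text \<open>Says that the degree \<open>n\<close> homology of the \<open>Y\<close>-torsion
  subcomplex injects into that of \<open>J\<close>. It is formulated for homogeneous elements
  because division by powers of \<open>y\<close> is available for them.\<close>

definition lift_tor :: "'a set \<Rightarrow> int \<Rightarrow> bool" where
  "lift_tor Y n \<longleftrightarrow> (\<forall>j. \<forall>z\<in>grade (cobj J n) j. z \<in> boundaries J n \<longrightarrow> z \<in> tset R (cobj J n) Y \<longrightarrow>
     (\<exists>w\<in>grade (cobj J (n + 1)) j. w \<in> tset R (cobj J (n + 1)) Y \<and> cdiff J (n + 1) w = z))"

text \<open>Let a \<open>Y\<close>-torsion \<open>w\<close> bound \<open>z\<close>. Some power
  \<open>y^c\<close> turns \<open>w\<close> into the boundary of a \<open>Y\<close>-torsion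
  \<open>v\<close>, by the hypothesis in degree \<open>n + 1\<close>. Dividing \<open>v\<close> by
  \<open>y^c\<close> up to torsion gives \<open>v'\<close>, and \<open>w - d v'\<close> still bounds
  \<open>z\<close> but is killed by a power of \<open>y\<close> as well.\<close>

lemma lift_tor_step:
  assumes Y: "Y \<subseteq> carrier R" and T: "lift_tor Y n" "lift_tor Y (n + 1)" and y: "y \<in> rgrade R d"
    and kk: "\<And>u. u \<in> cycles J (n + 1) \<Longrightarrow> y [^] (kk :: nat) \<odot>\<^bsub>cobj J (n + 1)\<^esub> u \<in> boundaries J (n + 1)"
  shows "lift_tor (insert y Y) n"
  unfolding lift_tor_def
proof (intro allI ballI impI)
  fix j z assume z: "z \<in> grade (cobj J n) j" "z \<in> boundaries J n" "z \<in> tset R (cobj J n) (insert y Y)"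
  let ?N = "cobj J n" and ?M = "cobj J (n + 1)" and ?L = "cobj J (n + 1 + 1)"
  note cg = cobj_graded[OF J]
  interpret N: graded_mod R ?N by (rule graded_modI[OF cg])
  interpret M: graded_mod R ?M by (rule graded_modI[OF cg])
  interpret L: graded_mod R ?L by (rule graded_modI[OF cg])
  have dM: "cdiff J (n + 1) \<in> graded_hom R ?M ?N" by (rule cdiff_hom'[OF J])
  have dL: "cdiff J (n + 1 + 1) \<in> graded_hom R ?L ?M" by (rule cdiff_hom'[OF J])
  have yc: "y \<in> carrier R" by (rule rgrade_carrier[OF y])
  have zY: "z \<in> tset R ?N Y" using z(3) by (auto simp: tset_def)
  obtain w where w: "w \<in> grade ?M j" "w \<in> tset R ?M Y" "cdiff J (n + 1) w = z"
    using T(1) z(1,2) zY unfolding lift_tor_def by blast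
  have wc: "w \<in> carrier ?M" by (rule M.D_carrier[OF w(1)])
  obtain m :: nat where m: "y [^] m \<odot>\<^bsub>?N\<^esub> z = \<zero>\<^bsub>?N\<^esub>" using z(3) by (auto simp: tset_def)
  have "cdiff J (n + 1) (y [^] m \<odot>\<^bsub>?M\<^esub> w) = \<zero>\<^bsub>?N\<^esub>" using hom_smult[OF dM, of "y [^] m" w] yc wc w(3) m by simp
  then have "y [^] m \<odot>\<^bsub>?M\<^esub> w \<in> cycles J (n + 1)" using yc wc by (simp add: cycles_def)
  then have "y [^] kk \<odot>\<^bsub>?M\<^esub> (y [^] m \<odot>\<^bsub>?M\<^esub> w) \<in> boundaries J (n + 1)" by (rule kk)
  moreover have "y [^] kk \<odot>\<^bsub>?M\<^esub> (y [^] m \<odot>\<^bsub>?M\<^esub> w) = y [^] (kk + m) \<odot>\<^bsub>?M\<^esub> w"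
    using yc wc by (simp add: M.smult_assoc1[symmetric] nat_pow_mult)
  ultimately have u: "y [^] (kk + m) \<odot>\<^bsub>?M\<^esub> w \<in> boundaries J (n + 1)" by simp
  \<comment> \<open>\<open>y^m\<close> kills \<open>z\<close> and so turns \<open>w\<close> into a
    cycle; \<open>y^kk\<close> turns that cycle into a boundary.\<close>
  let ?c = "kk + m"
  have ug: "y [^] ?c \<odot>\<^bsub>?M\<^esub> w \<in> grade ?M (int (?c * d) + j)" by (rule M.grade_smult[OF rgrade_pow[OF y] w(1)])
  have "y [^] ?c \<odot>\<^bsub>?M\<^esub> w \<in> tset R ?M Y" using yc by (intro tset_smult[OF cg Y w(2)]) simp
  then obtain v where v: "v \<in> grade ?L (int (?c * d) + j)" "v \<in> tset R ?L Y" "cdiff J (n + 1 + 1) v = y [^] ?c \<odot>\<^bsub>?M\<^esub> w"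
    using T(2) u ug unfolding lift_tor_def by blast
  have vc: "v \<in> carrier ?L" by (rule L.D_carrier[OF v(1)])
  obtain v' and e :: nat where v': "v' \<in> grade ?L (int (?c * d) + j - int (?c * d))"
    "y [^] (?c + e) \<odot>\<^bsub>?L\<^esub> v' = y [^] e \<odot>\<^bsub>?L\<^esub> v"
    "\<And>r. r \<in> carrier R \<Longrightarrow> r \<odot>\<^bsub>?L\<^esub> v = \<zero>\<^bsub>?L\<^esub> \<Longrightarrow> r \<odot>\<^bsub>?L\<^esub> v' = \<zero>\<^bsub>?L\<^esub>"
    using divisible_mod_torsion[OF cg inj v(1) y, of ?c] by blast
  have v'g: "v' \<in> grade ?L j" using v'(1) by simp
  have v'c: "v' \<in> carrier ?L" by (rule L.D_carrier[OF v'g])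
  \<comment> \<open>Whatever annihilates \<open>v\<close> annihilates \<open>v'\<close>, so the
    division keeps \<open>Y\<close>-torsion.\<close>
  have v'Y: "v' \<in> tset R ?L Y"
    unfolding tset_def
  proof (intro CollectI conjI ballI v'c)
    fix q assume q: "q \<in> Y"
    then obtain k :: nat where k: "q [^] k \<odot>\<^bsub>?L\<^esub> v = \<zero>\<^bsub>?L\<^esub>" using v(2) by (auto simp: tset_def)
    have "q [^] k \<in> carrier R" using q Y by auto
    then show "\<exists>n::nat. q [^] n \<odot>\<^bsub>?L\<^esub> v' = \<zero>\<^bsub>?L\<^esub>" using v'(3) k by blast
  qed
  let ?dv = "cdiff J (n + 1 + 1) v'"
  let ?w = "w \<ominus>\<^bsub>?M\<^esub> ?dv"
  have dvc: "?dv \<in> carrier ?M" by (rule hom_closed[OF dL v'c])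
  have "?w \<in> grade ?M j" by (rule M.D_minus[OF w(1) hom_grade[OF dL v'g]])
  moreover have "?w \<in> tset R ?M (insert y Y)"
  proof -
    have ee: "y [^] (?c + e) = y [^] e \<otimes> y [^] ?c" using yc by (simp add: nat_pow_mult add.commute)
    have "y [^] (?c + e) \<odot>\<^bsub>?M\<^esub> ?dv = cdiff J (n + 1 + 1) (y [^] (?c + e) \<odot>\<^bsub>?L\<^esub> v')"
      using hom_smult[OF dL _ v'c, of "y [^] (?c + e)"] yc by simp
    also have "\<dots> = y [^] e \<odot>\<^bsub>?M\<^esub> (y [^] ?c \<odot>\<^bsub>?M\<^esub> w)" unfolding v'(2) using hom_smult[OF dL _ vc, of "y [^] e"] yc v(3) by simp
    also have "\<dots> = y [^] (?c + e) \<odot>\<^bsub>?M\<^esub> w" using yc wc by (simp add: M.smult_assoc1 ee)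
    finally have "y [^] (?c + e) \<odot>\<^bsub>?M\<^esub> ?w = \<zero>\<^bsub>?M\<^esub>"
      using yc wc dvc by (simp add: M.M.minus_eq M.smult_r_distr M.smult_r_minus M.M.r_neg)
    moreover have "?w \<in> tset R ?M Y" by (rule tset_minus[OF cg Y w(2) tset_hom[OF cg cg dL Y v'Y]])
    ultimately show ?thesis unfolding tset_def by blast
  qed
  moreover have "cdiff J (n + 1) ?w = z"
  proof -
    have "cdiff J (n + 1) ?dv = \<zero>\<^bsub>?N\<^esub>" using cdiff_cdiff[OF J v'c] by simp
    then show ?thesis using hom_minus[OF cg cg dM wc dvc] w(3) N.D_carrier[OF z(1)] by (simp add: N.M.minus_eq)
  qed
  ultimately show "\<exists>w\<in>grade ?M j. w \<in> tset R ?M (insert y Y) \<and> cdiff J (n + 1) w = z" by blast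
qed

text \<open>Each \<open>y\<close> carries cycles to boundaries in every degree, so the exponent
  \<open>1\<close> suffices, and the induction delivers all degrees at once, as the step uses two of
  them.\<close>

lemma lift_tor_finite:
  assumes "finite Y" and Y: "\<And>y. y \<in> Y \<Longrightarrow> (\<exists>d. y \<in> rgrade R d) \<and>
     (\<forall>n. \<forall>u\<in>cycles J n. y \<odot>\<^bsub>cobj J n\<^esub> u \<in> boundaries J n)"
  shows "lift_tor Y n"
  using assms
proof (induction arbitrary: n rule: finite_induct)
  case (empty n)
  show ?case
    unfolding lift_tor_def
  proof (intro allI ballI impI)
    fix j z assume z: "z \<in> grade (cobj J n) j" "z \<in> boundaries J n"
    obtain w where w: "w \<in> grade (cobj J (n + 1)) j" "cdiff J (n + 1) w = z" by (rule boundary_homog[OF J z])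
    interpret M: graded_mod R "cobj J (n + 1)" by (rule graded_modI[OF cobj_graded[OF J]])
    show "\<exists>w\<in>grade (cobj J (n + 1)) j. w \<in> tset R (cobj J (n + 1)) {} \<and> cdiff J (n + 1) w = z"
      using w M.D_carrier[OF w(1)] by (intro bexI[of _ w]) (auto simp: tset_def)
  qed
next
  case (insert y Y n)
  obtain d where d: "y \<in> rgrade R d" using insert.prems by blast
  have 1: "Y \<subseteq> carrier R" using insert.prems rgrade_carrier by blast
  have 2: "lift_tor Y k" for k by (rule insert.IH) (use insert.prems in blast)
  have 3: "y [^] (1::nat) \<odot>\<^bsub>cobj J (n + 1)\<^esub> u \<in> boundaries J (n + 1)" if "u \<in> cycles J (n + 1)" for u
    using insert.prems that rgrade_carrier[OF d] by simp
  show ?case by (rule lift_tor_step[OF 1 2 2 d 3])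
qed

text \<open>Write powers of the generators as \<open>a + r x\<close> with \<open>a\<close> in
  \<open>A\<close>, and let \<open>Y\<close> consist of these \<open>a\<close>. They kill all
  homology, so \<open>lift_tor\<close> holds for \<open>Y\<close> in every degree. Adjoining
  \<open>x\<close> uses exactness in degree \<open>n + 1\<close>; homology can sit in degree
  \<open>0\<close>, hence the bound \<open>n <= -2\<close>. Torsion for \<open>Y\<close> and
  \<open>x\<close> is torsion for \<open>S\<close>, since a power of \<open>a + r x\<close> kills
  whatever powers of \<open>a\<close> and of \<open>x\<close> kill.\<close>

lemma vanishing:
  assumes ex: "\<And>n. n \<noteq> 0 \<Longrightarrow> cycles J n \<subseteq> boundaries J n"
    and A: "gideal R A" and kill: "\<And>a u. a \<in> A \<Longrightarrow> u \<in> cycles J 0 \<Longrightarrow> a \<odot>\<^bsub>cobj J 0\<^esub> u \<in> boundaries J 0"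
    and x: "x \<in> rgrade R d" "0 < d" "\<And>s. s \<in> S \<Longrightarrow> \<exists>n::nat. s [^] n \<in> ext_ideal A x"
    and n: "n \<le> -2" and z: "z \<in> grade (cobj J n) j" "z \<in> cycles J n" "z \<in> torsion_set R (cobj J n)"
  obtains w where "w \<in> grade (cobj J (n + 1)) j" "w \<in> torsion_set R (cobj J (n + 1))" "cdiff J (n + 1) w = z"
proof -
  note AD = idealD[OF gidealD(1)[OF A]]
  note eI = ext_ideal[OF A x(1)]
  have xc: "x \<in> carrier R" by (rule rgrade_carrier[OF x(1)])
  have "\<exists>N a r. 0 < N \<and> a \<in> A \<and> a \<in> rgrade R N \<and> r \<in> carrier R \<and> s [^] (N::nat) = a \<oplus> r \<otimes> x" if s: "s \<in> S" for s
  proof -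
    obtain m :: nat where m: "s [^] m \<in> ext_ideal A x" using x(3)[OF s] by blast
    have s1: "s \<in> rgrade R 1" using s S(2) by blast
    have sc: "s \<in> carrier R" by (rule S_carrier[OF s])
    let ?N = "Suc m"
    have "s [^] ?N \<in> ext_ideal A x" using idealD(5)[OF gidealD(1)[OF eI(1)] m sc] by simp
    then obtain a r where ar: "s [^] ?N = a \<oplus> r \<otimes> x" "a \<in> A" "r \<in> carrier R" by (auto simp: ext_ideal_def)
    have g: "s [^] ?N \<in> rgrade R ?N" using rgrade_pow[OF s1, of ?N] by simp
    \<comment> \<open>Passing to components of degree \<open>?N\<close> makes \<open>a\<close>
      homogeneous, as \<open>lift_tor_step\<close> requires of adjoined elements.\<close>
    let ?r = "if d \<le> ?N then rc (?N - d) r else \<zero>"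
    have "s [^] ?N = rc ?N (s [^] ?N)" using g by simp
    also have "\<dots> = rc ?N a \<oplus> ?r \<otimes> x" unfolding ar(1) using ar AD(1) xc by (simp add: cp_add rc_mult_homog[OF x(1)])
    finally have "s [^] ?N = rc ?N a \<oplus> ?r \<otimes> x" .
    moreover have "?r \<in> carrier R" using ar by simp
    ultimately show ?thesis using gidealD(2)[OF A ar(2)] cp_in[OF AD(1)[OF ar(2)]] by blast
  qed
  then have "\<forall>s\<in>S. \<exists>t. 0 < fst t \<and> fst (snd t) \<in> A \<and> fst (snd t) \<in> rgrade R (fst t) \<and> snd (snd t) \<in> carrier R \<and> s [^] (fst t::nat) = fst (snd t) \<oplus> snd (snd t) \<otimes> x"
    by fastforce
  from bchoice[OF this] obtain f where f: "\<forall>s\<in>S. 0 < fst (f s) \<and> fst (snd (f s)) \<in> A \<and> fst (snd (f s)) \<in> rgrade R (fst (f s)) \<and> snd (snd (f s)) \<in> carrier R \<and> s [^] (fst (f s)::nat) = fst (snd (f s)) \<oplus> snd (snd (f s)) \<otimes> x"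
    by (rule exE)
  define Y where "Y = (\<lambda>s. fst (snd (f s))) ` S"
  have Yc: "Y \<subseteq> carrier R" using f AD(1) by (auto simp: Y_def)
  have T: "lift_tor Y k" for k
  proof (rule lift_tor_finite)
    show "finite Y" using S(1) by (simp add: Y_def)
    fix y assume y: "y \<in> Y"
    then have "\<exists>d. y \<in> rgrade R d" and yA: "y \<in> A" using f by (auto simp: Y_def)
    moreover have "y \<odot>\<^bsub>cobj J n\<^esub> u \<in> boundaries J n" if u: "u \<in> cycles J n" for n u
    proof (cases "n = 0")
      case True then show ?thesis using kill yA u by simp
    next
      case False
      then show ?thesis using ex[OF False] gsubmodD(4)[OF cycles_gsubmod[OF J] AD(1)[OF yA] u] by blast
    qed
    ultimately show "(\<exists>d. y \<in> rgrade R d) \<and> (\<forall>n. \<forall>u\<in>cycles J n. y \<odot>\<^bsub>cobj J n\<^esub> u \<in> boundaries J n)" by blast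
  qed
  \<comment> \<open>Cycles in degree \<open>n + 1 <= -1\<close> already are boundaries, so the
    exponent \<open>0\<close> will do for \<open>x\<close>, which need not kill any
    homology.\<close>
  have T': "lift_tor (insert x Y) n"
  proof (rule lift_tor_step[where kk = 0, OF Yc T T x(1)])
    fix u assume u: "u \<in> cycles J (n + 1)"
    interpret M: graded_mod R "cobj J (n + 1)" by (rule graded_modI[OF cobj_graded[OF J]])
    have "u \<in> boundaries J (n + 1)" using ex[of "n + 1"] n u by auto
    then show "x [^] (0::nat) \<odot>\<^bsub>cobj J (n + 1)\<^esub> u \<in> boundaries J (n + 1)"
      using u by (simp add: cycles_def)
  qed
  have "z \<in> tset R (cobj J n) (insert x Y)"
    using z(3) torsion_kill[OF cobj_graded[OF J] z(3)] x(1,2) f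
    unfolding tset_def torsion_iff[OF cobj_graded[OF J]] Y_def by blast
  moreover have "z \<in> boundaries J n" using ex[of n] n z(2) by auto
  ultimately obtain w where w: "w \<in> grade (cobj J (n + 1)) j" "w \<in> tset R (cobj J (n + 1)) (insert x Y)" "cdiff J (n + 1) w = z"
    using T' z(1) unfolding lift_tor_def by blast
  have "w \<in> torsion_set R (cobj J (n + 1))"
    unfolding torsion_iff[OF cobj_graded[OF J]]
  proof (intro conjI ballI)
    let ?M = "cobj J (n + 1)"
    interpret M: graded_mod R ?M by (rule graded_modI[OF cobj_graded[OF J]])
    show wc: "w \<in> carrier ?M" using w(2) by (simp add: tset_def)
    fix s assume s: "s \<in> S"
    let ?N = "fst (f s)" and ?a = "fst (snd (f s))" and ?r = "snd (snd (f s))"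
    have fs: "?a \<in> A" "?r \<in> carrier R" "s [^] ?N = ?a \<oplus> ?r \<otimes> x" using f s by auto
    have ac: "?a \<in> carrier R" using AD(1) fs(1) by blast
    have sc: "s \<in> carrier R" by (rule S_carrier[OF s])
    have "?a \<in> Y" using s by (auto simp: Y_def)
    then obtain p :: nat where p: "?a [^] p \<odot>\<^bsub>?M\<^esub> w = \<zero>\<^bsub>?M\<^esub>" using w(2) by (auto simp: tset_def)
    obtain q :: nat where q: "x [^] q \<odot>\<^bsub>?M\<^esub> w = \<zero>\<^bsub>?M\<^esub>" using w(2) by (auto simp: tset_def)
    let ?I = "{r \<in> carrier R. r \<odot>\<^bsub>?M\<^esub> w = \<zero>\<^bsub>?M\<^esub>}"
    have I: "ideal ?I R" by (rule annihilator_of_ideal[OF cobj_graded[OF J] wc])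
    have "(?r \<otimes> x) [^] q = ?r [^] q \<otimes> x [^] q" using fs(2) xc by (simp add: nat_pow_distrib)
    then have "(?r \<otimes> x) [^] q \<otimes> \<one> \<in> ?I" using fs(2) xc q wc by (simp add: M.smult_assoc1)
    moreover have "?a [^] p \<otimes> \<one> \<in> ?I" using ac p by simp
    ultimately have "(?a \<oplus> ?r \<otimes> x) [^] (p + q) \<otimes> \<one> \<in> ?I"
      using fs(2) xc by (intro ideal_pow_add[OF I ac]) auto
    then have "(s [^] ?N) [^] (p + q) \<otimes> \<one> \<in> ?I" by (simp only: fs(3))
    then have "s [^] (?N * (p + q)) \<odot>\<^bsub>?M\<^esub> w = \<zero>\<^bsub>?M\<^esub>" using sc by (simp add: nat_pow_pow)
    then show "\<exists>n::nat. s [^] n \<odot>\<^bsub>?M\<^esub> w = \<zero>\<^bsub>?M\<^esub>" by blast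
  qed
  with w(1,3) that show ?thesis by blast
qed

end

end

section \<open>Lifting the top homology\<close>

context graded_ring
begin

text \<open>The factorization is well defined because \<open>\<beta>\<close> kills the kernel of
  \<open>\<alpha>\<close>; it respects degrees because a homogeneous value has a homogeneous
  preimage, a component of any preimage.\<close>

lemma factor_hom:
  assumes N: "graded_module R N" and A: "graded_module R A" and B: "graded_module R B"
    and a: "\<alpha> \<in> graded_hom R N A" and b: "\<beta> \<in> graded_hom R N B"
    and ker: "\<And>x. x \<in> carrier N \<Longrightarrow> \<alpha> x = \<zero>\<^bsub>A\<^esub> \<Longrightarrow> \<beta> x = \<zero>\<^bsub>B\<^esub>"
  obtains h where "h \<in> graded_hom R (gsub A (\<alpha> ` carrier N)) B" "\<And>x. x \<in> carrier N \<Longrightarrow> h (\<alpha> x) = \<beta> x"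
proof -
  interpret N: graded_mod R N by (rule graded_modI) fact
  interpret A: graded_mod R A by (rule graded_modI) fact
  interpret B: graded_mod R B by (rule graded_modI) fact
  define h where "h y = \<beta> (SOME x. x \<in> carrier N \<and> \<alpha> x = y)" for y
  have h: "h (\<alpha> x) = \<beta> x" if x: "x \<in> carrier N" for x
  proof -
    let ?x = "SOME x'. x' \<in> carrier N \<and> \<alpha> x' = \<alpha> x"
    have s: "?x \<in> carrier N \<and> \<alpha> ?x = \<alpha> x" by (rule someI[of _ x]) (use x in simp)
    have "\<alpha> (?x \<ominus>\<^bsub>N\<^esub> x) = \<zero>\<^bsub>A\<^esub>"
      using hom_minus[OF N A a, of ?x x] s x hom_closed[OF a x] by (simp add: A.M.minus_eq A.M.r_neg)
    then have "\<beta> (?x \<ominus>\<^bsub>N\<^esub> x) = \<zero>\<^bsub>B\<^esub>" using s x by (intro ker) auto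
    then have "\<beta> ?x \<ominus>\<^bsub>B\<^esub> \<beta> x = \<zero>\<^bsub>B\<^esub>" using hom_minus[OF N B b, of ?x x] s x by simp
    then have "\<beta> ?x = \<beta> x" using B.M.minus_zero_iff hom_closed[OF b] s x by blast
    then show ?thesis by (simp add: h_def)
  qed
  have "h \<in> graded_hom R (gsub A (\<alpha> ` carrier N)) B"
  proof (rule graded_homI)
    fix y assume "y \<in> carrier (gsub A (\<alpha> ` carrier N))"
    then show "h y \<in> carrier B" using h hom_closed[OF b] by auto
  next
    fix x y assume "x \<in> carrier (gsub A (\<alpha> ` carrier N))" "y \<in> carrier (gsub A (\<alpha> ` carrier N))"
    then obtain x' y' where x': "x' \<in> carrier N" "x = \<alpha> x'" "y' \<in> carrier N" "y = \<alpha> y'" by auto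
    then have "h (\<alpha> (x' \<oplus>\<^bsub>N\<^esub> y')) = \<beta> x' \<oplus>\<^bsub>B\<^esub> \<beta> y'" using h hom_add[OF b] by simp
    then show "h (x \<oplus>\<^bsub>gsub A (\<alpha> ` carrier N)\<^esub> y) = h x \<oplus>\<^bsub>B\<^esub> h y" using x' h hom_add[OF a] by simp
  next
    fix r x assume r: "r \<in> carrier R" and "x \<in> carrier (gsub A (\<alpha> ` carrier N))"
    then obtain x' where x': "x' \<in> carrier N" "x = \<alpha> x'" by auto
    then have "h (\<alpha> (r \<odot>\<^bsub>N\<^esub> x')) = r \<odot>\<^bsub>B\<^esub> \<beta> x'" using h hom_smult[OF b r] r by simp
    then show "h (r \<odot>\<^bsub>gsub A (\<alpha> ` carrier N)\<^esub> x) = r \<odot>\<^bsub>B\<^esub> h x" using x' h hom_smult[OF a r] by simp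
  next
    fix j x assume "x \<in> grade (gsub A (\<alpha> ` carrier N)) j"
    then obtain x' where x': "x' \<in> carrier N" "x = \<alpha> x'" "x \<in> grade A j" by auto
    have "\<alpha> (mcp N j x') = x" using hom_mcp[OF N A a x'(1), of j] x' by simp
    then have "h x = \<beta> (mcp N j x')" using h[of "mcp N j x'"] x'(1) by simp
    then show "h x \<in> grade B j" using hom_grade[OF b N.cp_in[OF x'(1)]] by simp
  qed
  with h that show ?thesis by blast
qed

lemma minus_hom:
  assumes M: "graded_module R M" and N: "graded_module R N" and f: "f \<in> graded_hom R M N" and g: "g \<in> graded_hom R M N"
  shows "(\<lambda>x. f x \<ominus>\<^bsub>N\<^esub> g x) \<in> graded_hom R M N"
proof -
  interpret N: graded_mod R N by (rule graded_modI) fact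
  show ?thesis
    using hom_closed[OF f] hom_closed[OF g]
    by (intro graded_homI) (auto simp: hom_add[OF f] hom_add[OF g] hom_smult[OF f] hom_smult[OF g] N.M.minus_eq
        N.M.minus_add N.M.a_ac N.smult_r_distr N.smult_r_minus intro: N.D_add N.D_inv hom_grade[OF f] hom_grade[OF g])
qed

text \<open>Injectivity is required in Baer's form, which passes directly to products and to copies
  in other carrier types and so survives the formation of cones.\<close>

definition inj_complex :: "('r, 'e) gcomplex \<Rightarrow> int \<Rightarrow> bool" where
  "inj_complex C b \<longleftrightarrow> graded_complex R C \<and> (\<forall>i. baer_inj R (cobj C i)) \<and> (\<forall>i>b. zero_module (cobj C i))"

lemma inj_complexD:
  assumes "inj_complex C b"
  shows "graded_complex R C" "baer_inj R (cobj C i)" "b < i \<Longrightarrow> zero_module (cobj C i)"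
  using assms by (auto simp: inj_complex_def)

definition exact_at :: "('r, 'e) gcomplex \<Rightarrow> int \<Rightarrow> bool" where
  "exact_at C n \<longleftrightarrow> cycles C n \<subseteq> boundaries C n"

text \<open>A bounded above complex of injectives splits in the degrees above its top homology.\<close>

lemma boundary_section:
  assumes C: "inj_complex C b" and ex: "\<And>n. t < n \<Longrightarrow> exact_at C n" and "t \<le> i"
  shows "\<exists>\<sigma>. \<sigma> \<in> graded_hom R (gsub (cobj C i) (boundaries C i)) (cobj C (i + 1)) \<and>
    (\<forall>z\<in>boundaries C i. cdiff C (i + 1) (\<sigma> z) = z)"
proof -
  note G = inj_complexD(1)[OF C]
  note cg = cobj_graded[OF G]
  \<comment> \<open>Downward induction from degree \<open>b + 1\<close>, where the terms vanish;
    \<open>k\<close> is the distance from there.\<close>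
  have "\<forall>i. t \<le> i \<longrightarrow> b + 1 - int k = i \<longrightarrow> (\<exists>\<sigma>. \<sigma> \<in> graded_hom R (gsub (cobj C i) (boundaries C i)) (cobj C (i + 1)) \<and>
    (\<forall>z\<in>boundaries C i. cdiff C (i + 1) (\<sigma> z) = z))" for k
  proof (induction k)
    case 0
    show ?case
    proof (intro allI impI)
      fix i assume "b + 1 - int 0 = i"
      then have z: "zero_module (cobj C i)" "zero_module (cobj C (i + 1))" using inj_complexD(3)[OF C] by auto
      have "(\<lambda>_. \<zero>\<^bsub>cobj C (i + 1)\<^esub>) \<in> graded_hom R (gsub (cobj C i) (boundaries C i)) (cobj C (i + 1))"
        by (rule zero_module_hom[OF z(2) cg gsub_graded[OF cg boundaries_gsubmod[OF G]]])
      moreover have "cdiff C (i + 1) \<zero>\<^bsub>cobj C (i + 1)\<^esub> = z" if "z \<in> boundaries C i" for z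
      proof -
        have "z \<in> carrier (cobj C i)" by (rule gsubmodD(6)[OF boundaries_gsubmod[OF G] that])
        then have "z = \<zero>\<^bsub>cobj C i\<^esub>" using z(1) by (simp add: zero_module_def)
        then show ?thesis using hom_zero[OF cg cg cdiff_hom'[OF G], of i] by simp
      qed
      ultimately show "\<exists>\<sigma>. \<sigma> \<in> graded_hom R (gsub (cobj C i) (boundaries C i)) (cobj C (i + 1)) \<and>
        (\<forall>z\<in>boundaries C i. cdiff C (i + 1) (\<sigma> z) = z)" by blast
    qed
  next
    case (Suc k)
    show ?case
    proof (intro allI impI)
      fix i assume i: "t \<le> i" "b + 1 - int (Suc k) = i"
      let ?N = "cobj C i" and ?M = "cobj C (i + 1)" and ?L = "cobj C (i + 1 + 1)"
      interpret N: graded_mod R ?N by (rule graded_modI[OF cg])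
      interpret M: graded_mod R ?M by (rule graded_modI[OF cg])
      have "b + 1 - int k = i + 1" using i(2) by simp
      then obtain \<sigma> where \<sigma>: "\<sigma> \<in> graded_hom R (gsub ?M (boundaries C (i + 1))) ?L"
        "\<forall>z\<in>boundaries C (i + 1). cdiff C (i + 1 + 1) (\<sigma> z) = z" using spec[OF Suc, of "i + 1"] i(1) by auto
      obtain \<sigma>' where \<sigma>': "\<sigma>' \<in> graded_hom R ?M ?L" "\<And>z. z \<in> boundaries C (i + 1) \<Longrightarrow> \<sigma>' z = \<sigma> z"
        by (rule baer_extension[OF cg cg inj_complexD(2)[OF C] boundaries_gsubmod[OF G] \<sigma>(1)]) blast
      have d2: "(\<lambda>y. cdiff C (i + 1 + 1) (\<sigma>' y)) \<in> graded_hom R ?M ?M"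
        by (rule hom_compose[OF \<sigma>'(1) cdiff_hom'[OF G]])
      \<comment> \<open>Subtracting what the section in degree \<open>i + 1\<close> reaches kills
        every cycle of that degree, so the remainder factors through the differential; the factor is
        the section in degree \<open>i\<close>.\<close>
      let ?\<tau> = "\<lambda>y. y \<ominus>\<^bsub>?M\<^esub> cdiff C (i + 1 + 1) (\<sigma>' y)"
      have "(\<lambda>y. y) \<in> graded_hom R ?M ?M" by (rule graded_homI) auto
      from minus_hom[OF cg cg this d2] have \<tau>: "?\<tau> \<in> graded_hom R ?M ?M" .
      obtain h where h: "h \<in> graded_hom R (gsub ?N (cdiff C (i + 1) ` carrier ?M)) ?M"
        "\<And>y. y \<in> carrier ?M \<Longrightarrow> h (cdiff C (i + 1) y) = ?\<tau> y"
      proof (rule factor_hom[OF cg cg cg cdiff_hom'[OF G] \<tau>])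
        fix y assume y: "y \<in> carrier ?M" "cdiff C (i + 1) y = \<zero>\<^bsub>?N\<^esub>"
        then have "y \<in> cycles C (i + 1)" by (simp add: cycles_def)
        then have yb: "y \<in> boundaries C (i + 1)" using ex[of "i + 1"] i(1) by (auto simp: exact_at_def)
        then have "cdiff C (i + 1 + 1) (\<sigma>' y) = y" using \<sigma>(2) \<sigma>'(2) by simp
        then show "?\<tau> y = \<zero>\<^bsub>?M\<^esub>" using y(1) by (simp add: M.M.minus_eq M.M.r_neg)
      qed blast
      have "cdiff C (i + 1) (h z) = z" if z: "z \<in> boundaries C i" for z
      proof -
        obtain y where y: "y \<in> carrier ?M" "z = cdiff C (i + 1) y" using z by (auto simp: boundaries_def)
        have dc: "cdiff C (i + 1 + 1) (\<sigma>' y) \<in> carrier ?M" by (rule hom_closed[OF d2 y(1)])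
        have "cdiff C (i + 1) (?\<tau> y) = cdiff C (i + 1) y \<ominus>\<^bsub>?N\<^esub> cdiff C (i + 1) (cdiff C (i + 1 + 1) (\<sigma>' y))"
          by (rule hom_minus[OF cg cg cdiff_hom'[OF G] y(1) dc])
        also have "cdiff C (i + 1) (cdiff C (i + 1 + 1) (\<sigma>' y)) = \<zero>\<^bsub>?N\<^esub>"
          using cdiff_cdiff[OF G hom_closed[OF \<sigma>'(1) y(1)]] by simp
        finally show ?thesis using h(2)[OF y(1)] y(2) hom_closed[OF cdiff_hom'[OF G] y(1)] by (simp add: N.M.minus_eq)
      qed
      then show "\<exists>\<sigma>. \<sigma> \<in> graded_hom R (gsub ?N (boundaries C i)) ?M \<and> (\<forall>z\<in>boundaries C i. cdiff C (i + 1) (\<sigma> z) = z)"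
        using h(1) unfolding boundaries_def by blast
    qed
  qed
  note main = this
  show ?thesis
  proof (cases "i \<le> b + 1")
    case True
    then have "b + 1 - int (nat (b + 1 - i)) = i" by simp
    then show ?thesis using main[of "nat (b + 1 - i)"] assms(3) by blast
  next
    case False
    then have z: "zero_module (cobj C i)" "zero_module (cobj C (i + 1))" using inj_complexD(3)[OF C] by auto
    have "(\<lambda>_. \<zero>\<^bsub>cobj C (i + 1)\<^esub>) \<in> graded_hom R (gsub (cobj C i) (boundaries C i)) (cobj C (i + 1))"
      by (rule zero_module_hom[OF z(2) cg gsub_graded[OF cg boundaries_gsubmod[OF G]]])
    moreover have "cdiff C (i + 1) \<zero>\<^bsub>cobj C (i + 1)\<^esub> = z" if "z \<in> boundaries C i" for z
    proof -
      have "z \<in> carrier (cobj C i)" by (rule gsubmodD(6)[OF boundaries_gsubmod[OF G] that])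
      then have "z = \<zero>\<^bsub>cobj C i\<^esub>" using z(1) by (simp add: zero_module_def)
      then show ?thesis using hom_zero[OF cg cg cdiff_hom'[OF G], of i] by simp
    qed
    ultimately show ?thesis by blast
  qed
qed

text \<open>The section in degree \<open>t\<close>, extended by injectivity and followed by the
  differential. It splits off the boundaries and so provides canonical representatives
  \<open>u - \<rho> u\<close> of homology classes.\<close>

lemma boundary_retraction:
  assumes C: "inj_complex C b" and ex: "\<And>n. t < n \<Longrightarrow> exact_at C n"
  obtains \<rho> where "\<rho> \<in> graded_hom R (cobj C t) (cobj C t)" "\<And>y. y \<in> carrier (cobj C t) \<Longrightarrow> \<rho> y \<in> boundaries C t"
    "\<And>z. z \<in> boundaries C t \<Longrightarrow> \<rho> z = z"
proof -
  note G = inj_complexD(1)[OF C]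
  note cg = cobj_graded[OF G]
  obtain \<sigma> where \<sigma>: "\<sigma> \<in> graded_hom R (gsub (cobj C t) (boundaries C t)) (cobj C (t + 1))"
    "\<forall>z\<in>boundaries C t. cdiff C (t + 1) (\<sigma> z) = z" using boundary_section[OF C ex, of t] by blast
  obtain \<sigma>' where \<sigma>': "\<sigma>' \<in> graded_hom R (cobj C t) (cobj C (t + 1))" "\<And>z. z \<in> boundaries C t \<Longrightarrow> \<sigma>' z = \<sigma> z"
    by (rule baer_extension[OF cg cg inj_complexD(2)[OF C] boundaries_gsubmod[OF G] \<sigma>(1)]) blast
  show ?thesis
  proof (rule that[of "\<lambda>y. cdiff C (t + 1) (\<sigma>' y)"])
    show "(\<lambda>y. cdiff C (t + 1) (\<sigma>' y)) \<in> graded_hom R (cobj C t) (cobj C t)"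
      by (rule hom_compose[OF \<sigma>'(1) cdiff_hom'[OF G]])
    show "cdiff C (t + 1) (\<sigma>' y) \<in> boundaries C t" if "y \<in> carrier (cobj C t)" for y
      using hom_closed[OF \<sigma>'(1) that] by (auto simp: boundaries_def)
  qed (use \<sigma> \<sigma>' in auto)
qed

text \<open>An isomorphism from the \<open>n\<close>-th homology of \<open>C\<close> to \<open>M\<close>, as a relation between cycles and
  elements of \<open>M\<close>; this avoids types of cosets that grow with each cone.\<close>

definition linked :: "('r, 'e) gcomplex \<Rightarrow> int \<Rightarrow> ('r, 'c) gmodule \<Rightarrow> bool" where
  "linked C n M \<longleftrightarrow> (\<exists>Q. gsubmod R (prodm (cobj C n) M) Q \<and> fst ` Q = cycles C n \<and> snd ` Q = carrier M \<and>
     (\<forall>u m. (u, m) \<in> Q \<longrightarrow> (u \<in> boundaries C n \<longleftrightarrow> m = \<zero>\<^bsub>M\<^esub>)))"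

text \<open>The relation consists of all \<open>(b + f x, p x)\<close> with \<open>b\<close> a
  boundary; adding the boundaries makes its first projection reach every cycle.\<close>

lemma linkedI:
  assumes C: "graded_complex R C" and N: "graded_module R N" and M: "graded_module R M"
    and f: "f \<in> graded_hom R N (cobj C n)" and p: "p \<in> graded_hom R N M" "p ` carrier N = carrier M"
    and fc: "\<And>x. x \<in> carrier N \<Longrightarrow> f x \<in> cycles C n"
    and surj: "\<And>u. u \<in> cycles C n \<Longrightarrow> \<exists>x\<in>carrier N. u \<ominus>\<^bsub>cobj C n\<^esub> f x \<in> boundaries C n"
    and ker: "\<And>x. x \<in> carrier N \<Longrightarrow> f x \<in> boundaries C n \<longleftrightarrow> p x = \<zero>\<^bsub>M\<^esub>"
  shows "linked C n M"
proof -
  let ?C = "cobj C n"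
  note cg = cobj_graded[OF C]
  note gb = gsub_graded[OF cg boundaries_gsubmod[OF C]]
  note BD = gsubmodD[OF boundaries_gsubmod[OF C]]
  interpret C: graded_mod R ?C by (rule graded_modI[OF cg])
  let ?P = "prodm (gsub ?C (boundaries C n)) N"
  note gP = prodm_graded(1)[OF gb N]
  let ?F = "\<lambda>q. (fst q \<oplus>\<^bsub>?C\<^esub> f (snd q), p (snd q))"
  have F: "?F \<in> graded_hom R ?P (prodm ?C M)"
  proof (rule graded_homI)
    show "?F x \<in> carrier (prodm ?C M)" if "x \<in> carrier ?P" for x
      using that BD(6) hom_closed[OF f] hom_closed[OF p(1)] by auto
    show "?F x \<in> grade (prodm ?C M) j" if "x \<in> grade ?P j" for x j
      using that hom_grade[OF f] hom_grade[OF p(1)] by (auto intro: C.D_add)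
    show "?F (x \<oplus>\<^bsub>?P\<^esub> y) = ?F x \<oplus>\<^bsub>prodm ?C M\<^esub> ?F y" if "x \<in> carrier ?P" "y \<in> carrier ?P" for x y
      using that BD(6) hom_closed[OF f] by (auto simp: hom_add[OF f] hom_add[OF p(1)] C.M.a_ac)
    show "?F (r \<odot>\<^bsub>?P\<^esub> x) = r \<odot>\<^bsub>prodm ?C M\<^esub> ?F x" if "r \<in> carrier R" "x \<in> carrier ?P" for r x
      using that BD(6) hom_closed[OF f] by (auto simp: hom_smult[OF f] hom_smult[OF p(1)] C.smult_r_distr)
  qed
  let ?Q = "?F ` carrier ?P"
  have cyB: "boundaries C n \<subseteq> cycles C n" by (rule boundaries_cycles[OF C])
  show ?thesis
    unfolding linked_def
  proof (intro exI[of _ ?Q] conjI allI impI)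
    show "gsubmod R (prodm ?C M) ?Q"
      by (rule gsubmod_image[OF gP prodm_graded(1)[OF cg M] F gsubmod_carrier[OF gP]])
    show "fst ` ?Q = cycles C n"
    proof
      show "fst ` ?Q \<subseteq> cycles C n" using fc cyB gsubmodD(3)[OF cycles_gsubmod[OF C]] by auto
      show "cycles C n \<subseteq> fst ` ?Q"
      proof
        fix u assume u: "u \<in> cycles C n"
        have uc: "u \<in> carrier ?C" using u by (simp add: cycles_def)
        obtain x where x: "x \<in> carrier N" "u \<ominus>\<^bsub>?C\<^esub> f x \<in> boundaries C n" using surj[OF u] by blast
        have 1: "fst (?F (u \<ominus>\<^bsub>?C\<^esub> f x, x)) = u"
          using uc hom_closed[OF f x(1)] by (simp add: C.M.minus_eq C.M.a_assoc C.M.l_neg)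
        have "(u \<ominus>\<^bsub>?C\<^esub> f x, x) \<in> carrier ?P" using x by simp
        then have "fst (?F (u \<ominus>\<^bsub>?C\<^esub> f x, x)) \<in> fst ` ?Q" by (intro imageI)
        then show "u \<in> fst ` ?Q" unfolding 1 .
      qed
    qed
    show "snd ` ?Q = carrier M"
    proof -
      have "snd ` ?Q = (\<lambda>q. p (snd q)) ` carrier ?P" by (simp add: image_image)
      also have "\<dots> = p ` carrier N" using BD(2) by (force simp: image_iff)
      finally show ?thesis using p(2) by simp
    qed
    fix u m assume "(u, m) \<in> ?Q"
    then obtain b x where bx: "b \<in> boundaries C n" "x \<in> carrier N" "u = b \<oplus>\<^bsub>?C\<^esub> f x" "m = p x" by auto
    have "u \<in> boundaries C n \<longleftrightarrow> f x \<in> boundaries C n"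
    proof
      assume "u \<in> boundaries C n"
      then have "u \<ominus>\<^bsub>?C\<^esub> b \<in> boundaries C n" by (rule gsubmod_minus[OF cg boundaries_gsubmod[OF C] _ bx(1)])
      moreover have "u \<ominus>\<^bsub>?C\<^esub> b = f x"
        using bx(3) BD(6)[OF bx(1)] hom_closed[OF f bx(2)] C.M.a_comm[of b "f x"]
        by (simp add: C.M.minus_eq C.M.a_assoc C.M.r_neg)
      ultimately show "f x \<in> boundaries C n" by simp
    qed (use bx BD(3) in simp)
    then show "u \<in> boundaries C n \<longleftrightarrow> m = \<zero>\<^bsub>M\<^esub>" using ker[OF bx(2)] bx(4) by simp
  qed
qed

lemma linked_zero:
  assumes "linked C n M" "zero_module M"
  shows "exact_at C n"
  unfolding exact_at_def
proof
  obtain Q where Q: "fst ` Q = cycles C n" "snd ` Q = carrier M"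
     "\<forall>u m. (u, m) \<in> Q \<longrightarrow> (u \<in> boundaries C n \<longleftrightarrow> m = \<zero>\<^bsub>M\<^esub>)" using assms(1) unfolding linked_def by blast
  fix u assume "u \<in> cycles C n"
  then obtain m where m: "(u, m) \<in> Q" using Q(1) by force
  then have "m \<in> carrier M" using Q(2) by force
  then show "u \<in> boundaries C n" using Q(3) m assms(2) by (auto simp: zero_module_def)
qed

text \<open>In degree \<open>t\<close> a cycle \<open>z\<close> of \<open>K\<close> goes to
  \<open>u - \<rho> u\<close>, where \<open>u\<close> is any cycle of \<open>I\<close> related to
  the same element of \<open>M\<close>; two choices of \<open>u\<close> differ by a boundary, which
  the retraction removes. This map kills boundaries, so it continues by zero above \<open>t\<close>.
  Below \<open>t\<close> it continues by injectivity of the terms of \<open>I\<close>, as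
  \<open>K\<close> is exact there.\<close>

lemma lift_map:
  fixes I :: "('r, 'e) gcomplex" and K :: "('r, 'f) gcomplex" and M :: "('r, 'c) gmodule"
  assumes I: "inj_complex I b" and exaI: "\<And>n. t < n \<Longrightarrow> exact_at I n" and lI: "linked I t M"
    and K: "graded_complex R K" and exK: "\<And>n. n < t \<Longrightarrow> exact_at K n" and lK: "linked K t M"
    and M: "graded_module R M"
  shows "\<exists>\<psi>. chain_map R K I \<psi> \<and> (\<forall>z\<in>cycles K t. \<psi> t z \<in> boundaries I t \<longrightarrow> z \<in> boundaries K t) \<and>
     (\<forall>u\<in>cycles I t. \<exists>z\<in>cycles K t. u \<ominus>\<^bsub>cobj I t\<^esub> \<psi> t z \<in> boundaries I t)"
proof -
  note G = inj_complexD(1)[OF I]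
  note cI = cobj_graded[OF G]
  note cK = cobj_graded[OF K]
  obtain \<rho> where \<rho>: "\<rho> \<in> graded_hom R (cobj I t) (cobj I t)" "\<And>y. y \<in> carrier (cobj I t) \<Longrightarrow> \<rho> y \<in> boundaries I t"
    "\<And>z. z \<in> boundaries I t \<Longrightarrow> \<rho> z = z" by (rule boundary_retraction[OF I exaI]) blast+
  obtain Q where Q: "gsubmod R (prodm (cobj I t) M) Q" "fst ` Q = cycles I t" "snd ` Q = carrier M"
     "\<forall>u m. (u, m) \<in> Q \<longrightarrow> (u \<in> boundaries I t \<longleftrightarrow> m = \<zero>\<^bsub>M\<^esub>)" using lI unfolding linked_def by blast
  obtain Q' where Q': "gsubmod R (prodm (cobj K t) M) Q'" "fst ` Q' = cycles K t" "snd ` Q' = carrier M"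
     "\<forall>u m. (u, m) \<in> Q' \<longrightarrow> (u \<in> boundaries K t \<longleftrightarrow> m = \<zero>\<^bsub>M\<^esub>)" using lK unfolding linked_def by blast
  let ?I = "cobj I t" and ?K = "cobj K t"
  interpret I: graded_mod R ?I by (rule graded_modI[OF cI])
  interpret K: graded_mod R ?K by (rule graded_modI[OF cK])
  interpret M: graded_mod R M by (rule graded_modI[OF M])
  note gPI = prodm_graded[OF cI M] and gPK = prodm_graded[OF cK M]
  note QD = gsubmodD[OF Q(1)] and QD' = gsubmodD[OF Q'(1)]
  have Qc: "u \<in> carrier ?I" "m \<in> carrier M" if "(u, m) \<in> Q" for u m using QD(6)[OF that] by auto
  have Qc': "u \<in> carrier ?K" "m \<in> carrier M" if "(u, m) \<in> Q'" for u m using QD'(6)[OF that] by auto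
  have Qa: "(u \<oplus>\<^bsub>?I\<^esub> u', m \<oplus>\<^bsub>M\<^esub> m') \<in> Q" if "(u, m) \<in> Q" "(u', m') \<in> Q" for u m u' m' using QD(3)[OF that] by simp
  have Qa': "(u \<oplus>\<^bsub>?K\<^esub> u', m \<oplus>\<^bsub>M\<^esub> m') \<in> Q'" if "(u, m) \<in> Q'" "(u', m') \<in> Q'" for u m u' m' using QD'(3)[OF that] by simp
  have Qs: "(r \<odot>\<^bsub>?I\<^esub> u, r \<odot>\<^bsub>M\<^esub> m) \<in> Q" if "(u, m) \<in> Q" "r \<in> carrier R" for u m r using QD(4)[OF that(2,1)] by simp
  have Qs': "(r \<odot>\<^bsub>?K\<^esub> u, r \<odot>\<^bsub>M\<^esub> m) \<in> Q'" if "(u, m) \<in> Q'" "r \<in> carrier R" for u m r using QD'(4)[OF that(2,1)] by simp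
  have Qm: "(u \<ominus>\<^bsub>?I\<^esub> u', m \<ominus>\<^bsub>M\<^esub> m') \<in> Q" if "(u, m) \<in> Q" "(u', m') \<in> Q" for u m u' m'
    using Qa[OF that(1) Qs[OF that(2), of "\<ominus> \<one>"]] Qc[OF that(2)] by (simp add: I.smult_l_minus M.smult_l_minus I.M.minus_eq M.M.minus_eq)
  have Qm': "(u \<ominus>\<^bsub>?K\<^esub> u', m \<ominus>\<^bsub>M\<^esub> m') \<in> Q'" if "(u, m) \<in> Q'" "(u', m') \<in> Q'" for u m u' m'
    using Qa'[OF that(1) Qs'[OF that(2), of "\<ominus> \<one>"]] Qc'[OF that(2)] by (simp add: K.smult_l_minus M.smult_l_minus K.M.minus_eq M.M.minus_eq)
  have Qf: "m = m'" if "(u, m) \<in> Q" "(u, m') \<in> Q" for u m m'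
  proof -
    have "u \<ominus>\<^bsub>?I\<^esub> u = \<zero>\<^bsub>?I\<^esub>" using Qc[OF that(1)] by (simp add: I.M.minus_eq I.M.r_neg)
    then have "m \<ominus>\<^bsub>M\<^esub> m' = \<zero>\<^bsub>M\<^esub>" using Qm[OF that] Q(4) gsubmodD(2)[OF boundaries_gsubmod[OF G]] by metis
    then show ?thesis using M.M.minus_zero_iff Qc that by blast
  qed
  have Qf': "m = m'" if "(u, m) \<in> Q'" "(u, m') \<in> Q'" for u m m'
  proof -
    have "u \<ominus>\<^bsub>?K\<^esub> u = \<zero>\<^bsub>?K\<^esub>" using Qc'[OF that(1)] by (simp add: K.M.minus_eq K.M.r_neg)
    then have "m \<ominus>\<^bsub>M\<^esub> m' = \<zero>\<^bsub>M\<^esub>" using Qm'[OF that] Q'(4) gsubmodD(2)[OF boundaries_gsubmod[OF K]] by metis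
    then show ?thesis using M.M.minus_zero_iff Qc' that by blast
  qed
  have Qb: "(v, \<zero>\<^bsub>M\<^esub>) \<in> Q" if v: "v \<in> boundaries I t" for v
  proof -
    have "v \<in> fst ` Q" using v boundaries_cycles[OF G] Q(2) by blast
    then obtain m where "(v, m) \<in> Q" by force
    then show ?thesis using Q(4) v by auto
  qed
  have Qb': "(v, \<zero>\<^bsub>M\<^esub>) \<in> Q'" if v: "v \<in> boundaries K t" for v
  proof -
    have "v \<in> fst ` Q'" using v boundaries_cycles[OF K] Q'(2) by blast
    then obtain m where "(v, m) \<in> Q'" by force
    then show ?thesis using Q'(4) v by auto
  qed
  have Qz: "(\<zero>\<^bsub>?I\<^esub>, \<zero>\<^bsub>M\<^esub>) \<in> Q" "(\<zero>\<^bsub>?K\<^esub>, \<zero>\<^bsub>M\<^esub>) \<in> Q'" using QD(2) QD'(2) by auto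
  \<comment> \<open>The fibre product of the two relations over \<open>M\<close>: pairs of cycles
    that represent the same class.\<close>
  define N where "N = {(z, u). \<exists>m. (z, m) \<in> Q' \<and> (u, m) \<in> Q}"
  have N: "gsubmod R (prodm ?K ?I) N"
  proof (rule gsubmodI)
    show "N \<subseteq> carrier (prodm ?K ?I)" using Qc Qc' by (auto simp: N_def)
    show "\<zero>\<^bsub>prodm ?K ?I\<^esub> \<in> N" using Qz by (auto simp: N_def)
    show "x \<oplus>\<^bsub>prodm ?K ?I\<^esub> y \<in> N" if "x \<in> N" "y \<in> N" for x y using that Qa Qa' by (force simp: N_def)
    show "r \<odot>\<^bsub>prodm ?K ?I\<^esub> x \<in> N" if "r \<in> carrier R" "x \<in> N" for r x using that Qs Qs' by (force simp: N_def)
    show "mcp (prodm ?K ?I) i x \<in> N" if "x \<in> N" for i x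
    proof -
      obtain z u m where x: "x = (z, u)" "(z, m) \<in> Q'" "(u, m) \<in> Q" using \<open>x \<in> N\<close> by (auto simp: N_def)
      have "(mcp ?K i z, mcp M i m) \<in> Q'" using QD'(5)[OF x(2), of i] gPK(2) Qc'[OF x(2)] by simp
      moreover have "(mcp ?I i u, mcp M i m) \<in> Q" using QD(5)[OF x(3), of i] gPI(2) Qc[OF x(3)] by simp
      ultimately show ?thesis using x prodm_graded(2)[OF cK cI] Qc'[OF x(2)] Qc[OF x(3)] by (auto simp: N_def)
    qed
  qed
  let ?N = "gsub (prodm ?K ?I) N"
  have gN: "graded_module R ?N" by (rule gsub_graded[OF prodm_graded(1)[OF cK cI] N])
  have h1: "fst \<in> graded_hom R ?N ?K"
    by (rule gsub_hom1[OF _ gsubmodD(1)[OF N]]) (rule graded_homI, auto)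
  have h2: "snd \<in> graded_hom R ?N ?I"
    by (rule gsub_hom1[OF _ gsubmodD(1)[OF N]]) (rule graded_homI, auto)
  have h3: "(\<lambda>q. snd q \<ominus>\<^bsub>?I\<^esub> \<rho> (snd q)) \<in> graded_hom R ?N ?I"
    by (rule minus_hom[OF gN cI h2 hom_compose[OF h2 \<rho>(1)]])
  obtain \<psi>0 where p0: "\<psi>0 \<in> graded_hom R (gsub ?K (fst ` carrier ?N)) ?I"
    "\<And>q. q \<in> carrier ?N \<Longrightarrow> \<psi>0 (fst q) = snd q \<ominus>\<^bsub>?I\<^esub> \<rho> (snd q)"
  proof (rule factor_hom[OF gN cK cI h1 h3])
    fix q assume q: "q \<in> carrier ?N" "fst q = \<zero>\<^bsub>?K\<^esub>"
    then obtain u m where u: "q = (\<zero>\<^bsub>?K\<^esub>, u)" "(\<zero>\<^bsub>?K\<^esub>, m) \<in> Q'" "(u, m) \<in> Q" by (auto simp: N_def)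
    then have "m = \<zero>\<^bsub>M\<^esub>" using Qf' Qz(2) by blast
    then have "u \<in> boundaries I t" using Q(4) u(3) by blast
    then have "\<rho> u = u" by (rule \<rho>(3))
    then show "snd q \<ominus>\<^bsub>?I\<^esub> \<rho> (snd q) = \<zero>\<^bsub>?I\<^esub>" using u Qc[OF u(3)] by (simp add: I.M.minus_eq I.M.r_neg)
  qed blast
  have dom: "fst ` carrier ?N = cycles K t"
  proof
    show "fst ` carrier ?N \<subseteq> cycles K t" using Q'(2) by (force simp: N_def)
    show "cycles K t \<subseteq> fst ` carrier ?N"
    proof
      fix z assume "z \<in> cycles K t"
      then have "z \<in> fst ` Q'" using Q'(2) by simp
      then obtain m where m: "(z, m) \<in> Q'" by force
      then have "m \<in> snd ` Q" using Q(3) Qc' by simp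
      then obtain u where "(u, m) \<in> Q" by force
      then have "(z, u) \<in> carrier ?N" using m by (auto simp: N_def)
      then show "z \<in> fst ` carrier ?N" by force
    qed
  qed
  \<comment> \<open>So far the map lives on cycles; injectivity extends it to the whole
    term.\<close>
  obtain h0 where h0: "h0 \<in> graded_hom R ?K ?I" "\<And>z. z \<in> cycles K t \<Longrightarrow> h0 z = \<psi>0 z"
    by (rule baer_extension[OF cK cI inj_complexD(2)[OF I] cycles_gsubmod[OF K] p0(1)[unfolded dom]]) blast
  have h0Q: "(h0 z, m) \<in> Q \<and> h0 z \<in> cycles I t" if zm: "(z, m) \<in> Q'" for z m
  proof -
    have "m \<in> snd ` Q" using Q(3) Qc'[OF zm] by simp
    then obtain u where u: "(u, m) \<in> Q" by force
    then have q: "(z, u) \<in> carrier ?N" using zm by (auto simp: N_def)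
    then have "z \<in> cycles K t" using dom by force
    then have e: "h0 z = u \<ominus>\<^bsub>?I\<^esub> \<rho> u" using h0(2) p0(2)[OF q] by simp
    have "(u \<ominus>\<^bsub>?I\<^esub> \<rho> u, m \<ominus>\<^bsub>M\<^esub> \<zero>\<^bsub>M\<^esub>) \<in> Q" by (rule Qm[OF u Qb[OF \<rho>(2)[OF Qc(1)[OF u]]]])
    then have "(h0 z, m) \<in> Q" using e Qc[OF u] by (simp add: M.M.minus_eq)
    moreover from this have "h0 z \<in> cycles I t" using Q(2) by force
    ultimately show ?thesis by blast
  qed
  have h0b: "h0 z = \<zero>\<^bsub>?I\<^esub>" if z: "z \<in> boundaries K t" for z
  proof -
    have q: "(z, \<zero>\<^bsub>?I\<^esub>) \<in> carrier ?N" using Qb'[OF z] Qz(1) by (auto simp: N_def)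
    have "z \<in> cycles K t" using z boundaries_cycles[OF K] by blast
    then have "h0 z = \<zero>\<^bsub>?I\<^esub> \<ominus>\<^bsub>?I\<^esub> \<rho> \<zero>\<^bsub>?I\<^esub>" using h0(2) p0(2)[OF q] by simp
    then show ?thesis using hom_zero[OF cI cI \<rho>(1)] by (simp add: I.M.minus_eq)
  qed
  define dg where "dg n = t - int n" for n
  have dgS: "dg (Suc n) = dg n - 1" for n by (simp add: dg_def)
  \<comment> \<open>The invariant that cycles go to cycles lets the composite with the differential
    of \<open>I\<close> factor through the boundaries of \<open>K\<close> one degree lower.\<close>
  let ?P = "\<lambda>n h. h \<in> graded_hom R (cobj K (dg n)) (cobj I (dg n)) \<and> (n = 0 \<longrightarrow> h = h0) \<and>
     (\<forall>x\<in>cycles K (dg n). cdiff I (dg n) (h x) = \<zero>\<^bsub>cobj I (dg n - 1)\<^esub>)"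
  let ?S = "\<lambda>n h h'. \<forall>x\<in>carrier (cobj K (dg n)). h' (cdiff K (dg n) x) = cdiff I (dg n) (h x)"
  have "\<exists>f. \<forall>n. ?P n (f n) \<and> ?S n (f n) (f (Suc n))"
  proof (rule dependent_nat_choice)
    have "cdiff I t (h0 x) = \<zero>\<^bsub>cobj I (t - 1)\<^esub>" if x: "x \<in> cycles K t" for x
    proof -
      have "x \<in> fst ` Q'" using x Q'(2) by simp
      then obtain m where "(x, m) \<in> Q'" by force
      then have "h0 x \<in> cycles I t" using h0Q by blast
      then show ?thesis by (simp add: cycles_def)
    qed
    then have "?P 0 h0" using h0(1) by (simp add: dg_def)
    then show "\<exists>x. ?P 0 x" by (intro exI[of _ h0])
  next
    fix h n assume h: "?P n h"
    then have hh: "h \<in> graded_hom R (cobj K (dg n)) (cobj I (dg n))" and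
      hc: "\<And>x. x \<in> cycles K (dg n) \<Longrightarrow> cdiff I (dg n) (h x) = \<zero>\<^bsub>cobj I (dg n - 1)\<^esub>" by blast+
    have dh: "(\<lambda>x. cdiff I (dg n) (h x)) \<in> graded_hom R (cobj K (dg n)) (cobj I (dg n - 1))"
      by (rule hom_compose[OF hh cdiff_hom[OF G]])
    obtain g where g: "g \<in> graded_hom R (gsub (cobj K (dg n - 1)) (cdiff K (dg n) ` carrier (cobj K (dg n)))) (cobj I (dg n - 1))"
      "\<And>x. x \<in> carrier (cobj K (dg n)) \<Longrightarrow> g (cdiff K (dg n) x) = cdiff I (dg n) (h x)"
    proof (rule factor_hom[OF cK cK cI cdiff_hom[OF K] dh])
      fix x assume "x \<in> carrier (cobj K (dg n))" "cdiff K (dg n) x = \<zero>\<^bsub>cobj K (dg n - 1)\<^esub>"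
      then show "cdiff I (dg n) (h x) = \<zero>\<^bsub>cobj I (dg n - 1)\<^esub>" by (intro hc) (simp add: cycles_def)
    qed blast
    have bd: "cdiff K (dg n) ` carrier (cobj K (dg n)) = boundaries K (dg n - 1)" by (simp add: boundaries_def)
    obtain h' where h': "h' \<in> graded_hom R (cobj K (dg n - 1)) (cobj I (dg n - 1))" "\<And>x. x \<in> boundaries K (dg n - 1) \<Longrightarrow> h' x = g x"
      by (rule baer_extension[OF cK cI inj_complexD(2)[OF I] boundaries_gsubmod[OF K] g(1)[unfolded bd]]) blast
    have step: "h' (cdiff K (dg n) x) = cdiff I (dg n) (h x)" if x: "x \<in> carrier (cobj K (dg n))" for x
    proof -
      have "cdiff K (dg n) x \<in> boundaries K (dg n - 1)" using x bd by blast
      then show ?thesis using h'(2) g(2)[OF x] by simp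
    qed
    \<comment> \<open>Below \<open>t\<close> every cycle of \<open>K\<close> is a boundary, so the
      invariant follows from \<open>d d = 0\<close> in \<open>I\<close>.\<close>
    have "cdiff I (dg n - 1) (h' x) = \<zero>\<^bsub>cobj I (dg n - 1 - 1)\<^esub>" if x: "x \<in> cycles K (dg n - 1)" for x
    proof -
      have "dg n - 1 < t" by (simp add: dg_def)
      then have "x \<in> cdiff K (dg n) ` carrier (cobj K (dg n))" using exK[of "dg n - 1"] x bd by (auto simp: exact_at_def)
      then obtain y where y: "y \<in> carrier (cobj K (dg n))" "x = cdiff K (dg n) y" by blast
      have "cdiff I (dg n - 1) (cdiff I (dg n - 1 + 1) (h y)) = \<zero>\<^bsub>cobj I (dg n - 1 - 1)\<^esub>"
        by (rule cdiff_cdiff[OF G]) (use hom_closed[OF hh y(1)] in simp)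
      then show ?thesis using step[OF y(1)] y(2) by simp
    qed
    then have "?P (Suc n) h'" using h'(1) by (simp add: dgS)
    then show "\<exists>y. ?P (Suc n) y \<and> ?S n h y" using step by blast
  qed
  then obtain f where f: "\<forall>n. ?P n (f n) \<and> ?S n (f n) (f (Suc n))" by (rule exE)
  have f1: "f n \<in> graded_hom R (cobj K (dg n)) (cobj I (dg n))" for n using f by blast
  have f0: "f 0 = h0" using f by blast
  have f2: "f (Suc n) (cdiff K (dg n) x) = cdiff I (dg n) (f n x)" if "x \<in> carrier (cobj K (dg n))" for n x using f that by blast
  define \<psi> where "\<psi> i = (if i \<le> t then f (nat (t - i)) else (\<lambda>_. \<zero>\<^bsub>cobj I i\<^esub>))" for i
  have dgn: "dg (nat (t - i)) = i" if "i \<le> t" for i using that by (simp add: dg_def)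
  have zhom: "(\<lambda>_. \<zero>\<^bsub>cobj I i\<^esub>) \<in> graded_hom R (cobj K i) (cobj I i)" for i
  proof -
    interpret X: graded_mod R "cobj I i" by (rule graded_modI[OF cI])
    show ?thesis by (rule graded_homI) auto
  qed
  have \<psi>h: "\<psi> i \<in> graded_hom R (cobj K i) (cobj I i)" for i
  proof (cases "i \<le> t")
    case True then show ?thesis using f1[of "nat (t - i)"] dgn[OF True] by (simp add: \<psi>_def)
  qed (use zhom in \<open>simp add: \<psi>_def\<close>)
  have dz: "cdiff I i \<zero>\<^bsub>cobj I i\<^esub> = \<zero>\<^bsub>cobj I (i - 1)\<^esub>" for i by (rule hom_zero[OF cI cI cdiff_hom[OF G]])
  have comm: "\<psi> (i - 1) (cdiff K i x) = cdiff I i (\<psi> i x)" if x: "x \<in> carrier (cobj K i)" for i x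
  proof -
    consider "i \<le> t" | "i = t + 1" | "t + 1 < i" by linarith
    then show ?thesis
    proof cases
      case 1
      then have "nat (t - (i - 1)) = Suc (nat (t - i))" by simp
      then show ?thesis using f2[of x "nat (t - i)"] dgn[OF 1] 1 x by (simp add: \<psi>_def)
    next
      case 2
      have "cdiff K (t + 1) x \<in> boundaries K t" using x 2 by (auto simp: boundaries_def)
      then have "h0 (cdiff K i x) = \<zero>\<^bsub>?I\<^esub>" using h0b 2 by simp
      then show ?thesis using 2 dz[of i] by (simp add: \<psi>_def f0)
    next
      case 3
      then show ?thesis using dz[of i] by (simp add: \<psi>_def)
    qed
  qed
  have \<psi>t: "\<psi> t = h0" by (simp add: \<psi>_def f0)
  show ?thesis
  proof (intro exI[of _ \<psi>] conjI ballI impI)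
    show "chain_map R K I \<psi>" using \<psi>h comm by (simp add: chain_map_def)
  next
    fix z assume z: "z \<in> cycles K t" "\<psi> t z \<in> boundaries I t"
    then have "z \<in> fst ` Q'" using Q'(2) by simp
    then obtain m where m: "(z, m) \<in> Q'" by force
    then have "(h0 z, m) \<in> Q" using h0Q by blast
    then have "m = \<zero>\<^bsub>M\<^esub>" using z(2) \<psi>t Q(4) by auto
    then show "z \<in> boundaries K t" using Q'(4) m by auto
  next
    fix u assume "u \<in> cycles I t"
    then have "u \<in> fst ` Q" using Q(2) by simp
    then obtain m where m: "(u, m) \<in> Q" by force
    then have "m \<in> snd ` Q'" using Q'(3) Qc by simp
    then obtain z where z: "(z, m) \<in> Q'" by force
    have "(u \<ominus>\<^bsub>?I\<^esub> h0 z, m \<ominus>\<^bsub>M\<^esub> m) \<in> Q" using Qm[OF m] h0Q[OF z] by blast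
    moreover have "m \<ominus>\<^bsub>M\<^esub> m = \<zero>\<^bsub>M\<^esub>" using Qc[OF m] by (simp add: M.M.minus_eq M.M.r_neg)
    ultimately have "u \<ominus>\<^bsub>?I\<^esub> h0 z \<in> boundaries I t" using Q(4) by auto
    moreover have "z \<in> cycles K t" using Q'(2) z by force
    ultimately show "\<exists>z\<in>cycles K t. u \<ominus>\<^bsub>?I\<^esub> \<psi> t z \<in> boundaries I t" using \<psi>t by auto
  qed
qed

end

section \<open>Mapping cones\<close>

definition cone :: "('r, 'e) gcomplex \<Rightarrow> ('r, 'f) gcomplex \<Rightarrow> (int \<Rightarrow> 'f \<Rightarrow> 'e) \<Rightarrow> ('r, 'e \<times> 'f) gcomplex" where
  "cone I K \<psi> = \<lparr>cobj = (\<lambda>n. prodm (cobj I n) (cobj K (n - 1))),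
     cdiff = (\<lambda>n x. (cdiff I n (fst x) \<oplus>\<^bsub>cobj I (n - 1)\<^esub> \<psi> (n - 1) (snd x), \<ominus>\<^bsub>cobj K (n - 2)\<^esub> cdiff K (n - 1) (snd x)))\<rparr>"

text \<open>One map \<open>p\<close> serves all degrees, so cycles, boundaries and torsion of the
  copy are simply images under \<open>p\<close>.\<close>

definition imagec :: "('b \<Rightarrow> 'c) \<Rightarrow> ('r, 'b) gcomplex \<Rightarrow> ('r, 'c) gcomplex" where
  "imagec p C = \<lparr>cobj = (\<lambda>n. imagem p (cobj C n)), cdiff = (\<lambda>n x. p (cdiff C n (inv_into (carrier (cobj C n)) p x)))\<rparr>"

text \<open>No sign is put on the differential, so cycles and boundaries of the shift are literally
  those of \<open>C\<close>.\<close>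

definition shiftc :: "int \<Rightarrow> ('r, 'b) gcomplex \<Rightarrow> ('r, 'b) gcomplex" where
  "shiftc t C = \<lparr>cobj = (\<lambda>n. cobj C (n - t)), cdiff = (\<lambda>n. cdiff C (n - t))\<rparr>"

lemma shiftc_simps [simp]: "cobj (shiftc t C) n = cobj C (n - t)" "cdiff (shiftc t C) n = cdiff C (n - t)"
  by (auto simp: shiftc_def)

lemma shiftc_cycles [simp]: "cycles (shiftc t C) n = cycles C (n - t)"
  by (simp add: cycles_def algebra_simps)

lemma shiftc_boundaries [simp]: "boundaries (shiftc t C) n = boundaries C (n - t)"
proof -
  have "n + 1 - t = n - t + 1" by simp
  show ?thesis unfolding boundaries_def shiftc_simps \<open>n + 1 - t = n - t + 1\<close> ..
qed

lemma boundaryE: "z \<in> boundaries D n \<Longrightarrow> \<exists>w\<in>carrier (cobj D (n + 1)). cdiff D (n + 1) w = z"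
  by (auto simp: boundaries_def)

section \<open>Torsion homology in a single bidegree\<close>

context std_graded
begin

lemma prodm_torsion:
  assumes M: "graded_module R M" and N: "graded_module R N"
  shows "(u, w) \<in> torsion_set R (prodm M N) \<longleftrightarrow> u \<in> torsion_set R M \<and> w \<in> torsion_set R N"
proof -
  interpret M: graded_mod R M by (rule graded_modI[OF M])
  interpret N: graded_mod R N by (rule graded_modI[OF N])
  note P = prodm_graded(1)[OF M N]
  have f: "fst \<in> graded_hom R (prodm M N) M" "snd \<in> graded_hom R (prodm M N) N" by (rule graded_homI, auto)+
  have g: "(\<lambda>x. (x, \<zero>\<^bsub>N\<^esub>)) \<in> graded_hom R M (prodm M N)" "(\<lambda>x. (\<zero>\<^bsub>M\<^esub>, x)) \<in> graded_hom R N (prodm M N)"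
    by (rule graded_homI, auto)+
  show ?thesis
  proof
    assume "(u, w) \<in> torsion_set R (prodm M N)"
    from torsion_hom[OF P M f(1) this] torsion_hom[OF P N f(2) this]
    show "u \<in> torsion_set R M \<and> w \<in> torsion_set R N" by simp
  next
    assume a: "u \<in> torsion_set R M \<and> w \<in> torsion_set R N"
    then have "u \<in> carrier M" "w \<in> carrier N" by (auto simp: torsion_set_def)
    moreover have "(u, \<zero>\<^bsub>N\<^esub>) \<oplus>\<^bsub>prodm M N\<^esub> (\<zero>\<^bsub>M\<^esub>, w) \<in> torsion_set R (prodm M N)"
      by (rule gsubmodD(3)[OF torsion_gsubmod[OF P] torsion_hom[OF M P g(1)] torsion_hom[OF N P g(2)]]) (use a in auto)
    ultimately show "(u, w) \<in> torsion_set R (prodm M N)" by simp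
  qed
qed

text \<open>The homology of the torsion complex is nonzero in degree \<open>j\<close>.\<close>

definition tor_homology :: "('a, 'e) gcomplex \<Rightarrow> int \<Rightarrow> int \<Rightarrow> bool" where
  "tor_homology C n j \<longleftrightarrow> (\<exists>z\<in>grade (cobj C n) j. z \<in> cycles C n \<and> z \<in> torsion_set R (cobj C n) \<and>
     \<not> (\<exists>w\<in>grade (cobj C (n + 1)) j. w \<in> torsion_set R (cobj C (n + 1)) \<and> cdiff C (n + 1) w = z))"

lemma tor_homologyE:
  assumes "\<not> tor_homology C n j" "z \<in> grade (cobj C n) j" "z \<in> cycles C n" "z \<in> torsion_set R (cobj C n)"
  obtains w where "w \<in> grade (cobj C (n + 1)) j" "w \<in> torsion_set R (cobj C (n + 1))" "cdiff C (n + 1) w = z"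
  using assms unfolding tor_homology_def by blast

lemma tor_homology_shiftc: "tor_homology (shiftc t C) n j \<longleftrightarrow> tor_homology C (n - t) j"
proof -
  have "n + 1 - t = n - t + 1" by simp
  show ?thesis unfolding tor_homology_def shiftc_simps shiftc_cycles \<open>n + 1 - t = n - t + 1\<close> ..
qed

text \<open>Above its homology the complex splits: the section of \<open>boundary_section\<close> is
  a graded homomorphism, and homomorphisms preserve torsion, so torsion boundaries bound torsion
  elements.\<close>

lemma tor_homology_above:
  assumes C: "inj_complex C b" and ex: "\<And>n. t < n \<Longrightarrow> exact_at C n" and "t < n"
  shows "\<not> tor_homology C n j"
proof
  note G = inj_complexD(1)[OF C]
  note cg = cobj_graded[OF G]
  assume "tor_homology C n j"
  then obtain z where z: "z \<in> grade (cobj C n) j" "z \<in> cycles C n" "z \<in> torsion_set R (cobj C n)"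
    "\<not> (\<exists>w\<in>grade (cobj C (n + 1)) j. w \<in> torsion_set R (cobj C (n + 1)) \<and> cdiff C (n + 1) w = z)"
    unfolding tor_homology_def by blast
  obtain \<sigma> where \<sigma>: "\<sigma> \<in> graded_hom R (gsub (cobj C n) (boundaries C n)) (cobj C (n + 1))"
    "\<forall>z\<in>boundaries C n. cdiff C (n + 1) (\<sigma> z) = z" using boundary_section[OF C ex, of n] assms(3) by force
  have zb: "z \<in> boundaries C n" using ex[OF assms(3)] z(2) by (auto simp: exact_at_def)
  have gb: "graded_module R (gsub (cobj C n) (boundaries C n))" by (rule gsub_graded[OF cg boundaries_gsubmod[OF G]])
  have "z \<in> torsion_set R (gsub (cobj C n) (boundaries C n))" using z(3) zb unfolding torsion_set_def by simp
  then have "\<sigma> z \<in> torsion_set R (cobj C (n + 1))" by (rule torsion_hom[OF gb cg \<sigma>(1)])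
  moreover have "\<sigma> z \<in> grade (cobj C (n + 1)) j" using hom_grade[OF \<sigma>(1), of z j] z(1) zb by simp
  ultimately show False using z(4) \<sigma>(2) zb by blast
qed

lemma torsion_complex_graded:
  assumes G: "graded_complex R C"
  shows "graded_complex R (torsion_complex R C)"
proof -
  note cg = cobj_graded[OF G]
  note ts = torsion_gsubmod[OF cg]
  show ?thesis
    unfolding graded_complex_def
  proof (intro allI conjI ballI)
    fix i
    show "graded_module R (cobj (torsion_complex R C) i)"
      by (simp add: torsion_complex_def gsub_graded[OF cg ts])
    show "cdiff (torsion_complex R C) i \<in> graded_hom R (cobj (torsion_complex R C) i) (cobj (torsion_complex R C) (i - 1))"
      using gsub_hom[OF cdiff_hom[OF G] gsubmodD(1)[OF ts] torsion_hom[OF cg cg cdiff_hom[OF G]]]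
      by (simp add: torsion_complex_def)
    fix x assume "x \<in> carrier (cobj (torsion_complex R C) i)"
    then have "x \<in> carrier (cobj C i)" using gsubmodD(6)[OF ts] by (simp add: torsion_complex_def)
    then show "cdiff (torsion_complex R C) (i - 1) (cdiff (torsion_complex R C) i x) = \<zero>\<^bsub>cobj (torsion_complex R C) (i - 2)\<^esub>"
      using G unfolding graded_complex_def by (simp add: torsion_complex_def)
  qed
qed

text \<open>Links the graded pieces occurring in \<open>reg\<close> to the elementwise notion;
  \<open>boundary_homog\<close>, applied to the torsion complex, supplies bounding elements in
  degree \<open>j\<close>.\<close>

lemma tor_homology_iff:
  assumes G: "graded_complex R C"
  shows "grade (homology (torsion_complex R C) n) j \<noteq> {\<zero>\<^bsub>homology (torsion_complex R C) n\<^esub>} \<longleftrightarrow> tor_homology C n j"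
proof -
  let ?T = "torsion_complex R C"
  note gT = torsion_complex_graded[OF G]
  have c: "carrier (cobj ?T i) = torsion_set R (cobj C i)" "grade (cobj ?T i) j = grade (cobj C i) j \<inter> torsion_set R (cobj C i)"
    "cdiff ?T i = cdiff C i" "\<zero>\<^bsub>cobj ?T i\<^esub> = \<zero>\<^bsub>cobj C i\<^esub>" for i by (auto simp: torsion_complex_def)
  have tc: "x \<in> torsion_set R (cobj C i) \<Longrightarrow> x \<in> carrier (cobj C i)" for x i by (simp add: torsion_set_def)
  have b: "z \<in> boundaries ?T n \<longleftrightarrow> (\<exists>w\<in>grade (cobj C (n + 1)) j. w \<in> torsion_set R (cobj C (n + 1)) \<and> cdiff C (n + 1) w = z)"
    if z: "z \<in> grade (cobj ?T n) j" for z
  proof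
    assume "z \<in> boundaries ?T n"
    from boundary_homog[OF gT z this] show "\<exists>w\<in>grade (cobj C (n + 1)) j. w \<in> torsion_set R (cobj C (n + 1)) \<and> cdiff C (n + 1) w = z"
      unfolding c by (metis IntD1 IntD2)
  qed (auto simp: boundaries_def c)
  have cyc: "z \<in> cycles ?T n \<longleftrightarrow> z \<in> cycles C n \<and> z \<in> torsion_set R (cobj C n)" for z
    using tc by (auto simp: c cycles_def)
  have g: "z \<in> grade (cobj ?T n) j \<longleftrightarrow> z \<in> grade (cobj C n) j \<and> z \<in> torsion_set R (cobj C n)" for z
    by (simp add: c)
  show ?thesis
    unfolding grade_homology_ne[OF gT] tor_homology_def Bex_def cyc g
    using b[unfolded g] by (intro ex_cong1) blast
qed

lemma cone_simps [simp]:
  "cobj (cone I K \<psi>) n = prodm (cobj I n) (cobj K (n - 1))"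
  "cdiff (cone I K \<psi>) n x = (cdiff I n (fst x) \<oplus>\<^bsub>cobj I (n - 1)\<^esub> \<psi> (n - 1) (snd x), \<ominus>\<^bsub>cobj K (n - 2)\<^esub> cdiff K (n - 1) (snd x))"
  by (auto simp: cone_def)

lemma prodm_baer:
  assumes M: "baer_inj R M" "graded_module R M" and N: "baer_inj R N" "graded_module R N"
  shows "baer_inj R (prodm M N)"
  unfolding baer_inj_def
proof (intro allI impI)
  fix A s g assume A: "gideal R A" and g: "\<forall>a\<in>A. g a \<in> carrier (prodm M N)"
    "\<forall>a\<in>A. \<forall>b\<in>A. g (a \<oplus> b) = g a \<oplus>\<^bsub>prodm M N\<^esub> g b"
    "\<forall>r\<in>carrier R. \<forall>a\<in>A. g (r \<otimes> a) = r \<odot>\<^bsub>prodm M N\<^esub> g a"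
    "\<forall>i. \<forall>a\<in>A \<inter> rgrade R i. g a \<in> grade (prodm M N) (int i + s)"
  have gc: "fst (g a) \<in> carrier M" "snd (g a) \<in> carrier N" if "a \<in> A" for a using g(1) that by (auto simp: mem_Times_iff)
  have gg: "fst (g a) \<in> grade M (int i + s)" "snd (g a) \<in> grade N (int i + s)" if "a \<in> A" "a \<in> rgrade R i" for a i
    using g(4) that by (auto simp: mem_Times_iff)
  obtain e where e: "e \<in> grade M s" "\<And>a. a \<in> A \<Longrightarrow> fst (g a) = a \<odot>\<^bsub>M\<^esub> e"
    by (rule baer_injD[OF M(1) A, of "\<lambda>a. fst (g a)" s]) (use g(2,3) gc gg in auto)
  obtain e' where e': "e' \<in> grade N s" "\<And>a. a \<in> A \<Longrightarrow> snd (g a) = a \<odot>\<^bsub>N\<^esub> e'"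
    by (rule baer_injD[OF N(1) A, of "\<lambda>a. snd (g a)" s]) (use g(2,3) gc gg in auto)
  show "\<exists>e\<in>grade (prodm M N) s. \<forall>a\<in>A. g a = a \<odot>\<^bsub>prodm M N\<^esub> e"
    using e e' by (intro bexI[of _ "(e, e')"]) (auto simp: prod_eq_iff)
qed

section \<open>The cone of a map inducing an isomorphism in top homology\<close>

context
  fixes I :: "('a, 'e) gcomplex" and K :: "('a, 'f) gcomplex" and \<psi> t b b'
  assumes I: "inj_complex I b" and K: "inj_complex K b'" and psi: "chain_map R K I \<psi>"
    and exaI: "\<And>n. t < n \<Longrightarrow> exact_at I n" and exaK: "\<And>n. n \<noteq> t \<Longrightarrow> exact_at K n"
    and psi_inj: "\<And>z. z \<in> cycles K t \<Longrightarrow> \<psi> t z \<in> boundaries I t \<Longrightarrow> z \<in> boundaries K t"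
    and psi_surj: "\<And>u. u \<in> cycles I t \<Longrightarrow> \<exists>z\<in>cycles K t. u \<ominus>\<^bsub>cobj I t\<^esub> \<psi> t z \<in> boundaries I t"
begin

private abbreviation "C \<equiv> cone I K \<psi>"
private lemmas GI = inj_complexD(1)[OF I]
private lemmas GK = inj_complexD(1)[OF K]
private lemmas cI = cobj_graded[OF GI]
private lemmas cK = cobj_graded[OF GK]

private lemma ph: "\<psi> n \<in> graded_hom R (cobj K n) (cobj I n)" using psi by (simp add: chain_map_def)
private lemma pc: "x \<in> carrier (cobj K n) \<Longrightarrow> \<psi> (n - 1) (cdiff K n x) = cdiff I n (\<psi> n x)" using psi by (simp add: chain_map_def)

text \<open>The cone holds in degree \<open>n\<close> the term of \<open>K\<close> of degree
  \<open>n - 1\<close>, hence \<open>b' + 1\<close> in the bound.\<close>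

lemma cone_inj_complex: "inj_complex C (max b (b' + 1))"
  unfolding inj_complex_def
proof (intro conjI allI impI)
  show "graded_complex R C"
    unfolding graded_complex_def
  proof (intro allI conjI ballI)
    fix n
    show "graded_module R (cobj C n)" by (simp add: prodm_graded(1)[OF cI cK])
    have n2: "n - 1 - 1 = n - 2" by simp
    interpret A: graded_mod R "cobj I (n - 1)" by (rule graded_modI[OF cI])
    interpret B: graded_mod R "cobj K (n - 2)" by (rule graded_modI[OF cK])
    interpret A2: graded_mod R "cobj I (n - 2)" by (rule graded_modI[OF cI])
    interpret B3: graded_mod R "cobj K (n - 3)" by (rule graded_modI[OF cK])
    note dI = cdiff_hom[OF GI, of n] and dK = cdiff_hom[OF GK, of "n - 1", unfolded n2]
    show "cdiff C n \<in> graded_hom R (cobj C n) (cobj C (n - 1))"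
    proof (rule graded_homI)
      show "cdiff C n x \<in> carrier (cobj C (n - 1))" if "x \<in> carrier (cobj C n)" for x
        using that hom_closed[OF dI] hom_closed[OF dK] hom_closed[OF ph] by (auto simp: n2)
      show "cdiff C n x \<in> grade (cobj C (n - 1)) j" if "x \<in> grade (cobj C n) j" for x j
      proof -
        have x: "fst x \<in> grade (cobj I n) j" "snd x \<in> grade (cobj K (n - 1)) j" using that by auto
        show ?thesis
          using A.D_add[OF hom_grade[OF dI x(1)] hom_grade[OF ph x(2)]] B.D_inv[OF hom_grade[OF dK x(2)]] by (simp add: n2)
      qed
      show "cdiff C n (x \<oplus>\<^bsub>cobj C n\<^esub> y) = cdiff C n x \<oplus>\<^bsub>cobj C (n - 1)\<^esub> cdiff C n y"
        if "x \<in> carrier (cobj C n)" "y \<in> carrier (cobj C n)" for x y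
        using that hom_closed[OF dI] hom_closed[OF dK] hom_closed[OF ph]
        by (auto simp: n2 hom_add[OF dI] hom_add[OF dK] hom_add[OF ph] A.M.a_ac B.M.minus_add)
      show "cdiff C n (r \<odot>\<^bsub>cobj C n\<^esub> x) = r \<odot>\<^bsub>cobj C (n - 1)\<^esub> cdiff C n x"
        if "r \<in> carrier R" "x \<in> carrier (cobj C n)" for r x
        using that hom_closed[OF dI] hom_closed[OF dK] hom_closed[OF ph]
        by (auto simp: n2 hom_smult[OF dI] hom_smult[OF dK] hom_smult[OF ph] A.smult_r_distr B.smult_r_minus)
    qed
    fix x assume x: "x \<in> carrier (cobj C n)"
    then obtain u w where uw: "x = (u, w)" "u \<in> carrier (cobj I n)" "w \<in> carrier (cobj K (n - 1))" by auto
    have n3: "n - 1 - 2 = n - 3" "n - 2 - 1 = n - 3" by auto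
    note dI1 = cdiff_hom[OF GI, of "n - 1", unfolded n2] and dK2 = cdiff_hom[OF GK, of "n - 2", unfolded n3]
    have a: "cdiff I n u \<in> carrier (cobj I (n - 1))" by (rule hom_closed[OF dI uw(2)])
    have pw: "\<psi> (n - 1) w \<in> carrier (cobj I (n - 1))" by (rule hom_closed[OF ph uw(3)])
    have dw: "cdiff K (n - 1) w \<in> carrier (cobj K (n - 2))" by (rule hom_closed[OF dK uw(3)])
    have 1: "cdiff I (n - 1) (cdiff I n u) = \<zero>\<^bsub>cobj I (n - 2)\<^esub>"
      using GI uw(2) unfolding graded_complex_def by blast
    have 2: "cdiff K (n - 2) (cdiff K (n - 1) w) = \<zero>\<^bsub>cobj K (n - 3)\<^esub>"
      using cdiff_cdiff[OF GK, of w "n - 2"] uw(3) n3 by simp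
    have 3: "\<psi> (n - 2) (cdiff K (n - 1) w) = cdiff I (n - 1) (\<psi> (n - 1) w)" using pc[OF uw(3)] n2 by simp
    \<comment> \<open>The sign on the \<open>K\<close>-part makes the two mixed terms
      cancel.\<close>
    have c1: "cdiff I (n - 1) (cdiff I n u \<oplus>\<^bsub>cobj I (n - 1)\<^esub> \<psi> (n - 1) w) \<oplus>\<^bsub>cobj I (n - 2)\<^esub> \<psi> (n - 2) (\<ominus>\<^bsub>cobj K (n - 2)\<^esub> cdiff K (n - 1) w) = \<zero>\<^bsub>cobj I (n - 2)\<^esub>"
      using hom_add[OF dI1 a pw] 1 3 hom_inv[OF cK cI ph dw] hom_closed[OF dI1 pw] by (simp add: A2.M.r_neg)
    have c2: "\<ominus>\<^bsub>cobj K (n - 3)\<^esub> cdiff K (n - 2) (\<ominus>\<^bsub>cobj K (n - 2)\<^esub> cdiff K (n - 1) w) = \<zero>\<^bsub>cobj K (n - 3)\<^esub>"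
      using hom_inv[OF cK cK dK2 dw] 2 by simp
    show "cdiff C (n - 1) (cdiff C n x) = \<zero>\<^bsub>cobj C (n - 2)\<^esub>"
      using c1 c2 by (simp add: uw(1) n2 n3)
  qed
  show "baer_inj R (cobj C n)" for n
    using prodm_baer[OF inj_complexD(2)[OF I] cI inj_complexD(2)[OF K] cK] by simp
  fix n assume "max b (b' + 1) < n"
  then have "zero_module (cobj I n)" "zero_module (cobj K (n - 1))" using inj_complexD(3)[OF I] inj_complexD(3)[OF K] by auto
  then show "zero_module (cobj C n)" by (auto simp: zero_module_def)
qed

private lemmas GC = inj_complexD(1)[OF cone_inj_complex]

lemma cone_cycles: "(u, w) \<in> cycles C n \<longleftrightarrow> u \<in> carrier (cobj I n) \<and> w \<in> cycles K (n - 1) \<and>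
    cdiff I n u \<oplus>\<^bsub>cobj I (n - 1)\<^esub> \<psi> (n - 1) w = \<zero>\<^bsub>cobj I (n - 1)\<^esub>"
proof -
  interpret B: graded_mod R "cobj K (n - 2)" by (rule graded_modI[OF cK])
  have n2: "n - 1 - 1 = n - 2" by simp
  have "\<ominus>\<^bsub>cobj K (n - 2)\<^esub> cdiff K (n - 1) w = \<zero>\<^bsub>cobj K (n - 2)\<^esub> \<longleftrightarrow> cdiff K (n - 1) w = \<zero>\<^bsub>cobj K (n - 2)\<^esub>"
    if "w \<in> carrier (cobj K (n - 1))"
    using hom_closed[OF cdiff_hom[OF GK] that] n2 by (metis B.M.minus_minus B.M.inv_zero)
  then show ?thesis by (auto simp: cycles_def n2)
qed

lemma cone_boundariesI:
  assumes "v \<in> carrier (cobj I (n + 1))" "w \<in> carrier (cobj K n)"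
  shows "(cdiff I (n + 1) v \<oplus>\<^bsub>cobj I n\<^esub> \<psi> n w, \<ominus>\<^bsub>cobj K (n - 1)\<^esub> cdiff K n w) \<in> boundaries C n"
proof -
  have "cdiff C (n + 1) (v, w) \<in> boundaries C n" unfolding boundaries_def using assms by (intro imageI) simp
  moreover have "n + 1 - 2 = n - 1" by simp
  ultimately show ?thesis by simp
qed

lemma cone_boundariesE:
  assumes "(u, w) \<in> boundaries C n"
  obtains v y where "v \<in> carrier (cobj I (n + 1))" "y \<in> carrier (cobj K n)"
    "u = cdiff I (n + 1) v \<oplus>\<^bsub>cobj I n\<^esub> \<psi> n y" "w = \<ominus>\<^bsub>cobj K (n - 1)\<^esub> cdiff K n y"
proof -
  obtain x where x: "x \<in> carrier (cobj C (n + 1))" "(u, w) = cdiff C (n + 1) x" using assms by (auto simp: boundaries_def)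
  have e: "n + 1 - 2 = n - 1" by simp
  show ?thesis using x that[of "fst x" "snd x"] by (auto simp: e)
qed

lemma psi_boundary: "z \<in> boundaries K n \<Longrightarrow> \<psi> n z \<in> boundaries I n"
  using pc[of _ "n + 1"] hom_closed[OF ph, of _ "n + 1"] by (auto simp: boundaries_def)

lemma psi_cycle: "z \<in> cycles K n \<Longrightarrow> \<psi> n z \<in> cycles I n"
  using pc[of z n] hom_closed[OF ph, of z n] hom_zero[OF cK cI ph, of "n - 1"] by (auto simp: cycles_def)

text \<open>A cycle whose \<open>K\<close>-part bounds is homologous to one coming from \<open>I\<close>.\<close>

lemma cone_reduce:
  assumes c: "(u, w) \<in> cycles C n" and w': "w' \<in> carrier (cobj K n)" "cdiff K n w' = w"
  shows "u \<oplus>\<^bsub>cobj I n\<^esub> \<psi> n w' \<in> cycles I n"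
    "u \<oplus>\<^bsub>cobj I n\<^esub> \<psi> n w' = cdiff I (n + 1) v \<oplus>\<^bsub>cobj I n\<^esub> \<psi> n y \<Longrightarrow> v \<in> carrier (cobj I (n + 1)) \<Longrightarrow> y \<in> cycles K n \<Longrightarrow>
      cdiff C (n + 1) (v, y \<ominus>\<^bsub>cobj K n\<^esub> w') = (u, w)"
proof -
  interpret A: graded_mod R "cobj I n" by (rule graded_modI[OF cI])
  interpret A1: graded_mod R "cobj I (n - 1)" by (rule graded_modI[OF cI])
  interpret B: graded_mod R "cobj K n" by (rule graded_modI[OF cK])
  interpret B1: graded_mod R "cobj K (n - 1)" by (rule graded_modI[OF cK])
  have uc: "u \<in> carrier (cobj I n)" and wc: "w \<in> carrier (cobj K (n - 1))"
    and e: "cdiff I n u \<oplus>\<^bsub>cobj I (n - 1)\<^esub> \<psi> (n - 1) w = \<zero>\<^bsub>cobj I (n - 1)\<^esub>"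
    using c cone_cycles by (auto simp: cycles_def)
  have pw: "\<psi> n w' \<in> carrier (cobj I n)" by (rule hom_closed[OF ph w'(1)])
  have "cdiff I n (u \<oplus>\<^bsub>cobj I n\<^esub> \<psi> n w') = cdiff I n u \<oplus>\<^bsub>cobj I (n - 1)\<^esub> cdiff I n (\<psi> n w')"
    by (rule hom_add[OF cdiff_hom[OF GI] uc pw])
  also have "cdiff I n (\<psi> n w') = \<psi> (n - 1) w" using pc[OF w'(1)] w'(2) by simp
  finally show "u \<oplus>\<^bsub>cobj I n\<^esub> \<psi> n w' \<in> cycles I n" using e uc pw by (simp add: cycles_def)
  assume *: "u \<oplus>\<^bsub>cobj I n\<^esub> \<psi> n w' = cdiff I (n + 1) v \<oplus>\<^bsub>cobj I n\<^esub> \<psi> n y" "v \<in> carrier (cobj I (n + 1))" "y \<in> cycles K n"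
  have yc: "y \<in> carrier (cobj K n)" "cdiff K n y = \<zero>\<^bsub>cobj K (n - 1)\<^esub>" using *(3) by (auto simp: cycles_def)
  have dv: "cdiff I (n + 1) v \<in> carrier (cobj I n)" by (rule hom_closed[OF cdiff_hom'[OF GI] *(2)])
  have py: "\<psi> n y \<in> carrier (cobj I n)" by (rule hom_closed[OF ph yc(1)])
  have "cdiff I (n + 1) v \<oplus>\<^bsub>cobj I n\<^esub> \<psi> n (y \<ominus>\<^bsub>cobj K n\<^esub> w') = (cdiff I (n + 1) v \<oplus>\<^bsub>cobj I n\<^esub> \<psi> n y) \<oplus>\<^bsub>cobj I n\<^esub> \<ominus>\<^bsub>cobj I n\<^esub> \<psi> n w'"
    using hom_minus[OF cK cI ph yc(1) w'(1)] dv py pw by (simp add: A.M.minus_eq A.M.a_assoc)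
  also have "\<dots> = (u \<oplus>\<^bsub>cobj I n\<^esub> \<psi> n w') \<oplus>\<^bsub>cobj I n\<^esub> \<ominus>\<^bsub>cobj I n\<^esub> \<psi> n w'" by (simp only: *(1))
  also have "\<dots> = u" using uc pw by (simp add: A.M.a_assoc A.M.r_neg)
  finally have 1: "cdiff I (n + 1) v \<oplus>\<^bsub>cobj I n\<^esub> \<psi> n (y \<ominus>\<^bsub>cobj K n\<^esub> w') = u" .
  have "cdiff K n (y \<ominus>\<^bsub>cobj K n\<^esub> w') = \<ominus>\<^bsub>cobj K (n - 1)\<^esub> w"
    using hom_minus[OF cK cK cdiff_hom[OF GK] yc(1) w'(1)] yc(2) w'(2) wc by (simp add: B1.M.minus_eq)
  then have 2: "\<ominus>\<^bsub>cobj K (n - 1)\<^esub> cdiff K n (y \<ominus>\<^bsub>cobj K n\<^esub> w') = w" using wc by simp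
  have n: "n + 1 - 2 = n - 1" by simp
  show "cdiff C (n + 1) (v, y \<ominus>\<^bsub>cobj K n\<^esub> w') = (u, w)" using 1 2 by (simp add: n)
qed

lemma K_boundaryE: "z \<in> boundaries K (n - 1) \<Longrightarrow> \<exists>w\<in>carrier (cobj K n). cdiff K n w = z"
  using boundaryE[of z K "n - 1"] by simp

text \<open>The \<open>K\<close>-part of a cycle bounds by exactness of \<open>K\<close>, or, when
  \<open>n - 1 = t\<close>, by injectivity of the homology map. After reduction to a cycle of
  \<open>I\<close>, this cycle bounds if \<open>n > t\<close>; if \<open>n = t\<close>, surjectivity
  makes it a boundary plus the image of a cycle of \<open>K\<close>.\<close>

lemma cone_exact_above:
  assumes n: "t \<le> n"
  shows "exact_at C n"
  unfolding exact_at_def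
proof
  fix x assume x: "x \<in> cycles C n"
  obtain u w where uw: "x = (u, w)" by (cases x)
  have c: "(u, w) \<in> cycles C n" using x uw by simp
  have uc: "u \<in> carrier (cobj I n)" and wz: "w \<in> cycles K (n - 1)" and e: "cdiff I n u \<oplus>\<^bsub>cobj I (n - 1)\<^esub> \<psi> (n - 1) w = \<zero>\<^bsub>cobj I (n - 1)\<^esub>"
    using c cone_cycles by auto
  interpret A: graded_mod R "cobj I n" by (rule graded_modI[OF cI])
  interpret A1: graded_mod R "cobj I (n - 1)" by (rule graded_modI[OF cI])
  interpret A': graded_mod R "cobj I (n + 1)" by (rule graded_modI[OF cI])
  interpret B: graded_mod R "cobj K n" by (rule graded_modI[OF cK])
  have "w \<in> boundaries K (n - 1)"
  proof (cases "n - 1 = t")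
    case False then show ?thesis using exaK[OF False] wz by (auto simp: exact_at_def)
  next
    case True
    have pw: "\<psi> (n - 1) w \<in> carrier (cobj I (n - 1))" using hom_closed[OF ph] wz by (auto simp: cycles_def)
    have du: "cdiff I n u \<in> carrier (cobj I (n - 1))" by (rule hom_closed[OF cdiff_hom[OF GI] uc])
    have "\<psi> (n - 1) w \<oplus>\<^bsub>cobj I (n - 1)\<^esub> cdiff I n u = \<zero>\<^bsub>cobj I (n - 1)\<^esub>" using e du pw by (simp add: A1.M.a_comm)
    then have "\<psi> (n - 1) w = \<ominus>\<^bsub>cobj I (n - 1)\<^esub> cdiff I n u" using A1.M.minus_equality[OF _ du pw] by simp
    also have "\<dots> = cdiff I n (\<ominus>\<^bsub>cobj I n\<^esub> u)" by (rule hom_inv[OF cI cI cdiff_hom[OF GI] uc, symmetric])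
    also have "\<dots> \<in> boundaries I (n - 1)" using uc by (simp add: boundaries_def)
    finally show ?thesis using psi_inj[of w] wz True by simp
  qed
  then obtain w' where w': "w' \<in> carrier (cobj K n)" "cdiff K n w' = w" using K_boundaryE by blast
  let ?u = "u \<oplus>\<^bsub>cobj I n\<^esub> \<psi> n w'"
  have ucy: "?u \<in> cycles I n" by (rule cone_reduce(1)[OF c w'])
  have uuc: "?u \<in> carrier (cobj I n)" using ucy by (simp add: cycles_def)
  have "\<exists>z\<in>cycles K n. ?u \<ominus>\<^bsub>cobj I n\<^esub> \<psi> n z \<in> boundaries I n"
  proof (cases "n = t")
    case True then show ?thesis using psi_surj ucy by simp
  next
    case False
    then have "?u \<in> boundaries I n" using exaI[of n] n ucy by (auto simp: exact_at_def)
    moreover have "?u \<ominus>\<^bsub>cobj I n\<^esub> \<psi> n \<zero>\<^bsub>cobj K n\<^esub> = ?u" using hom_zero[OF cK cI ph, of n] uuc by (simp add: A.M.minus_eq)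
    moreover have "\<zero>\<^bsub>cobj K n\<^esub> \<in> cycles K n" by (rule gsubmodD(2)[OF cycles_gsubmod[OF GK]])
    ultimately show ?thesis by (intro bexI[of _ "\<zero>\<^bsub>cobj K n\<^esub>"]) simp_all
  qed
  then obtain z where z: "z \<in> cycles K n" "?u \<ominus>\<^bsub>cobj I n\<^esub> \<psi> n z \<in> boundaries I n" by blast
  obtain v where v: "v \<in> carrier (cobj I (n + 1))" "cdiff I (n + 1) v = ?u \<ominus>\<^bsub>cobj I n\<^esub> \<psi> n z"
    by (rule bexE[OF boundaryE[OF z(2)]]) (rule that)
  have pz: "\<psi> n z \<in> carrier (cobj I n)" using hom_closed[OF ph] z(1) by (simp add: cycles_def)
  have "?u = cdiff I (n + 1) v \<oplus>\<^bsub>cobj I n\<^esub> \<psi> n z"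
    unfolding v(2) using uuc pz by (simp only: A.M.minus_eq A.M.a_assoc A.M.l_neg A.M.a_inv_closed A.M.r_zero)
  from cone_reduce(2)[OF c w' this v(1) z(1)] have "cdiff C (n + 1) (v, z \<ominus>\<^bsub>cobj K n\<^esub> w') = x" using uw by simp
  moreover have "(v, z \<ominus>\<^bsub>cobj K n\<^esub> w') \<in> carrier (cobj C (n + 1))" using v(1) w'(1) z(1) by (simp add: cycles_def)
  ultimately show "x \<in> boundaries C n" unfolding boundaries_def by blast
qed

text \<open>Below \<open>t\<close> the complex \<open>K\<close> is exact in degrees \<open>n\<close>
  and \<open>n - 1\<close>, so the inclusion \<open>u\<close> to \<open>(u, 0)\<close> of
  \<open>I\<close> into the cone induces an isomorphism in degree \<open>n\<close>; the relation for
  \<open>I\<close> is pushed along it.\<close>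

lemma cone_linked:
  assumes l: "linked I n M" and n: "n < t" and M: "graded_module R M"
  shows "linked C n M"
proof -
  obtain Q where Q: "gsubmod R (prodm (cobj I n) M) Q" "fst ` Q = cycles I n" "snd ` Q = carrier M"
     "\<forall>u m. (u, m) \<in> Q \<longrightarrow> (u \<in> boundaries I n \<longleftrightarrow> m = \<zero>\<^bsub>M\<^esub>)" using l unfolding linked_def by blast
  interpret A: graded_mod R "cobj I n" by (rule graded_modI[OF cI])
  interpret A1: graded_mod R "cobj I (n - 1)" by (rule graded_modI[OF cI])
  interpret A': graded_mod R "cobj C n" by (rule graded_modI[OF cobj_graded[OF GC]])
  interpret B: graded_mod R "cobj K n" by (rule graded_modI[OF cK])
  let ?N = "gsub (prodm (cobj I n) M) Q"
  have gN: "graded_module R ?N" by (rule gsub_graded[OF prodm_graded(1)[OF cI M] Q(1)])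
  have h2: "snd \<in> graded_hom R ?N M"
    by (rule gsub_hom1[OF _ gsubmodD(1)[OF Q(1)]]) (rule graded_homI, auto)
  have qc: "fst q \<in> cycles I n" "fst q \<in> carrier (cobj I n)" if "q \<in> Q" for q
    using Q(2) imageI[OF that, of fst] by (auto simp: cycles_def)
  interpret B1: graded_mod R "cobj K (n - 1)" by (rule graded_modI[OF cK])
  have h1: "(\<lambda>q. (fst q, \<zero>\<^bsub>cobj K (n - 1)\<^esub>)) \<in> graded_hom R ?N (cobj C n)"
    by (rule gsub_hom1[OF _ gsubmodD(1)[OF Q(1)]]) (rule graded_homI, auto)
  have z: "\<psi> i \<zero>\<^bsub>cobj K i\<^esub> = \<zero>\<^bsub>cobj I i\<^esub>" for i by (rule hom_zero[OF cK cI ph])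
  have zK: "\<zero>\<^bsub>cobj K i\<^esub> \<in> cycles K i" for i by (rule gsubmodD(2)[OF cycles_gsubmod[OF GK]])
  show ?thesis
  proof (rule linkedI[OF GC gN M h1 h2])
    show "snd ` carrier ?N = carrier M" using Q(3) by simp
    fix q assume "q \<in> carrier ?N"
    then have q: "q \<in> Q" by simp
    have qcy: "cdiff I n (fst q) = \<zero>\<^bsub>cobj I (n - 1)\<^esub>" using qc[OF q] by (simp add: cycles_def)
    show "(fst q, \<zero>\<^bsub>cobj K (n - 1)\<^esub>) \<in> cycles C n"
      using qc[OF q] qcy zK z[of "n - 1"] by (simp add: cone_cycles)
    show "(fst q, \<zero>\<^bsub>cobj K (n - 1)\<^esub>) \<in> boundaries C n \<longleftrightarrow> snd q = \<zero>\<^bsub>M\<^esub>"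
    proof -
      have "(fst q, \<zero>\<^bsub>cobj K (n - 1)\<^esub>) \<in> boundaries C n \<longleftrightarrow> fst q \<in> boundaries I n"
      proof
        assume "(fst q, \<zero>\<^bsub>cobj K (n - 1)\<^esub>) \<in> boundaries C n"
        then obtain v y where vy: "v \<in> carrier (cobj I (n + 1))" "y \<in> carrier (cobj K n)"
          "fst q = cdiff I (n + 1) v \<oplus>\<^bsub>cobj I n\<^esub> \<psi> n y" "\<zero>\<^bsub>cobj K (n - 1)\<^esub> = \<ominus>\<^bsub>cobj K (n - 1)\<^esub> cdiff K n y"
          by (rule cone_boundariesE)
        have "cdiff K n y = \<zero>\<^bsub>cobj K (n - 1)\<^esub>"
          using vy(4) hom_closed[OF cdiff_hom[OF GK] vy(2)] by (metis B1.M.minus_minus B1.M.inv_zero)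
        then have "y \<in> boundaries K n" using vy(2) exaK[of n] n by (auto simp: exact_at_def cycles_def)
        then have "\<psi> n y \<in> boundaries I n" by (rule psi_boundary)
        moreover have "cdiff I (n + 1) v \<in> boundaries I n" using vy(1) by (auto simp: boundaries_def)
        ultimately show "fst q \<in> boundaries I n" using vy(3) gsubmodD(3)[OF boundaries_gsubmod[OF GI]] by simp
      next
        assume "fst q \<in> boundaries I n"
        then have "\<exists>v\<in>carrier (cobj I (n + 1)). cdiff I (n + 1) v = fst q" by (rule boundaryE)
        then obtain v where v: "v \<in> carrier (cobj I (n + 1))" "cdiff I (n + 1) v = fst q" by (rule bexE)
        have dz: "cdiff K n \<zero>\<^bsub>cobj K n\<^esub> = \<zero>\<^bsub>cobj K (n - 1)\<^esub>" by (rule hom_zero[OF cK cK cdiff_hom[OF GK]])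
        show "(fst q, \<zero>\<^bsub>cobj K (n - 1)\<^esub>) \<in> boundaries C n"
          using cone_boundariesI[OF v(1), of "\<zero>\<^bsub>cobj K n\<^esub>"] v(2) z[of n] qc[OF q] dz by simp
      qed
      also have "\<dots> \<longleftrightarrow> snd q = \<zero>\<^bsub>M\<^esub>" using Q(4) q by (metis prod.collapse)
      finally show ?thesis .
    qed
  next
    fix x assume x: "x \<in> cycles C n"
    obtain u w where uw: "x = (u, w)" by (cases x)
    have c: "(u, w) \<in> cycles C n" using x uw by simp
    have uc: "u \<in> carrier (cobj I n)" and wz: "w \<in> cycles K (n - 1)" using c cone_cycles by auto
    have wc: "w \<in> carrier (cobj K (n - 1))" using wz by (simp add: cycles_def)
    have "w \<in> boundaries K (n - 1)" using exaK[of "n - 1"] n wz by (auto simp: exact_at_def)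
    then obtain w' where w': "w' \<in> carrier (cobj K n)" "cdiff K n w' = w" using K_boundaryE by blast
    let ?u = "u \<oplus>\<^bsub>cobj I n\<^esub> \<psi> n w'"
    have ucy: "?u \<in> cycles I n" by (rule cone_reduce(1)[OF c w'])
    have pw: "\<psi> n w' \<in> carrier (cobj I n)" by (rule hom_closed[OF ph w'(1)])
    have "?u \<in> fst ` Q" using ucy Q(2) by simp
    then obtain q where q: "q \<in> Q" "fst q = ?u" by force
    interpret A2: graded_mod R "cobj I (n + 1)" by (rule graded_modI[OF cI])
    have d0: "cdiff I (n + 1) \<zero>\<^bsub>cobj I (n + 1)\<^esub> = \<zero>\<^bsub>cobj I n\<^esub>" by (rule hom_zero[OF cI cI cdiff_hom'[OF GI]])
    \<comment> \<open>The difference between \<open>x\<close> and its reduction to \<open>I\<close>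
      is the boundary of \<open>(0, - w')\<close>.\<close>
    have "(cdiff I (n + 1) \<zero>\<^bsub>cobj I (n + 1)\<^esub> \<oplus>\<^bsub>cobj I n\<^esub> \<psi> n (\<ominus>\<^bsub>cobj K n\<^esub> w'), \<ominus>\<^bsub>cobj K (n - 1)\<^esub> cdiff K n (\<ominus>\<^bsub>cobj K n\<^esub> w')) \<in> boundaries C n"
      using w'(1) by (intro cone_boundariesI) auto
    then have bd: "(\<ominus>\<^bsub>cobj I n\<^esub> \<psi> n w', w) \<in> boundaries C n"
      using hom_inv[OF cK cI ph w'(1)] hom_inv[OF cK cK cdiff_hom[OF GK] w'(1)] d0 w'(2) pw wc by simp
    have "x \<ominus>\<^bsub>cobj C n\<^esub> (fst q, \<zero>\<^bsub>cobj K (n - 1)\<^esub>) = (\<ominus>\<^bsub>cobj I n\<^esub> \<psi> n w', w)"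
    proof -
      have fqc: "(fst q, \<zero>\<^bsub>cobj K (n - 1)\<^esub>) \<in> carrier (cobj C n)" using qc[OF q(1)] by simp
      have "(\<ominus>\<^bsub>cobj I n\<^esub> \<psi> n w', w) \<oplus>\<^bsub>cobj C n\<^esub> (fst q, \<zero>\<^bsub>cobj K (n - 1)\<^esub>) = x"
        using q(2) uc pw wc uw by (simp add: A.M.a_comm[of u] A.M.r_neg1)
      then have "x \<ominus>\<^bsub>cobj C n\<^esub> (fst q, \<zero>\<^bsub>cobj K (n - 1)\<^esub>) = ((\<ominus>\<^bsub>cobj I n\<^esub> \<psi> n w', w) \<oplus>\<^bsub>cobj C n\<^esub> (fst q, \<zero>\<^bsub>cobj K (n - 1)\<^esub>)) \<ominus>\<^bsub>cobj C n\<^esub> (fst q, \<zero>\<^bsub>cobj K (n - 1)\<^esub>)" by simp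
      also have "\<dots> = (\<ominus>\<^bsub>cobj I n\<^esub> \<psi> n w', w)"
      proof -
        have "(\<ominus>\<^bsub>cobj I n\<^esub> \<psi> n w', w) \<in> carrier (cobj C n)" using pw wc by simp
        then show ?thesis using fqc by (simp only: A'.M.minus_eq A'.M.a_assoc A'.M.r_neg A'.M.a_inv_closed A'.M.r_zero)
      qed
      finally show ?thesis .
    qed
    then show "\<exists>q\<in>carrier ?N. x \<ominus>\<^bsub>cobj C n\<^esub> (fst q, \<zero>\<^bsub>cobj K (n - 1)\<^esub>) \<in> boundaries C n"
      using bd q(1) by (intro bexI[of _ q]) auto
  qed
qed

section \<open>The long exact sequence of torsion homology\<close>

private lemma tC: "(u, w) \<in> torsion_set R (prodm (cobj I n) (cobj K m)) \<longleftrightarrow> u \<in> torsion_set R (cobj I n) \<and> w \<in> torsion_set R (cobj K m)"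
  by (rule prodm_torsion[OF cI cK])

private lemma tp: "w \<in> torsion_set R (cobj K n) \<Longrightarrow> \<psi> n w \<in> torsion_set R (cobj I n)"
  by (rule torsion_hom[OF cK cI ph])

private lemma tcar: "w \<in> torsion_set R N \<Longrightarrow> w \<in> carrier N"
  by (simp add: torsion_set_def)

text \<open>Exactness at the cone: its torsion homology in degree \<open>n\<close> sits between that
  of \<open>I\<close> in degree \<open>n\<close> and that of \<open>K\<close> in degree
  \<open>n - 1\<close>. For \<open>n < t\<close> the latter vanishes by hypothesis; from degree
  \<open>t\<close> on the cone is exact.\<close>

lemma tor_homology_cone_le:
  assumes v: "\<And>n j. n \<le> t - 2 \<Longrightarrow> \<not> tor_homology K n j" and nI: "\<not> tor_homology I n j"
  shows "\<not> tor_homology C n j"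
proof (cases "t \<le> n")
  case True
  show ?thesis by (rule tor_homology_above[OF cone_inj_complex, of "t - 1"]) (use True cone_exact_above in auto)
next
  case False
  interpret A: graded_mod R "cobj I n" by (rule graded_modI[OF cI])
  interpret B: graded_mod R "cobj K n" by (rule graded_modI[OF cK])
  have "\<exists>q\<in>grade (cobj C (n + 1)) j. q \<in> torsion_set R (cobj C (n + 1)) \<and> cdiff C (n + 1) q = x"
    if x: "x \<in> grade (cobj C n) j" "x \<in> cycles C n" "x \<in> torsion_set R (cobj C n)" for x
  proof -
    obtain u w where uw: "x = (u, w)" by (cases x)
    have c: "(u, w) \<in> cycles C n" using x uw by simp
    have wz: "w \<in> cycles K (n - 1)" using c cone_cycles by auto
    have g: "u \<in> grade (cobj I n) j" "w \<in> grade (cobj K (n - 1)) j" using x(1) uw by auto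
    have tt: "u \<in> torsion_set R (cobj I n)" "w \<in> torsion_set R (cobj K (n - 1))" using x(3) uw tC by auto
    have "\<not> tor_homology K (n - 1) j" using v False by simp
    then obtain w' where w': "w' \<in> grade (cobj K n) j" "w' \<in> torsion_set R (cobj K n)" "cdiff K n w' = w"
      using tor_homologyE[of K "n - 1" j w] g(2) wz tt(2) by auto
    let ?u = "u \<oplus>\<^bsub>cobj I n\<^esub> \<psi> n w'"
    have ucy: "?u \<in> cycles I n" by (rule cone_reduce(1)[OF c tcar[OF w'(2)] w'(3)])
    have ug: "?u \<in> grade (cobj I n) j" by (rule A.D_add[OF g(1) hom_grade[OF ph w'(1)]])
    have ut: "?u \<in> torsion_set R (cobj I n)" by (rule gsubmodD(3)[OF torsion_gsubmod[OF cI] tt(1) tp[OF w'(2)]])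
    obtain v where v: "v \<in> grade (cobj I (n + 1)) j" "v \<in> torsion_set R (cobj I (n + 1))" "cdiff I (n + 1) v = ?u"
      by (rule tor_homologyE[OF nI ug ucy ut])
    have zc: "\<zero>\<^bsub>cobj K n\<^esub> \<in> cycles K n" by (rule gsubmodD(2)[OF cycles_gsubmod[OF GK]])
    have "?u = cdiff I (n + 1) v \<oplus>\<^bsub>cobj I n\<^esub> \<psi> n \<zero>\<^bsub>cobj K n\<^esub>"
      using hom_zero[OF cK cI ph, of n] v(3) tcar[OF ut] by simp
    from cone_reduce(2)[OF c tcar[OF w'(2)] w'(3) this tcar[OF v(2)] zc]
    have "cdiff C (n + 1) (v, \<zero>\<^bsub>cobj K n\<^esub> \<ominus>\<^bsub>cobj K n\<^esub> w') = x" using uw by simp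
    moreover have "\<zero>\<^bsub>cobj K n\<^esub> \<ominus>\<^bsub>cobj K n\<^esub> w' = \<ominus>\<^bsub>cobj K n\<^esub> w'" using tcar[OF w'(2)] by (simp add: B.M.minus_eq)
    moreover have "(v, \<ominus>\<^bsub>cobj K n\<^esub> w') \<in> grade (cobj C (n + 1)) j" using v(1) B.D_inv[OF w'(1)] by simp
    moreover have "(v, \<ominus>\<^bsub>cobj K n\<^esub> w') \<in> torsion_set R (cobj C (n + 1))"
      using tC v(2) gsubmod_inv[OF cK torsion_gsubmod[OF cK] w'(2)] by simp
    ultimately show ?thesis by (intro bexI[of _ "(v, \<ominus>\<^bsub>cobj K n\<^esub> w')"]) simp_all
  qed
  then show ?thesis unfolding tor_homology_def by blast
qed

text \<open>Exactness at \<open>K\<close>: if the image in \<open>I\<close> of a torsion cycle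
  \<open>w\<close> bounds a torsion \<open>v\<close>, then \<open>(- v, w)\<close> is a torsion
  cycle of the cone, and the \<open>K\<close>-part of an element bounding it bounds \<open>w\<close>
  up to sign.\<close>

lemma tor_homology_cone_stalk:
  assumes nC: "\<not> tor_homology C (n + 1) j" and nI: "\<not> tor_homology I n j"
  shows "\<not> tor_homology K n j"
proof -
  interpret A: graded_mod R "cobj I n" by (rule graded_modI[OF cI])
  interpret A1: graded_mod R "cobj I (n + 1)" by (rule graded_modI[OF cI])
  interpret B1: graded_mod R "cobj K (n + 1)" by (rule graded_modI[OF cK])
  have "\<exists>y\<in>grade (cobj K (n + 1)) j. y \<in> torsion_set R (cobj K (n + 1)) \<and> cdiff K (n + 1) y = w"
    if w: "w \<in> grade (cobj K n) j" "w \<in> cycles K n" "w \<in> torsion_set R (cobj K n)" for w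
  proof -
    obtain v where v: "v \<in> grade (cobj I (n + 1)) j" "v \<in> torsion_set R (cobj I (n + 1))" "cdiff I (n + 1) v = \<psi> n w"
      by (rule tor_homologyE[OF nI hom_grade[OF ph w(1)] psi_cycle[OF w(2)] tp[OF w(3)]])
    let ?x = "(\<ominus>\<^bsub>cobj I (n + 1)\<^esub> v, w)"
    have 1: "?x \<in> grade (cobj C (n + 1)) j" using A1.D_inv[OF v(1)] w(1) by simp
    have dv: "cdiff I (n + 1) (\<ominus>\<^bsub>cobj I (n + 1)\<^esub> v) = \<ominus>\<^bsub>cobj I n\<^esub> \<psi> n w"
      using hom_inv[OF cI cI cdiff_hom'[OF GI] tcar[OF v(2)]] v(3) by simp
    have 2: "?x \<in> cycles C (n + 1)"
      using cone_cycles[of "\<ominus>\<^bsub>cobj I (n + 1)\<^esub> v" w "n + 1"] w(2) tcar[OF v(2)] dv tcar[OF tp[OF w(3)]] by (simp add: A.M.l_neg)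
    have 3: "?x \<in> torsion_set R (cobj C (n + 1))"
      using tC gsubmod_inv[OF cI torsion_gsubmod[OF cI] v(2)] w(3) by simp
    obtain q where q: "q \<in> grade (cobj C (n + 1 + 1)) j" "q \<in> torsion_set R (cobj C (n + 1 + 1))" "cdiff C (n + 1 + 1) q = ?x"
      by (rule tor_homologyE[OF nC 1 2 3])
    obtain v' y where q': "q = (v', y)" by (cases q)
    have e: "n + 1 + 1 - 1 = n + 1" "n + 1 + 1 - 2 = n" by auto
    have y: "y \<in> grade (cobj K (n + 1)) j" using q(1) unfolding q' cone_simps e by simp
    have yt: "y \<in> torsion_set R (cobj K (n + 1))" using q(2) unfolding q' cone_simps e tC by simp
    have "\<ominus>\<^bsub>cobj K n\<^esub> cdiff K (n + 1) y = w" using q(3) unfolding q' cone_simps e by simp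
    then have "cdiff K (n + 1) (\<ominus>\<^bsub>cobj K (n + 1)\<^esub> y) = w" using hom_inv[OF cK cK cdiff_hom'[OF GK] tcar[OF yt]] by simp
    then show ?thesis using B1.D_inv[OF y] gsubmod_inv[OF cK torsion_gsubmod[OF cK] yt] by blast
  qed
  then show ?thesis unfolding tor_homology_def by blast
qed

text \<open>Exactness at \<open>I\<close>: a torsion cycle of \<open>I\<close> bounds in the cone,
  so up to a torsion boundary it is the image of a torsion cycle of \<open>K\<close>, which bounds
  in turn.\<close>

lemma tor_homology_cone_ge:
  assumes nC: "\<not> tor_homology C n j" and nK: "\<not> tor_homology K n j"
  shows "\<not> tor_homology I n j"
proof -
  interpret A: graded_mod R "cobj I n" by (rule graded_modI[OF cI])
  interpret A0: graded_mod R "cobj I (n - 1)" by (rule graded_modI[OF cI])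
  interpret A1: graded_mod R "cobj I (n + 1)" by (rule graded_modI[OF cI])
  interpret B0: graded_mod R "cobj K (n - 1)" by (rule graded_modI[OF cK])
  have "\<exists>y\<in>grade (cobj I (n + 1)) j. y \<in> torsion_set R (cobj I (n + 1)) \<and> cdiff I (n + 1) y = u"
    if u: "u \<in> grade (cobj I n) j" "u \<in> cycles I n" "u \<in> torsion_set R (cobj I n)" for u
  proof -
    let ?x = "(u, \<zero>\<^bsub>cobj K (n - 1)\<^esub>)"
    have 1: "?x \<in> grade (cobj C n) j" using u(1) by simp
    have du: "cdiff I n u = \<zero>\<^bsub>cobj I (n - 1)\<^esub>" using u(2) by (simp add: cycles_def)
    have 2: "?x \<in> cycles C n"
      using cone_cycles[of u "\<zero>\<^bsub>cobj K (n - 1)\<^esub>" n] tcar[OF u(3)] du gsubmodD(2)[OF cycles_gsubmod[OF GK]] hom_zero[OF cK cI ph, of "n - 1"] by simp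
    have 3: "?x \<in> torsion_set R (cobj C n)"
      using tC u(3) gsubmodD(2)[OF torsion_gsubmod[OF cK]] by simp
    obtain q where q: "q \<in> grade (cobj C (n + 1)) j" "q \<in> torsion_set R (cobj C (n + 1))" "cdiff C (n + 1) q = ?x"
      by (rule tor_homologyE[OF nC 1 2 3])
    obtain v w where q': "q = (v, w)" by (cases q)
    have e: "n + 1 - 1 = n" "n + 1 - 2 = n - 1" by auto
    have g: "v \<in> grade (cobj I (n + 1)) j" "w \<in> grade (cobj K n) j" using q(1) unfolding q' cone_simps e by auto
    have tt: "v \<in> torsion_set R (cobj I (n + 1))" "w \<in> torsion_set R (cobj K n)" using q(2) unfolding q' cone_simps e tC by auto
    have d: "cdiff I (n + 1) v \<oplus>\<^bsub>cobj I n\<^esub> \<psi> n w = u" "\<ominus>\<^bsub>cobj K (n - 1)\<^esub> cdiff K n w = \<zero>\<^bsub>cobj K (n - 1)\<^esub>"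
      using q(3) unfolding q' cone_simps e by auto
    have "cdiff K n w = \<zero>\<^bsub>cobj K (n - 1)\<^esub>"
      using d(2) hom_closed[OF cdiff_hom[OF GK] tcar[OF tt(2)]] by (metis B0.M.minus_minus B0.M.inv_zero)
    then have wc: "w \<in> cycles K n" using tcar[OF tt(2)] by (simp add: cycles_def)
    obtain y where y: "y \<in> grade (cobj K (n + 1)) j" "y \<in> torsion_set R (cobj K (n + 1))" "cdiff K (n + 1) y = w"
      by (rule tor_homologyE[OF nK g(2) wc tt(2)])
    have "\<psi> n w = cdiff I (n + 1) (\<psi> (n + 1) y)" using pc[OF tcar[OF y(2)]] y(3) by simp
    then have "cdiff I (n + 1) (v \<oplus>\<^bsub>cobj I (n + 1)\<^esub> \<psi> (n + 1) y) = u"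
      using d(1) hom_add[OF cdiff_hom'[OF GI] tcar[OF tt(1)] tcar[OF tp[OF y(2)]]] by simp
    then show ?thesis
      using A1.D_add[OF g(1) hom_grade[OF ph y(1)]] gsubmodD(3)[OF torsion_gsubmod[OF cI] tt(1) tp[OF y(2)]] by blast
  qed
  then show ?thesis unfolding tor_homology_def by blast
qed

text \<open>The first alternative is fed by the dimension bound on the homology in degree
  \<open>t\<close>; the second occurs when no homology is left below \<open>t\<close>.\<close>

lemma tor_homology_cone:
  assumes "(\<forall>n j. n \<le> t - 2 \<longrightarrow> \<not> tor_homology K n j) \<or> (\<forall>n. exact_at C n)"
  shows "tor_homology I n j \<longleftrightarrow> tor_homology K n j \<or> tor_homology C n j"
  using assms
proof
  assume v: "\<forall>n j. n \<le> t - 2 \<longrightarrow> \<not> tor_homology K n j"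
  have "\<not> tor_homology K n j" if nI: "\<not> tor_homology I n j"
  proof (cases "n \<le> t - 2")
    case False
    have "\<not> tor_homology C (n + 1) j"
      by (rule tor_homology_above[OF cone_inj_complex, of "t - 1"]) (use False cone_exact_above in auto)
    then show ?thesis by (rule tor_homology_cone_stalk[OF _ nI])
  qed (use v in blast)
  then show ?thesis using tor_homology_cone_le[of n j] tor_homology_cone_ge[of n j] v by blast
next
  assume x: "\<forall>n. exact_at C n"
  have nC: "\<not> tor_homology C n j" for n
    by (rule tor_homology_above[OF cone_inj_complex, of "n - 1"]) (use x in auto)
  show ?thesis using nC tor_homology_cone_stalk[of n j] tor_homology_cone_ge[of n j] by blast
qed

end

end

section \<open>Decomposition of the torsion homology\<close>

lemma imagec_simps [simp]:
  "cobj (imagec p C) n = imagem p (cobj C n)"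
  "cdiff (imagec p C) n x = p (cdiff C n (inv_into (carrier (cobj C n)) p x))"
  by (auto simp: imagec_def)

lemma imagem_zero [simp]: "\<zero>\<^bsub>imagem p M\<^esub> = p \<zero>\<^bsub>M\<^esub>"
  by (simp add: imagem_def Let_def)

context graded_ring
begin

lemma imagem_baer:
  assumes E: "baer_inj R E" and gE: "graded_module R E" and p: "inj p"
  shows "baer_inj R (imagem p E)"
proof -
  have pc: "inj_on p (carrier E)" using p by (rule inj_on_subset) simp
  note im = imagem_graded[OF gE pc]
  let ?q = "inv_into (carrier E) p"
  show ?thesis
    unfolding baer_inj_def
  proof (intro allI impI)
    fix A s g assume A: "gideal R A" and g: "\<forall>a\<in>A. g a \<in> carrier (imagem p E)"
      "\<forall>a\<in>A. \<forall>b\<in>A. g (a \<oplus> b) = g a \<oplus>\<^bsub>imagem p E\<^esub> g b"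
      "\<forall>r\<in>carrier R. \<forall>a\<in>A. g (r \<otimes> a) = r \<odot>\<^bsub>imagem p E\<^esub> g a"
      "\<forall>i. \<forall>a\<in>A \<inter> rgrade R i. g a \<in> grade (imagem p E) (int i + s)"
    obtain e where e: "e \<in> grade E s" "\<And>a. a \<in> A \<Longrightarrow> ?q (g a) = a \<odot>\<^bsub>E\<^esub> e"
    proof (rule baer_injD[OF E A, of "\<lambda>a. ?q (g a)" s])
      show "?q (g a) \<in> carrier E" if "a \<in> A" for a using hom_closed[OF im(3)] g(1) that by blast
      show "?q (g (a \<oplus> b)) = ?q (g a) \<oplus>\<^bsub>E\<^esub> ?q (g b)" if "a \<in> A" "b \<in> A" for a b
        using hom_add[OF im(3)] g(1,2) that by simp
      show "?q (g (r \<otimes> a)) = r \<odot>\<^bsub>E\<^esub> ?q (g a)" if "r \<in> carrier R" "a \<in> A" for r a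
        using hom_smult[OF im(3)] g(1,3) that by simp
      show "?q (g a) \<in> grade E (int i + s)" if "a \<in> A" "a \<in> rgrade R i" for i a
        using hom_grade[OF im(3)] g(4) that by blast
    qed blast
    interpret E: graded_mod R E by (rule graded_modI[OF gE])
    have ec: "e \<in> carrier E" by (rule E.grade_carrier[OF e(1)])
    have "g a = a \<odot>\<^bsub>imagem p E\<^esub> p e" if a: "a \<in> A" for a
    proof -
      have ac: "a \<in> carrier R" using idealD(1)[OF gidealD(1)[OF A] a] .
      have "g a \<in> p ` carrier E" using g(1) a im(4) by simp
      then have "p (?q (g a)) = g a" by (rule f_inv_into_f)
      then show ?thesis using e(2)[OF a] hom_smult[OF im(2) ac ec] by simp
    qed
    then show "\<exists>e\<in>grade (imagem p E) s. \<forall>a\<in>A. g a = a \<odot>\<^bsub>imagem p E\<^esub> e"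
      using hom_grade[OF im(2) e(1)] by blast
  qed
qed

context
  fixes C :: "('r, 'e) gcomplex" and p :: "'e \<Rightarrow> 'w"
  assumes G: "graded_complex R C" and p: "inj p"
begin

private lemma pon: "inj_on p X'" using p by (rule inj_on_subset) simp
private lemmas cg = cobj_graded[OF G]
private lemmas im = imagem_graded[OF cg pon]

lemma cdiff_imagec: "u \<in> carrier (cobj C n) \<Longrightarrow> cdiff (imagec p C) n (p u) = p (cdiff C n u)"
  using pon by simp

lemma imagec_graded: "graded_complex R (imagec p C)"
  unfolding graded_complex_def
proof (intro allI conjI ballI)
  fix n
  show "graded_module R (cobj (imagec p C) n)" using im(1) by simp
  have "(\<lambda>x. p (cdiff C n (inv_into (carrier (cobj C n)) p x))) \<in> graded_hom R (imagem p (cobj C n)) (imagem p (cobj C (n - 1)))"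
    by (rule hom_compose[OF hom_compose[OF im(3) cdiff_hom[OF G]] im(2)])
  then show "cdiff (imagec p C) n \<in> graded_hom R (cobj (imagec p C) n) (cobj (imagec p C) (n - 1))"
    by (simp add: imagec_def)
  fix x assume "x \<in> carrier (cobj (imagec p C) n)"
  then obtain u where u: "u \<in> carrier (cobj C n)" "x = p u" using im(4) by auto
  have "cdiff C (n - 1) (cdiff C n u) = \<zero>\<^bsub>cobj C (n - 2)\<^esub>" using G u(1) unfolding graded_complex_def by blast
  then show "cdiff (imagec p C) (n - 1) (cdiff (imagec p C) n x) = \<zero>\<^bsub>cobj (imagec p C) (n - 2)\<^esub>"
    unfolding u(2) cdiff_imagec[OF u(1)] cdiff_imagec[OF hom_closed[OF cdiff_hom[OF G] u(1)]] by simp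
qed

lemma cycles_imagec: "cycles (imagec p C) n = p ` cycles C n"
proof -
  have e: "cdiff (imagec p C) n (p u) = \<zero>\<^bsub>cobj (imagec p C) (n - 1)\<^esub> \<longleftrightarrow> cdiff C n u = \<zero>\<^bsub>cobj C (n - 1)\<^esub>"
    if "u \<in> carrier (cobj C n)" for u
    unfolding cdiff_imagec[OF that] using inj_eq[OF p] by simp
  have c: "carrier (cobj (imagec p C) n) = p ` carrier (cobj C n)" using im(4) by simp
  show ?thesis unfolding cycles_def c using e by blast
qed

lemma boundaries_imagec: "boundaries (imagec p C) n = p ` boundaries C n"
proof -
  have c: "carrier (cobj (imagec p C) (n + 1)) = p ` carrier (cobj C (n + 1))" using im(4) by simp
  show ?thesis unfolding boundaries_def c image_image by (rule image_cong[OF refl]) (rule cdiff_imagec)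
qed

lemma exact_at_imagec: "exact_at C n \<Longrightarrow> exact_at (imagec p C) n"
  unfolding exact_at_def cycles_imagec boundaries_imagec by (rule image_mono)

lemma linked_imagec:
  assumes l: "linked C n M" and M: "graded_module R M"
  shows "linked (imagec p C) n M"
proof -
  obtain Q where Q: "gsubmod R (prodm (cobj C n) M) Q" "fst ` Q = cycles C n" "snd ` Q = carrier M"
     "\<forall>u m. (u, m) \<in> Q \<longrightarrow> (u \<in> boundaries C n \<longleftrightarrow> m = \<zero>\<^bsub>M\<^esub>)" using l unfolding linked_def by blast
  let ?N = "gsub (prodm (cobj C n) M) Q"
  have gN: "graded_module R ?N" by (rule gsub_graded[OF prodm_graded(1)[OF cg M] Q(1)])
  have h2: "snd \<in> graded_hom R ?N M"
    by (rule gsub_hom1[OF _ gsubmodD(1)[OF Q(1)]]) (rule graded_homI, auto)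
  have h1: "fst \<in> graded_hom R ?N (cobj C n)"
    by (rule gsub_hom1[OF _ gsubmodD(1)[OF Q(1)]]) (rule graded_homI, auto)
  have h1': "(\<lambda>q. p (fst q)) \<in> graded_hom R ?N (cobj (imagec p C) n)" using hom_compose[OF h1 im(2)] by simp
  interpret D: graded_mod R "cobj (imagec p C) n" by (rule graded_modI[OF cobj_graded[OF imagec_graded]])
  show ?thesis
  proof (rule linkedI[OF imagec_graded gN M h1' h2])
    show "snd ` carrier ?N = carrier M" using Q(3) by simp
    fix q assume "q \<in> carrier ?N"
    then have q: "q \<in> Q" by simp
    then show "p (fst q) \<in> cycles (imagec p C) n" unfolding cycles_imagec using Q(2) by blast
    have "(p (fst q) \<in> p ` boundaries C n) = (fst q \<in> boundaries C n)" using inj_image_mem_iff[OF p] .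
    also have "\<dots> = (snd q = \<zero>\<^bsub>M\<^esub>)" using Q(4) q by (metis prod.collapse)
    finally show "p (fst q) \<in> boundaries (imagec p C) n \<longleftrightarrow> snd q = \<zero>\<^bsub>M\<^esub>" unfolding boundaries_imagec .
  next
    fix u assume "u \<in> cycles (imagec p C) n"
    then obtain v where v: "v \<in> cycles C n" "u = p v" unfolding cycles_imagec by blast
    then have "v \<in> fst ` Q" using Q(2) by simp
    then obtain q where q: "q \<in> Q" "fst q = v" by force
    have "u \<in> carrier (cobj (imagec p C) n)" using v im(4) by (auto simp: cycles_def)
    then have "u \<ominus>\<^bsub>cobj (imagec p C) n\<^esub> p (fst q) = \<zero>\<^bsub>cobj (imagec p C) n\<^esub>"
      using q v by (simp only: D.M.minus_eq D.M.r_neg)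
    then have "u \<ominus>\<^bsub>cobj (imagec p C) n\<^esub> p (fst q) \<in> boundaries (imagec p C) n"
      using gsubmodD(2)[OF boundaries_gsubmod[OF imagec_graded]] by simp
    then show "\<exists>q\<in>carrier ?N. u \<ominus>\<^bsub>cobj (imagec p C) n\<^esub> p (fst q) \<in> boundaries (imagec p C) n" using q(1) by auto
  qed
qed

lemma imagec_inj_complex:
  assumes C: "inj_complex C b"
  shows "inj_complex (imagec p C) b"
  unfolding inj_complex_def
proof (intro conjI allI impI)
  show "baer_inj R (cobj (imagec p C) i)" for i using imagem_baer[OF inj_complexD(2)[OF C] cg p] by simp
  show "zero_module (cobj (imagec p C) i)" if "b < i" for i
    using inj_complexD(3)[OF C that] im(4) by (simp add: zero_module_def)
qed (rule imagec_graded)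

end

end

section \<open>Torsion homology of copies and shifts, and the induction on the top degree\<close>

context std_graded
begin

lemma torsion_imagem:
  assumes M: "graded_module R M" and p: "inj p"
  shows "torsion_set R (imagem p M) = p ` torsion_set R M"
proof -
  have pc: "inj_on p (carrier M)" using p by (rule inj_on_subset) simp
  note im = imagem_graded[OF M pc]
  show ?thesis
  proof
    show "p ` torsion_set R M \<subseteq> torsion_set R (imagem p M)" using torsion_hom[OF M im(1,2)] by blast
    show "torsion_set R (imagem p M) \<subseteq> p ` torsion_set R M"
    proof
      fix x assume x: "x \<in> torsion_set R (imagem p M)"
      then have "x \<in> p ` carrier M" using im(4) by (simp add: torsion_set_def)
      then have "p (inv_into (carrier M) p x) = x" by (rule f_inv_into_f)
      then show "x \<in> p ` torsion_set R M" using torsion_hom[OF im(1) M im(3) x] by (metis imageI)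
    qed
  qed
qed

lemma tor_homology_imagec:
  assumes G: "graded_complex R C" and p: "inj p"
  shows "tor_homology (imagec p C) n j \<longleftrightarrow> tor_homology C n j"
proof -
  note cg = cobj_graded[OF G]
  have pc: "inj_on p (carrier M)" for M using p by (rule inj_on_subset) simp
  have g: "grade (cobj (imagec p C) m) j = p ` grade (cobj C m) j" for m using imagem_graded(5)[OF cg pc] by simp
  have tt: "torsion_set R (cobj (imagec p C) m) = p ` torsion_set R (cobj C m)" for m using torsion_imagem[OF cg p] by simp
  have w: "(\<exists>w\<in>p ` grade (cobj C (n + 1)) j. w \<in> p ` torsion_set R (cobj C (n + 1)) \<and> cdiff (imagec p C) (n + 1) w = p z) \<longleftrightarrow>
    (\<exists>w\<in>grade (cobj C (n + 1)) j. w \<in> torsion_set R (cobj C (n + 1)) \<and> cdiff C (n + 1) w = z)" for z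
  proof -
    have "cdiff (imagec p C) (n + 1) (p v) = p z \<longleftrightarrow> cdiff C (n + 1) v = z" if "v \<in> torsion_set R (cobj C (n + 1))" for v
    proof -
      have "v \<in> carrier (cobj C (n + 1))" using that by (simp add: torsion_set_def)
      from cdiff_imagec[OF G p this] show ?thesis using inj_eq[OF p] by simp
    qed
    then show ?thesis by (simp only: bex_simps inj_image_mem_iff[OF p]) blast
  qed
  have bimg: "(\<exists>z\<in>p ` D. P z) \<longleftrightarrow> (\<exists>z\<in>D. P (p z))" for D P by blast
  show ?thesis
    unfolding tor_homology_def g tt cycles_imagec[OF G p]
    by (subst bimg, simp only: w, simp only: inj_image_mem_iff[OF p])
qed

lemma shiftc_inj_complex:
  assumes C: "inj_complex C b"
  shows "inj_complex (shiftc t C) (b + t)"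
  unfolding inj_complex_def
proof (intro conjI allI impI)
  note G = inj_complexD(1)[OF C]
  show "graded_complex R (shiftc t C)"
    unfolding graded_complex_def
  proof (intro allI conjI ballI)
    fix i
    have e: "i - 1 - t = i - t - 1" "i - 2 - t = i - t - 2" by auto
    show "graded_module R (cobj (shiftc t C) i)" using cobj_graded[OF G] by simp
    show "cdiff (shiftc t C) i \<in> graded_hom R (cobj (shiftc t C) i) (cobj (shiftc t C) (i - 1))"
      unfolding shiftc_simps e by (rule cdiff_hom[OF G])
    show "cdiff (shiftc t C) (i - 1) (cdiff (shiftc t C) i x) = \<zero>\<^bsub>cobj (shiftc t C) (i - 2)\<^esub>"
      if "x \<in> carrier (cobj (shiftc t C) i)" for x
      using G that unfolding shiftc_simps e graded_complex_def by blast
  qed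
  show "baer_inj R (cobj (shiftc t C) i)" for i using inj_complexD(2)[OF C] by simp
  show "zero_module (cobj (shiftc t C) i)" if "b + t < i" for i using inj_complexD(3)[OF C] that by simp
qed

lemma shiftc_exact_at: "exact_at (shiftc t C) n \<longleftrightarrow> exact_at C (n - t)"
  by (simp add: exact_at_def)

lemma shiftc_linked: "linked (shiftc t C) n M \<longleftrightarrow> linked C (n - t) M"
  by (simp add: linked_def)

text \<open>Each cone is moved back along \<open>pr\<close>, so that the induction stays in the type \<open>'w\<close>.\<close>

theorem tor_homology_decomposition:
  fixes pr :: "'w \<times> 'v \<Rightarrow> 'w" and J :: "int \<Rightarrow> ('a, 'v) gcomplex" and M :: "int \<Rightarrow> ('a, 'c) gmodule"
  assumes pr: "inj pr" and J: "\<And>q. inj_complex (J q) (bj q)" and exJ: "\<And>q n. n \<noteq> 0 \<Longrightarrow> exact_at (J q) n"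
    and lJ: "\<And>q. linked (J q) 0 (M q)" and gM: "\<And>q. graded_module R (M q)"
    and zM: "\<And>q. q < lo \<Longrightarrow> zero_module (M q)"
    and van: "\<And>p q n j. p < q \<Longrightarrow> \<not> zero_module (M p) \<Longrightarrow> n \<le> -2 \<Longrightarrow> \<not> tor_homology (J q) n j"
  shows "inj_complex (C :: ('a, 'w) gcomplex) b \<Longrightarrow> (\<And>n. t < n \<Longrightarrow> exact_at C n) \<Longrightarrow> (\<And>n. n \<le> t \<Longrightarrow> linked C n (M n)) \<Longrightarrow>
    tor_homology C n j \<longleftrightarrow> (\<exists>q\<le>t. tor_homology (J q) (n - q) j)"
proof (induction "nat (t - lo + 1)" arbitrary: t C b)
  case 0
  then have t: "t < lo" by simp
  \<comment> \<open>With measure zero, \<open>C\<close> and all \<open>J q\<close> with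
    \<open>q <= t\<close> are linked to zero modules only, so both sides are false.\<close>
  have "exact_at C m" for m
  proof (cases "m \<le> t")
    case True
    then show ?thesis using linked_zero[OF 0(4)[OF True]] zM[of m] t by simp
  qed (use 0(3) in simp)
  then have "\<not> tor_homology C n j" by (intro tor_homology_above[OF 0(2), of "n - 1"]) auto
  moreover have "\<not> tor_homology (J q) m j" if "q \<le> t" for q m
  proof -
    have "exact_at (J q) i" for i using exJ[of i q] linked_zero[OF lJ, of q] zM[of q] that t by (cases "i = 0") auto
    then show ?thesis by (intro tor_homology_above[OF J, of "m - 1"]) auto
  qed
  ultimately show ?case by blast
next
  case (Suc k t C b)
  note C = Suc(3) and exC = Suc(4) and lC = Suc(5)
  define K where "K = shiftc t (J t)"
  have K: "inj_complex K (bj t + t)" unfolding K_def by (rule shiftc_inj_complex[OF J])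
  have exK: "exact_at K n" if "n \<noteq> t" for n unfolding K_def shiftc_exact_at using exJ that by simp
  have lK: "linked K t (M t)" unfolding K_def shiftc_linked using lJ by simp
  have exK': "exact_at K n" if "n < t" for n using exK that by simp
  have "\<exists>\<psi>. chain_map R K C \<psi> \<and> (\<forall>z\<in>cycles K t. \<psi> t z \<in> boundaries C t \<longrightarrow> z \<in> boundaries K t) \<and>
     (\<forall>u\<in>cycles C t. \<exists>z\<in>cycles K t. u \<ominus>\<^bsub>cobj C t\<^esub> \<psi> t z \<in> boundaries C t)"
    by (rule lift_map[OF C exC lC[OF order_refl] inj_complexD(1)[OF K] exK' lK gM])
  then obtain \<psi> where psi: "chain_map R K C \<psi>" and pinj: "\<forall>z\<in>cycles K t. \<psi> t z \<in> boundaries C t \<longrightarrow> z \<in> boundaries K t"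
    and psurj: "\<forall>u\<in>cycles C t. \<exists>z\<in>cycles K t. u \<ominus>\<^bsub>cobj C t\<^esub> \<psi> t z \<in> boundaries C t"
    by (elim exE conjE)
  note A = C K psi exC exK bspec[OF pinj, THEN mp] bspec[OF psurj]
  let ?D = "cone C K \<psi>"
  have gD: "graded_complex R ?D" by (rule inj_complexD(1)[OF cone_inj_complex[OF A]])
  have ex1: "exact_at ?D n" if "t \<le> n" for n by (rule cone_exact_above[OF A that])
  have l1: "linked ?D n (M n)" if "n < t" for n by (rule cone_linked[OF A lC that gM]) (use that in auto)
  \<comment> \<open>If some lower \<open>M p\<close> is nonzero, \<open>van\<close> applies to
    \<open>J t\<close>; otherwise the cone has no homology left.\<close>
  have dis: "(\<forall>n j. n \<le> t - 2 \<longrightarrow> \<not> tor_homology K n j) \<or> (\<forall>n. exact_at ?D n)"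
  proof (cases "\<exists>p<t. \<not> zero_module (M p)")
    case True
    then show ?thesis unfolding K_def tor_homology_shiftc using van[of _ t] by fastforce
  next
    case False
    have "exact_at ?D n" for n
      using ex1[of n] linked_zero[OF l1[of n]] False by (cases "n < t") auto
    then show ?thesis by blast
  qed
  have "tor_homology C n j \<longleftrightarrow> tor_homology K n j \<or> tor_homology ?D n j" by (rule tor_homology_cone[OF A dis])
  also have "tor_homology ?D n j \<longleftrightarrow> tor_homology (imagec pr ?D) n j" by (rule tor_homology_imagec[OF gD pr, symmetric])
  also have "\<dots> \<longleftrightarrow> (\<exists>q\<le>t - 1. tor_homology (J q) (n - q) j)"
  proof (rule Suc(1))
    show "k = nat (t - 1 - lo + 1)" using Suc(2) by simp
    show "inj_complex (imagec pr ?D) (max b (bj t + t + 1))" by (rule imagec_inj_complex[OF gD pr cone_inj_complex[OF A]])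
    show "exact_at (imagec pr ?D) n" if "t - 1 < n" for n using ex1 that by (intro exact_at_imagec[OF gD pr]) simp
    show "linked (imagec pr ?D) n (M n)" if "n \<le> t - 1" for n using l1 that by (intro linked_imagec[OF gD pr _ gM]) simp
  qed
  \<comment> \<open>The resolution \<open>J t\<close>, shifted by \<open>t\<close>, contributes the
    term \<open>q = t\<close> of the disjunction.\<close>
  finally show ?case unfolding K_def tor_homology_shiftc
    by (metis linorder_not_le order_refl zle_diff1_eq order.strict_implies_order order_le_less)
qed

end

section \<open>Regularity\<close>

context graded_ring
begin

text \<open>A component of \<open>r\<close> kills a homogeneous \<open>y\<close>, because the
  product is a component of \<open>r y = 0\<close>; additivity does the rest.\<close>

lemma annihilator_gideal:
  assumes M: "graded_module R M"
  shows "gideal R (annihilator R M)"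
  unfolding gideal_def
proof (intro conjI allI ballI)
  interpret M: graded_mod R M by (rule graded_modI[OF M])
  show "ideal (annihilator R M) R"
    by (rule idealI') (auto simp: annihilator_def M.smult_l_distr M.smult_assoc1 M.smult_l_null)
  fix i r assume r: "r \<in> annihilator R M"
  then have rc: "r \<in> carrier R" by (simp add: annihilator_def)
  have "rc i r \<odot>\<^bsub>M\<^esub> x = \<zero>\<^bsub>M\<^esub>" if "x \<in> carrier M" for x
    using that
  proof (induction rule: M.dsum_induct)
    case zero
    show ?case using rc by (simp add: M.smult_r_null)
  next
    case (homog j y)
    have "y \<in> carrier M" using homog by (rule M.grade_carrier)
    then have "r \<odot>\<^bsub>M\<^esub> y = \<zero>\<^bsub>M\<^esub>" using r by (simp add: annihilator_def)
    then show ?case using smult_hom_mcp[OF graded_ring_axioms M homog rc, of i] by simp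
  next
    case (add y z)
    then show ?case using rc by (simp add: M.smult_r_distr)
  qed
  then show "rc i r \<in> annihilator R M" using rc by (simp add: annihilator_def)
qed

section \<open>Stalk complexes and injective resolutions\<close>

lemma stalk_complex_simps:
  "cobj (stalk_complex M) n = (if n = 0 then M else gsub M {\<zero>\<^bsub>M\<^esub>})"
  "cdiff (stalk_complex M) n x = \<zero>\<^bsub>M\<^esub>"
  "\<zero>\<^bsub>cobj (stalk_complex M) n\<^esub> = \<zero>\<^bsub>M\<^esub>"
  by (auto simp: stalk_complex_def)

lemma stalk_complex_graded:
  assumes M: "graded_module R M"
  shows "graded_complex R (stalk_complex M)"
  unfolding graded_complex_def
proof (intro allI conjI ballI)
  interpret M: graded_mod R M by (rule graded_modI[OF M])
  fix n
  show g: "graded_module R (cobj (stalk_complex M) n)" for n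
    using M gsub_graded[OF M gsubmod_zero[OF M]] by (simp add: stalk_complex_simps)
  interpret N: graded_mod R "cobj (stalk_complex M) (n - 1)" by (rule graded_modI[OF g])
  have "(\<lambda>x. \<zero>\<^bsub>cobj (stalk_complex M) (n - 1)\<^esub>) \<in> graded_hom R (cobj (stalk_complex M) n) (cobj (stalk_complex M) (n - 1))"
    by (rule graded_homI) auto
  then show "cdiff (stalk_complex M) n \<in> graded_hom R (cobj (stalk_complex M) n) (cobj (stalk_complex M) (n - 1))"
    unfolding stalk_complex_simps(3) by (simp add: stalk_complex_def)
  fix x
  show "cdiff (stalk_complex M) (n - 1) (cdiff (stalk_complex M) n x) = \<zero>\<^bsub>cobj (stalk_complex M) (n - 2)\<^esub>"
    by (simp add: stalk_complex_simps)
qed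

lemma stalk_complex_cycles: "cycles (stalk_complex M) n = (if n = 0 then carrier M else {\<zero>\<^bsub>M\<^esub>})"
  unfolding cycles_def stalk_complex_simps by simp

lemma stalk_complex_boundaries:
  assumes M: "graded_module R M"
  shows "boundaries (stalk_complex M) n = {\<zero>\<^bsub>M\<^esub>}"
proof -
  interpret N: graded_mod R "cobj (stalk_complex M) (n + 1)"
    by (rule graded_modI[OF cobj_graded[OF stalk_complex_graded[OF M]]])
  have "carrier (cobj (stalk_complex M) (n + 1)) \<noteq> {}" using N.M.zero_closed by blast
  then show ?thesis unfolding boundaries_def stalk_complex_simps(2) by auto
qed

lemma injective_resolutionD:
  assumes "injective_resolution R G I" "graded_complex R G"
  obtains c \<phi> where "inj_complex I c" "chain_map R G I \<phi>"
    "\<And>i z. z \<in> cycles G i \<Longrightarrow> \<phi> i z \<in> boundaries I i \<Longrightarrow> z \<in> boundaries G i"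
    "\<And>i u. u \<in> cycles I i \<Longrightarrow> \<exists>z\<in>cycles G i. u \<ominus>\<^bsub>cobj I i\<^esub> \<phi> i z \<in> boundaries I i"
proof -
  have I: "graded_complex R I" "\<And>i. graded_injective R (cobj I i)" using assms(1) by (auto simp: injective_resolution_def)
  obtain c where c: "\<forall>i>c. zero_module (cobj I i)" using assms(1) by (auto simp: injective_resolution_def)
  obtain \<phi> where \<phi>: "quasi_iso R G I \<phi>" using assms(1) unfolding injective_resolution_def by blast
  have "inj_complex I c" unfolding inj_complex_def using I(1) graded_injective_imp_baer[OF I(2)] c by blast
  then show ?thesis using that \<phi>[unfolded quasi_iso_iff[OF assms(2) I(1)]] by blast
qed

text \<open>Every cycle of \<open>I\<close> is a boundary plus the image of a cycle of
  \<open>G\<close>, and that cycle of \<open>G\<close> bounds.\<close>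

lemma injective_resolution_exact_at:
  assumes r: "injective_resolution R G I" and G: "graded_complex R G" and z: "zero_module (homology G n)"
  shows "exact_at I n"
proof -
  obtain c \<phi> where I: "inj_complex I c" and ch: "chain_map R G I \<phi>"
    and surj: "\<And>u. u \<in> cycles I n \<Longrightarrow> \<exists>z\<in>cycles G n. u \<ominus>\<^bsub>cobj I n\<^esub> \<phi> n z \<in> boundaries I n"
    by (rule injective_resolutionD[OF r G]) blast
  note GI = inj_complexD(1)[OF I]
  interpret A: graded_mod R "cobj I n" by (rule graded_modI[OF cobj_graded[OF GI]])
  show ?thesis
    unfolding exact_at_def
  proof
    fix u assume u: "u \<in> cycles I n"
    then obtain z where zz: "z \<in> cycles G n" "u \<ominus>\<^bsub>cobj I n\<^esub> \<phi> n z \<in> boundaries I n" using surj by blast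
    have uc: "u \<in> carrier (cobj I n)" using u by (simp add: cycles_def)
    have "z \<in> boundaries G n" using zz(1) z zero_homology_iff[OF G] by blast
    then obtain x where x: "x \<in> carrier (cobj G (n + 1))" "z = cdiff G (n + 1) x" by (auto simp: boundaries_def)
    have hom: "\<phi> (n + 1) \<in> graded_hom R (cobj G (n + 1)) (cobj I (n + 1))" using ch by (simp add: chain_map_def)
    have "\<phi> (n + 1 - 1) (cdiff G (n + 1) x) = cdiff I (n + 1) (\<phi> (n + 1) x)" using ch x(1) unfolding chain_map_def by blast
    then have "\<phi> n z = cdiff I (n + 1) (\<phi> (n + 1) x)" using x(2) by simp
    then have pz: "\<phi> n z \<in> boundaries I n" using hom_closed[OF hom x(1)] by (auto simp: boundaries_def)
    have pc: "\<phi> n z \<in> carrier (cobj I n)" by (rule gsubmodD(6)[OF boundaries_gsubmod[OF GI] pz])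
    have "(u \<ominus>\<^bsub>cobj I n\<^esub> \<phi> n z) \<oplus>\<^bsub>cobj I n\<^esub> \<phi> n z = u"
      using uc pc by (simp only: A.M.minus_eq A.M.a_assoc A.M.l_neg A.M.a_inv_closed A.M.r_zero)
    then show "u \<in> boundaries I n" using gsubmodD(3)[OF boundaries_gsubmod[OF GI] zz(2) pz] by simp
  qed
qed

text \<open>The map \<open>p\<close> presents \<open>M\<close> as cycles modulo boundaries of
  \<open>G\<close>. Two instances matter: the class map for \<open>G\<close> itself, and the
  identity for a stalk complex.\<close>

lemma injective_resolution_linked:
  assumes r: "injective_resolution R G I" and G: "graded_complex R G" and M: "graded_module R M"
    and p: "p \<in> graded_hom R (gsub (cobj G n) (cycles G n)) M" "p ` cycles G n = carrier M"
    and ker: "\<And>z. z \<in> cycles G n \<Longrightarrow> p z = \<zero>\<^bsub>M\<^esub> \<longleftrightarrow> z \<in> boundaries G n"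
  shows "linked I n M"
proof -
  obtain c \<phi> where I: "inj_complex I c" and ch: "chain_map R G I \<phi>"
    and inj: "\<And>i z. z \<in> cycles G i \<Longrightarrow> \<phi> i z \<in> boundaries I i \<Longrightarrow> z \<in> boundaries G i"
    and surj: "\<And>i u. u \<in> cycles I i \<Longrightarrow> \<exists>z\<in>cycles G i. u \<ominus>\<^bsub>cobj I i\<^esub> \<phi> i z \<in> boundaries I i"
    by (rule injective_resolutionD[OF r G]) blast
  note GI = inj_complexD(1)[OF I]
  have hom: "\<phi> i \<in> graded_hom R (cobj G i) (cobj I i)" for i using ch by (simp add: chain_map_def)
  show ?thesis
  proof (rule linkedI[OF GI gsub_graded[OF cobj_graded[OF G] cycles_gsubmod[OF G]] M gsub_hom1[OF hom gsubmodD(1)[OF cycles_gsubmod[OF G]]] p(1)])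
    show "p ` carrier (gsub (cobj G n) (cycles G n)) = carrier M" using p(2) by simp
    show "\<exists>x\<in>carrier (gsub (cobj G n) (cycles G n)). u \<ominus>\<^bsub>cobj I n\<^esub> \<phi> n x \<in> boundaries I n" if "u \<in> cycles I n" for u
      using surj[OF that] by simp
    fix z assume "z \<in> carrier (gsub (cobj G n) (cycles G n))"
    then have z: "z \<in> cycles G n" by simp
    show "\<phi> n z \<in> cycles I n" by (rule homology_map_coset(2)[OF G GI ch z])
    have "\<phi> n z \<in> boundaries I n" if zb: "z \<in> boundaries G n"
    proof -
      obtain x where x: "x \<in> carrier (cobj G (n + 1))" "z = cdiff G (n + 1) x" using zb by (auto simp: boundaries_def)
      have "\<phi> (n + 1 - 1) (cdiff G (n + 1) x) = cdiff I (n + 1) (\<phi> (n + 1) x)" using ch x(1) unfolding chain_map_def by blast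
      then have "\<phi> n z = cdiff I (n + 1) (\<phi> (n + 1) x)" using x(2) by simp
      then show ?thesis using hom_closed[OF hom x(1)] by (auto simp: boundaries_def)
    qed
    then show "\<phi> n z \<in> boundaries I n \<longleftrightarrow> p z = \<zero>\<^bsub>M\<^esub>" using ker[OF z] inj[OF z] by blast
  qed
qed

text \<open>The linking relation is a submodule, so together with \<open>(u, m)\<close> it contains
  \<open>(a u, 0)\<close>.\<close>

lemma linked_kill:
  assumes l: "linked C n M" and a: "a \<in> annihilator R M" and u: "u \<in> cycles C n"
  shows "a \<odot>\<^bsub>cobj C n\<^esub> u \<in> boundaries C n"
proof -
  obtain Q where Q: "gsubmod R (prodm (cobj C n) M) Q" "fst ` Q = cycles C n" "snd ` Q = carrier M"
     "\<forall>u m. (u, m) \<in> Q \<longrightarrow> (u \<in> boundaries C n \<longleftrightarrow> m = \<zero>\<^bsub>M\<^esub>)" using l unfolding linked_def by blast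
  have "u \<in> fst ` Q" using u Q(2) by simp
  then obtain m where m: "(u, m) \<in> Q" by force
  then have "m \<in> snd ` Q" by force
  then have "a \<odot>\<^bsub>M\<^esub> m = \<zero>\<^bsub>M\<^esub>" using a Q(3) by (simp add: annihilator_def)
  moreover have "a \<odot>\<^bsub>prodm (cobj C n) M\<^esub> (u, m) \<in> Q" using gsubmodD(4)[OF Q(1) _ m] a by (simp add: annihilator_def)
  ultimately show ?thesis using Q(4) by simp
qed

end

text \<open>The three primes would form a chain of length \<open>2\<close> in the supremum that
  defines the dimension.\<close>

lemma module_dim_le_1:
  assumes "module_dim R M \<le> 1" "primeideal P0 R" "primeideal P1 R" "primeideal P2 R" "annihilator R M \<subseteq> P0" "P0 \<subset> P1"
  shows "\<not> P1 \<subset> P2"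
proof
  assume P: "P1 \<subset> P2"
  define Q where "Q i = (if i = 0 then P0 else if i = 1 then P1 else P2)" for i :: nat
  have "(\<forall>i\<le>2. primeideal (Q i) R) \<and> (\<forall>i<2. Q i \<subset> Q (Suc i)) \<and> annihilator R M \<subseteq> Q 0"
    using assms P by (auto simp: Q_def less_Suc_eq numeral_2_eq_2)
  then have "ereal (real 2) \<le> module_dim R M" unfolding module_dim_def by (intro Sup_upper) blast
  then have "ereal (real 2) \<le> 1" using assms(1) by (rule order_trans)
  then show False by (simp add: one_ereal_def)
qed

section \<open>The regularity formula\<close>

context std_graded
begin

text \<open>Grothendieck vanishing in dimension at most one: local cohomology is zero in
  cohomological degrees \<open>2\<close> and above, where cohomological degree \<open>i\<close> is
  homological degree \<open>- i\<close>.\<close>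

lemma tor_homology_vanishing:
  assumes J: "inj_complex J c" and ex: "\<And>n. n \<noteq> 0 \<Longrightarrow> exact_at J n" and l: "linked J 0 M" and M: "graded_module R M"
    and dim: "module_dim R M \<le> 1" and n: "n \<le> -2"
  shows "\<not> tor_homology J n j"
proof -
  note A = annihilator_gideal[OF M]
  obtain x d where x: "x \<in> rgrade R d" "0 < d" "\<And>s. s \<in> S \<Longrightarrow> \<exists>n::nat. s [^] n \<in> ext_ideal (annihilator R M) x"
    by (rule parameter_exists[OF A module_dim_le_1[OF dim]]) blast+
  have ex': "cycles J n \<subseteq> boundaries J n" if "n \<noteq> 0" for n using ex[OF that] by (simp add: exact_at_def)
  have "\<exists>w\<in>grade (cobj J (n + 1)) j. w \<in> torsion_set R (cobj J (n + 1)) \<and> cdiff J (n + 1) w = z"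
    if z: "z \<in> grade (cobj J n) j" "z \<in> cycles J n" "z \<in> torsion_set R (cobj J n)" for z
  proof -
    obtain w where "w \<in> grade (cobj J (n + 1)) j" "w \<in> torsion_set R (cobj J (n + 1))" "cdiff J (n + 1) w = z"
      by (rule vanishing[OF inj_complexD(1)[OF J] inj_complexD(2)[OF J] ex' A linked_kill[OF l] x n z])
    then show ?thesis by (intro bexI conjI)
  qed
  then show ?thesis unfolding tor_homology_def by blast
qed

lemma reg_tor_homology:
  fixes G :: "('a, 'm) gcomplex" and I :: "('a, 'a list \<Rightarrow> 'm) gcomplex"
  assumes I: "I = (SOME I. injective_resolution R G I)" and r: "injective_resolution R G I"
  shows "reg R G = Sup {ereal (real_of_int (i + j)) | i j. tor_homology I (- i) j}"
proof -
  have "graded_complex R I" using r by (simp add: injective_resolution_def)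
  from tor_homology_iff[OF this] show ?thesis unfolding reg_def local_cohomology_def RGamma_def I[symmetric] by simp
qed

theorem reg_eq_SUP:
  fixes G :: "('a, 'm) gcomplex"
  assumes Dfb: "Dfb R G" and dim: "\<And>i::int. complex_inf G < ereal (real_of_int i) \<Longrightarrow> module_dim R (homology G i) \<le> 1"
  shows "reg R G = (SUP i::int. reg_module R (homology G i) - ereal (real_of_int i))"
proof -
  have G: "graded_complex R G" using Dfb by (simp add: Dfb_def)
  obtain b where b: "\<And>i. \<bar>i\<bar> > b \<Longrightarrow> zero_module (homology G i)" using Dfb unfolding Dfb_def by blast
  define M where "M q = homology G q" for q
  have gM: "graded_module R (M q)" for q unfolding M_def by (rule homology_graded[OF G])
  \<comment> \<open>These are the very resolutions that \<open>RGamma\<close> chooses, hence their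
    types.\<close>
  define I :: "('a, 'a list \<Rightarrow> 'm) gcomplex" where "I = (SOME I. injective_resolution R G I)"
  define J :: "int \<Rightarrow> ('a, 'a list \<Rightarrow> 'm set) gcomplex" where "J q = (SOME I. injective_resolution R (stalk_complex (M q)) I)" for q
  have "\<exists>I :: ('a, 'a list \<Rightarrow> 'm) gcomplex. injective_resolution R G I"
    by (rule injective_resolution_exists[OF ground_field G, of b]) (rule b, simp)
  then have rI: "injective_resolution R G I" unfolding I_def by (rule someI_ex)
  have gS: "graded_complex R (stalk_complex (M q))" for q by (rule stalk_complex_graded[OF gM])
  have zS: "zero_module (homology (stalk_complex (M q)) n)" if "n \<noteq> 0" for q n
    unfolding zero_homology_iff[OF gS] stalk_complex_boundaries[OF gM] stalk_complex_cycles using that by simp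
  have "\<exists>I :: ('a, 'a list \<Rightarrow> 'm set) gcomplex. injective_resolution R (stalk_complex (M q)) I" for q
    by (rule injective_resolution_exists[OF ground_field gS, of 0]) (rule zS, simp)
  then have rJ: "injective_resolution R (stalk_complex (M q)) (J q)" for q unfolding J_def by (rule someI_ex)
  have "\<exists>c. inj_complex (J q) c" for q by (rule injective_resolutionD[OF rJ gS]) blast
  then obtain bj where J: "inj_complex (J q) (bj q)" for q by metis
  obtain bI where I: "inj_complex I bI" by (rule injective_resolutionD[OF rI G]) blast
  have exJ: "exact_at (J q) n" if "n \<noteq> 0" for q n by (rule injective_resolution_exact_at[OF rJ gS zS[OF that]])
  have exI: "exact_at I n" if "b < n" for n by (rule injective_resolution_exact_at[OF rI G b]) (use that in simp)
  have lJ: "linked (J q) 0 (M q)" for q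
  proof (rule injective_resolution_linked[OF rJ gS gM])
    show "(\<lambda>x. x) \<in> graded_hom R (gsub (cobj (stalk_complex (M q)) 0) (cycles (stalk_complex (M q)) 0)) (M q)"
      unfolding stalk_complex_cycles stalk_complex_simps by (rule graded_homI) auto
    show "(\<lambda>x. x) ` cycles (stalk_complex (M q)) 0 = carrier (M q)" by (simp add: stalk_complex_cycles)
    show "(z = \<zero>\<^bsub>M q\<^esub>) = (z \<in> boundaries (stalk_complex (M q)) 0)" for z unfolding stalk_complex_boundaries[OF gM] by simp
  qed
  have lI: "linked I n (M n)" for n
  proof (rule injective_resolution_linked[OF rI G gM])
    show "hcl G n \<in> graded_hom R (gsub (cobj G n) (cycles G n)) (M n)" unfolding M_def by (rule homology_proj[OF G])
    show "hcl G n ` cycles G n = carrier (M n)" unfolding M_def homology_carrier[OF G] ..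
    fix z assume "z \<in> cycles G n"
    then have "z \<in> carrier (cobj G n)" by (simp add: cycles_def)
    then show "(hcl G n z = \<zero>\<^bsub>M n\<^esub>) = (z \<in> boundaries G n)" unfolding M_def homology_zero[OF G] by (rule hcl_zero[OF G])
  qed
  \<comment> \<open>A nonzero homology module in a degree \<open>p < q\<close> puts \<open>q\<close>
    strictly above \<open>inf G\<close>, so the dimension hypothesis applies to
    \<open>M q\<close>.\<close>
  have van: "\<not> tor_homology (J q) n j" if "p < q" "\<not> zero_module (M p)" "n \<le> -2" for p q n j
  proof -
    have "complex_inf G \<le> ereal (real_of_int p)" unfolding complex_inf_def using that(2) by (intro Inf_lower) (auto simp: M_def)
    also have "\<dots> < ereal (real_of_int q)" using that(1) by simp
    finally have md: "module_dim R (M q) \<le> 1" unfolding M_def by (rule dim)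
    show ?thesis by (rule tor_homology_vanishing[OF J exJ lJ gM md that(3)])
  qed
  \<comment> \<open>The common carrier type pairs a coordinate from \<open>I\<close> with a list of
    coordinates from the \<open>J q\<close>; \<open>emb\<close> starts with the empty list, and
    \<open>pr\<close> puts the coordinate of each new cone in front.\<close>
  define emb where "emb u = (u, [] :: ('a list \<Rightarrow> 'm set) list)" for u :: "'a list \<Rightarrow> 'm"
  define pr where "pr x = (fst (fst x), snd x # snd (fst x))" for x :: "(('a list \<Rightarrow> 'm) \<times> ('a list \<Rightarrow> 'm set) list) \<times> ('a list \<Rightarrow> 'm set)"
  have emb: "inj emb" by (auto simp: emb_def inj_def)
  have pr: "inj pr" by (auto simp: pr_def inj_def)
  note GI = inj_complexD(1)[OF I]
  have zM: "zero_module (M q)" if "q < - \<bar>b\<bar>" for q using b[of q] that by (simp add: M_def)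
  have "tor_homology I n j \<longleftrightarrow> (\<exists>q\<le>b. tor_homology (J q) (n - q) j)" for n j
  proof -
    have "tor_homology (imagec emb I) n j \<longleftrightarrow> (\<exists>q\<le>b. tor_homology (J q) (n - q) j)"
    proof (rule tor_homology_decomposition[OF pr J exJ lJ gM zM van])
      show "inj_complex (imagec emb I) bI" by (rule imagec_inj_complex[OF GI emb I])
      show "exact_at (imagec emb I) n" if "b < n" for n by (rule exact_at_imagec[OF GI emb exI[OF that]])
      show "linked (imagec emb I) n (M n)" for n by (rule linked_imagec[OF GI emb lI gM])
    qed
    then show ?thesis using tor_homology_imagec[OF GI emb] by simp
  qed
  moreover have "\<not> tor_homology (J q) n j" if "b < q" for q n j
  proof -
    have "zero_module (M q)" using b[of q] that by (simp add: M_def)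
    then have "exact_at (J q) i" for i using exJ[of i q] linked_zero[OF lJ, of q] by (cases "i = 0") auto
    then show ?thesis by (intro tor_homology_above[OF J, of "n - 1"]) auto
  qed
  ultimately have main: "tor_homology I n j \<longleftrightarrow> (\<exists>q. tor_homology (J q) (n - q) j)" for n j by (meson linorder_not_le)
  have regG: "reg R G = Sup {ereal (real_of_int (i + j)) | i j. tor_homology I (- i) j}"
    by (rule reg_tor_homology[OF I_def rI])
  have regM: "reg_module R (M q) = Sup {ereal (real_of_int (i + j)) | i j. tor_homology (J q) (- i) j}" for q
    unfolding reg_module_def by (rule reg_tor_homology[OF J_def rJ])
  have "reg R G = (SUP q. reg_module R (M q) - ereal (real_of_int q))"
  proof (rule antisym)
    show "reg R G \<le> (SUP q. reg_module R (M q) - ereal (real_of_int q))"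
      unfolding regG
    proof (rule Sup_least)
      fix x assume "x \<in> {ereal (real_of_int (i + j)) | i j. tor_homology I (- i) j}"
      then obtain i j where x: "x = ereal (real_of_int (i + j))" "tor_homology I (- i) j" by blast
      \<comment> \<open>Degree \<open>- i\<close> of \<open>I\<close> corresponds to degree
        \<open>- (i + q)\<close> of \<open>J q\<close>, so the number \<open>i + j\<close> grows by
        the \<open>q\<close> that the formula subtracts.\<close>
      then obtain q where "tor_homology (J q) (- i - q) j" using main by blast
      then have "tor_homology (J q) (- (i + q)) j" by simp
      then have "ereal (real_of_int (i + q + j)) \<le> reg_module R (M q)" unfolding regM by (intro Sup_upper) blast
      then have "ereal (real_of_int (i + q + j)) - ereal (real_of_int q) \<le> reg_module R (M q) - ereal (real_of_int q)"
        by (rule ereal_minus_mono) simp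
      then have "x \<le> reg_module R (M q) - ereal (real_of_int q)" by (simp add: x(1))
      then show "x \<le> (SUP q. reg_module R (M q) - ereal (real_of_int q))" by (rule SUP_upper2[OF UNIV_I])
    qed
    show "(SUP q. reg_module R (M q) - ereal (real_of_int q)) \<le> reg R G"
    proof (rule SUP_least)
      fix q :: int
      \<comment> \<open>With the finite number \<open>q\<close> moved to the right, a bound for each
        element of the set suffices, whatever infinite values the suprema take.\<close>
      have "reg_module R (M q) \<le> reg R G + ereal (real_of_int q)"
        unfolding regM
      proof (rule Sup_least)
        fix x assume "x \<in> {ereal (real_of_int (i + j)) | i j. tor_homology (J q) (- i) j}"
        then obtain i j where x: "x = ereal (real_of_int (i + j))" "tor_homology (J q) (- i) j" by blast
        have "tor_homology (J q) (- (i - q) - q) j" using x(2) by simp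
        then have "tor_homology I (- (i - q)) j" using main by blast
        then have "ereal (real_of_int (i - q + j)) \<le> reg R G" unfolding regG by (intro Sup_upper) blast
        then have "ereal (real_of_int (i - q + j)) + ereal (real_of_int q) \<le> reg R G + ereal (real_of_int q)"
          by (rule add_right_mono)
        then show "x \<le> reg R G + ereal (real_of_int q)" by (simp add: x(1))
      qed
      then show "reg_module R (M q) - ereal (real_of_int q) \<le> reg R G" by (simp add: ereal_minus_le)
    qed
  qed
  then show ?thesis unfolding M_def .
qed

end

theorem theorem1p1:
  fixes R :: "'r gring" and G :: "('r, 'm) gcomplex"
  assumes "standard_graded_algebra R"
    and "Dfb R G"
    and "\<And>i::int. complex_inf G < ereal (real_of_int i) \<Longrightarrow> module_dim R (homology G i) \<le> 1"
  shows "reg R G = (SUP i::int. reg_module R (homology G i) - ereal (real_of_int i))"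
proof -
  obtain S where S: "finite S" "S \<subseteq> rgrade R 1" "generate_ring R (rgrade R 0 \<union> S) = carrier R"
    using assms(1) unfolding standard_graded_algebra_def by (elim conjE exE)
  note R = conjunct1[OF assms(1)[unfolded standard_graded_algebra_def]]
    conjunct1[OF conjunct2[OF assms(1)[unfolded standard_graded_algebra_def]]]
  interpret graded_ring R by (rule graded_ringI[OF R(1)])
  interpret std_graded R S by (intro std_graded.intro graded_ring_axioms std_graded_axioms.intro R(2) S)
  show ?thesis by (rule reg_eq_SUP[OF assms(2,3)])
qed

end
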